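(* (Rotation formula) For any angle $\theta\in\mathbb{R}$ and all $n,m\in\mathbb{Z}$, $$W_{n,m}[B^\theta,\sigma^\theta,\mu^\theta,\omega]=e^{i(m-n)\theta}\,W_{n,m}[B,\sigma,\mu,\omega],$$ where, identifying $\mathbb{R}^2$ with $\mathbb{C}$, $B^\theta=e^{i\theta}B$, $\sigma^\theta=\sigma(e^{-i\theta}\,\cdot)$, $\mu^\theta=\mu(e^{-i\theta}\,\cdot)$.
   Context: $\omega>0$ is a fixed frequency; $(|x|,\theta_x)$ are polar coordinates of $x\in\mathbb{R}^2$. $\sigma,\mu$ are positive functions on $\mathbb{R}^2$ such that $\frac1\sigma$ and $\mu$ are bounded and measurable, $0<\lambda_1\le\frac1\sigma\le\lambda_2$ and $0<\lambda_3\le\mu\le\lambda_4$ for constants $\lambda_j$, and $\frac1\sigma-1$, $\mu-1$ are compactly supported. $B\subset\mathbb{R}^2$ is a bounded domain with Lipschitz boundary, containing the origin, with $\operatorname{supp}(\frac1\sigma-1)\subset B$ and $\operatorname{supp}(\mu-1)\subset B$; $\nu$ is the outward unit normal on $\partial B$. Standing assumptions: $\omega^2$ is not a Neumann eigenvalue of $-\frac1\mu\nabla\cdot\frac1\sigma\nabla$ on $B$ and not a Dirichlet eigenvalue of $-\Delta$ on $B$. $\Gamma_\omega(x)=-\frac i4H_0^{(1)}(\omega|x|)$; $S^\omega_B[\phi](x)=\int_{\partial B}\Gamma_\omega(x-y)\phi(y)\,dS_y$; $(K^\omega_B)^*[\phi](x)=\int_{\partial B}\frac{\partial\Gamma_\omega}{\partial\nu_x}(x-y)\phi(y)\,dS_y$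 for $x\in\partial B$ (principal value). $\Lambda_{\sigma,\mu}[g]=w|_{\partial B}$, where $w$ solves $\nabla\cdot\frac1\sigma\nabla w+\omega^2\mu w=0$ in $B$, $\frac1\sigma\frac{\partial w}{\partial\nu}=g$ on $\partial B$. The operator $$\mathcal{A}=\begin{bmatrix}-S^\omega_B & \Lambda_{\sigma,\mu}\\ -\left(\frac12I+(K^\omega_B)^*\right) & I\end{bmatrix}:L^2(\partial B)\times L^2(\partial B)\to H^1(\partial B)\times L^2(\partial B)$$ is invertible. With the cylindrical waves $\mathcal{C}_m(x)=J_m(\omega|x|)e^{im\theta_x}$ ($J_m$ Bessel functions), let $(\phi_m,\psi_m)$ be the solution of $\mathcal{A}(\phi_m,\psi_m)^T=(\mathcal{C}_m,\frac{\partial\mathcal{C}_m}{\partial\nu})^T$ on $\partial B$. The scattering coefficients are $W_{n,m}[B,\sigma,\mu,\omega]=\int_{\partial B}\overline{\mathcal{C}_n(y)}\,\phi_m(y)\,dS_y$, $n,m\in\mathbb{Z}$. The coefficients of $(B^\theta,\sigma^\theta,\mu^\theta)$ are defined by the same formulas with $B,\sigma,\mu$ replaced by $B^\theta,\sigma^\theta,\mu^\theta$. *)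

theory Defs
  imports "HOL-Analysis.Analysis"
begin

text \<open>The plane is identified with the type \<^typ>\<open>complex\<close>, regarded as a two-dimensional
  real inner product space; the coordinate directions are \<^term>\<open>1\<close> and \<^term>\<open>\<i>\<close>.\<close>

section \<open>Bessel and Hankel functions, cylindrical waves\<close>

text \<open>The power series of the Bessel function of the first kind, for an arbitrary integer order.
  Since the reciprocal Gamma function vanishes at the nonpositive integers, the terms with a
  negative exponent vanish, and the identity between orders \<open>-m\<close> and \<open>m\<close> (factor \<open>(-1)^m\<close>)
  is built in.\<close>

definition bessel_J :: "int \<Rightarrow> real \<Rightarrow> real" where
  "bessel_J m r =
     (\<Sum>k. (-1) ^ k / fact k * rGamma (of_int m + of_nat k + 1) * (r / 2) powi (m + 2 * int k))"

text \<open>The Bessel function of the second kind of order zero, for \<open>r > 0\<close>.\<close>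

definition bessel_Y0 :: "real \<Rightarrow> real" where
  "bessel_Y0 r = 2 / pi * (ln (r / 2) + euler_mascheroni) * bessel_J 0 r
     - 2 / pi * (\<Sum>k. (-1) ^ k * harm k / (fact k)\<^sup>2 * (r\<^sup>2 / 4) ^ k)"

definition hankel1_0 :: "real \<Rightarrow> complex" where
  "hankel1_0 r = Complex (bessel_J 0 r) (bessel_Y0 r)"

definition fund_sol :: "real \<Rightarrow> complex \<Rightarrow> complex" where
  "fund_sol \<omega> x = - (\<i> / 4) * hankel1_0 (\<omega> * cmod x)"

definition cyl_wave :: "real \<Rightarrow> int \<Rightarrow> complex \<Rightarrow> complex" where
  "cyl_wave \<omega> m x = of_real (bessel_J m (\<omega> * cmod x)) * exp (\<i> * of_int m * of_real (Arg x))"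


section \<open>Lipschitz domains, surface measure, outward normal\<close>

text \<open>Near every boundary point, in suitably rotated coordinates centred at that point, the domain
  is the strict epigraph of a Lipschitz function.\<close>

definition lipschitz_boundary :: "complex set \<Rightarrow> bool" where
  "lipschitz_boundary B \<longleftrightarrow>
     (\<forall>p\<in>frontier B. \<exists>u r h g L. cmod u = 1 \<and> r > 0 \<and> h > 0 \<and> L-lipschitz_on (UNIV :: real set) g \<and>
        (\<forall>s t. \<bar>s\<bar> < r \<and> \<bar>t\<bar> < h \<longrightarrow> (p + u * Complex s t \<in> B \<longleftrightarrow> g s < t)))"

definition bounded_lipschitz_domain :: "complex set \<Rightarrow> bool" where
  "bounded_lipschitz_domain B \<longleftrightarrow>
     B \<noteq> {} \<and> open B \<and> connected B \<and> bounded B \<and> lipschitz_boundary B"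

text \<open>One-dimensional Hausdorff measure; on a Lipschitz curve it is the arc length.
  It is a metric outer measure, hence countably additive on the Borel sets. The diameter of the
  library is meaningful for bounded sets only.\<close>

definition hausdorff1_pre :: "real \<Rightarrow> 'a::metric_space set \<Rightarrow> ennreal" where
  "hausdorff1_pre \<delta> A =
     (INF U\<in>{U :: nat \<Rightarrow> 'a set. A \<subseteq> (\<Union>i. U i) \<and> (\<forall>i. bounded (U i) \<and> diameter (U i) \<le> \<delta>)}.
        \<Sum>i. ennreal (diameter (U i)))"

definition hausdorff1_outer :: "'a::metric_space set \<Rightarrow> ennreal" where
  "hausdorff1_outer A = (SUP \<delta>\<in>{0<..}. hausdorff1_pre \<delta> A)"

definition hausdorff1 :: "'a::metric_space measure" where
  "hausdorff1 = measure_of UNIV (sets borel) hausdorff1_outer"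

definition surface_measure :: "complex set \<Rightarrow> complex measure" where
  "surface_measure B = restrict_space hausdorff1 (frontier B)"

text \<open>\<open>n\<close> is the outward unit normal at \<open>x\<close> if, to first order at \<open>x\<close>, the set \<open>B\<close> is the
  half plane of the points \<open>y\<close> with \<open>(y - x) \<bullet> n < 0\<close>. When the boundary is the graph of a Lipschitz
  function, this says that the function is differentiable at the point in question, so that \<open>n\<close>
  exists almost everywhere; on the exceptional null set the normal is set to zero.\<close>

definition is_outward_normal :: "complex set \<Rightarrow> complex \<Rightarrow> complex \<Rightarrow> bool" where
  "is_outward_normal B x n \<longleftrightarrow> norm n = 1 \<and>
     (\<forall>\<epsilon>>0. \<exists>\<delta>>0. \<forall>y. dist y x < \<delta> \<longrightarrow>
        ((y - x) \<bullet> n < - \<epsilon> * dist y x \<longrightarrow> y \<in> B) \<and>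
        ((y - x) \<bullet> n > \<epsilon> * dist y x \<longrightarrow> y \<notin> B))"

definition outward_normal :: "complex set \<Rightarrow> complex \<Rightarrow> complex" where
  "outward_normal B x =
     (if \<exists>n. is_outward_normal B x n then THE n. is_outward_normal B x n else 0)"

definition normal_deriv :: "complex set \<Rightarrow> (complex \<Rightarrow> complex) \<Rightarrow> complex \<Rightarrow> complex" where
  "normal_deriv B f x = frechet_derivative f (at x) (outward_normal B x)"


section \<open>Function spaces\<close>

text \<open>Elements of Lebesgue and Sobolev spaces are represented by functions; only their values almost
  everywhere matter.\<close>

definition in_L2 :: "'a measure \<Rightarrow> ('a \<Rightarrow> complex) \<Rightarrow> bool" where
  "in_L2 M f \<longleftrightarrow> f \<in> borel_measurable M \<and> integrable M (\<lambda>x. (cmod (f x))\<^sup>2)"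

definition L2_tendsto :: "'a measure \<Rightarrow> (nat \<Rightarrow> 'a \<Rightarrow> complex) \<Rightarrow> ('a \<Rightarrow> complex) \<Rightarrow> bool" where
  "L2_tendsto M f g \<longleftrightarrow> (\<lambda>k. \<integral>\<^sup>+ x. ennreal ((cmod (f k x - g x))\<^sup>2) \<partial>M) \<longlonglongrightarrow> 0"

definition dir_deriv :: "complex \<Rightarrow> (complex \<Rightarrow> complex) \<Rightarrow> complex \<Rightarrow> complex" where
  "dir_deriv d f x = frechet_derivative f (at x) d"

text \<open>Real \<open>C\<^sup>\<infinity>\<close>-smoothness on the plane: all iterated directional derivatives are (real)
  differentiable.\<close>

definition smooth :: "(complex \<Rightarrow> complex) \<Rightarrow> bool" where
  "smooth f \<longleftrightarrow> (\<forall>ds. foldr dir_deriv ds f differentiable_on UNIV)"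

definition test_function :: "complex set \<Rightarrow> (complex \<Rightarrow> complex) \<Rightarrow> bool" where
  "test_function B \<eta> \<longleftrightarrow>
     smooth \<eta> \<and> compact (closure {x. \<eta> x \<noteq> 0}) \<and> closure {x. \<eta> x \<noteq> 0} \<subseteq> B"

definition weak_deriv ::
  "complex set \<Rightarrow> complex \<Rightarrow> (complex \<Rightarrow> complex) \<Rightarrow> (complex \<Rightarrow> complex) \<Rightarrow> bool" where
  "weak_deriv B d u v \<longleftrightarrow>
     (\<forall>\<eta>. test_function B \<eta> \<longrightarrow>
        (\<integral>x. u x * dir_deriv d \<eta> x \<partial>lebesgue_on B) = - (\<integral>x. v x * \<eta> x \<partial>lebesgue_on B))"

text \<open>\<open>u\<close> belongs to \<open>H\<^sup>1(B)\<close>, with weak gradient \<open>(u\<^sub>1, u\<^sub>2)\<close>.\<close>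

definition in_H1 ::
  "complex set \<Rightarrow> (complex \<Rightarrow> complex) \<Rightarrow> (complex \<Rightarrow> complex) \<Rightarrow> (complex \<Rightarrow> complex) \<Rightarrow> bool" where
  "in_H1 B u u\<^sub>1 u\<^sub>2 \<longleftrightarrow>
     in_L2 (lebesgue_on B) u \<and> in_L2 (lebesgue_on B) u\<^sub>1 \<and> in_L2 (lebesgue_on B) u\<^sub>2 \<and>
     weak_deriv B 1 u u\<^sub>1 \<and> weak_deriv B \<i> u u\<^sub>2"

definition H1_tendsto ::
  "complex set \<Rightarrow> (nat \<Rightarrow> complex \<Rightarrow> complex) \<Rightarrow>
     (complex \<Rightarrow> complex) \<Rightarrow> (complex \<Rightarrow> complex) \<Rightarrow> (complex \<Rightarrow> complex) \<Rightarrow> bool" where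
  "H1_tendsto B \<eta> u u\<^sub>1 u\<^sub>2 \<longleftrightarrow>
     L2_tendsto (lebesgue_on B) \<eta> u \<and>
     L2_tendsto (lebesgue_on B) (\<lambda>k. dir_deriv 1 (\<eta> k)) u\<^sub>1 \<and>
     L2_tendsto (lebesgue_on B) (\<lambda>k. dir_deriv \<i> (\<eta> k)) u\<^sub>2"

definition in_H1_0 ::
  "complex set \<Rightarrow> (complex \<Rightarrow> complex) \<Rightarrow> (complex \<Rightarrow> complex) \<Rightarrow> (complex \<Rightarrow> complex) \<Rightarrow> bool" where
  "in_H1_0 B u u\<^sub>1 u\<^sub>2 \<longleftrightarrow>
     in_H1 B u u\<^sub>1 u\<^sub>2 \<and> (\<exists>\<eta>. (\<forall>k. test_function B (\<eta> k)) \<and> H1_tendsto B \<eta> u u\<^sub>1 u\<^sub>2)"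

text \<open>\<open>h\<close> is the boundary trace of \<open>u\<close>: the extension by continuity of the restriction map for
  functions that are smooth up to the boundary.\<close>

definition has_trace :: "complex set \<Rightarrow> (complex \<Rightarrow> complex) \<Rightarrow> (complex \<Rightarrow> complex) \<Rightarrow> bool" where
  "has_trace B u h \<longleftrightarrow> in_L2 (surface_measure B) h \<and>
     (\<exists>u\<^sub>1 u\<^sub>2 \<eta>. in_H1 B u u\<^sub>1 u\<^sub>2 \<and> (\<forall>k. smooth (\<eta> k)) \<and> H1_tendsto B \<eta> u u\<^sub>1 u\<^sub>2 \<and>
        L2_tendsto (surface_measure B) \<eta> h)"


section \<open>Boundary value problems and eigenvalues, in weak form\<close>

text \<open>\<open>\<kappa>\<close> is a Neumann eigenvalue of \<open>- (1/\<mu>) \<nabla>\<cdot>(1/\<sigma>) \<nabla>\<close> on \<open>B\<close>.\<close>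

definition neumann_eigenvalue ::
  "complex set \<Rightarrow> (complex \<Rightarrow> real) \<Rightarrow> (complex \<Rightarrow> real) \<Rightarrow> real \<Rightarrow> bool" where
  "neumann_eigenvalue B \<sigma> \<mu> \<kappa> \<longleftrightarrow>
     (\<exists>u u\<^sub>1 u\<^sub>2. in_H1 B u u\<^sub>1 u\<^sub>2 \<and> \<not> (AE x in lebesgue_on B. u x = 0) \<and>
        (\<forall>v v\<^sub>1 v\<^sub>2. in_H1 B v v\<^sub>1 v\<^sub>2 \<longrightarrow>
           (\<integral>x. of_real (1 / \<sigma> x) * (u\<^sub>1 x * v\<^sub>1 x + u\<^sub>2 x * v\<^sub>2 x) \<partial>lebesgue_on B) =
           of_real \<kappa> * (\<integral>x. of_real (\<mu> x) * u x * v x \<partial>lebesgue_on B)))"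

text \<open>\<open>\<kappa>\<close> is a Dirichlet eigenvalue of \<open>- \<Delta>\<close> on \<open>B\<close>.\<close>

definition dirichlet_eigenvalue :: "complex set \<Rightarrow> real \<Rightarrow> bool" where
  "dirichlet_eigenvalue B \<kappa> \<longleftrightarrow>
     (\<exists>u u\<^sub>1 u\<^sub>2. in_H1_0 B u u\<^sub>1 u\<^sub>2 \<and> \<not> (AE x in lebesgue_on B. u x = 0) \<and>
        (\<forall>v v\<^sub>1 v\<^sub>2. in_H1_0 B v v\<^sub>1 v\<^sub>2 \<longrightarrow>
           (\<integral>x. u\<^sub>1 x * v\<^sub>1 x + u\<^sub>2 x * v\<^sub>2 x \<partial>lebesgue_on B) =
           of_real \<kappa> * (\<integral>x. u x * v x \<partial>lebesgue_on B)))"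

text \<open>\<open>w\<close> is a weak solution of \<open>\<nabla>\<cdot>(1/\<sigma>) \<nabla>w + \<omega>\<^sup>2 \<mu> w = 0\<close> in \<open>B\<close>,
  \<open>(1/\<sigma>) \<partial>w/\<partial>\<nu> = g\<close> on the boundary.\<close>

definition neumann_solution ::
  "real \<Rightarrow> complex set \<Rightarrow> (complex \<Rightarrow> real) \<Rightarrow> (complex \<Rightarrow> real) \<Rightarrow>
     (complex \<Rightarrow> complex) \<Rightarrow> (complex \<Rightarrow> complex) \<Rightarrow> bool" where
  "neumann_solution \<omega> B \<sigma> \<mu> g w \<longleftrightarrow>
     (\<exists>w\<^sub>1 w\<^sub>2. in_H1 B w w\<^sub>1 w\<^sub>2 \<and>
        (\<forall>v v\<^sub>1 v\<^sub>2 h. in_H1 B v v\<^sub>1 v\<^sub>2 \<and> has_trace B v h \<longrightarrow>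
           (\<integral>x. of_real (1 / \<sigma> x) * (w\<^sub>1 x * v\<^sub>1 x + w\<^sub>2 x * v\<^sub>2 x)
                - of_real (\<omega>\<^sup>2 * \<mu> x) * w x * v x \<partial>lebesgue_on B) =
           (\<integral>y. g y * h y \<partial>surface_measure B)))"

text \<open>The graph of the Neumann-to-Dirichlet operator \<open>\<Lambda>\<close>: \<open>h\<close> represents \<open>\<Lambda>[g]\<close>. Away from the
  Neumann eigenvalues, \<open>h\<close> exists and is unique up to null sets.\<close>

definition NtD_graph ::
  "real \<Rightarrow> complex set \<Rightarrow> (complex \<Rightarrow> real) \<Rightarrow> (complex \<Rightarrow> real) \<Rightarrow>
     (complex \<Rightarrow> complex) \<Rightarrow> (complex \<Rightarrow> complex) \<Rightarrow> bool" where
  "NtD_graph \<omega> B \<sigma> \<mu> g h \<longleftrightarrow> (\<exists>w. neumann_solution \<omega> B \<sigma> \<mu> g w \<and> has_trace B w h)"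


section \<open>Layer potentials and scattering coefficients\<close>

definition single_layer :: "real \<Rightarrow> complex set \<Rightarrow> (complex \<Rightarrow> complex) \<Rightarrow> complex \<Rightarrow> complex" where
  "single_layer \<omega> B \<phi> x = (\<integral>y. fund_sol \<omega> (x - y) * \<phi> y \<partial>surface_measure B)"

definition K_star :: "real \<Rightarrow> complex set \<Rightarrow> (complex \<Rightarrow> complex) \<Rightarrow> complex \<Rightarrow> complex" where
  "K_star \<omega> B \<phi> x =
     Lim (at_right 0) (\<lambda>\<epsilon>. LINT y:{y. dist x y > \<epsilon>}|surface_measure B.
        frechet_derivative (fund_sol \<omega>) (at (x - y)) (outward_normal B x) * \<phi> y)"

text \<open>The equation \<open>\<A>(\<phi>, \<psi>) = (f, g)\<close>, for square integrable \<open>\<phi>\<close> and \<open>\<psi>\<close>.\<close>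

definition A_equation ::
  "real \<Rightarrow> complex set \<Rightarrow> (complex \<Rightarrow> real) \<Rightarrow> (complex \<Rightarrow> real) \<Rightarrow>
     (complex \<Rightarrow> complex) \<times> (complex \<Rightarrow> complex) \<Rightarrow>
     (complex \<Rightarrow> complex) \<times> (complex \<Rightarrow> complex) \<Rightarrow> bool" where
  "A_equation \<omega> B \<sigma> \<mu> = (\<lambda>(\<phi>, \<psi>) (f, g).
     in_L2 (surface_measure B) \<phi> \<and> in_L2 (surface_measure B) \<psi> \<and>
     (\<exists>h. NtD_graph \<omega> B \<sigma> \<mu> \<psi> h \<and>
          (AE x in surface_measure B. - single_layer \<omega> B \<phi> x + h x = f x)) \<and>
     (AE x in surface_measure B. - (1 / 2 * \<phi> x + K_star \<omega> B \<phi> x) + \<psi> x = g x))"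

definition scattering_solution ::
  "real \<Rightarrow> complex set \<Rightarrow> (complex \<Rightarrow> real) \<Rightarrow> (complex \<Rightarrow> real) \<Rightarrow> int \<Rightarrow>
     (complex \<Rightarrow> complex) \<times> (complex \<Rightarrow> complex) \<Rightarrow> bool" where
  "scattering_solution \<omega> B \<sigma> \<mu> m p \<longleftrightarrow>
     A_equation \<omega> B \<sigma> \<mu> p (cyl_wave \<omega> m, normal_deriv B (cyl_wave \<omega> m))"

definition scattering_uniquely_solvable ::
  "real \<Rightarrow> complex set \<Rightarrow> (complex \<Rightarrow> real) \<Rightarrow> (complex \<Rightarrow> real) \<Rightarrow> int \<Rightarrow> bool" where
  "scattering_uniquely_solvable \<omega> B \<sigma> \<mu> m \<longleftrightarrow>
     (\<exists>p. scattering_solution \<omega> B \<sigma> \<mu> m p) \<and>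
     (\<forall>p q. scattering_solution \<omega> B \<sigma> \<mu> m p \<and> scattering_solution \<omega> B \<sigma> \<mu> m q \<longrightarrow>
        (AE x in surface_measure B. fst p x = fst q x \<and> snd p x = snd q x))"

text \<open>The solution \<open>(\<phi>\<^sub>m, \<psi>\<^sub>m)\<close> is unique up to null sets, which do not affect the integral.
  Unique solvability holds whenever \<open>\<A>\<close> is invertible, hence whenever \<open>\<omega>\<^sup>2\<close> avoids
  the Neumann and Dirichlet eigenvalues; otherwise the coefficient is by convention zero.\<close>

definition scattering_coeff ::
  "real \<Rightarrow> complex set \<Rightarrow> (complex \<Rightarrow> real) \<Rightarrow> (complex \<Rightarrow> real) \<Rightarrow> int \<Rightarrow> int \<Rightarrow> complex" where
  "scattering_coeff \<omega> B \<sigma> \<mu> n m =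
     (if scattering_uniquely_solvable \<omega> B \<sigma> \<mu> m
      then (\<integral>y. cnj (cyl_wave \<omega> n y) * fst (SOME p. scattering_solution \<omega> B \<sigma> \<mu> m p) y
              \<partial>surface_measure B)
      else 0)"

end

theory Submission
  imports Defs "HOL-Probability.Probability"
begin

text \<open>
  The plan is to push a solution of the boundary system forward by the rotation \<open>x \<mapsto> c x\<close> with
  \<open>c = exp (i \<theta>)\<close>. Surface measure, Lebesgue measure, normals, traces, weak derivatives and the
  kernel \<open>\<Gamma>\<close> are all carried along, so the pushed pair solves the system of the rotated
  domain (lemma \<open>A_equation_rotate\<close>). The cylindrical wave of order \<open>m\<close> satisfies
  \<open>C\<^sub>m (c x) = c\<^sup>m C\<^sub>m x\<close>, so the data on the right-hand side are those wanted up to the unimodular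
  factor \<open>c\<^sup>m\<close>, which linearity moves to the solution; the factor \<open>C\<^sub>n\<close> of the integrand contributes
  the conjugate of \<open>c\<^sup>n\<close>. Unique solvability then identifies the solutions.

  The delicate point is that linearity. The operator \<open>K_star\<close> is a principal value, written as the
  limit of truncated integrals, and such a limit commutes with multiplication by a constant only where it
  exists. So its existence almost everywhere, for every square integrable density on a merely Lipschitz
  curve, has to be proved. Up to a bounded kernel, the gradient of \<open>\<Gamma>\<close> is the Cauchy
  kernel, and in a chart the claim is the almost everywhere existence of
  \<open>lim \<integral> f t / (z t - z s) dt\<close> over \<open>\<bar>z t - z s\<bar> > h\<close> for a Lipschitz graph
  \<open>z s = (s, A s)\<close> (theorem \<open>AE_principal_value_L2\<close>). The argument is elementary:

  \<^item> The square of the Cauchy integral of a constant is, after symmetrization over three points, an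
    integral of squared curvatures of triangles inscribed in the graph. In terms of chords the
    integrand is a defect of convexity of the function
    \<open>r \<mapsto> \<integral> ((A y - A (y - r)) / r)\<^sup>2 dy\<close>, and a Frullani type
    cancellation bounds it by the entropy of the subdivision (\<open>entropy_frullani\<close>,
    \<open>nn_integral_cross_curv\<close>). The bound is linear in the length of the interval.
  \<^item> Symmetrization works for any nonnegative weight, not only for \<open>1\<close>. So the regularized operators \<open>T e\<close> are
    bounded from bounded to square integrable functions, uniformly in \<open>e\<close>, and by duality from square
    integrable to integrable functions (\<open>T_L1_bound\<close>).
  \<^item> The functions \<open>T (1/n) f\<close>, bounded in \<open>L\<^sup>1\<close>, have a subsequence whose primitives converge, by
    Helly's theorem, to functions of bounded variation. These are differentiable almost everywhere, so the
    averages of the limit over shrinking intervals converge.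
  \<^item> At a Lebesgue point of \<open>f\<close> where \<open>A\<close> is differentiable, the average of \<open>T e f\<close> against a tent
    of width \<open>h\<close>, with \<open>e \<le> h\<^sup>2\<close>, differs from the integral truncated at \<open>h\<close> by a null
    sequence (\<open>tent_average_vs_truncation\<close>). Hence the truncated integrals converge as well.\<close>

text \<open>Iterated integrals over Lebesgue measure are frequent enough to deserve a short binder.\<close>

abbreviation nn_lborel :: "('a::euclidean_space => ennreal) => ennreal" (binder "NN " 10)
  where "nn_lborel f \<equiv> integral\<^sup>N lborel f"

abbreviation (input) borel3 :: "(real \<times> real \<times> real) measure"
 where "borel3 \<equiv> borel \<Otimes>\<^sub>M borel \<Otimes>\<^sub>M borel"

section \<open>Differentiation of measures and functions on the line\<close>

lemma integrable_indicator_interval [simp]: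
 fixes a b :: real
 shows "integrable lborel (indicat_real {a..b})" "integrable lborel (indicat_real {a<..b})"
proof -
 have "emeasure lborel {a<..b} \<le> emeasure lborel {a..b}" by (rule emeasure_mono) auto
 then show "integrable lborel (indicat_real {a..b})" "integrable lborel (indicat_real {a<..b})"
  by (auto intro!: integrable_real_indicator intro: le_less_trans simp: emeasure_lborel_Icc_eq)
qed

lemma set_integrable_restrict:
 fixes f :: "'a => 'b::{banach, second_countable_topology}"
 assumes "integrable M f" "A \<in> sets M"
 shows "set_integrable M A f"
 unfolding set_integrable_def using assms(2,1) by (rule integrable_mult_indicator)

lemma AE_lborel_negligible:
 fixes P :: "real => bool"
 assumes "negligible N" "\<And>s. s \<notin> N ==> P s"
 shows "AE s in lborel. P s"
proof -
 have "N \<in> null_sets lebesgue" using assms(1) by (simp add: negligible_iff_null_sets)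
 then have "AE s in lebesgue. s \<notin> N" by (rule AE_not_in)
 then have "AE s in lborel. s \<notin> N" by (simp add: AE_completion_iff)
 then show ?thesis by eventually_elim (use assms(2) in auto)
qed

text \<open>Vitali covering: disjoint intervals whose \<open>M\<close>-mass is comparable to their length
  can be chosen inside an open neighbourhood of \<open>E\<close> of small \<open>M\<close>-mass.\<close>
lemma negligible_high_density:
 fixes M :: "real measure"
 assumes [measurable_cong]: "sets M = sets borel" and fin: "finite_measure M"
  and E: "E \<in> sets borel" "emeasure M E = 0" and a: "a > 0"
 shows "negligible {s\<in>E. \<forall>d>0. \<exists>h. 0 < h \<and> h < d \<and> measure M {s-h..s+h} > a * h}"
  (is "negligible ?S")
proof -
 interpret finite_measure M by fact
 have sp: "space M = UNIV" using sets_eq_imp_space_eq[OF assms(1)] by simp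
 show ?thesis
  unfolding negligible_outer_le
 proof (intro allI impI)
  fix e :: real assume "e > 0"
  define e' where "e' = e * a / 2"
  have "e' > 0" using a \<open>e > 0\<close> by (simp add: e'_def)
  have "emeasure M E = (INF U \<in> {U. E \<subseteq> U \<and> open U}. emeasure M U)"
   by (rule outer_regular[OF assms(1) _ E(1)]) simp
  then have "(INF U \<in> {U. E \<subseteq> U \<and> open U}. emeasure M U) = 0"
   using E(2) by metis
  then have "(INF U \<in> {U. E \<subseteq> U \<and> open U}. emeasure M U) < ennreal e'"
   using \<open>e' > 0\<close> by simp
  then obtain U where U: "E \<subseteq> U" "open U" "emeasure M U < ennreal e'"
   unfolding INF_less_iff by auto
  have Um: "U \<in> sets M" using U(2) by (simp add: assms(1))
  have mU: "measure M U < e'" using U(3) \<open>e' > 0\<close> by (simp add: emeasure_eq_measure ennreal_less_iff)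
  define K where "K = {p :: real \<times> real. 0 < snd p \<and> cball (fst p) (snd p) \<subseteq> U
    \<and> measure M (cball (fst p) (snd p)) > a * snd p}"
  have cov: "\<exists>i. i \<in> K \<and> x \<in> cball (fst i) (snd i) \<and> snd i < d" if "x \<in> ?S" "0 < d" for x d
  proof -
   have "x \<in> U" using that U by auto
   then obtain r where r: "r > 0" "cball x r \<subseteq> U" using U(2) open_contains_cball by blast
   have "min r d > 0" using r that by simp
   moreover have "\<forall>d>0. \<exists>h. 0 < h \<and> h < d \<and> measure M {x-h..x+h} > a * h" using that(1) by simp
   ultimately obtain h where h: "0 < h" "h < min r d" "measure M {x-h..x+h} > a*h" by meson
   have "cball x h \<subseteq> cball x r" using h by auto
   then have "(x,h) \<in> K" using h r by (auto simp: K_def cball_eq_atLeastAtMost)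
   then show ?thesis using h by (intro exI[of _ "(x,h)"]) auto
  qed
  obtain C where C: "countable C" "C \<subseteq> K"
   "pairwise (\<lambda>i j. disjnt (cball (fst i) (snd i)) (cball (fst j) (snd j))) C"
   "negligible (?S - (\<Union>i\<in>C. cball (fst i) (snd i)))"
   by (rule Vitali_covering_theorem_cballs[of K snd ?S fst]) (use cov in \<open>auto simp: K_def\<close>)
  let ?V = "\<Union>i\<in>C. cball (fst i) (snd i)"
  have Vm: "?V \<in> sets borel" using C(1) by auto
  have disj: "disjoint_family_on (\<lambda>i. cball (fst i) (snd i)) C"
   using C(3) by (auto simp: disjoint_family_on_def pairwise_def disjnt_def)
  have "emeasure lborel ?V = (\<integral>\<^sup>+i. emeasure lborel (cball (fst i) (snd i)) \<partial>count_space C)"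
   by (rule emeasure_UN_countable) (use C disj in auto)
  also have "... \<le> (\<integral>\<^sup>+i. ennreal (2/a) * emeasure M (cball (fst i) (snd i)) \<partial>count_space C)"
  proof (rule nn_integral_mono)
   fix i assume "i \<in> space (count_space C)"
   then have "i \<in> K" using C by auto
   then have i: "0 < snd i" "a * snd i < measure M (cball (fst i) (snd i))" by (auto simp: K_def)
   have "emeasure lborel (cball (fst i) (snd i)) = ennreal (2 * snd i)"
    using i by (simp add: cball_eq_atLeastAtMost)
   also have "... \<le> ennreal (2/a * measure M (cball (fst i) (snd i)))"
    using i a by (intro ennreal_leI) (simp add: field_simps)
   also have "... = ennreal (2/a) * emeasure M (cball (fst i) (snd i))"
    unfolding emeasure_eq_measure by (rule ennreal_mult) (use a in auto)
   finally show "emeasure lborel (cball (fst i) (snd i)) \<le> ennreal (2/a) * emeasure M (cball (fst i) (snd i))" .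
  qed
  also have "... = ennreal (2/a) * (\<integral>\<^sup>+i. emeasure M (cball (fst i) (snd i)) \<partial>count_space C)"
   by (rule nn_integral_cmult) simp
  also have "(\<integral>\<^sup>+i. emeasure M (cball (fst i) (snd i)) \<partial>count_space C) = emeasure M ?V"
   by (rule emeasure_UN_countable[symmetric]) (use C disj in \<open>auto simp: assms(1)\<close>)
  also have "emeasure M ?V \<le> emeasure M U"
   by (rule emeasure_mono[OF _ Um]) (use C in \<open>auto simp: K_def\<close>)
  also have "ennreal (2/a) * emeasure M U \<le> ennreal (2/a) * ennreal e'"
   using U(3) by (intro mult_left_mono) auto
  also have "... = ennreal e" using a \<open>e > 0\<close> by (simp add: ennreal_mult[symmetric] e'_def)
  finally have V: "emeasure lborel ?V \<le> ennreal e" by (simp add: mult_left_mono)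
  have V': "emeasure lebesgue ?V \<le> ennreal e" using V Vm by simp
  let ?N = "?S - ?V"
  have N0: "emeasure lebesgue ?N = 0" "?N \<in> sets lebesgue"
   using C(4) by (auto simp: negligible_iff_null_sets null_sets_def)
  have em: "emeasure lebesgue (?V \<union> ?N) \<le> ennreal e"
   using emeasure_subadditive[of ?V lebesgue ?N] N0 V' Vm by auto
  have "?V \<union> ?N \<in> sets lebesgue" using N0(2) Vm by (intro sets.Un) auto
  then have "?V \<union> ?N \<in> lmeasurable"
   by (rule fmeasurableI) (rule le_less_trans[OF em], simp)
  moreover have "measure lebesgue (?V \<union> ?N) \<le> e"
   using em \<open>e > 0\<close> by (simp add: measure_def enn2real_leI)
  ultimately show "\<exists>T. ?S \<subseteq> T \<and> T \<in> lmeasurable \<and> measure lebesgue T \<le> e"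
   by (intro exI[of _ "?V \<union> ?N"]) auto
 qed
qed

lemma AE_null_set_zero_density:
 fixes M :: "real measure"
 assumes sM: "sets M = sets borel" and fin: "finite_measure M"
  and E: "E \<in> sets borel" "emeasure M E = 0"
 shows "AE s in lborel. s \<in> E \<longrightarrow> ((\<lambda>h. measure M {s-h..s+h} / h) \<longlongrightarrow> 0) (at_right 0)"
proof -
 define S where "S a = {s\<in>E. \<forall>d>0. \<exists>h. 0 < h \<and> h < d \<and> measure M {s-h..s+h} > a * h}" for a :: real
 have "negligible (\<Union>n::nat. S (inverse (real (Suc n))))"
  unfolding S_def by (rule negligible_Union_nat, rule negligible_high_density[OF assms]) simp
 then show ?thesis
 proof (rule AE_lborel_negligible, intro impI)
  fix s assume s: "s \<notin> (\<Union>n::nat. S (inverse (real (Suc n))))" "s \<in> E"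
  show "((\<lambda>h. measure M {s-h..s+h} / h) \<longlongrightarrow> 0) (at_right 0)"
  proof (rule tendstoI)
   fix e :: real assume "e > 0"
   then obtain n where n: "inverse (real (Suc n)) < e" using reals_Archimedean by blast
   have "s \<notin> S (inverse (real (Suc n)))" using s by blast
   then obtain d where d: "d > 0" "\<And>h. 0 < h ==> h < d ==> measure M {s-h..s+h} \<le> inverse (real (Suc n)) * h"
    unfolding S_def using s(2) not_le by auto
   have "eventually (\<lambda>h. h \<in> {0<..<d}) (at_right 0)"
    using d(1) by (rule eventually_at_right_real)
   then show "eventually (\<lambda>h. dist (measure M {s-h..s+h} / h) 0 < e) (at_right 0)"
   proof eventually_elim
    case (elim h)
    then have "measure M {s-h..s+h} / h \<le> inverse (real (Suc n))"
     using d(2)[of h] by (simp add: pos_divide_le_eq)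
    then show ?case using n elim by (simp add: dist_real_def)
   qed
  qed
 qed
qed

text \<open>The measure with density \<open>max (f - q) 0\<close> does not charge \<open>{f \<le>
  q}\<close>, so it has zero density almost everywhere there, and averages of \<open>f\<close> cannot
  exceed \<open>q\<close> in the limit; \<open>q\<close> runs over the rationals.\<close>
lemma AE_average_le:
 fixes f :: "real => real"
 assumes f: "integrable lborel f" and pos: "\<And>x. f x \<ge> 0"
 shows "AE s in lborel. \<forall>r>f s. eventually (\<lambda>h. (LBINT x:{s-h..s+h}. f x) / (2 * h) < r) (at_right 0)"
proof -
 have fm[measurable]: "f \<in> borel_measurable borel" using f by (auto dest: borel_measurable_integrable)
 define g where "g q x = max (f x - q) 0" for q x :: real
 have gm[measurable]: "g q \<in> borel_measurable borel" for q unfolding g_def by measurable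
 define M where "M q = density lborel (\<lambda>x. ennreal (g q x))" for q
 have gnn: "g q x \<ge> 0" for q x by (simp add: g_def)
 have gint: "integrable lborel (g q)" if "q > 0" for q
  by (rule Bochner_Integration.integrable_bound[OF f]) (use pos that in \<open>auto simp: g_def\<close>)
 have measM: "measure (M q) A = (LBINT x:A. g q x)" if "q > 0" "A \<in> sets borel" for q A
 proof -
  have "emeasure (M q) A = (NN x. ennreal (indicator A x *\<^sub>R g q x))"
   unfolding M_def using that by (subst emeasure_density) (auto intro!: nn_integral_cong simp: indicator_def)
  also have "... = ennreal (LBINT x:A. g q x)"
   unfolding set_lebesgue_integral_def
   by (rule nn_integral_eq_integral[OF integrable_mult_indicator])
    (use gint[OF that(1)] that(2) gnn in auto)
  finally show ?thesis
   using gnn by (simp add: measure_def set_lebesgue_integral_def)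
 qed
 have "AE s in lborel. f s \<le> q \<longrightarrow> ((\<lambda>h. measure (M q) {s-h..s+h} / h) \<longlongrightarrow> 0) (at_right 0)" if "q > 0" for q
 proof -
  have "AE s in lborel. s \<in> {x. f x \<le> q} \<longrightarrow> ((\<lambda>h. measure (M q) {s-h..s+h} / h) \<longlongrightarrow> 0) (at_right 0)"
  proof (rule AE_null_set_zero_density)
   show "sets (M q) = sets borel" by (simp add: M_def)
   show "finite_measure (M q)"
   proof (rule finite_measureI)
    have "emeasure (M q) (space (M q)) = (NN x. ennreal (g q x))"
     unfolding M_def by (simp add: emeasure_density)
    also have "... = ennreal (integral\<^sup>L lborel (g q))"
     by (rule nn_integral_eq_integral[OF gint[OF that]]) (simp add: g_def)
    finally show "emeasure (M q) (space (M q)) \<noteq> \<infinity>" by simp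
   qed
   show "emeasure (M q) {x. f x \<le> q} = 0"
    unfolding M_def by (subst emeasure_density) (auto simp: nn_integral_0_iff_AE indicator_def g_def ennreal_neg)
  qed measurable
  then show ?thesis by simp
 qed
 then have "AE s in lborel. \<forall>q\<in>{q\<in>\<rat>. q > 0}. f s \<le> q \<longrightarrow> ((\<lambda>h. measure (M q) {s-h..s+h} / h) \<longlongrightarrow> 0) (at_right 0)"
  by (subst AE_ball_countable) (auto intro: countable_subset[OF _ countable_rat])
 then show ?thesis
 proof eventually_elim
  case (elim s)
  show ?case
  proof (intro allI impI)
   fix r assume r: "f s < r"
   then obtain q where q: "q \<in> \<rat>" "f s < q" "q < r" using Rats_dense_in_real by blast
   have q0: "q > 0" using q(2) pos[of s] by linarith
   have lim: "((\<lambda>h. measure (M q) {s-h..s+h} / h) \<longlongrightarrow> 0) (at_right 0)" using elim q q0 by auto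
   have "eventually (\<lambda>h. measure (M q) {s-h..s+h} / h < r - q) (at_right 0)"
    by (rule order_tendstoD(2)[OF lim]) (use q in simp)
   moreover have "eventually (\<lambda>h. h \<in> {0<..<1::real}) (at_right 0)" by (rule eventually_at_right_real) simp
   ultimately show "eventually (\<lambda>h. (LBINT x:{s-h..s+h}. f x) / (2*h) < r) (at_right 0)"
   proof eventually_elim
    case (elim h)
    have "(LBINT x:{s-h..s+h}. f x) \<le> (LBINT x:{s-h..s+h}. g q x + q)"
    proof (rule set_integral_mono)
     show "set_integrable lborel {s-h..s+h} f"
      unfolding set_integrable_def using f by (intro integrable_mult_indicator) auto
     have "set_integrable lborel {s-h..s+h} (g q)"
      unfolding set_integrable_def using gint[OF q0] by (intro integrable_mult_indicator) auto
     then show "set_integrable lborel {s-h..s+h} (\<lambda>x. g q x + q)"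
      by (rule set_integral_add) (auto simp: set_integrable_def)
    qed (simp add: g_def)
    also have "... = (LBINT x:{s-h..s+h}. g q x) + (LBINT x:{s-h..s+h}. q)"
     by (rule set_integral_add(2)[OF set_integrable_restrict[OF gint[OF q0]]]) (auto simp: set_integrable_def)
    also have "(LBINT x:{s-h..s+h}. q) = 2*h*q"
     using elim by (simp add: set_integral_const)
    also have "(LBINT x:{s-h..s+h}. g q x) = measure (M q) {s-h..s+h}" using q0 by (simp add: measM)
    finally have "(LBINT x:{s-h..s+h}. f x) \<le> measure (M q) {s-h..s+h} + 2*h*q" .
    moreover have "measure (M q) {s-h..s+h} < (r-q)*h" using elim by (simp add: field_simps)
    ultimately have "(LBINT x:{s-h..s+h}. f x) < (r-q)*h + 2*h*q" by linarith
    also have "... \<le> r * (2*h)"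
    proof -
     have "(r-q)*h \<le> (r-q)*(2*h)" using elim q by (intro mult_left_mono) auto
     then show ?thesis by (simp add: algebra_simps)
    qed
    finally show ?case using elim by (simp add: pos_divide_less_eq)
   qed
  qed
 qed
qed

text \<open>The differentiation theorem is applied to the distances from a countable dense set of
  constants. Exponent 2 is needed to pair with the square bounds for the Cauchy integral.\<close>
lemma AE_lebesgue_point_pow:
 fixes F :: "real => complex" and p :: nat
 assumes [measurable]: "F \<in> borel_measurable borel" and int: "integrable lborel (\<lambda>x. cmod (F x) ^ p)"
  and p: "p = 1 \<or> p = 2"
 shows "AE s in lborel. ((\<lambda>h. (LBINT x:{s-h..s+h}. cmod (F x - F s) ^ p) / h) \<longlongrightarrow> 0) (at_right 0)"
proof -
 obtain D :: "complex set" where D: "countable D" "\<And>X. open X ==> X \<noteq> {} ==> \<exists>d\<in>D. d \<in> X"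
  by (rule countable_dense_setE) blast
 have pow2: "cmod (a - b) ^ p \<le> 2 * (cmod (a - c) ^ p + cmod (c - b) ^ p)" for a b c :: complex
 proof -
  have t: "cmod (a - b) \<le> cmod (a - c) + cmod (c - b)"
   using norm_triangle_ineq[of "a - c" "c - b"] by simp
  have "(cmod (a - c) + cmod (c - b))^2 \<le> 2 * ((cmod (a - c))^2 + (cmod (c - b))^2)"
   using zero_le_power2[of "cmod (a - c) - cmod (c - b)"] by (simp add: power2_eq_square algebra_simps)
  moreover have "(cmod (a - b))^2 \<le> (cmod (a - c) + cmod (c - b))^2" using t by (intro power_mono) auto
  ultimately have "(cmod (a - b))^2 \<le> 2 * ((cmod (a - c))^2 + (cmod (c - b))^2)" by linarith
  moreover have "cmod (a - b) \<le> 2 * (cmod (a - c) + cmod (c - b))"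
   using t norm_ge_zero[of "a - c"] norm_ge_zero[of "c - b"] unfolding distrib_left by linarith
  ultimately show ?thesis using p by auto
 qed
 define f where "f N c x = indicator {- real N..real N} x * cmod (F x - c) ^ p" for N c x
 have fint: "integrable lborel (f N c)" for N c
 proof (rule Bochner_Integration.integrable_bound)
  show "integrable lborel (\<lambda>x. 2 * (cmod (F x) ^ p + indicator {- real N..real N} x * cmod c ^ p))"
   using int by (intro integrable_mult_right Bochner_Integration.integrable_add integrable_mult_left) auto
  have "\<bar>f N c x\<bar> \<le> 2 * (cmod (F x) ^ p + indicator {- real N..real N} x * cmod c ^ p)" for x
   using pow2[of "F x" c 0] by (auto simp: f_def indicator_def abs_mult)
  then show "AE x in lborel. norm (f N c x) \<le> norm (2 * (cmod (F x) ^ p + indicator {- real N..real N} x * cmod c ^ p))"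
   by (intro AE_I2) (simp only: real_norm_def, meson abs_ge_self order_trans)
 qed (unfold f_def, measurable)
 have "AE s in lborel. \<forall>N. \<forall>c\<in>D. \<forall>r>f N c s. eventually (\<lambda>h. (LBINT x:{s-h..s+h}. f N c x) / (2 * h) < r) (at_right 0)"
  unfolding AE_all_countable AE_ball_countable[OF D(1)]
  by (intro allI ballI AE_average_le fint) (simp add: f_def)
 then show ?thesis
 proof eventually_elim
  case (elim s)
  show ?case
  proof (rule tendstoI)
   fix e :: real assume e: "e > 0"
   define \<eta> where "\<eta> = min (1/2) (e / 16)"
   have \<eta>: "0 < \<eta>" "\<eta> < 1" "8 * \<eta> < e" using e by (auto simp: \<eta>_def)
   obtain c where c: "c \<in> D" "c \<in> ball (F s) \<eta>" using D(2)[of "ball (F s) \<eta>"] \<eta> by auto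
   have cs: "cmod (c - F s) < \<eta>" using c(2) by (simp add: dist_norm norm_minus_commute)
   have cp: "cmod (c - F s) ^ p < \<eta>"
   proof -
    have "(cmod (c - F s))^2 \<le> cmod (c - F s)" using cs \<eta>
     by (simp add: power2_eq_square mult_left_le)
    then show ?thesis using p cs by auto
   qed
   obtain N :: nat where N: "\<bar>s\<bar> + 1 < real N" using reals_Archimedean2 by blast
   have "f N c s < \<eta>" using N cp by (auto simp: f_def indicator_def norm_minus_commute)
   then have "eventually (\<lambda>h. (LBINT x:{s-h..s+h}. f N c x) / (2 * h) < \<eta>) (at_right 0)"
    using elim c(1) by blast
   moreover have "eventually (\<lambda>h. h \<in> {0<..<1::real}) (at_right 0)" by (rule eventually_at_right_real) simp
   ultimately show "eventually (\<lambda>h. dist ((LBINT x:{s-h..s+h}. cmod (F x - F s) ^ p) / h) 0 < e) (at_right 0)"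
   proof eventually_elim
    case (elim h)
    let ?J = "{s-h..s+h}"
    have fJ: "set_integrable lborel ?J (f N c)"
     unfolding set_integrable_def using fint by (intro integrable_mult_indicator) auto
    have kJ: "set_integrable lborel ?J (\<lambda>x. r)" for r :: real by (simp add: set_integrable_def)
    have le: "cmod (F x - F s) ^ p \<le> 2 * f N c x + 2 * \<eta>" if "x \<in> ?J" for x
     using pow2[of "F x" "F s" c] cp that N elim by (auto simp: f_def indicator_def)
    have gJ: "set_integrable lborel ?J (\<lambda>x. 2 * f N c x + 2 * \<eta>)"
     using fJ kJ by (intro set_integral_add set_integrable_mult_right) auto
    have iJ: "set_integrable lborel ?J (\<lambda>x. cmod (F x - F s) ^ p)"
     unfolding set_integrable_def
     by (rule Bochner_Integration.integrable_bound[OF gJ[unfolded set_integrable_def]])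
      (use le in \<open>auto simp: indicator_def intro!: AE_I2 intro: order_trans[OF _ abs_ge_self]\<close>)
    have "(LBINT x:?J. cmod (F x - F s) ^ p) \<le> (LBINT x:?J. 2 * f N c x + 2 * \<eta>)"
     by (rule set_integral_mono[OF iJ gJ le])
    also have "... = 2 * (LBINT x:?J. f N c x) + 2 * \<eta> * (2 * h)"
     using fJ kJ elim by (subst set_integral_add) (auto simp: set_integral_const)
    also have "... < 2 * (\<eta> * (2 * h)) + 2 * \<eta> * (2 * h)"
     using elim by (simp add: pos_divide_less_eq)
    also have "... \<le> e * h" using \<eta> elim by (simp add: mult_right_mono[of "8*\<eta>" e h, simplified])
    finally have "(LBINT x:?J. cmod (F x - F s) ^ p) < e * h" .
    moreover have "(LBINT x:?J. cmod (F x - F s) ^ p) \<ge> 0"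
     unfolding set_lebesgue_integral_def by (rule integral_nonneg_AE) auto
    ultimately show ?case using elim by (simp add: dist_real_def pos_divide_less_eq)
   qed
  qed
 qed
qed

lemma lebesgue_decomposition:
 fixes M :: "real measure"
 assumes sM: "sets M = sets borel" and fin: "finite_measure M"
 obtains f :: "real => real" and E where "integrable lborel f" "\<And>x. f x \<ge> 0" "E \<in> null_sets lborel"
  "\<And>A. A \<in> sets borel ==> measure M A = (LBINT x:A. f x) + measure M (A \<inter> E)"
proof -
 interpret finite_measure M by fact
 note [measurable_cong] = sM
 have sp: "space M = UNIV" using sets_eq_imp_space_eq[OF sM] by simp
 define \<alpha> where "\<alpha> = (SUP E\<in>null_sets lborel. measure M E)"
 have bdd: "bdd_above (measure M ` null_sets lborel)"
  by (intro bdd_aboveI[of _ "measure M (space M)"]) (auto intro: bounded_measure)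
 have "\<exists>E\<in>null_sets lborel. \<alpha> - inverse (real (Suc n)) < measure M E" for n
 proof -
  have "\<alpha> - inverse (real (Suc n)) < \<alpha>" by simp
  then show ?thesis unfolding \<alpha>_def using bdd by (subst (asm) less_cSUP_iff) auto
 qed
 then obtain En where En: "\<And>n. En n \<in> null_sets lborel" "\<And>n. \<alpha> - inverse (real (Suc n)) < measure M (En n)"
  by metis
 define E where "E = (\<Union>n. En n)"
 have E: "E \<in> null_sets lborel" unfolding E_def using En by blast
 have Eb[measurable]: "E \<in> sets borel" using E by auto
 have leE: "\<alpha> \<le> measure M E"
 proof (rule field_le_epsilon)
  fix e :: real assume "e > 0"
  then obtain n where n: "inverse (real (Suc n)) < e" using reals_Archimedean by blast
  have "measure M (En n) \<le> measure M E" by (rule finite_measure_mono) (auto simp: E_def sM Eb[unfolded E_def])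
  then show "\<alpha> \<le> measure M E + e" using En(2)[of n] n by linarith
 qed
 define N where "N = density M (indicator (- E))"
 have eN: "emeasure N A = emeasure M (A - E)" if "A \<in> sets borel" for A :: "real set"
 proof -
  have "emeasure N A = (\<integral>\<^sup>+x. indicator (- E) x * indicator A x \<partial>M)"
   unfolding N_def using that by (subst emeasure_density) auto
  also have "... = (\<integral>\<^sup>+x. indicator (A - E) x \<partial>M)"
   by (rule nn_integral_cong) (auto simp: indicator_def)
  also have "... = emeasure M (A - E)" using that by (intro nn_integral_indicator) (auto simp: sM)
  finally show ?thesis .
 qed
 have sN: "sets N = sets lborel" by (simp add: N_def sM)
 have "absolutely_continuous lborel N"
  unfolding absolutely_continuous_def
 proof
  fix A :: "real set" assume A: "A \<in> null_sets lborel"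
  then have Ab: "A \<in> sets borel" by auto
  have "A - E \<union> E \<in> null_sets lborel" using A E by (auto intro: null_sets.Un null_set_Diff)
  then have "measure M (A - E \<union> E) \<le> \<alpha>" unfolding \<alpha>_def by (rule cSUP_upper[OF _ bdd])
  moreover have "measure M (A - E \<union> E) = measure M (A - E) + measure M E"
   by (rule finite_measure_Union) (use Ab in \<open>auto simp: sM\<close>)
  ultimately have "measure M (A - E) = 0" using leE measure_nonneg[of M "A - E"] by linarith
  then have "emeasure N A = 0" using eN[OF Ab] by (simp add: emeasure_eq_measure)
  then show "A \<in> null_sets N" using Ab sN by auto
 qed
 from sigma_finite_measure.Radon_Nikodym[OF sigma_finite_lborel this sN]
 obtain g where g[measurable]: "g \<in> borel_measurable lborel" and gN: "density lborel g = N" by auto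
 have gfin: "(NN x. g x) < \<infinity>"
 proof -
  have "(NN x. g x) = emeasure (density lborel g) UNIV" by (simp add: emeasure_density)
  also have "... = emeasure M (UNIV - E)" unfolding gN by (rule eN) simp
  finally show ?thesis by (simp add: emeasure_eq_measure)
 qed
 have gae: "AE x in lborel. g x \<noteq> \<infinity>" by (rule nn_integral_PInf_AE) (use gfin in auto)
 define f where "f x = enn2real (g x)" for x
 have fm[measurable]: "f \<in> borel_measurable borel" unfolding f_def by measurable
 have fg: "AE x in lborel. ennreal (f x) = g x" using gae by eventually_elim (simp add: f_def ennreal_enn2real_if)
 have f0: "f x \<ge> 0" for x by (simp add: f_def)
 have fint: "integrable lborel f"
 proof (rule integrableI_nonneg)
  have "(NN x. ennreal (f x)) = (NN x. g x)" by (rule nn_integral_cong_AE) (use fg in auto)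
  then show "(NN x. ennreal (f x)) < \<infinity>" using gfin by simp
 qed (use f0 in auto)
 have "measure M A = (LBINT x:A. f x) + measure M (A \<inter> E)" if A: "A \<in> sets borel" for A
 proof -
  have "emeasure M (A - E) = (NN x. g x * indicator A x)"
   using eN[OF A] A unfolding gN[symmetric] by (simp add: emeasure_density)
  also have "... = (NN x. ennreal (indicator A x *\<^sub>R f x))"
   by (rule nn_integral_cong_AE) (use fg in eventually_elim, auto simp: indicator_def)
  also have "... = ennreal (LBINT x:A. f x)"
   unfolding set_lebesgue_integral_def
   by (rule nn_integral_eq_integral[OF integrable_mult_indicator]) (use fint A f0 in auto)
  finally have "measure M (A - E) = (LBINT x:A. f x)"
   using f0 by (simp add: measure_def set_lebesgue_integral_def)
  moreover have "measure M A = measure M (A - E) + measure M (A \<inter> E)"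
   by (subst finite_measure_Union[symmetric]) (use A in \<open>auto simp: sM Diff_disjoint intro!: arg_cong[where f="measure M"]\<close>)
  ultimately show ?thesis by simp
 qed
 then show ?thesis using that fint f0 E by blast
qed

text \<open>Lebesgue: the Stieltjes measure of \<open>F\<close> splits into a density, which is recovered
  at its Lebesgue points, and a measure that charges only a null set and has zero density almost
  everywhere.\<close>
lemma AE_monotone_differentiable:
 fixes F :: "real => real"
 assumes mono: "mono F" and rc: "\<And>x. continuous (at_right x) F" and bd: "\<And>x. \<bar>F x\<bar> \<le> C"
 shows "AE s in lborel. \<exists>d. (F has_real_derivative d) (at s)"
proof -
 define M where "M = interval_measure F"
 have sM: "sets M = sets borel" by (simp add: M_def)
 note [measurable_cong] = sM
 have Ioc: "emeasure M {a<..b} = ennreal (F b - F a)" if "a \<le> b" for a b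
  unfolding M_def by (rule emeasure_interval_measure_Ioc) (use that mono rc in \<open>auto dest: monoD\<close>)
 have fin: "finite_measure M"
 proof (rule finite_measureI)
  have "emeasure M (\<Union>n::nat. {- real n<..real n}) = (SUP n::nat. emeasure M {- real n<..real n})"
   by (rule SUP_emeasure_incseq[symmetric]) (auto simp: sM incseq_def)
  also have "... \<le> ennreal (2 * C)"
  proof (rule SUP_least)
   fix n :: nat
   have "F (real n) - F (- real n) \<le> 2 * C" using bd[of "real n"] bd[of "- real n"] by linarith
   then show "emeasure M {- real n<..real n} \<le> ennreal (2 * C)" by (simp add: Ioc ennreal_leI)
  qed
  also have "(\<Union>n::nat. {- real n<..real n}) = space M"
  proof -
   have "\<exists>n::nat. - real n < x \<and> x \<le> real n" for x
    using reals_Archimedean2[of "\<bar>x\<bar>"] by (metis abs_less_iff less_imp_le minus_less_iff)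
   then show ?thesis by (auto simp: M_def)
  qed
  finally show "emeasure M (space M) \<noteq> \<infinity>" by (auto simp: top_unique)
 qed
 interpret finite_measure M by fact
 have mIoc: "measure M {a<..b} = F b - F a" if "a \<le> b" for a b
  using Ioc[OF that] monoD[OF mono that] by (simp add: measure_def)
 obtain f E where fE: "integrable lborel f" "\<And>x. f x \<ge> (0::real)" "E \<in> null_sets lborel"
  "\<And>A. A \<in> sets borel ==> measure M A = (LBINT x:A. f x) + measure M (A \<inter> E)"
  by (rule lebesgue_decomposition[OF sM fin]) blast
 have Eb[measurable]: "E \<in> sets borel" using fE(3) by auto
 have fm[measurable]: "f \<in> borel_measurable borel" using fE(1) by (auto dest: borel_measurable_integrable)
 define Ms where "Ms = density M (indicator E)"
 have eMs: "emeasure Ms A = emeasure M (A \<inter> E)" if "A \<in> sets borel" for A :: "real set"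
 proof -
  have "emeasure Ms A = (\<integral>\<^sup>+x. indicator E x * indicator A x \<partial>M)"
   unfolding Ms_def using that by (subst emeasure_density) auto
  also have "... = (\<integral>\<^sup>+x. indicator (A \<inter> E) x \<partial>M)"
   by (rule nn_integral_cong) (auto simp: indicator_def)
  also have "... = emeasure M (A \<inter> E)" using that by (intro nn_integral_indicator) (auto simp: sM)
  finally show ?thesis .
 qed
 have mMs: "measure Ms A = measure M (A \<inter> E)" if "A \<in> sets borel" for A
  using eMs[OF that] by (simp add: measure_def)
 have "AE s in lborel. s \<in> - E \<longrightarrow> ((\<lambda>h. measure Ms {s-h..s+h} / h) \<longlongrightarrow> 0) (at_right 0)"
 proof (rule AE_null_set_zero_density)
  show "sets Ms = sets borel" by (simp add: Ms_def sM)
  show "finite_measure Ms"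
   by (rule finite_measureI) (use eMs[of UNIV] in \<open>auto simp: Ms_def M_def emeasure_eq_measure[unfolded M_def]\<close>)
  show "emeasure Ms (- E) = 0" by (subst eMs) auto
 qed auto
 moreover have "AE s in lborel. s \<notin> E" using fE(3) by (rule AE_not_in)
 moreover have "AE s in lborel. ((\<lambda>h. (LBINT x:{s-h..s+h}. cmod (complex_of_real (f x) - complex_of_real (f s)) ^ 1) / h) \<longlongrightarrow> 0) (at_right 0)"
  by (rule AE_lebesgue_point_pow) (use fE in \<open>auto\<close>)
 ultimately show ?thesis
 proof eventually_elim
  case (elim s)
  let ?er = "\<lambda>h. measure Ms {s-h..s+h} / h + (LBINT x:{s-h..s+h}. \<bar>f x - f s\<bar>) / h"
  have "((\<lambda>h. (LBINT x:{s-h..s+h}. \<bar>f x - f s\<bar>) / h) \<longlongrightarrow> 0) (at_right 0)"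
   using elim(3) by (simp add: of_real_diff[symmetric] del: of_real_diff)
  then have er: "(?er \<longlongrightarrow> 0) (at_right 0)"
   using elim by (intro tendsto_add_zero) auto
  have main: "\<bar>(F b - F a) - h * f s\<bar> \<le> measure Ms {s-h..s+h} + (LBINT x:{s-h..s+h}. \<bar>f x - f s\<bar>)"
   if h: "h > 0" "a \<le> b" "b - a = h" "s - h \<le> a" "b \<le> s + h" for a b h
  proof -
   have sub: "{a<..b} \<subseteq> {s-h..s+h}" using h by auto
   have i1: "set_integrable lborel {a<..b} f"
    unfolding set_integrable_def using fE(1) by (intro integrable_mult_indicator) auto
   have i2: "set_integrable lborel {a<..b} (\<lambda>x. f s)" by (simp add: set_integrable_def)
   have i3: "set_integrable lborel {s-h..s+h} (\<lambda>x. f x - f s)"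
    by (rule set_integral_diff, rule set_integrable_restrict[OF fE(1)]) (auto simp: set_integrable_def)
   have i4: "set_integrable lborel {s-h..s+h} (\<lambda>x. \<bar>f x - f s\<bar>)"
    by (rule set_integrable_abs[OF i3])
   have "F b - F a = (LBINT x:{a<..b}. f x) + measure Ms {a<..b}"
    using mIoc[OF h(2)] fE(4)[of "{a<..b}"] mMs[of "{a<..b}"] by simp
   moreover have "(LBINT x:{a<..b}. f s) = h * f s" using h by (simp add: set_integral_const)
   ultimately have "(F b - F a) - h * f s = (LBINT x:{a<..b}. f x - f s) + measure Ms {a<..b}"
    using set_integral_diff(2)[OF i1 i2] by simp
   also have "\<bar>...\<bar> \<le> \<bar>LBINT x:{a<..b}. f x - f s\<bar> + measure Ms {a<..b}"
    using measure_nonneg[of Ms "{a<..b}"] by linarith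
   also have "\<bar>LBINT x:{a<..b}. f x - f s\<bar> \<le> (LBINT x:{a<..b}. \<bar>f x - f s\<bar>)"
    using set_integral_norm_bound[of lborel "{a<..b}" "\<lambda>x. f x - f s"] set_integral_diff(1)[OF i1 i2] by simp
   also have "... \<le> (LBINT x:{s-h..s+h}. \<bar>f x - f s\<bar>)"
    unfolding set_lebesgue_integral_def
    by (rule integral_mono)
     (use sub i4 set_integrable_subset[OF i4 _ sub] in \<open>auto simp: set_integrable_def indicator_def\<close>)
   also have "measure Ms {a<..b} \<le> measure Ms {s-h..s+h}"
    using sub by (subst (1 2) mMs) (auto intro!: finite_measure_mono simp: sM)
   finally show ?thesis by simp
  qed
  show ?case
  proof (intro exI)
   show "(F has_real_derivative f s) (at s)"
    unfolding DERIV_def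
   proof (rule LIM_I)
    fix e :: real assume "e > 0"
    then have "eventually (\<lambda>h. ?er h < e) (at_right 0)" using order_tendstoD(2)[OF er] by blast
    then obtain d where d: "d > 0" "\<And>h. 0 < h ==> h < d ==> ?er h < e"
     unfolding eventually_at_right_field by blast
    show "\<exists>d>0. \<forall>k. k \<noteq> 0 \<and> norm (k - 0) < d \<longrightarrow> norm ((F (s + k) - F s) / k - f s) < e"
    proof (intro exI conjI allI impI)
     show "d > 0" by fact
     fix k :: real assume k: "k \<noteq> 0 \<and> norm (k - 0) < d"
     have "\<bar>(F (s + k) - F s) - k * f s\<bar> \<le> \<bar>k\<bar> * ?er \<bar>k\<bar>"
     proof (cases "k > 0")
      case True
      then show ?thesis using main[of k s "s+k"] by (simp add: distrib_left)
     next
      case False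
      then have "k < 0" using k by simp
      then show ?thesis using main[of "-k" "s+k" s] by (simp add: distrib_left abs_minus_commute algebra_simps)
     qed
     also have "... < \<bar>k\<bar> * e" using d(2)[of "\<bar>k\<bar>"] k by (intro mult_strict_left_mono) auto
     finally have "\<bar>(F (s + k) - F s) - k * f s\<bar> / \<bar>k\<bar> < e" using k by (simp add: pos_divide_less_eq mult.commute)
     moreover have "(F (s + k) - F s) / k - f s = ((F (s + k) - F s) - k * f s) / k"
      using k by (simp add: field_simps)
     ultimately show "norm ((F (s + k) - F s) / k - f s) < e" by (simp add: abs_divide)
    qed
   qed
  qed
 qed
qed

text \<open>A Lipschitz function becomes monotone after a linear function is added; boundedness is
  arranged by freezing it outside \<open>[-N, N]\<close>.\<close>
lemma AE_lipschitz_differentiable: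
 fixes A :: "real => real"
 assumes L: "L-lipschitz_on UNIV A"
 shows "AE s in lborel. \<exists>d. (A has_real_derivative d) (at s)"
proof -
 have L0: "L \<ge> 0" by (rule lipschitz_on_nonneg[OF L])
 define cl where "cl N x = max (- real N) (min (real N) x)" for N x
 define F where "F N x = A (cl N x) + L * cl N x" for N x
 have contA: "continuous_on UNIV A" by (rule lipschitz_on_continuous_on[OF L])
 have clc: "continuous_on UNIV (cl N)" for N unfolding cl_def by (intro continuous_intros)
 have Fc: "continuous_on UNIV (F N)" for N
  unfolding F_def by (intro continuous_intros continuous_on_compose2[OF contA] clc) auto
 have Fm: "mono (F N)" for N
 proof (rule monoI)
  fix x y :: real assume "x \<le> y"
  then have "cl N x \<le> cl N y" by (auto simp: cl_def)
  moreover have "\<bar>A (cl N x) - A (cl N y)\<bar> \<le> L * \<bar>cl N x - cl N y\<bar>"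
   using lipschitz_onD[OF L, of "cl N x" "cl N y"] by (simp add: dist_real_def)
  ultimately show "F N x \<le> F N y" by (simp add: F_def algebra_simps abs_le_iff)
 qed
 have Fb: "\<exists>C. \<forall>x. \<bar>F N x\<bar> \<le> C" for N
 proof -
  have "compact (F N ` {- real N..real N})"
   by (intro compact_continuous_image continuous_on_subset[OF Fc]) auto
  then obtain C where "\<And>y. y \<in> F N ` {- real N..real N} ==> \<bar>y\<bar> \<le> C"
   using compact_imp_bounded bounded_iff by (metis real_norm_def)
  moreover have "F N x = F N (cl N x)" "cl N x \<in> {- real N..real N}" for x by (auto simp: F_def cl_def)
  ultimately show ?thesis by (metis imageI)
 qed
 have "AE s in lborel. \<forall>N. \<exists>d. (F N has_real_derivative d) (at s)"
  unfolding AE_all_countable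
 proof
  fix N
  obtain C where C: "\<And>x. \<bar>F N x\<bar> \<le> C" using Fb by blast
  show "AE s in lborel. \<exists>d. (F N has_real_derivative d) (at s)"
   by (rule AE_monotone_differentiable[OF Fm _ C])
    (use Fc in \<open>auto simp: continuous_on_eq_continuous_at intro: continuous_at_imp_continuous_within\<close>)
 qed
 then show ?thesis
 proof eventually_elim
  case (elim s)
  obtain N :: nat where N: "\<bar>s\<bar> < real N" using reals_Archimedean2 by blast
  obtain d where d: "(F N has_real_derivative d) (at s)" using elim by blast
  have "((\<lambda>x. F N x - L * x) has_real_derivative (d - L)) (at s)"
   by (rule derivative_eq_intros d refl | simp)+
  moreover have "eventually (\<lambda>x. x \<in> {- real N<..<real N}) (nhds s)"
   by (rule eventually_nhds_in_open) (use N in auto)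
  then have "eventually (\<lambda>x. F N x - L * x = A x) (nhds s)"
   by eventually_elim (auto simp: F_def cl_def)
  ultimately have "(A has_real_derivative (d - L)) (at s)"
   by (subst (asm) DERIV_cong_ev[OF refl _ refl]) auto
  then show ?case by blast
 qed
qed

section \<open>An entropy inequality on the half line\<close>

lemma nn_integral_lborel_swap:
 fixes f :: "real => real => ennreal"
 assumes "case_prod f \<in> borel_measurable (borel \<Otimes>\<^sub>M borel)"
 shows "(NN x. NN y. f x y) = (NN y. NN x. f x y)"
 using lborel_pair.Fubini'[of f] assms by simp

text \<open>The substitution \<open>(u, v) = (l r, (1 - l) r)\<close>, of Jacobian \<open>r\<close>: an
  interval of length \<open>r\<close> is divided in the ratio \<open>l : 1 - l\<close>.\<close>
lemma nn_integral_polar_simplex: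
 fixes g :: "real => real => ennreal"
 assumes [measurable]: "case_prod g \<in> borel_measurable (borel \<Otimes>\<^sub>M borel)"
 shows "(NN u. NN v. indicator {0<..} u * indicator {0<..} v * g u v) =
  (NN l. indicator {0<..<1} l * (NN r. indicator {0<..} r * (ennreal r * g (l * r) ((1 - l) * r))))"
proof -
 have "(NN u. NN v. indicator {0<..} u * indicator {0<..} v * g u v)
   = (NN u. NN r. indicator {0<..} u * indicator {0<..} (r - u) * g u (r - u))"
 proof (rule nn_integral_cong)
  fix u :: real
  show "(NN v. indicator {0<..} u * indicator {0<..} v * g u v)
   = (NN r. indicator {0<..} u * indicator {0<..} (r - u) * g u (r - u))"
   by (subst nn_integral_real_affine[where c=1 and t="- u"]) auto
 qed
 also have "... = (NN r. NN u. indicator {0<..} u * indicator {0<..} (r - u) * g u (r - u))"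
  by (rule nn_integral_lborel_swap) measurable
 also have "... = (NN r. NN l. indicator {0<..<1} l * (indicator {0<..} r * (ennreal r * g (l * r) ((1 - l) * r))))"
 proof (rule nn_integral_cong)
  fix r :: real
  show "(NN u. indicator {0<..} u * indicator {0<..} (r - u) * g u (r - u)) =
   (NN l. indicator {0<..<1} l * (indicator {0<..} r * (ennreal r * g (l * r) ((1 - l) * r))))"
  proof (cases "r > 0")
   case True
   have "(NN u. indicator {0<..} u * indicator {0<..} (r - u) * g u (r - u))
    = ennreal r * (NN x. indicator {0<..} (r * x) * indicator {0<..} (r - r * x) * g (r * x) (r - r * x))"
    using True by (subst nn_integral_real_affine[where c=r and t=0]) auto
   also have "... = (NN x. ennreal r * (indicator {0<..} (r * x) * indicator {0<..} (r - r * x) * g (r * x) (r - r * x)))"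
    by (rule nn_integral_cmult[symmetric]) measurable
   also have "... = (NN l. indicator {0<..<1} l * (indicator {0<..} r * (ennreal r * g (l * r) ((1 - l) * r))))"
   proof (rule nn_integral_cong)
    fix x :: real
    have "r - r * x > 0 \<longleftrightarrow> x < 1" using True by (simp add: field_simps)
    moreover have "r * x > 0 \<longleftrightarrow> x > 0" using True by (simp add: zero_less_mult_iff)
    ultimately show "ennreal r * (indicator {0<..} (r * x) * indicator {0<..} (r - r * x) * g (r * x) (r - r * x))
     = indicator {0<..<1} x * (indicator {0<..} r * (ennreal r * g (x * r) ((1 - x) * r)))"
     using True by (auto simp: indicator_def algebra_simps)
   qed
   finally show ?thesis .
  next
   case False
   then have "indicator {0<..} u * indicator {0<..} (r - u) * g u (r - u) = 0" for u
    by (auto simp: indicator_def)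
   then show ?thesis using False by (simp add: nn_integral_0_iff_AE)
  qed
 qed
 also have "... = (NN l. NN r. indicator {0<..<1} l * (indicator {0<..} r * (ennreal r * g (l * r) ((1 - l) * r))))"
  by (rule nn_integral_lborel_swap) measurable
 also have "... = (NN l. indicator {0<..<1} l * (NN r. indicator {0<..} r * (ennreal r * g (l * r) ((1 - l) * r))))"
  by (intro nn_integral_cong nn_integral_cmult) measurable
 finally show ?thesis .
qed

lemma nn_integral_inverse_Icc:
 assumes "0 < a" "a \<le> b"
 shows "(NN x. ennreal (1/x) * indicator {a..b} x) = ennreal (ln b - ln a)"
 by (rule nn_integral_FTC_Icc) (use assms in \<open>auto intro!: derivative_eq_intros\<close>)

text \<open>Under the scale invariant measure \<open>dr/r\<close> the three functions \<open>n (l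
  r)\<close>, \<open>n ((1 - l) r)\<close> and \<open>n r\<close> have the same integral up to boundary
  terms. On \<open>[x, y]\<close> the shift by the factor \<open>l\<close> costs at most \<open>c\<close>
  times \<open>ln (1/l)\<close>, whatever \<open>x\<close> and \<open>y\<close> are.\<close>
lemma entropy_frullani:
 fixes n :: "real => real"
 assumes [measurable]: "n \<in> borel_measurable borel" and n0: "\<And>r. 0 \<le> n r" and nc: "\<And>r. r > 0 ==> n r \<le> c"
  and l: "0 < l" "l < 1"
  and conv: "\<And>r. r > 0 ==> n r \<le> l * n (l * r) + (1 - l) * n ((1 - l) * r)"
 shows "(NN r. indicator {0<..} r * ennreal ((l * n (l * r) + (1 - l) * n ((1 - l) * r) - n r) / r))
  \<le> ennreal (c * (l * ln (1/l) + (1 - l) * ln (1/(1 - l))))"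
proof -
 have c0: "c \<ge> 0" using n0[of 1] nc[of 1] by simp
 define m where "m r = ennreal (n r / r)" for r
 have [measurable]: "m \<in> borel_measurable borel" unfolding m_def by measurable
 define I where "I x y = (NN r. m r * indicator {x..y} r)" for x y
 have mle: "m r \<le> ennreal c * ennreal (1/r)" if "r > 0" for r
 proof -
  have "n r / r \<le> c * (1/r)" using nc[OF that] that by (simp add: field_simps)
  then show ?thesis unfolding m_def using c0 that by (subst ennreal_mult[symmetric]) (auto intro: ennreal_leI)
 qed
 have I_le: "I x y \<le> ennreal (c * (ln y - ln x))" if "0 < x" "x \<le> y" for x y
 proof -
  have "I x y \<le> (NN r. ennreal c * (ennreal (1/r) * indicator {x..y} r))"
   unfolding I_def using that mle by (intro nn_integral_mono) (auto simp: indicator_def)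
  also have "... = ennreal c * ennreal (ln y - ln x)"
   using that by (subst nn_integral_cmult) (auto simp: nn_integral_inverse_Icc)
  also have "... = ennreal (c * (ln y - ln x))" using c0 that by (simp add: ennreal_mult)
  finally show ?thesis .
 qed
 have scale: "(NN r. ennreal (n (a * r) / r) * indicator {x..y} r) = I (a * x) (a * y)"
  if "0 < a" "0 < x" for a x y
 proof -
  have "I (a * x) (a * y) = ennreal a * (NN r. m (a * r) * indicator {a * x..a * y} (a * r))"
   unfolding I_def using that by (subst nn_integral_real_affine[where c=a and t=0]) auto
  also have "... = (NN r. ennreal a * (m (a * r) * indicator {a * x..a * y} (a * r)))"
   by (rule nn_integral_cmult[symmetric]) measurable
  also have "... = (NN r. ennreal (n (a * r) / r) * indicator {x..y} r)"
  proof (rule nn_integral_cong)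
   fix r :: real
   have "a * r \<in> {a * x..a * y} \<longleftrightarrow> r \<in> {x..y}" using that by auto
   moreover have "ennreal a * m (a * r) = ennreal (n (a * r) / r)" if "r \<in> {x..y}"
    unfolding m_def using that \<open>0 < a\<close> \<open>0 < x\<close> n0 by (subst ennreal_mult[symmetric]) (auto simp: field_simps)
   ultimately show "ennreal a * (m (a * r) * indicator {a * x..a * y} (a * r)) = ennreal (n (a * r) / r) * indicator {x..y} r"
    by (auto simp: indicator_def)
  qed
  finally show ?thesis by simp
 qed
 (* Moving the window [x, y] to [a x, a y] adds at most the integral over [a x, x]. *)
 have shift: "I (a * x) (a * y) \<le> ennreal (c * ln (1/a)) + I x y" if "0 < a" "a < 1" "0 < x" "x \<le> y" for a x y
 proof -
  have "I (a * x) (a * y) \<le> (NN r. m r * indicator {a*x..x} r + m r * indicator {x..y} r)"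
   unfolding I_def
  proof (intro nn_integral_mono)
   fix r :: real
   have "a * y \<le> y" using that by (simp add: mult_left_le_one_le)
   then show "m r * indicator {a * x..a * y} r \<le> m r * indicator {a*x..x} r + m r * indicator {x..y} r"
    by (auto simp: indicator_def)
  qed
  also have "... = I (a*x) x + I x y" unfolding I_def by (subst nn_integral_add) auto
  also have "I (a*x) x \<le> ennreal (c * (ln x - ln (a*x)))"
   using that by (intro I_le) (auto simp: mult_left_le_one_le)
  also have "ln x - ln (a*x) = ln (1/a)" using that by (simp add: ln_mult ln_div)
  finally show ?thesis by (simp add: add_right_mono)
 qed
 define e where "e r = l * n (l * r) + (1 - l) * n ((1 - l) * r) - n r" for r
 have [measurable]: "e \<in> borel_measurable borel" unfolding e_def by measurable
 have e0: "e r \<ge> 0" if "r > 0" for r using conv[OF that] by (simp add: e_def)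
 let ?H = "c * (l * ln (1/l) + (1 - l) * ln (1/(1 - l)))"
 have lnp: "ln (1/l) \<ge> 0" "ln (1/(1-l)) \<ge> 0" using l by auto
 have part: "(NN r. ennreal (e r / r) * indicator {x..y} r) \<le> ennreal ?H" if "0 < x" "x \<le> y" for x y
 proof -
  have fin: "I x y < \<infinity>" using I_le[OF that] by (rule le_less_trans) simp
  have "(NN r. ennreal (e r / r) * indicator {x..y} r) + I x y
    = (NN r. ennreal (e r / r) * indicator {x..y} r + m r * indicator {x..y} r)"
   unfolding I_def by (subst nn_integral_add) auto
  also have "... = (NN r. ennreal l * (ennreal (n (l * r) / r) * indicator {x..y} r)
    + ennreal (1 - l) * (ennreal (n ((1 - l) * r) / r) * indicator {x..y} r))"
  proof (rule nn_integral_cong)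
   fix r :: real
   show "ennreal (e r / r) * indicator {x..y} r + m r * indicator {x..y} r =
    ennreal l * (ennreal (n (l * r) / r) * indicator {x..y} r)
    + ennreal (1 - l) * (ennreal (n ((1 - l) * r) / r) * indicator {x..y} r)"
   proof (cases "r \<in> {x..y}")
    case True
    then have r: "r > 0" using that by auto
    have "ennreal (e r / r) + m r = ennreal (e r / r + n r / r)"
     unfolding m_def using e0[OF r] n0 r by (intro ennreal_plus[symmetric]) auto
    also have "e r / r + n r / r = l * (n (l * r) / r) + (1 - l) * (n ((1 - l) * r) / r)"
     using r by (simp add: e_def field_simps)
    also have "ennreal ... = ennreal l * ennreal (n (l * r) / r) + ennreal (1 - l) * ennreal (n ((1 - l) * r) / r)"
     using l n0 r by (simp add: ennreal_mult[symmetric])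
    finally show ?thesis using True by simp
   qed simp
  qed
  also have "... = ennreal l * I (l * x) (l * y) + ennreal (1 - l) * I ((1 - l) * x) ((1 - l) * y)"
   using l that by (subst nn_integral_add) (auto simp: nn_integral_cmult scale)
  also have "... \<le> ennreal l * (ennreal (c * ln (1/l)) + I x y) + ennreal (1 - l) * (ennreal (c * ln (1/(1-l))) + I x y)"
   using l that by (intro add_mono mult_left_mono shift) auto
  also have "... = (ennreal l * ennreal (c * ln (1/l)) + ennreal (1 - l) * ennreal (c * ln (1/(1-l))))
    + (ennreal l + ennreal (1 - l)) * I x y"
   by (simp add: algebra_simps)
  also have "ennreal l + ennreal (1 - l) = 1" using l by (subst ennreal_plus[symmetric]) auto
  also have "ennreal l * ennreal (c * ln (1/l)) + ennreal (1 - l) * ennreal (c * ln (1/(1-l))) = ennreal ?H"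
  proof -
   have "ennreal l * ennreal (c * ln (1/l)) = ennreal (l * (c * ln (1/l)))"
    using l c0 lnp by (intro ennreal_mult[symmetric]) auto
   moreover have "ennreal (1-l) * ennreal (c * ln (1/(1-l))) = ennreal ((1-l) * (c * ln (1/(1-l))))"
    using l c0 lnp by (intro ennreal_mult[symmetric]) auto
   moreover have "ennreal (l * (c * ln (1/l))) + ennreal ((1-l) * (c * ln (1/(1-l))))
     = ennreal (l * (c * ln (1/l)) + (1-l) * (c * ln (1/(1-l))))"
    using l c0 lnp by (intro ennreal_plus[symmetric] mult_nonneg_nonneg) auto
   moreover have "l * (c * ln (1/l)) + (1-l) * (c * ln (1/(1-l))) = ?H" by (simp only: algebra_simps)
   ultimately show ?thesis by metis
  qed
  finally show ?thesis using fin by (auto simp: ennreal_add_left_cancel_le add.commute[of _ "I x y"])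
 qed
 define f where "f k r = ennreal (e r / r) * indicator {inverse (real (Suc k))..real (Suc k)} r" for k r
 have "(NN r. (SUP k. f k r)) = (SUP k. NN r. f k r)"
 proof (rule nn_integral_monotone_convergence_SUP)
  show "incseq f"
  proof (rule incseq_SucI, rule le_funI)
   fix k r
   have "inverse (real (Suc (Suc k))) \<le> inverse (real (Suc k))" by (rule le_imp_inverse_le) auto
   moreover have "real (Suc k) \<le> real (Suc (Suc k))" by simp
   ultimately have sub: "{inverse (real (Suc k))..real (Suc k)} \<subseteq> {inverse (real (Suc (Suc k)))..real (Suc (Suc k))}"
    using atLeastatMost_subset_iff by blast
   show "f k r \<le> f (Suc k) r" unfolding f_def using subsetD[OF sub, of r]
    by (auto simp: indicator_def simp del: of_nat_Suc atLeastAtMost_iff)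
  qed
 qed (auto simp: f_def)
 also have "... \<le> ennreal ?H"
 proof (rule SUP_least)
  fix k :: nat
  have "inverse (real (Suc k)) \<le> 1" "1 \<le> real (Suc k)" by (auto simp: field_simps)
  then show "(NN r. f k r) \<le> ennreal ?H"
   unfolding f_def by (intro part) auto
 qed
 finally have "(NN r. (SUP k. f k r)) \<le> ennreal ?H" .
 moreover have "indicator {0<..} r * ennreal (e r / r) \<le> (SUP k. f k r)" for r
 proof (cases "r > 0")
  case True
  obtain k1 where k1: "inverse (real (Suc k1)) < r" using reals_Archimedean[OF True] by blast
  obtain k2 :: nat where k2: "r < real k2" using reals_Archimedean2 by blast
  let ?k = "max k1 k2"
  have "inverse (real (Suc ?k)) \<le> inverse (real (Suc k1))" by (rule le_imp_inverse_le) auto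
  then have "inverse (real (Suc ?k)) \<le> r" using k1 by linarith
  moreover have "r \<le> real (Suc ?k)" using k2 by simp
  ultimately have "r \<in> {inverse (real (Suc ?k))..real (Suc ?k)}" unfolding atLeastAtMost_iff by blast
  then have "indicator {0<..} r * ennreal (e r / r) = f ?k r" using True by (simp add: f_def del: of_nat_Suc)
  also have "... \<le> (SUP k. f k r)" by (rule SUP_upper) simp
  finally show ?thesis .
 qed simp
 ultimately show ?thesis unfolding e_def[symmetric] by (meson nn_integral_mono order_trans)
qed

text \<open>Makes the entropy integrable against \<open>1 / (l (1 - l))\<close>.\<close>
lemma ln_inverse_le:
 assumes "0 < l" "l < (1::real)"
 shows "ln (1/l) \<le> (1 - l) / sqrt l"
proof -
 define x where "x = sqrt l"
 have x: "0 < x" "x < 1" "l = x^2" using assms by (auto simp: x_def)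
 define g where "g t = t - inverse t + 2 * ln (inverse t)" for t :: real
 have "g 1 \<ge> g x"
 proof (rule DERIV_nonneg_imp_nondecreasing[where f=g and a=x and b=1])
  show "x \<le> 1" using x by simp
  fix t assume t: "x \<le> t" "t \<le> 1"
  then have "t > 0" using x by simp
  have "(g has_real_derivative (1 + 1/t^2 - 2/t)) (at t)"
   unfolding g_def using \<open>t > 0\<close>
   by (auto intro!: derivative_eq_intros simp: field_simps power2_eq_square)
  moreover have "1 + 1/t^2 - 2/t = (1 - 1/t)^2" by (simp add: power2_eq_square algebra_simps)
  ultimately show "\<exists>y. (g has_real_derivative y) (at t) \<and> 0 \<le> y" by (metis zero_le_power2)
 qed
 then have "2 * ln (inverse x) \<le> inverse x - x" by (simp add: g_def)
 moreover have "ln (1/l) = 2 * ln (inverse x)" using x by (simp add: ln_div ln_inverse ln_realpow)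
 moreover have "(1 - l) / sqrt l = inverse x - x" using x by (simp add: field_simps power2_eq_square)
 ultimately show ?thesis by simp
qed

lemma nn_integral_inverse_sqrt:
 "(NN l. indicator {0<..<1} l * ennreal (1 / sqrt l)) = 2"
proof -
 have "((\<lambda>x. x powr (-1/2)) has_integral (1 powr (-1/2 + 1) / (-1/2 + 1))) {0..1::real}"
  by (rule has_integral_powr_from_0) auto
 then have "((\<lambda>x. indicator {0..1} x * x powr (-1/2)) has_integral (2::real)) UNIV"
 proof -
  have "(\<lambda>x. indicator {0..1} x * x powr (-1/2)) = (\<lambda>x::real. if x \<in> {0..1} then x powr (-1/2) else 0)"
   by (auto simp: indicator_def)
  then show ?thesis using \<open>(_ has_integral _) {0..1::real}\<close> by (simp only: has_integral_restrict_UNIV) simp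
 qed
 then have "(NN x. ennreal (indicator {0..1} x * x powr (-1/2))) = ennreal 2"
  by (intro nn_integral_has_integral_lborel) (auto simp: indicator_def)
 moreover have "AE l in lborel. indicator {0<..<1} l * ennreal (1 / sqrt l) = ennreal (indicator {0..1} l * l powr (-1/2))"
  using AE_lborel_singleton[of "1::real"] AE_lborel_singleton[of "0::real"]
  by eventually_elim (auto simp: indicator_def powr_minus powr_half_sqrt field_simps)
 then have "(NN l. indicator {0<..<1} l * ennreal (1 / sqrt l)) =
   (NN l. ennreal (indicator {0..1} l * l powr (-1/2)))"
  by (rule nn_integral_cong_AE)
 ultimately show ?thesis by simp
qed

lemma nn_integral_inverse_sqrt':
 "(NN l. indicator {0<..<1} l * ennreal (1 / sqrt (1 - l))) = 2"
proof -
 have "(NN l. indicator {0<..<1} l * ennreal (1 / sqrt l)) =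
  (NN l. indicator {0<..<1} (1 - l) * ennreal (1 / sqrt (1 - l)))"
  by (subst nn_integral_real_affine[where c="-1" and t=1]) auto
 also have "... = (NN l. indicator {0<..<1} l * ennreal (1 / sqrt (1 - l)))"
  by (rule nn_integral_cong) (auto simp: indicator_def)
 finally show ?thesis by (simp add: nn_integral_inverse_sqrt)
qed

lemma nn_integral_entropy:
 assumes "c \<ge> 0"
 shows "(NN l. indicator {0<..<1} l * ennreal (c * (l * ln (1/l) + (1 - l) * ln (1/(1 - l))) / (l * (1 - l)))) \<le> ennreal (4 * c)"
proof -
 have "(NN l. indicator {0<..<1} l * ennreal (c * (l * ln (1/l) + (1 - l) * ln (1/(1 - l))) / (l * (1 - l))))
  \<le> (NN l. ennreal c * (indicator {0<..<1} l * ennreal (1 / sqrt l)) + ennreal c * (indicator {0<..<1} l * ennreal (1 / sqrt (1 - l))))"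
 proof (rule nn_integral_mono)
  fix l :: real
  show "indicator {0<..<1} l * ennreal (c * (l * ln (1/l) + (1 - l) * ln (1/(1 - l))) / (l * (1 - l)))
   \<le> ennreal c * (indicator {0<..<1} l * ennreal (1 / sqrt l)) + ennreal c * (indicator {0<..<1} l * ennreal (1 / sqrt (1 - l)))"
  proof (cases "l \<in> {0<..<1}")
   case True
   then have l: "0 < l" "l < 1" by auto
   have "(l * ln (1/l) + (1 - l) * ln (1/(1 - l))) / (l * (1 - l)) = ln (1/l) / (1 - l) + ln (1/(1-l)) / l"
    using l by (simp add: add_divide_distrib)
   also have "... \<le> 1 / sqrt l + 1 / sqrt (1 - l)"
    using ln_inverse_le[of l] ln_inverse_le[of "1 - l"] l
    by (intro add_mono) (auto simp: field_simps)
   finally have "c * ((l * ln (1/l) + (1 - l) * ln (1/(1 - l))) / (l * (1 - l))) \<le> c * (1 / sqrt l + 1 / sqrt (1 - l))"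
    using assms by (rule mult_left_mono)
   then have "ennreal (c * (l * ln (1/l) + (1 - l) * ln (1/(1 - l))) / (l * (1 - l))) \<le> ennreal (c * (1 / sqrt l) + c * (1 / sqrt (1 - l)))"
    by (intro ennreal_leI) (simp add: distrib_left)
   also have "... = ennreal c * ennreal (1 / sqrt l) + ennreal c * ennreal (1 / sqrt (1 - l))"
    using assms l by (subst ennreal_plus) (auto simp: ennreal_mult[symmetric])
   finally show ?thesis using True by simp
  qed simp
 qed
 also have "... = ennreal c * 2 + ennreal c * 2"
  by (subst nn_integral_add) (auto simp: nn_integral_cmult nn_integral_inverse_sqrt nn_integral_inverse_sqrt')
 also have "... = ennreal (4 * c)"
  using assms by (simp add: ennreal_mult' mult.commute flip: distrib_left)
 finally show ?thesis .
qed

section \<open>The curvature integral of a Lipschitz graph\<close>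

lemma measurable_uncurry3:
 assumes "(\<lambda>(x, y, w). f x y w) \<in> borel_measurable (borel3)"
  and "g1 \<in> borel_measurable M" "g2 \<in> borel_measurable M" "g3 \<in> borel_measurable M"
 shows "(\<lambda>p. f (g1 p) (g2 p) (g3 p)) \<in> borel_measurable M"
proof -
 have "(\<lambda>p. (g1 p, g2 p, g3 p)) \<in> measurable M (borel3)"
  using assms(2-4) by measurable
 from measurable_compose[OF this assms(1)] show ?thesis by simp
qed

lemma nn_integral_lborel_swap3:
 fixes f :: "real => real => real => ennreal"
 assumes m: "(\<lambda>(x, y, w). f x y w) \<in> borel_measurable (borel3)"
 shows "(NN x. NN y. NN w. f x y w) = (NN y. NN x. NN w. f x y w)"
  and "(NN x. NN y. NN w. f x y w) = (NN x. NN w. NN y. f x y w)"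
proof -
 have [measurable]: "(\<lambda>p. f (fst (fst p)) (snd (fst p)) (snd p)) \<in> borel_measurable ((borel \<Otimes>\<^sub>M borel) \<Otimes>\<^sub>M borel)"
  by (rule measurable_uncurry3[OF m]) measurable
 have [measurable]: "(\<lambda>p. f x (fst p) (snd p)) \<in> borel_measurable (borel \<Otimes>\<^sub>M borel)" for x
  by (rule measurable_uncurry3[OF m]) measurable
 show "(NN x. NN y. NN w. f x y w) = (NN y. NN x. NN w. f x y w)"
  by (rule nn_integral_lborel_swap) measurable
 show "(NN x. NN y. NN w. f x y w) = (NN x. NN w. NN y. f x y w)"
  by (intro nn_integral_cong nn_integral_lborel_swap) measurable
qed

text \<open>For slopes \<open>p/u\<close> and \<open>r/v\<close> of adjacent chords, the right-hand side
  is their variance: it exhibits the squared slope difference as the loss of energy when both chords are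
  replaced by one.\<close>
lemma chord_variance_identity:
 fixes p r u v :: real
 assumes "u > 0" "v > 0"
 shows "(p / u - r / v)\<^sup>2 = ((u + v) / (u * v)) * (p\<^sup>2 / u + r\<^sup>2 / v - (p + r)\<^sup>2 / (u + v))"
 using assms by (simp add: divide_simps) (simp add: power2_eq_square algebra_simps)

text \<open>A majorant of a quarter of the squared Menger curvature of the triangle with vertices over
  \<open>s, t, r\<close>: parameter distances replace the distances of the vertices.\<close>
definition cross_curv :: "(real => real) => real => real => real => real" where
 "cross_curv A s t r = ((r - s) * (A t - A s) - (t - s) * (A r - A s))\<^sup>2 / ((t - s)\<^sup>2 * (r - s)\<^sup>2 * (t - r)\<^sup>2)"

lemma cross_curv_perm:
 "cross_curv A t s r = cross_curv A s t r" "cross_curv A s r t = cross_curv A s t r"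
proof -
 have "((r - t) * (A s - A t) - (s - t) * (A r - A t)) = - ((r - s) * (A t - A s) - (t - s) * (A r - A s))"
  by (simp add: algebra_simps)
 then have "((r - t) * (A s - A t) - (s - t) * (A r - A t))\<^sup>2 = ((r - s) * (A t - A s) - (t - s) * (A r - A s))\<^sup>2"
  by (metis power2_minus)
 then show "cross_curv A t s r = cross_curv A s t r"
  by (simp add: cross_curv_def power2_commute[of s t] power2_commute[of r t] power2_commute[of s r] mult_ac)
 have "((t - s) * (A r - A s) - (r - s) * (A t - A s))\<^sup>2 = ((r - s) * (A t - A s) - (t - s) * (A r - A s))\<^sup>2"
  by (rule power2_commute)
 then show "cross_curv A s r t = cross_curv A s t r"
  by (simp add: cross_curv_def power2_commute[of r t] mult_ac)
qed

lemma cross_curv_nonneg [simp]: "cross_curv A s t r \<ge> 0" by (simp add: cross_curv_def)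

lemma measurable_cross_curv [measurable (raw)]:
 assumes [measurable]: "A \<in> borel_measurable borel" "g1 \<in> borel_measurable M" "g2 \<in> borel_measurable M" "g3 \<in> borel_measurable M"
 shows "(\<lambda>p. cross_curv A (g1 p) (g2 p) (g3 p)) \<in> borel_measurable M"
 unfolding cross_curv_def by measurable

lemma cross_curv_chords:
 assumes "u > 0" "v > 0"
 shows "cross_curv A y (y - u) (y + v) = ((A y - A (y - u)) / u - (A (y + v) - A y) / v)\<^sup>2 / (u + v)\<^sup>2"
proof -
 define D1 where "D1 = (A y - A (y - u)) / u"
 define D2 where "D2 = (A (y + v) - A y) / v"
 have e: "A y - A (y - u) = u * D1" "A (y + v) - A y = v * D2" using assms by (auto simp: D1_def D2_def)
 have "A (y - u) - A y = - (u * D1)" using e(1) by linarith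
 then have "(y + v - y) * (A (y - u) - A y) - (y - u - y) * (A (y + v) - A y) = - (u * v * (D1 - D2))"
  unfolding \<open>A (y - u) - A y = - (u * D1)\<close> e(2) by (simp add: algebra_simps)
 then have "cross_curv A y (y - u) (y + v) = (u * v * (D1 - D2))\<^sup>2 / (u\<^sup>2 * v\<^sup>2 * (u + v)\<^sup>2)"
  unfolding cross_curv_def using power2_minus[of "u + v"] by simp
 also have "... = (D1 - D2)\<^sup>2 / (u + v)\<^sup>2" using assms by (simp add: power_mult_distrib)
 finally show ?thesis by (simp add: D1_def D2_def)
qed

text \<open>By the variance identity the inner integral is, with \<open>r = u + v\<close>, the convexity
  defect of the chord energy \<open>n r = \<integral> ((A y - A (y - r)) / r)\<^sup>2 dy\<close>. Polar
  coordinates and the Frullani estimate bound it by the entropy, whose weighted integral is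
  finite.\<close>
lemma nn_integral_chord_differences:
 fixes A :: "real => real"
 assumes L: "L-lipschitz_on UNIV A" and ab: "a < b"
  and lo: "\<And>x. x \<le> a ==> A x = A a" and hi: "\<And>x. x \<ge> b ==> A x = A b"
 shows "(NN u. NN v. indicator {0<..} u * indicator {0<..} v *
   (NN y. ennreal (((A y - A (y - u)) / u - (A (y + v) - A y) / v)\<^sup>2 / (u + v)\<^sup>2)))
  \<le> ennreal (8 * L\<^sup>2 * (b - a))"
proof -
 have L0: "L \<ge> 0" by (rule lipschitz_on_nonneg[OF L])
 have lip: "\<bar>A x - A y\<bar> \<le> L * \<bar>x - y\<bar>" for x y using lipschitz_onD[OF L, of x y] by (simp add: dist_real_def)
 have contA: "continuous_on UNIV A" by (rule lipschitz_on_continuous_on[OF L])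
 then have [measurable]: "A \<in> borel_measurable borel" by (rule borel_measurable_continuous_onI)
 define d where "d u y = A (y + u) - A y" for u y
 have [measurable]: "(\<lambda>(u,y). d u y) \<in> borel_measurable (borel \<Otimes>\<^sub>M borel)" unfolding d_def by measurable
 have d0: "d u y = 0" if "u > 0" "y \<notin> {a-u..b}" for u y
 proof (cases "y > b")
  case True then show ?thesis using that hi[of y] hi[of "y+u"] by (simp add: d_def)
 next
  case False then have "y < a - u" using that by auto
  then show ?thesis using that lo[of y] lo[of "y+u"] by (simp add: d_def)
 qed
 have dle: "\<bar>d u y\<bar> \<le> L * min u (b - a)" if "u > 0" for u y
 proof -
  have "\<bar>d u y\<bar> \<le> L * u" using lip[of "y+u" y] that by (simp add: d_def)
  moreover have "\<bar>d u y\<bar> \<le> L * (b - a)"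
  proof -
   define cl where "cl x = max a (min b x)" for x
   have "A x = A (cl x)" for x using lo[of x] hi[of x] ab by (auto simp: cl_def max_def min_def)
   then have "\<bar>d u y\<bar> = \<bar>A (cl (y+u)) - A (cl y)\<bar>" by (simp add: d_def)
   also have "... \<le> L * \<bar>cl (y+u) - cl y\<bar>" by (rule lip)
   also have "... \<le> L * (b - a)" using L0 ab by (intro mult_left_mono) (auto simp: cl_def)
   finally show ?thesis .
  qed
  ultimately show ?thesis by (simp add: min_def)
 qed
 have dsq: "(d u y)\<^sup>2 \<le> (L * min u (b - a))\<^sup>2 * indicator {a-u..b} y" if "u > 0" for u y
 proof (cases "y \<in> {a-u..b}")
  case True then show ?thesis using dle[OF that, of y] power_mono[OF dle[OF that, of y], of 2] by simp
 qed (use d0[OF that] in simp)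
 have dint: "integrable lborel (\<lambda>y. (d u y)\<^sup>2)" if "u > 0" for u
 proof (rule Bochner_Integration.integrable_bound)
  show "integrable lborel (\<lambda>y. (L * min u (b - a))\<^sup>2 * indicator {a-u..b} y)"
   by (intro integrable_mult_right) (simp add: integrable_indicator_iff emeasure_lborel_Icc_eq)
 qed (use dsq[OF that] in auto)
 define N where "N u = (LINT y|lborel. (d u y)\<^sup>2)" for u
 have [measurable]: "N \<in> borel_measurable borel" unfolding N_def by measurable
 have N0: "N u \<ge> 0" for u by (simp add: N_def)
 define n where "n u = N u / u\<^sup>2" for u
 have [measurable]: "n \<in> borel_measurable borel" unfolding n_def by measurable
 have n0: "n u \<ge> 0" for u by (simp add: n_def N0)
 have nle: "n u \<le> 2 * L\<^sup>2 * (b - a)" if u: "u > 0" for u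
 proof -
  have "N u \<le> (LINT y|lborel. (L * min u (b - a))\<^sup>2 * indicator {a-u..b} y)"
   unfolding N_def
   by (rule integral_mono[OF dint[OF u]])
    (use dsq[OF u] in \<open>auto intro!: integrable_mult_right simp: integrable_indicator_iff emeasure_lborel_Icc_eq\<close>)
  also have "... = L\<^sup>2 * ((min u (b - a))\<^sup>2 * ((b - a) + u))"
   using u ab by (simp add: power_mult_distrib algebra_simps)
  also have "(min u (b - a))\<^sup>2 * ((b - a) + u) \<le> 2 * (b - a) * u\<^sup>2"
  proof (cases "u \<le> b - a")
   case True
   then have "u\<^sup>2 * ((b - a) + u) \<le> u\<^sup>2 * ((b - a) + (b - a))" by (intro mult_left_mono) auto
   then show ?thesis using True by (simp add: algebra_simps)
  next
   case False
   then have "(b - a)\<^sup>2 * ((b - a) + u) \<le> (b - a)\<^sup>2 * (2 * u)" by (intro mult_left_mono) auto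
   also have "... = 2 * (b - a) * ((b - a) * u)" by (simp add: power2_eq_square)
   also have "... \<le> 2 * (b - a) * (u * u)" using False ab by (intro mult_left_mono mult_right_mono) auto
   finally show ?thesis using False by (simp add: power2_eq_square)
  qed
  finally have "N u \<le> L\<^sup>2 * (2 * (b - a) * u\<^sup>2)" by (simp add: mult_left_mono)
  also have "... = 2 * L\<^sup>2 * (b - a) * u\<^sup>2" by (simp only: mult_ac)
  finally have "N u \<le> 2 * L\<^sup>2 * (b - a) * u\<^sup>2" .
  then show ?thesis using u unfolding n_def by (subst pos_divide_le_eq) auto
 qed
 have key: "has_bochner_integral lborel (\<lambda>y. ((A y - A (y - u)) / u - (A (y + v) - A y) / v)\<^sup>2)
   (((u + v) / (u * v)) * (N u / u + N v / v - N (u + v) / (u + v)))" if uv: "u > 0" "v > 0" for u v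
 proof -
  have eq: "((A y - A (y - u)) / u - (A (y + v) - A y) / v)\<^sup>2 =
    ((u + v) / (u * v)) * ((d u (y - u))\<^sup>2 / u + (d v y)\<^sup>2 / v - (d (u + v) (y - u))\<^sup>2 / (u + v))" for y
   using chord_variance_identity[OF uv, of "d u (y - u)" "d v y"] by (simp add: d_def algebra_simps)
  have sh: "has_bochner_integral lborel (\<lambda>y. (d w (y - u))\<^sup>2) (N w)" if "w > 0" for w
   using lborel_has_bochner_integral_real_affine_iff[of 1 "\<lambda>y. (d w y)\<^sup>2" "N w" "-u"] dint[OF that]
   by (simp add: N_def has_bochner_integral_iff)
  have "has_bochner_integral lborel (\<lambda>y. (d v y)\<^sup>2) (N v)"
   using dint[OF uv(2)] by (simp add: N_def has_bochner_integral_iff)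
  then show ?thesis unfolding eq
   using uv by (intro has_bochner_integral_mult_right has_bochner_integral_add has_bochner_integral_diff
    has_bochner_integral_divide_zero sh) auto
 qed
 define g where "g u v = ennreal (((u + v) / (u * v)) * (N u / u + N v / v - N (u + v) / (u + v)) / (u + v)\<^sup>2)" for u v
 have [measurable]: "case_prod g \<in> borel_measurable (borel \<Otimes>\<^sub>M borel)" unfolding g_def by measurable
 have geq: "(NN y. ennreal (((A y - A (y - u)) / u - (A (y + v) - A y) / v)\<^sup>2 / (u + v)\<^sup>2)) = g u v"
  if uv: "u > 0" "v > 0" for u v
  unfolding g_def
  using has_bochner_integral_divide_zero[OF key[OF uv], of "(u+v)\<^sup>2"]
  by (subst nn_integral_eq_integral) (auto simp: has_bochner_integral_iff)
 have conv: "n r \<le> l * n (l * r) + (1 - l) * n ((1 - l) * r)" "ennreal r * g (l * r) ((1 - l) * r) =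
   ennreal (((l * n (l * r) + (1 - l) * n ((1 - l) * r) - n r) / r) / (l * (1 - l)))"
  if l: "0 < l" "l < 1" and r: "r > 0" for l r
 proof -
  let ?u = "l * r" and ?v = "(1 - l) * r"
  have uv: "?u > 0" "?v > 0" "?u + ?v = r" using l r by (auto simp: algebra_simps)
  have Nn: "N w = w\<^sup>2 * n w" if "w > 0" for w using that by (simp add: n_def)
  have "N ?u / ?u + N ?v / ?v - N r / r = ?u * n ?u + ?v * n ?v - r * n r"
   using uv r by (simp add: Nn power2_eq_square)
  also have "... = r * (l * n ?u + (1 - l) * n ?v - n r)" by (simp add: algebra_simps)
  finally have E: "N ?u / ?u + N ?v / ?v - N r / r = r * (l * n ?u + (1 - l) * n ?v - n r)" .
  have "0 \<le> ((?u + ?v) / (?u * ?v)) * (N ?u / ?u + N ?v / ?v - N (?u + ?v) / (?u + ?v))"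
   by (subst has_bochner_integral_integral_eq[OF key[OF uv(1,2)], symmetric]) (rule integral_nonneg_AE, simp)
  then have "0 \<le> (r / (?u * ?v)) * (r * (l * n ?u + (1 - l) * n ?v - n r))"
   unfolding uv(3) E .
  moreover have "r / (?u * ?v) > 0" using l r by (intro divide_pos_pos mult_pos_pos) auto
  ultimately have "0 \<le> r * (l * n ?u + (1 - l) * n ?v - n r)" by (simp add: zero_le_mult_iff)
  then have nn: "0 \<le> l * n ?u + (1 - l) * n ?v - n r" using r by (simp add: zero_le_mult_iff)
  then show "n r \<le> l * n (l * r) + (1 - l) * n ((1 - l) * r)" by simp
  have "ennreal r * g ?u ?v = ennreal (r * ((r / (?u * ?v)) * (r * (l * n ?u + (1 - l) * n ?v - n r)) / r\<^sup>2))"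
   unfolding g_def uv(3) E by (rule ennreal_mult[symmetric])
    (use r l nn in \<open>auto intro!: divide_nonneg_nonneg mult_nonneg_nonneg\<close>)
  also have "r * ((r / (?u * ?v)) * (r * (l * n ?u + (1 - l) * n ?v - n r)) / r\<^sup>2)
    = ((l * n ?u + (1 - l) * n ?v - n r) / r) / (l * (1 - l))"
   using l r by (simp add: divide_simps power2_eq_square)
  finally show "ennreal r * g ?u ?v = ennreal (((l * n ?u + (1 - l) * n ?v - n r) / r) / (l * (1 - l)))" .
 qed
 let ?c = "2 * L\<^sup>2 * (b - a)"
 have "(NN u. NN v. indicator {0<..} u * indicator {0<..} v *
   (NN y. ennreal (((A y - A (y - u)) / u - (A (y + v) - A y) / v)\<^sup>2 / (u + v)\<^sup>2)))
  = (NN u. NN v. indicator {0<..} u * indicator {0<..} v * g u v)"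
  by (intro nn_integral_cong) (auto simp: indicator_def geq)
 also have "... = (NN l. indicator {0<..<1} l * (NN r. indicator {0<..} r * (ennreal r * g (l * r) ((1 - l) * r))))"
  by (rule nn_integral_polar_simplex) measurable
 also have "... \<le> (NN l. indicator {0<..<1} l * ennreal (?c * (l * ln (1/l) + (1 - l) * ln (1/(1 - l))) / (l * (1 - l))))"
 proof (rule nn_integral_mono)
  fix l :: real
  show "indicator {0<..<1} l * (NN r. indicator {0<..} r * (ennreal r * g (l * r) ((1 - l) * r)))
   \<le> indicator {0<..<1} l * ennreal (?c * (l * ln (1/l) + (1 - l) * ln (1/(1 - l))) / (l * (1 - l)))"
  proof (cases "l \<in> {0<..<1}")
   case True
   then have l: "0 < l" "l < 1" by auto
   then have l1: "l * (1 - l) > 0" by simp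
   let ?e = "\<lambda>r. (l * n (l * r) + (1 - l) * n ((1 - l) * r) - n r) / r"
   have "(NN r. indicator {0<..} r * (ennreal r * g (l * r) ((1 - l) * r)))
    = (NN r. ennreal (1 / (l * (1 - l))) * (indicator {0<..} r * ennreal (?e r)))"
   proof (rule nn_integral_cong)
    fix r :: real
    show "indicator {0<..} r * (ennreal r * g (l * r) ((1 - l) * r)) = ennreal (1 / (l * (1 - l))) * (indicator {0<..} r * ennreal (?e r))"
    proof (cases "r > 0")
     case True
     have "ennreal (?e r / (l * (1 - l))) = ennreal (1 / (l * (1 - l))) * ennreal (?e r)"
      using l1 True conv(1)[OF l True] by (subst ennreal_mult[symmetric]) auto
     then show ?thesis using True conv(2)[OF l True] by simp
    qed simp
   qed
   also have "... = ennreal (1 / (l * (1 - l))) * (NN r. indicator {0<..} r * ennreal (?e r))"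
    by (rule nn_integral_cmult) measurable
   also have "... \<le> ennreal (1 / (l * (1 - l))) * ennreal (?c * (l * ln (1/l) + (1 - l) * ln (1/(1 - l))))"
    by (intro mult_left_mono entropy_frullani n0 nle conv(1) l) auto
   also have "... = ennreal (?c * (l * ln (1/l) + (1 - l) * ln (1/(1 - l))) / (l * (1 - l)))"
    using l1 by (subst ennreal_mult'[symmetric]) auto
   finally show ?thesis using True by simp
  qed simp
 qed
 also have "... \<le> ennreal (4 * ?c)" by (rule nn_integral_entropy) (use ab in auto)
 finally show ?thesis by (simp add: mult.assoc)
qed

text \<open>The function is frozen outside \<open>[a, b]\<close>, which does not change the integrand; the
  six orderings of \<open>s, t, r\<close> contribute equally.\<close>
lemma nn_integral_cross_curv:
 fixes A :: "real => real"
 assumes L: "L-lipschitz_on UNIV A" and ab: "a < b"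
 shows "(NN s. NN t. NN r. indicator {a..b} s * indicator {a..b} t * indicator {a..b} r * ennreal (cross_curv A s t r))
  \<le> ennreal (48 * L\<^sup>2 * (b - a))"
proof -
 have L0: "L \<ge> 0" by (rule lipschitz_on_nonneg[OF L])
 have contA: "continuous_on UNIV A" by (rule lipschitz_on_continuous_on[OF L])
 then have [measurable]: "A \<in> borel_measurable borel" by (rule borel_measurable_continuous_onI)
 define J where "J = {a..b}"
 have [measurable]: "J \<in> sets borel" by (simp add: J_def)
 define P where "P x y w = (if x < y \<and> y < w then indicator J x * indicator J y * indicator J w * ennreal (cross_curv A x y w) else 0)" for x y w
 have m: "(\<lambda>(x, y, w). P x w y) \<in> borel_measurable (borel3)"
  "(\<lambda>(x, y, w). P y x w) \<in> borel_measurable (borel3)"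
  "(\<lambda>(x, y, w). P y w x) \<in> borel_measurable (borel3)"
  "(\<lambda>(x, y, w). P w x y) \<in> borel_measurable (borel3)"
  "(\<lambda>(x, y, w). P w y x) \<in> borel_measurable (borel3)"
  unfolding P_def by measurable
 let ?I = "\<lambda>f :: real => real => real => ennreal. NN s. NN t. NN r. f s t r"
 have p1: "?I (\<lambda>s t r. P s r t) = ?I P" by (rule nn_integral_lborel_swap3(2)[OF m(1)])
 have p2: "?I (\<lambda>s t r. P t s r) = ?I P" by (rule nn_integral_lborel_swap3(1)[OF m(2)])
 have p3: "?I (\<lambda>s t r. P t r s) = ?I P" by (rule trans[OF nn_integral_lborel_swap3(1)[OF m(3)] p1])
 have p4: "?I (\<lambda>s t r. P r s t) = ?I P" by (rule trans[OF nn_integral_lborel_swap3(2)[OF m(4)] p2])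
 have p5: "?I (\<lambda>s t r. P r t s) = ?I P" by (rule trans[OF nn_integral_lborel_swap3(2)[OF m(5)] p3])
 have deg: "cross_curv A s t r = 0" if "s = t \<or> t = r \<or> s = r" for s t r
  using that by (auto simp: cross_curv_def)
 have split: "indicator J s * indicator J t * indicator J r * ennreal (cross_curv A s t r) =
   P s t r + (P s r t + (P t s r + (P t r s + (P r s t + P r t s))))" for s t r
 proof -
  consider "s = t \<or> t = r \<or> s = r" | "s < t" "t < r" | "s < r" "r < t" | "t < s" "s < r" | "t < r" "r < s"
   | "r < s" "s < t" | "r < t" "t < s" by linarith
  then show ?thesis
  proof cases
   case 1 then show ?thesis by (auto simp: P_def deg)
  qed (use cross_curv_perm in \<open>simp_all add: P_def mult_ac\<close>)
 qed
 have "?I (\<lambda>s t r. indicator J s * indicator J t * indicator J r * ennreal (cross_curv A s t r)) =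
  ?I P + (?I (\<lambda>s t r. P s r t) + (?I (\<lambda>s t r. P t s r) + (?I (\<lambda>s t r. P t r s) + (?I (\<lambda>s t r. P r s t) + ?I (\<lambda>s t r. P r t s)))))"
  unfolding split by (subst nn_integral_add, (unfold P_def; measurable), (unfold P_def; measurable))+ simp
 also have "?I (\<lambda>s t r. P s r t) = ?I P" by (rule p1)
 also have "?I (\<lambda>s t r. P t s r) = ?I P" by (rule p2)
 also have "?I (\<lambda>s t r. P t r s) = ?I P" by (rule p3)
 also have "?I (\<lambda>s t r. P r s t) = ?I P" by (rule p4)
 also have "?I (\<lambda>s t r. P r t s) = ?I P" by (rule p5)
 finally have sum6: "?I (\<lambda>s t r. indicator J s * indicator J t * indicator J r * ennreal (cross_curv A s t r)) =
  ?I P + (?I P + (?I P + (?I P + (?I P + ?I P))))" .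
 have six: "?I (\<lambda>s t r. indicator J s * indicator J t * indicator J r * ennreal (cross_curv A s t r)) = 6 * ?I P"
 proof -
  have "6 * x = x + (x + (x + (x + (x + x))))" for x :: ennreal
  proof -
   have "(6::ennreal) = 1 + 1 + 1 + 1 + 1 + 1" by simp
   then show ?thesis by (simp only: distrib_right mult_1 add.assoc)
  qed
  then show ?thesis unfolding sum6 by metis
 qed
 define cl where "cl x = max a (min b x)" for x
 define At where "At x = A (cl x)" for x
 have At: "L-lipschitz_on UNIV At"
 proof (rule lipschitz_onI)
  fix x y
  have "dist (At x) (At y) \<le> L * dist (cl x) (cl y)" unfolding At_def by (rule lipschitz_onD[OF L]) auto
  also have "... \<le> L * dist x y" using L0 by (intro mult_left_mono) (auto simp: cl_def dist_real_def)
  finally show "dist (At x) (At y) \<le> L * dist x y" .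
 qed (rule L0)
 have AtJ: "At x = A x" if "x \<in> J" for x using that by (auto simp: At_def cl_def J_def)
 have contAt: "continuous_on UNIV At" by (rule lipschitz_on_continuous_on[OF At])
 then have [measurable]: "At \<in> borel_measurable borel" by (rule borel_measurable_continuous_onI)
 have "?I P = (NN y. NN x. NN w. P x y w)"
  by (rule nn_integral_lborel_swap3(1)) (unfold P_def, measurable)
 also have "... = (NN y. NN u. NN v. P (y - u) y (y + v))"
 proof (rule nn_integral_cong)
  fix y :: real
  have [measurable]: "(\<lambda>p. P (fst p) y (snd p)) \<in> borel_measurable (borel \<Otimes>\<^sub>M borel)" "P x y \<in> borel_measurable borel" for x
   unfolding P_def by measurable
  have "(NN x. NN w. P x y w) = (NN u. NN w. P (y - u) y w)"
   by (subst nn_integral_real_affine[where c="-1" and t=y]) auto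
  also have "... = (NN u. NN v. P (y - u) y (y + v))"
  proof (rule nn_integral_cong)
   fix u :: real
   show "(NN w. P (y - u) y w) = (NN v. P (y - u) y (y + v))"
    by (subst nn_integral_real_affine[where c="1" and t=y]) auto
  qed
  finally show "(NN x. NN w. P x y w) = (NN u. NN v. P (y - u) y (y + v))" .
 qed
 also have "... \<le> (NN y. NN u. NN v. indicator {0<..} u * indicator {0<..} v *
   ennreal (((At y - At (y - u)) / u - (At (y + v) - At y) / v)\<^sup>2 / (u + v)\<^sup>2))"
 proof (intro nn_integral_mono)
  fix y u v :: real
  show "P (y - u) y (y + v) \<le> indicator {0<..} u * indicator {0<..} v *
   ennreal (((At y - At (y - u)) / u - (At (y + v) - At y) / v)\<^sup>2 / (u + v)\<^sup>2)"
  proof (cases "u > 0 \<and> v > 0 \<and> y - u \<in> J \<and> y \<in> J \<and> y + v \<in> J")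
   case True
   then have "cross_curv A (y - u) y (y + v) = ((At y - At (y - u)) / u - (At (y + v) - At y) / v)\<^sup>2 / (u + v)\<^sup>2"
    by (subst cross_curv_perm(1)) (simp add: cross_curv_chords AtJ)
   then show ?thesis using True by (simp add: P_def)
  qed (auto simp: P_def)
 qed
 also have "... = (NN u. NN y. NN v. indicator {0<..} u * indicator {0<..} v *
   ennreal (((At y - At (y - u)) / u - (At (y + v) - At y) / v)\<^sup>2 / (u + v)\<^sup>2))"
  by (rule nn_integral_lborel_swap3(1)) measurable
 also have "... = (NN u. NN v. NN y. indicator {0<..} u * indicator {0<..} v *
   ennreal (((At y - At (y - u)) / u - (At (y + v) - At y) / v)\<^sup>2 / (u + v)\<^sup>2))"
  by (rule nn_integral_lborel_swap3(2)) measurable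
 also have "... = (NN u. NN v. indicator {0<..} u * indicator {0<..} v *
   (NN y. ennreal (((At y - At (y - u)) / u - (At (y + v) - At y) / v)\<^sup>2 / (u + v)\<^sup>2)))"
  by (intro nn_integral_cong nn_integral_cmult) measurable
 also have "... \<le> ennreal (8 * L\<^sup>2 * (b - a))"
  by (rule nn_integral_chord_differences[OF At ab]) (use ab in \<open>auto simp: At_def cl_def\<close>)
 finally have "?I P \<le> ennreal (8 * L\<^sup>2 * (b - a))" .
 then have "6 * ?I P \<le> 6 * ennreal (8 * L\<^sup>2 * (b - a))" by (intro mult_left_mono) auto
 also have "... = ennreal (48 * L\<^sup>2 * (b - a))"
  using ennreal_mult'[of 6 "8 * L\<^sup>2 * (b - a)"] by (simp add: mult.assoc)
 finally show ?thesis using six by (simp add: J_def)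
qed

section \<open>The Cauchy kernel on a Lipschitz graph\<close>

lemma borel_measurable_cnj [measurable]: "cnj \<in> borel_measurable borel"
 by (intro borel_measurable_continuous_onI continuous_intros)

text \<open>Expanding the square gives a triple integral of \<open>K s t * cnj (K s r)\<close>; averaging
  over which of the three points plays the role of \<open>s\<close> replaces the integrand by a
  nonnegative one.\<close>
lemma integral_symmetrize:
 fixes K :: "real => real => complex"
 assumes fin: "finite_measure m" and [measurable_cong]: "sets m = sets borel"
  and Km: "case_prod K \<in> borel_measurable (borel \<Otimes>\<^sub>M borel)"
  and bd: "\<And>s t. cmod (K s t) \<le> C"
  and pos: "\<And>s t r. 0 \<le> Re (K s t * cnj (K s r)) + Re (K t s * cnj (K t r)) + Re (K r s * cnj (K r t))"
 shows "ennreal (3 * (LINT s|m. (cmod (LINT t|m. K s t))\<^sup>2)) =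
  (\<integral>\<^sup>+s. \<integral>\<^sup>+t. \<integral>\<^sup>+r. ennreal (Re (K s t * cnj (K s r)) + Re (K t s * cnj (K t r)) + Re (K r s * cnj (K r t))) \<partial>m \<partial>m \<partial>m)"
proof -
 interpret finite_measure m by fact
 interpret P: pair_sigma_finite m m ..
 interpret PP: finite_measure "m \<Otimes>\<^sub>M m"
 proof (rule finite_measureI)
  show "emeasure (m \<Otimes>\<^sub>M m) (space (m \<Otimes>\<^sub>M m)) \<noteq> \<infinity>"
   unfolding space_pair_measure by (subst emeasure_pair_measure_Times) (auto simp: ennreal_mult_eq_top_iff emeasure_eq_measure)
 qed
 have Kp[measurable (raw)]: "(\<lambda>p. K (f p) (g p)) \<in> borel_measurable M" if "f \<in> borel_measurable M" "g \<in> borel_measurable M"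
  for f g and M :: "(real \<times> real) measure"
  using measurable_compose[OF measurable_Pair[OF that] Km] by simp
 have Kp1[measurable (raw)]: "(\<lambda>p. K (f p) (g p)) \<in> borel_measurable M" if "f \<in> borel_measurable M" "g \<in> borel_measurable M"
  for f g and M :: "real measure"
  using measurable_compose[OF measurable_Pair[OF that] Km] by simp
 have Kp3[measurable (raw)]: "(\<lambda>p. K (f p) (g p)) \<in> borel_measurable M" if "f \<in> borel_measurable M" "g \<in> borel_measurable M"
  for f g and M :: "((real \<times> real) \<times> real) measure"
  using measurable_compose[OF measurable_Pair[OF that] Km] by simp
 have C0: "C \<ge> 0" using bd[of 0 0] norm_ge_zero order_trans by blast
 define g where "g s t r = Re (K s t * cnj (K s r))" for s t r
 have gb: "\<bar>g s t r\<bar> \<le> C * C" for s t r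
 proof -
  have "\<bar>g s t r\<bar> \<le> cmod (K s t * cnj (K s r))" unfolding g_def by (rule abs_Re_le_cmod)
  also have "... \<le> C * C" unfolding norm_mult complex_mod_cnj using bd C0 by (intro mult_mono) auto
  finally show ?thesis .
 qed
 let ?I = "\<lambda>f :: real => real => real => real. (LINT s|m. LINT t|m. LINT r|m. f s t r)"
 define B where "B = measure m (space m)"
 have B0: "B \<ge> 0" by (simp add: B_def)
 have ib: "integrable m h" if "h \<in> borel_measurable m" "\<And>x. \<bar>h x\<bar> \<le> D" for h :: "real => real" and D
  using that by (intro integrable_const_bound[of _ D]) auto
 have ibp: "integrable (m \<Otimes>\<^sub>M m) h" if "h \<in> borel_measurable (m \<Otimes>\<^sub>M m)" "\<And>x. \<bar>h x\<bar> \<le> D" for h :: "real \<times> real => real" and D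
  using that by (intro PP.integrable_const_bound[of _ D]) auto
 have lb: "\<bar>LINT x|m. h x\<bar> \<le> B * D" if "h \<in> borel_measurable m" "\<And>x. \<bar>h x\<bar> \<le> D" for h :: "real => real" and D
 proof -
  have "\<bar>LINT x|m. h x\<bar> \<le> (LINT x|m. \<bar>h x\<bar>)" by (rule integral_abs_bound)
  also have "... \<le> (LINT x|m. D)" using that by (intro integral_mono ib[of _ D]) (auto intro: order_trans[OF abs_ge_zero])
  finally show ?thesis by (simp add: B_def)
 qed
 have swap: "(LINT s|m. LINT t|m. h s t) = (LINT t|m. LINT s|m. h s t)"
  if "case_prod h \<in> borel_measurable (m \<Otimes>\<^sub>M m)" "\<And>x y. \<bar>h x y\<bar> \<le> D" for h :: "real => real => real" and D
  by (rule P.Fubini_integral[symmetric]) (use that in \<open>auto intro!: ibp[of _ D]\<close>)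
 have I1: "(LINT s|m. (cmod (LINT t|m. K s t))\<^sup>2) = ?I g"
 proof (rule Bochner_Integration.integral_cong[OF refl])
  fix s
  have iK: "integrable m (K s)" using bd by (intro integrable_const_bound[of _ C]) auto
  define k where "k = (LINT t|m. K s t)"
  have "(LINT t|m. LINT r|m. g s t r) = (LINT t|m. Re (K s t * cnj k))"
  proof (rule Bochner_Integration.integral_cong[OF refl])
   fix t
   have "(LINT r|m. g s t r) = Re (LINT r|m. K s t * cnj (K s r))"
    unfolding g_def using iK by (intro integral_Re integrable_mult_right integrable_cnj)
   also have "(LINT r|m. K s t * cnj (K s r)) = K s t * cnj k"
    unfolding k_def using iK by (simp add: integral_cnj[symmetric])
   finally show "(LINT r|m. g s t r) = Re (K s t * cnj k)" .
  qed
  also have "... = Re (LINT t|m. K s t * cnj k)" using iK by (intro integral_Re integrable_mult_left) auto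
  also have "(LINT t|m. K s t * cnj k) = k * cnj k" unfolding k_def by (rule integral_mult_left_zero)
  also have "Re (k * cnj k) = (cmod k)\<^sup>2" by (simp add: complex_norm_square[symmetric] flip: of_real_power)
  finally show "(cmod (LINT t|m. K s t))\<^sup>2 = (LINT t|m. LINT r|m. g s t r)" by (simp add: k_def)
 qed
 have I2: "?I (\<lambda>s t r. g t s r) = ?I g"
 proof -
  have "(LINT s|m. LINT t|m. (LINT r|m. g t s r)) = (LINT t|m. LINT s|m. (LINT r|m. g t s r))"
   by (rule swap[where D="B * (C * C)"]) (use gb in \<open>auto intro!: lb simp: g_def\<close>)
  then show ?thesis .
 qed
 have I3: "?I (\<lambda>s t r. g r s t) = ?I g"
 proof -
  have "?I (\<lambda>s t r. g r s t) = (LINT s|m. LINT r|m. LINT t|m. g r s t)"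
   by (intro Bochner_Integration.integral_cong refl swap[where D="C * C"] gb) (simp add: g_def)
  also have "... = ?I g" by (rule I2)
  finally show ?thesis .
 qed
 define G where "G s t r = g s t r + g t s r + g r s t" for s t r
 have m1: "(\<lambda>r. g s t r) \<in> borel_measurable m" "(\<lambda>r. g t s r) \<in> borel_measurable m" "(\<lambda>r. g r s t) \<in> borel_measurable m" for s t
  unfolding g_def by measurable
 have m2: "(\<lambda>t. LINT r|m. g s t r) \<in> borel_measurable m" "(\<lambda>t. LINT r|m. g t s r) \<in> borel_measurable m" "(\<lambda>t. LINT r|m. g r s t) \<in> borel_measurable m" for s
  unfolding g_def by measurable
 have m3: "(\<lambda>s. LINT t|m. LINT r|m. g s t r) \<in> borel_measurable m" "(\<lambda>s. LINT t|m. LINT r|m. g t s r) \<in> borel_measurable m" "(\<lambda>s. LINT t|m. LINT r|m. g r s t) \<in> borel_measurable m"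
  unfolding g_def by measurable
 note i1 = ib[OF m1(1) gb] ib[OF m1(2) gb] ib[OF m1(3) gb]
 note i2 = ib[OF m2(1) lb[OF m1(1) gb]] ib[OF m2(2) lb[OF m1(2) gb]] ib[OF m2(3) lb[OF m1(3) gb]]
 note i3 = ib[OF m3(1) lb[OF m2(1) lb[OF m1(1) gb]]] ib[OF m3(2) lb[OF m2(2) lb[OF m1(2) gb]]] ib[OF m3(3) lb[OF m2(3) lb[OF m1(3) gb]]]
 have "3 * (LINT s|m. (cmod (LINT t|m. K s t))\<^sup>2) = ?I g + ?I (\<lambda>s t r. g t s r) + ?I (\<lambda>s t r. g r s t)"
  unfolding I1 I2 I3 by simp
 also have "... = ?I G"
  unfolding G_def using i1 i2 i3 by (simp add: Bochner_Integration.integral_add)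
 finally have three: "3 * (LINT s|m. (cmod (LINT t|m. K s t))\<^sup>2) = ?I G" .
 have G0: "0 \<le> G s t r" for s t r using pos[of s t r] by (simp add: G_def g_def)
 have iG1: "integrable m (\<lambda>r. G s t r)" for s t unfolding G_def using i1 by (intro Bochner_Integration.integrable_add)
 have iG2: "integrable m (\<lambda>t. LINT r|m. G s t r)" for s
  unfolding G_def using i1 i2 by (simp add: Bochner_Integration.integral_add)
 have iG3: "integrable m (\<lambda>s. LINT t|m. LINT r|m. G s t r)"
  unfolding G_def using i1 i2 i3 by (simp add: Bochner_Integration.integral_add)
 have "(\<integral>\<^sup>+s. \<integral>\<^sup>+t. \<integral>\<^sup>+r. ennreal (G s t r) \<partial>m \<partial>m \<partial>m) = (\<integral>\<^sup>+s. \<integral>\<^sup>+t. ennreal (LINT r|m. G s t r) \<partial>m \<partial>m)"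
  using G0 by (intro nn_integral_cong nn_integral_eq_integral iG1) auto
 also have "... = (\<integral>\<^sup>+s. ennreal (LINT t|m. LINT r|m. G s t r) \<partial>m)"
  using G0 by (intro nn_integral_cong nn_integral_eq_integral iG2) (auto intro!: integral_nonneg_AE)
 also have "... = ennreal (?I G)"
  using G0 by (intro nn_integral_eq_integral iG3) (auto intro!: integral_nonneg_AE AE_I2)
 finally show ?thesis unfolding three G_def g_def by simp
qed

lemma nn_integral_poisson_le:
 assumes "e > 0" "a \<le> b"
 shows "(NN y. ennreal (e / ((y - x)\<^sup>2 + e\<^sup>2)) * indicator {a..b} y) \<le> ennreal pi"
proof -
 have "(NN y. ennreal (e / ((y - x)\<^sup>2 + e\<^sup>2)) * indicator {a..b} y) = ennreal (arctan ((b - x) / e) - arctan ((a - x) / e))"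
 proof (rule nn_integral_FTC_Icc)
  fix y :: real
  have "((\<lambda>y. arctan ((y - x) / e)) has_real_derivative inverse (1 + ((y - x) / e)\<^sup>2) * (1 / e)) (at y)"
   using assms by (auto intro!: derivative_eq_intros)
  moreover have "inverse (1 + ((y - x) / e)\<^sup>2) * (1 / e) = e / ((y - x)\<^sup>2 + e\<^sup>2)"
  proof -
   have "1 + ((y - x) / e)\<^sup>2 = ((y - x)\<^sup>2 + e\<^sup>2) / e\<^sup>2" using assms by (simp add: power_divide add_divide_distrib)
   then show ?thesis using assms by (simp add: power2_eq_square)
  qed
  ultimately show "((\<lambda>y. arctan ((y - x) / e)) has_real_derivative e / ((y - x)\<^sup>2 + e\<^sup>2)) (at y)"
   by metis
  show "0 \<le> e / ((y - x)\<^sup>2 + e\<^sup>2)" using assms by simp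
 qed (use assms in auto)
 also have "... \<le> ennreal pi"
  using arctan_bounded[of "(b - x) / e"] arctan_bounded[of "(a - x) / e"] by (intro ennreal_leI) linarith
 finally show ?thesis .
qed

text \<open>For \<open>e = 0\<close> this is Melnikov's identity, with the squared area of the triangle on
  the right; the regularization adds a term that is controlled by Poisson kernels.\<close>
lemma complex_triple_identity:
 fixes x1 y1 x2 y2 e :: real
 defines "da \<equiv> x1\<^sup>2 + y1\<^sup>2 + e" and "db \<equiv> x2\<^sup>2 + y2\<^sup>2 + e" and "dc \<equiv> (x2 - x1)\<^sup>2 + (y2 - y1)\<^sup>2 + e"
 shows "(x1 * x2 + y1 * y2) * dc - (x1 * (x2 - x1) + y1 * (y2 - y1)) * db + (x2 * (x2 - x1) + y2 * (y2 - y1)) * da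
  = 2 * (x2 * y1 - x1 * y2)\<^sup>2 + e * ((x1\<^sup>2 + y1\<^sup>2) + (x2\<^sup>2 + y2\<^sup>2) + ((x2 - x1)\<^sup>2 + (y2 - y1)\<^sup>2)) / 2"
 unfolding assms by (simp add: power2_eq_square field_simps)

locale lipschitz_graph =
 fixes A :: "real => real" and L :: real
 assumes lip: "L-lipschitz_on UNIV A"
begin

definition z :: "real => complex" where "z s = Complex s (A s)"

text \<open>The kernel \<open>1 / (z t - z s)\<close>, smoothed at distance \<open>e\<close> so that it
  stays antisymmetric and the three point identity survives.\<close>
definition ker :: "real => real => real => complex" where
 "ker e s t = cnj (z t - z s) / of_real ((cmod (z t - z s))\<^sup>2 + e\<^sup>2)"

definition T :: "real => (real => complex) => real => complex" where
 "T e g s = (LINT t|lborel. ker e s t * g t)"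

lemma L_nonneg: "L \<ge> 0" by (rule lipschitz_on_nonneg[OF lip])

lemma A_lip: "\<bar>A t - A s\<bar> \<le> L * \<bar>t - s\<bar>"
 using lipschitz_onD[OF lip, of t s] by (simp add: dist_real_def)

lemma A_continuous: "continuous_on S A"
 using lipschitz_on_continuous_on[OF lip] continuous_on_subset by blast

lemma A_measurable [measurable]: "A \<in> borel_measurable borel"
 by (rule borel_measurable_continuous_onI[OF A_continuous])

lemma z_continuous: "continuous_on S z"
 unfolding z_def Complex_eq by (intro continuous_intros A_continuous)

lemma z_measurable [measurable]: "z \<in> borel_measurable borel"
 by (rule borel_measurable_continuous_onI[OF z_continuous])

lemma norm_z_ge: "\<bar>t - s\<bar> \<le> cmod (z t - z s)"
 using abs_Re_le_cmod[of "z t - z s"] by (simp add: z_def)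

lemma norm_z_le: "cmod (z t - z s) \<le> (1 + L) * \<bar>t - s\<bar>"
 using cmod_le[of "z t - z s"] A_lip[of t s] by (simp add: z_def algebra_simps)

lemma norm_z_sq: "(cmod (z t - z s))\<^sup>2 = (t - s)\<^sup>2 + (A t - A s)\<^sup>2"
 by (simp add: z_def cmod_power2)

lemma ker_antisym: "ker e t s = - ker e s t"
 unfolding ker_def by (simp add: norm_minus_commute[of "z s"] minus_divide_left)

lemma ker_measurable [measurable (raw)]:
 assumes [measurable]: "f \<in> borel_measurable M" "g \<in> borel_measurable M"
 shows "(\<lambda>p. ker e (f p) (g p)) \<in> borel_measurable M"
proof -
 have c: "cnj \<in> borel_measurable borel" by (intro borel_measurable_continuous_onI continuous_intros)
 have "(\<lambda>p. cnj (z (g p) - z (f p))) \<in> borel_measurable M"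
  by (rule measurable_compose[OF _ c]) measurable
 then show ?thesis unfolding ker_def by measurable
qed

lemma norm_ker: "cmod (ker e s t) = cmod (z t - z s) / ((cmod (z t - z s))\<^sup>2 + e\<^sup>2)"
 unfolding ker_def norm_divide complex_mod_cnj norm_of_real by simp

lemma norm_ker_le: assumes "e > 0" shows "cmod (ker e s t) \<le> 1 / e"
proof -
 define x where "x = cmod (z t - z s)"
 have "x * e \<le> x\<^sup>2 + e\<^sup>2"
 proof -
  have "0 \<le> x * e" using assms by (simp add: x_def)
  moreover have "x\<^sup>2 + e\<^sup>2 = (x - e)\<^sup>2 + 2 * (x * e)" by (simp add: power2_eq_square algebra_simps)
  ultimately show ?thesis using zero_le_power2[of "x - e"] by linarith
 qed
 moreover have "x\<^sup>2 + e\<^sup>2 > 0" using assms by (simp add: add_nonneg_pos)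
 ultimately show ?thesis using assms unfolding norm_ker x_def[symmetric] by (simp add: divide_simps mult.commute)
qed

lemma norm_ker_le2: "cmod (ker e s t) \<le> 1 / cmod (z t - z s)"
proof (cases "z t = z s")
 case False
 then have x: "cmod (z t - z s) > 0" by simp
 have "cmod (z t - z s) / ((cmod (z t - z s))\<^sup>2 + e\<^sup>2) \<le> cmod (z t - z s) / ((cmod (z t - z s))\<^sup>2)"
  using x by (intro divide_left_mono) (auto intro!: mult_pos_pos add_pos_nonneg)
 then show ?thesis using x unfolding norm_ker by (simp add: power2_eq_square)
qed (simp add: norm_ker)

text \<open>The symmetrized product is nonnegative and at most a curvature term plus products of Poisson
  kernels, each of which integrates to at most \<open>pi\<close>.\<close>
lemma ker_sum:
 assumes "k > 0"
 defines "p \<equiv> \<lambda>x. k / (x\<^sup>2 + k\<^sup>2)"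
 shows "0 \<le> Re (ker k s t * cnj (ker k s r)) + Re (ker k t s * cnj (ker k t r)) + Re (ker k r s * cnj (ker k r t))" (is "0 \<le> ?G")
  and "Re (ker k s t * cnj (ker k s r)) + Re (ker k t s * cnj (ker k t r)) + Re (ker k r s * cnj (ker k r t))
   \<le> 2 * cross_curv A s t r + (p (r - s) * p (t - r) + p (t - s) * p (t - r) + p (t - s) * p (r - s)) / 2"
proof -
 define x1 where "x1 = t - s" define y1 where "y1 = A t - A s"
 define x2 where "x2 = r - s" define y2 where "y2 = A r - A s"
 define e where "e = k\<^sup>2"
 have e: "e > 0" using assms by (simp add: e_def)
 define da where "da = x1\<^sup>2 + y1\<^sup>2 + e"
 define db where "db = x2\<^sup>2 + y2\<^sup>2 + e"
 define dc where "dc = (x2 - x1)\<^sup>2 + (y2 - y1)\<^sup>2 + e"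
 have pos: "da > 0" "db > 0" "dc > 0" using e by (auto simp: da_def db_def dc_def add_nonneg_pos)
 have Re_div: "Re (cnj v / of_real c * cnj (cnj w / of_real d)) = (Re v * Re w + Im v * Im w) / (c * d)" for v w and c d :: real
  by (simp add: Re_divide Im_divide power2_eq_square divide_simps)
 have d: "(cmod (z t - z s))\<^sup>2 + k\<^sup>2 = da" "(cmod (z r - z s))\<^sup>2 + k\<^sup>2 = db" "(cmod (z r - z t))\<^sup>2 + k\<^sup>2 = dc"
  "(cmod (z s - z t))\<^sup>2 + k\<^sup>2 = da" "(cmod (z s - z r))\<^sup>2 + k\<^sup>2 = db" "(cmod (z t - z r))\<^sup>2 + k\<^sup>2 = dc"
  by (simp_all add: norm_z_sq da_def db_def dc_def x1_def x2_def y1_def y2_def e_def power2_commute[of s] power2_commute[of "A s"] power2_commute[of t r] power2_commute[of "A t" "A r"])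
 have c: "Re (z t - z s) = x1" "Im (z t - z s) = y1" "Re (z r - z s) = x2" "Im (z r - z s) = y2"
  "Re (z r - z t) = x2 - x1" "Im (z r - z t) = y2 - y1" "Re (z s - z t) = - x1" "Im (z s - z t) = - y1"
  "Re (z s - z r) = - x2" "Im (z s - z r) = - y2" "Re (z t - z r) = x1 - x2" "Im (z t - z r) = y1 - y2"
  by (simp_all add: z_def x1_def x2_def y1_def y2_def)
 have "?G = (x1 * x2 + y1 * y2) / (da * db) + (- x1 * (x2 - x1) + - y1 * (y2 - y1)) / (da * dc) + (- x2 * (x1 - x2) + - y2 * (y1 - y2)) / (db * dc)"
  unfolding ker_def Re_div d c ..
 also have "... = ((x1 * x2 + y1 * y2) * dc - (x1 * (x2 - x1) + y1 * (y2 - y1)) * db + (x2 * (x2 - x1) + y2 * (y2 - y1)) * da) / (da * db * dc)"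
  using pos by (simp add: add_divide_distrib diff_divide_distrib) (simp add: divide_simps, simp add: algebra_simps)
 also have "... = (2 * (x2 * y1 - x1 * y2)\<^sup>2 + e * ((x1\<^sup>2 + y1\<^sup>2) + (x2\<^sup>2 + y2\<^sup>2) + ((x2 - x1)\<^sup>2 + (y2 - y1)\<^sup>2)) / 2) / (da * db * dc)"
  unfolding da_def db_def dc_def complex_triple_identity ..
 finally have G: "?G = (2 * (x2 * y1 - x1 * y2)\<^sup>2 + e * ((x1\<^sup>2 + y1\<^sup>2) + (x2\<^sup>2 + y2\<^sup>2) + ((x2 - x1)\<^sup>2 + (y2 - y1)\<^sup>2)) / 2) / (da * db * dc)" .
 show "0 \<le> ?G" unfolding G using pos e by (intro divide_nonneg_nonneg add_nonneg_nonneg mult_nonneg_nonneg) auto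
 have X: "(x2 * y1 - x1 * y2)\<^sup>2 / (da * db * dc) \<le> cross_curv A s t r"
 proof (cases "x1 = 0 \<or> x2 = 0 \<or> x1 = x2")
  case True
  then have "x2 * y1 - x1 * y2 = 0" by (auto simp: x1_def x2_def y1_def y2_def)
  then show ?thesis by simp
 next
  case False
  have cc: "cross_curv A s t r = (x2 * y1 - x1 * y2)\<^sup>2 / (x1\<^sup>2 * x2\<^sup>2 * (x2 - x1)\<^sup>2)"
   by (simp add: cross_curv_def x1_def x2_def y1_def y2_def power2_commute[of t r])
  have "x1\<^sup>2 * x2\<^sup>2 * (x2 - x1)\<^sup>2 \<le> da * db * dc"
   using e by (intro mult_mono) (auto simp: da_def db_def dc_def)
  then show ?thesis unfolding cc using False pos
   by (intro divide_left_mono) (auto intro!: mult_pos_pos)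
 qed
 have p: "p x1 = k / (x1\<^sup>2 + e)" "p x2 = k / (x2\<^sup>2 + e)" "p (x1 - x2) = k / ((x2 - x1)\<^sup>2 + e)"
  by (simp_all add: p_def e_def power2_commute[of x1])
 have ple: "k / da \<le> p x1" "k / db \<le> p x2" "k / dc \<le> p (x1 - x2)" "0 \<le> k / da" "0 \<le> k / db" "0 \<le> k / dc"
  unfolding p using assms e pos by (auto intro!: divide_left_mono mult_pos_pos add_nonneg_pos simp: da_def db_def dc_def)
 have q: "e * u / (a * b * c) \<le> P * Q" if "0 \<le> u" "u \<le> a" "a > 0" "b > 0" "c > 0" "k / b \<le> P" "k / c \<le> Q" for u a b c P Q
 proof -
  have "e * u / (a * b * c) = (u / a) * ((k / b) * (k / c))" by (simp add: e_def power2_eq_square mult_ac)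
  also have "... \<le> 1 * ((k / b) * (k / c))" using that assms by (intro mult_right_mono) auto
  also have "... \<le> 1 * (P * Q)" using that assms
   by (intro mult_left_mono mult_mono) (auto intro: order_trans[of 0 "k / b" P])
  finally show ?thesis by simp
 qed
 have "?G = 2 * ((x2 * y1 - x1 * y2)\<^sup>2 / (da * db * dc)) + (e * (x1\<^sup>2 + y1\<^sup>2) / (da * db * dc) + e * (x2\<^sup>2 + y2\<^sup>2) / (db * da * dc)
   + e * ((x2 - x1)\<^sup>2 + (y2 - y1)\<^sup>2) / (dc * da * db)) / 2"
  unfolding G by (simp add: add_divide_distrib distrib_left mult_ac)
 also have "... \<le> 2 * cross_curv A s t r + (p x2 * p (x1 - x2) + p x1 * p (x1 - x2) + p x1 * p x2) / 2"
  using pos e ple by (intro add_mono mult_left_mono X divide_right_mono q) (auto simp: da_def db_def dc_def)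
 finally show "?G \<le> 2 * cross_curv A s t r + (p (r - s) * p (t - r) + p (t - s) * p (t - r) + p (t - s) * p (r - s)) / 2"
  by (simp add: x1_def x2_def)
qed

end

section \<open>Square estimate by symmetrization\<close>

lemma nn_integral_lborel_add3:
 fixes f g :: "real => real => real => ennreal"
 assumes m: "(\<lambda>(x, y, w). f x y w) \<in> borel_measurable (borel3)"
  "(\<lambda>(x, y, w). g x y w) \<in> borel_measurable (borel3)"
 shows "(NN x. NN y. NN w. f x y w + g x y w) =
  (NN x. NN y. NN w. f x y w) + (NN x. NN y. NN w. g x y w)"
  and "(\<lambda>(x, y, w). f x y w + g x y w) \<in> borel_measurable (borel3)"
proof -
 note u = measurable_uncurry3[OF m(1)] measurable_uncurry3[OF m(2)]
 have [measurable]: "(\<lambda>p. f (fst (fst p)) (snd (fst p)) (snd p)) \<in> borel_measurable ((borel \<Otimes>\<^sub>M borel) \<Otimes>\<^sub>M borel)"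
  "(\<lambda>p. g (fst (fst p)) (snd (fst p)) (snd p)) \<in> borel_measurable ((borel \<Otimes>\<^sub>M borel) \<Otimes>\<^sub>M borel)"
  by (rule u; measurable)+
 have [measurable]: "(\<lambda>p. f x (fst p) (snd p)) \<in> borel_measurable (borel \<Otimes>\<^sub>M borel)"
  "(\<lambda>p. g x (fst p) (snd p)) \<in> borel_measurable (borel \<Otimes>\<^sub>M borel)" for x
  by (rule u; measurable)+
 have [measurable]: "(\<lambda>w. f x y w) \<in> borel_measurable borel" "(\<lambda>w. g x y w) \<in> borel_measurable borel" for x y
  by (rule u; measurable)+
 have "(NN x. NN y. NN w. f x y w + g x y w) =
   (NN x. NN y. (NN w. f x y w) + (NN w. g x y w))"
  by (intro nn_integral_cong nn_integral_add) measurable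
 also have "... = (NN x. (NN y. NN w. f x y w) + (NN y. NN w. g x y w))"
  by (intro nn_integral_cong nn_integral_add) measurable
 also have "... = (NN x. NN y. NN w. f x y w) + (NN x. NN y. NN w. g x y w)"
  by (rule nn_integral_add) measurable
 finally show "(NN x. NN y. NN w. f x y w + g x y w) =
  (NN x. NN y. NN w. f x y w) + (NN x. NN y. NN w. g x y w)" .
 show "(\<lambda>(x, y, w). f x y w + g x y w) \<in> borel_measurable (borel3)"
  using borel_measurable_add[OF m] by (simp add: case_prod_unfold)
qed

context lipschitz_graph
begin

text \<open>Symmetrization is carried out for the measure with density \<open>F\<close>; the three weights
  are then estimated by \<open>M\<close>, which is possible because the symmetrized integrand is
  nonnegative. Curvature gives \<open>48 * 2 / 3\<close> times \<open>L\<^sup>2\<close>, the Poisson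
  products give \<open>pi\<^sup>2\<close>.\<close>
lemma norm_T_sq_weighted:
 fixes F :: "real => real"
 assumes eps: "e > 0" and ab: "a < b" and [measurable]: "F \<in> borel_measurable borel"
  and M: "\<And>x. 0 \<le> F x" "\<And>x. F x \<le> M" and supp: "\<And>x. x \<notin> {a..b} ==> F x = 0"
 shows "(LINT s|lborel. F s * (cmod (T e (\<lambda>t. of_real (F t)) s))\<^sup>2) \<le> M ^ 3 * ((32 * L\<^sup>2 + pi\<^sup>2) * (b - a))"
proof -
 define \<nu> where "\<nu> = density lborel (\<lambda>x. ennreal (F x))"
 have sn: "sets \<nu> = sets borel" by (simp add: \<nu>_def)
 have M0: "M \<ge> 0" using M[of 0] by linarith
 have PhiM: "ennreal (F x) \<le> ennreal M * indicator {a..b} x" for x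
  using M supp[of x] by (cases "x \<in> {a..b}") (auto intro: ennreal_leI)
 have nuM: "(\<integral>\<^sup>+x. f x \<partial>\<nu>) \<le> ennreal M * (NN x. indicator {a..b} x * f x)"
  if [measurable]: "f \<in> borel_measurable borel" for f
 proof -
  have "(\<integral>\<^sup>+x. f x \<partial>\<nu>) = (NN x. ennreal (F x) * f x)" unfolding \<nu>_def by (subst nn_integral_density) auto
  also have "... \<le> (NN x. ennreal M * (indicator {a..b} x * f x))"
   using PhiM by (intro nn_integral_mono) (auto simp: mult.assoc[symmetric] intro!: mult_right_mono)
  also have "... = ennreal M * (NN x. indicator {a..b} x * f x)" by (rule nn_integral_cmult) measurable
  finally show ?thesis .
 qed
 have fin: "finite_measure \<nu>"
 proof (rule finite_measureI)
  have "emeasure \<nu> (space \<nu>) = (\<integral>\<^sup>+x. 1 \<partial>\<nu>)" by simp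
  also have "... \<le> ennreal M * (NN x. indicator {a..b} x * 1)" by (rule nuM) simp
  also have "... < \<infinity>" by (simp add: emeasure_lborel_Icc_eq ennreal_mult_less_top)
  finally show "emeasure \<nu> (space \<nu>) \<noteq> \<infinity>" by simp
 qed
 let ?G = "\<lambda>s t r. Re (ker e s t * cnj (ker e s r)) + Re (ker e t s * cnj (ker e t r)) + Re (ker e r s * cnj (ker e r t))"
 define p where "p x = e / (x\<^sup>2 + e\<^sup>2)" for x
 have p0: "p x \<ge> 0" for x using eps by (simp add: p_def)
 have [measurable]: "p \<in> borel_measurable borel" unfolding p_def by measurable
 have psym: "p (x - y) = p (y - x)" for x y by (simp add: p_def power2_commute)
 define S where "S s t r = ennreal (2 * cross_curv A s t r) +
  (ennreal (p (r - s) * p (t - r) / 2) + (ennreal (p (t - s) * p (t - r) / 2) + ennreal (p (t - s) * p (r - s) / 2)))" for s t r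
 have GS: "ennreal (?G s t r) \<le> S s t r" for s t r
 proof -
  have "ennreal (?G s t r) \<le> ennreal (2 * cross_curv A s t r + (p (r - s) * p (t - r) / 2 + (p (t - s) * p (t - r) / 2 + p (t - s) * p (r - s) / 2)))"
   using ker_sum(2)[OF eps, of s t r] by (intro ennreal_leI) (simp add: p_def add_divide_distrib)
  also have "... = S s t r" unfolding S_def using p0 by simp
  finally show ?thesis .
 qed
 let ?J = "indicator {a..b} :: real => ennreal"
 have kb: "cmod (ker e s t) \<le> 1 / e" for s t by (rule norm_ker_le[OF eps])
 have eq: "(LINT t|\<nu>. ker e s t) = T e (\<lambda>t. of_real (F t)) s" for s
  unfolding \<nu>_def T_def using M by (subst integral_density) (auto simp: scaleR_conv_of_real mult.commute)
 have "ennreal (3 * (LINT s|\<nu>. (cmod (LINT t|\<nu>. ker e s t))\<^sup>2)) = (\<integral>\<^sup>+s. \<integral>\<^sup>+t. \<integral>\<^sup>+r. ennreal (?G s t r) \<partial>\<nu> \<partial>\<nu> \<partial>\<nu>)"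
 proof (rule integral_symmetrize[OF fin sn _ kb])
  show "0 \<le> ?G s t r" for s t r by (rule ker_sum(1)[OF eps])
 qed measurable
 also have "... \<le> (\<integral>\<^sup>+s. \<integral>\<^sup>+t. \<integral>\<^sup>+r. S s t r \<partial>\<nu> \<partial>\<nu> \<partial>\<nu>)"
  by (intro nn_integral_mono GS)
 also have "... \<le> (\<integral>\<^sup>+s. \<integral>\<^sup>+t. ennreal M * (NN r. ?J r * S s t r) \<partial>\<nu> \<partial>\<nu>)"
  by (intro nn_integral_mono nuM) (simp add: S_def)
 also have "... \<le> (\<integral>\<^sup>+s. ennreal M * (NN t. ?J t * (ennreal M * (NN r. ?J r * S s t r))) \<partial>\<nu>)"
  by (intro nn_integral_mono nuM) (simp add: S_def)
 also have "... \<le> ennreal M * (NN s. ?J s * (ennreal M * (NN t. ?J t * (ennreal M * (NN r. ?J r * S s t r)))))"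
  by (rule nuM) (simp add: S_def)
 also have "... = (NN s. NN t. NN r. ennreal (M ^ 3) * (?J s * ?J t * ?J r * S s t r))"
 proof -
  have M3: "ennreal (M ^ 3) = ennreal M * (ennreal M * ennreal M)"
   using M0 by (simp add: ennreal_mult[symmetric] power3_eq_cube mult.assoc)
  show ?thesis unfolding S_def M3 by (simp add: nn_integral_cmult[symmetric] mult_ac)
 qed
 also have "... = ennreal (M ^ 3) * (NN s. NN t. NN r. ?J s * ?J t * ?J r * S s t r)"
  unfolding S_def by (simp add: nn_integral_cmult)
 finally have main: "ennreal (3 * (LINT s|\<nu>. (cmod (LINT t|\<nu>. ker e s t))\<^sup>2))
  \<le> ennreal (M ^ 3) * (NN s. NN t. NN r. ?J s * ?J t * ?J r * S s t r)" .
 let ?l = "b - a"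
 have pint: "(NN y. ?J y * ennreal (p (y - x))) \<le> ennreal pi" "(NN y. ?J y * ennreal (p (x - y))) \<le> ennreal pi" for x
  using nn_integral_poisson_le[OF eps, of a b x] ab by (simp_all add: p_def mult.commute power2_commute[of x])
 have half: "ennreal (p x / 2) = ennreal (1/2) * ennreal (p x)" for x
  using p0 by (subst ennreal_mult[symmetric]) auto
 have pp: "(NN x. ?J x * (NN y. ?J y * ennreal (p (y - x)) * (NN w. ?J w * ennreal (p (w - u x y) / 2)))) \<le> ennreal (pi\<^sup>2 / 2 * ?l)"
  for u :: "real => real => real"
 proof -
  have h: "(NN w. ?J w * ennreal (p (w - v) / 2)) \<le> ennreal (pi / 2)" for v
  proof -
   have "(NN w. ?J w * ennreal (p (w - v) / 2)) = (NN w. ennreal (1/2) * (?J w * ennreal (p (w - v))))"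
    unfolding half by (simp only: mult_ac)
   also have "... = ennreal (1/2) * (NN w. ?J w * ennreal (p (w - v)))" by (rule nn_integral_cmult) measurable
   also have "... \<le> ennreal (1/2) * ennreal pi" by (intro mult_left_mono pint) simp
   also have "... = ennreal (pi / 2)" by (subst ennreal_mult[symmetric]) auto
   finally show ?thesis .
  qed
  have "(NN x. ?J x * (NN y. ?J y * ennreal (p (y - x)) * (NN w. ?J w * ennreal (p (w - u x y) / 2))))
   \<le> (NN x. ?J x * (NN y. ?J y * ennreal (p (y - x)) * ennreal (pi/2)))"
   by (intro nn_integral_mono mult_left_mono h) auto
  also have "... = (NN x. ?J x * ((NN y. ?J y * ennreal (p (y - x))) * ennreal (pi/2)))"
   by (subst nn_integral_multc) auto
  also have "... \<le> (NN x. ?J x * (ennreal pi * ennreal (pi/2)))"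
   by (intro nn_integral_mono mult_left_mono mult_right_mono pint) auto
  also have "... = ennreal ?l * (ennreal pi * ennreal (pi/2))"
   using ab by (subst nn_integral_multc) auto
  also have "... = ennreal (pi\<^sup>2 / 2 * ?l)"
   using ab by (simp add: ennreal_mult[symmetric] power2_eq_square mult_ac)
  finally show ?thesis .
 qed
 have e3: "ennreal (p x * p y / 2) = ennreal (p x) * ennreal (p y / 2)" for x y
  using p0 by (subst ennreal_mult[symmetric]) auto
 have t1: "(NN s. NN t. NN r. ?J s * ?J t * ?J r * ennreal (p (r - s) * p (t - r) / 2)) \<le> ennreal (pi\<^sup>2 / 2 * ?l)"
 proof -
  have "(NN s. NN t. NN r. ?J s * ?J t * ?J r * ennreal (p (r - s) * p (t - r) / 2))
   = (NN s. NN r. NN t. ?J s * ?J t * ?J r * ennreal (p (r - s) * p (t - r) / 2))"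
   by (rule nn_integral_lborel_swap3(2)) measurable
  also have "... = (NN s. ?J s * (NN r. ?J r * ennreal (p (r - s)) * (NN t. ?J t * ennreal (p (t - r) / 2))))"
   unfolding e3 by (simp add: nn_integral_cmult[symmetric] mult_ac)
  also have "... \<le> ennreal (pi\<^sup>2 / 2 * ?l)" by (rule pp)
  finally show ?thesis .
 qed
 have t2: "(NN s. NN t. NN r. ?J s * ?J t * ?J r * ennreal (p (t - s) * p (t - r) / 2)) \<le> ennreal (pi\<^sup>2 / 2 * ?l)"
 proof -
  have "(NN s. NN t. NN r. ?J s * ?J t * ?J r * ennreal (p (t - s) * p (t - r) / 2))
   = (NN s. ?J s * (NN t. ?J t * ennreal (p (t - s)) * (NN r. ?J r * ennreal (p (r - t) / 2))))"
   unfolding e3 psym[of t r for t r] by (simp add: nn_integral_cmult[symmetric] mult_ac psym)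
  also have "... \<le> ennreal (pi\<^sup>2 / 2 * ?l)" by (rule pp)
  finally show ?thesis .
 qed
 have t3: "(NN s. NN t. NN r. ?J s * ?J t * ?J r * ennreal (p (t - s) * p (r - s) / 2)) \<le> ennreal (pi\<^sup>2 / 2 * ?l)"
 proof -
  have "(NN s. NN t. NN r. ?J s * ?J t * ?J r * ennreal (p (t - s) * p (r - s) / 2))
   = (NN s. ?J s * (NN t. ?J t * ennreal (p (t - s)) * (NN r. ?J r * ennreal (p (r - s) / 2))))"
   unfolding e3 by (simp add: nn_integral_cmult[symmetric] mult_ac)
  also have "... \<le> ennreal (pi\<^sup>2 / 2 * ?l)" by (rule pp)
  finally show ?thesis .
 qed
 have t0: "(NN s. NN t. NN r. ?J s * ?J t * ?J r * ennreal (2 * cross_curv A s t r)) \<le> ennreal (96 * L\<^sup>2 * ?l)"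
 proof -
  have "(NN s. NN t. NN r. ?J s * ?J t * ?J r * ennreal (2 * cross_curv A s t r))
   = 2 * (NN s. NN t. NN r. ?J s * ?J t * ?J r * ennreal (cross_curv A s t r))"
   by (simp add: nn_integral_cmult[symmetric] ennreal_mult' mult_ac)
  also have "... \<le> 2 * ennreal (48 * L\<^sup>2 * ?l)" by (intro mult_left_mono nn_integral_cross_curv lip ab) auto
  also have "... = ennreal (96 * L\<^sup>2 * ?l)" using ennreal_mult'[of 2 "48 * L\<^sup>2 * ?l"] by (simp add: mult.assoc)
  finally show ?thesis .
 qed
 have "(NN s. NN t. NN r. ?J s * ?J t * ?J r * S s t r) =
  (NN s. NN t. NN r. ?J s * ?J t * ?J r * ennreal (2 * cross_curv A s t r)) +
  ((NN s. NN t. NN r. ?J s * ?J t * ?J r * ennreal (p (r - s) * p (t - r) / 2)) +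
  ((NN s. NN t. NN r. ?J s * ?J t * ?J r * ennreal (p (t - s) * p (t - r) / 2)) +
  (NN s. NN t. NN r. ?J s * ?J t * ?J r * ennreal (p (t - s) * p (r - s) / 2))))"
 proof -
  have m: "(\<lambda>(s, t, r). ?J s * ?J t * ?J r * ennreal (2 * cross_curv A s t r)) \<in> borel_measurable (borel3)"
   "(\<lambda>(s, t, r). ?J s * ?J t * ?J r * ennreal (p (r - s) * p (t - r) / 2)) \<in> borel_measurable (borel3)"
   "(\<lambda>(s, t, r). ?J s * ?J t * ?J r * ennreal (p (t - s) * p (t - r) / 2)) \<in> borel_measurable (borel3)"
   "(\<lambda>(s, t, r). ?J s * ?J t * ?J r * ennreal (p (t - s) * p (r - s) / 2)) \<in> borel_measurable (borel3)"
   by measurable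
  note m34 = nn_integral_lborel_add3(2)[OF m(3,4)]
  note m234 = nn_integral_lborel_add3(2)[OF m(2) m34]
  show ?thesis unfolding S_def distrib_left
   by (simp only: nn_integral_lborel_add3(1)[OF m(1) m234] nn_integral_lborel_add3(1)[OF m(2) m34] nn_integral_lborel_add3(1)[OF m(3,4)])
 qed
 also have "... \<le> ennreal (96 * L\<^sup>2 * ?l) + (ennreal (pi\<^sup>2 / 2 * ?l) + (ennreal (pi\<^sup>2 / 2 * ?l) + ennreal (pi\<^sup>2 / 2 * ?l)))"
  by (intro add_mono t0 t1 t2 t3)
 also have "... = ennreal (96 * L\<^sup>2 * ?l + (pi\<^sup>2 / 2 * ?l + (pi\<^sup>2 / 2 * ?l + pi\<^sup>2 / 2 * ?l)))"
  using ab by (simp add: ennreal_plus[symmetric] del: ennreal_plus)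
 also have "... \<le> ennreal (3 * ((32 * L\<^sup>2 + pi\<^sup>2) * ?l))"
 proof (rule ennreal_leI)
  have "0 \<le> ?l * pi\<^sup>2" using ab by simp
  then show "96 * L\<^sup>2 * ?l + (pi\<^sup>2 / 2 * ?l + (pi\<^sup>2 / 2 * ?l + pi\<^sup>2 / 2 * ?l)) \<le> 3 * ((32 * L\<^sup>2 + pi\<^sup>2) * ?l)"
   unfolding distrib_right distrib_left by simp
 qed
 finally have "ennreal (3 * (LINT s|\<nu>. (cmod (LINT t|\<nu>. ker e s t))\<^sup>2)) \<le> ennreal (M ^ 3) * ennreal (3 * ((32 * L\<^sup>2 + pi\<^sup>2) * ?l))"
  using main by (meson mult_left_mono order_trans zero_le)
 also have "... = ennreal (M ^ 3 * (3 * ((32 * L\<^sup>2 + pi\<^sup>2) * ?l)))"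
  using M0 ab by (intro ennreal_mult[symmetric]) auto
 finally have "3 * (LINT s|\<nu>. (cmod (LINT t|\<nu>. ker e s t))\<^sup>2) \<le> M ^ 3 * (3 * ((32 * L\<^sup>2 + pi\<^sup>2) * ?l))"
  using M0 ab by (subst (asm) ennreal_le_iff) auto
 moreover have "(LINT s|\<nu>. (cmod (LINT t|\<nu>. ker e s t))\<^sup>2) = (LINT s|lborel. F s * (cmod (T e (\<lambda>t. of_real (F t)) s))\<^sup>2)"
  unfolding eq unfolding \<nu>_def T_def using M by (subst integral_density) auto
 ultimately show ?thesis by simp
qed

end

section \<open>From square bounds to a uniform bound on square integrable data\<close>

context lipschitz_graph
begin

lemma T_measurable [measurable]:
 assumes [measurable]: "g \<in> borel_measurable borel"
 shows "T e g \<in> borel_measurable borel"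
 unfolding T_def by measurable

lemma ker_mult_integrable:
 assumes g: "integrable lborel g" and eps: "e > 0"
 shows "integrable lborel (\<lambda>t. ker e s t * g t)"
proof (rule Bochner_Integration.integrable_bound)
 show "integrable lborel (\<lambda>t. 1 / e * cmod (g t))" using g by simp
 show "(\<lambda>t. ker e s t * g t) \<in> borel_measurable lborel" using g by (auto dest: borel_measurable_integrable)
 show "AE t in lborel. norm (ker e s t * g t) \<le> norm (1 / e * cmod (g t))"
  using norm_ker_le[OF eps] eps by (intro AE_I2) (auto simp: norm_mult mult_right_mono[of _ "1/e", simplified])
qed

lemma norm_T_le:
 assumes g: "integrable lborel g" and eps: "e > 0"
 shows "cmod (T e g s) \<le> 1 / e * (LINT t|lborel. cmod (g t))"
proof -
 have "cmod (T e g s) \<le> (LINT t|lborel. cmod (ker e s t * g t))" unfolding T_def by (rule integral_norm_bound)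
 also have "... \<le> (LINT t|lborel. 1 / e * cmod (g t))"
 proof (rule integral_mono)
  show "integrable lborel (\<lambda>t. cmod (ker e s t * g t))" by (intro integrable_norm ker_mult_integrable g eps)
  show "integrable lborel (\<lambda>t. 1 / e * cmod (g t))" using g by simp
  show "cmod (ker e s t * g t) \<le> 1 / e * cmod (g t)" for t
   unfolding norm_mult by (rule mult_right_mono[OF norm_ker_le[OF eps]]) simp
 qed
 finally show ?thesis by simp
qed

lemma T_diff: "integrable lborel f ==> integrable lborel g ==> e > 0 ==> T e (\<lambda>t. f t - g t) s = T e f s - T e g s"
 unfolding T_def right_diff_distrib by (intro Bochner_Integration.integral_diff ker_mult_integrable)

lemma T_add: "integrable lborel f ==> integrable lborel g ==> e > 0 ==> T e (\<lambda>t. f t + g t) s = T e f s + T e g s"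
 unfolding T_def distrib_left by (intro Bochner_Integration.integral_add ker_mult_integrable)

lemma T_cmult: "T e (\<lambda>t. c * g t) s = c * T e g s"
 unfolding T_def by (simp add: mult.left_commute[of _ c])

lemma integrable_bounded_support:
 fixes g :: "real => complex"
 assumes "g \<in> borel_measurable borel" "\<And>x. cmod (g x) \<le> B" "\<And>x. x \<notin> {a..b} ==> g x = 0"
 shows "integrable lborel g"
proof (rule Bochner_Integration.integrable_bound)
 show "integrable lborel (\<lambda>x. B * indicat_real {a..b} x)"
  by (intro integrable_mult_right) (auto intro!: integrable_real_indicator simp: emeasure_lborel_Icc_eq)
 have "B \<ge> 0" using assms(2)[of 0] norm_ge_zero order_trans by blast
 then show "AE x in lborel. norm (g x) \<le> norm (B * indicat_real {a..b} x)"
  using assms(2,3) by (auto simp: indicator_def)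
qed (use assms in auto)

lemma T_sq_set_integrable:
 assumes g: "integrable lborel g" and eps: "e > 0"
 shows "set_integrable lborel {a..b} (\<lambda>s. (cmod (T e g s))\<^sup>2)"
proof -
 define B where "B = 1 / e * (LINT t|lborel. cmod (g t))"
 have B: "(cmod (T e g s))\<^sup>2 \<le> B\<^sup>2" for s using norm_T_le[OF g eps, of s] by (intro power_mono) (auto simp: B_def)
 have gm[measurable]: "g \<in> borel_measurable borel" using g by (auto dest: borel_measurable_integrable)
 show ?thesis unfolding set_integrable_def
 proof (rule Bochner_Integration.integrable_bound)
  show "integrable lborel (\<lambda>x. B\<^sup>2 * indicat_real {a..b} x)"
   by (intro integrable_mult_right) (auto intro!: integrable_real_indicator simp: emeasure_lborel_Icc_eq)
 qed (use B in \<open>auto simp: indicator_def\<close>)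
qed

text \<open>The weighted bound is not linear in the weight. It is used for \<open>1\<close> and for
  \<open>1 + g\<close>, both at least \<open>1\<close> on the interval, so that the weight in front can be
  dropped; the difference of the two is \<open>g\<close>, with constant \<open>18 = 2 * (1 + 2 ^
  3)\<close>.\<close>
lemma T_sq_bound_unit:
 fixes g :: "real => real"
 assumes eps: "e > 0" and ab: "a < b" and [measurable]: "g \<in> borel_measurable borel"
  and g: "\<And>x. 0 \<le> g x" "\<And>x. g x \<le> 1" "\<And>x. x \<notin> {a..b} ==> g x = 0"
 shows "(LBINT s:{a..b}. (cmod (T e (\<lambda>t. of_real (g t)) s))\<^sup>2) \<le> 18 * ((32 * L\<^sup>2 + pi\<^sup>2) * (b - a))"
proof -
 let ?C = "(32 * L\<^sup>2 + pi\<^sup>2) * (b - a)"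
 define \<Phi>1 :: "real => real" where "\<Phi>1 = indicator {a..b}"
 define \<Phi>2 where "\<Phi>2 x = \<Phi>1 x + g x" for x
 have [measurable]: "\<Phi>1 \<in> borel_measurable borel" by (simp add: \<Phi>1_def)
 have [measurable]: "\<Phi>2 \<in> borel_measurable borel" unfolding \<Phi>2_def by measurable
 let ?T = "\<lambda>f s. T e (\<lambda>t. complex_of_real (f t)) s"
 have int: "integrable lborel (\<lambda>t. complex_of_real (\<Phi>1 t))" "integrable lborel (\<lambda>t. complex_of_real (\<Phi>2 t))"
   "integrable lborel (\<lambda>t. complex_of_real (g t))"
 proof -
  have bnd: "cmod (complex_of_real (\<Phi>1 t)) \<le> 2" "cmod (complex_of_real (\<Phi>2 t)) \<le> 2" "cmod (complex_of_real (g t)) \<le> 2" for t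
   unfolding norm_of_real using g(1,2)[of t] by (auto simp: \<Phi>1_def \<Phi>2_def indicator_def)
  have zero: "complex_of_real (\<Phi>1 t) = 0" "complex_of_real (\<Phi>2 t) = 0" "complex_of_real (g t) = 0" if "t \<notin> {a..b}" for t
   using that g(3)[OF that] by (auto simp: \<Phi>1_def \<Phi>2_def)
  show "integrable lborel (\<lambda>t. complex_of_real (\<Phi>1 t))" by (rule integrable_bounded_support[OF _ bnd(1) zero(1)]) measurable
  show "integrable lborel (\<lambda>t. complex_of_real (\<Phi>2 t))" by (rule integrable_bounded_support[OF _ bnd(2) zero(2)]) measurable
  show "integrable lborel (\<lambda>t. complex_of_real (g t))" by (rule integrable_bounded_support[OF _ bnd(3) zero(3)]) measurable
 qed
 have b1: "(LBINT s:{a..b}. (cmod (?T \<Phi>1 s))\<^sup>2) \<le> ?C"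
  using norm_T_sq_weighted[OF eps ab, of \<Phi>1 1] unfolding set_lebesgue_integral_def by (simp add: \<Phi>1_def)
 have "(LBINT s:{a..b}. (cmod (?T \<Phi>2 s))\<^sup>2) \<le> (LINT s|lborel. \<Phi>2 s * (cmod (?T \<Phi>2 s))\<^sup>2)"
  unfolding set_lebesgue_integral_def
 proof (rule integral_mono)
  show i: "integrable lborel (\<lambda>s. indicat_real {a..b} s *\<^sub>R (cmod (?T \<Phi>2 s))\<^sup>2)"
   using T_sq_set_integrable[OF int(2) eps, of a b] by (simp add: set_integrable_def)
  show "integrable lborel (\<lambda>s. \<Phi>2 s * (cmod (?T \<Phi>2 s))\<^sup>2)"
  proof (rule Bochner_Integration.integrable_bound[OF integrable_mult_right[OF i, of 2]])
   have "\<Phi>2 s * (cmod (?T \<Phi>2 s))\<^sup>2 \<le> 2 * (indicat_real {a..b} s *\<^sub>R (cmod (?T \<Phi>2 s))\<^sup>2)" for s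
    using g(2)[of s] g(3)[of s] by (cases "s \<in> {a..b}") (auto simp: \<Phi>2_def \<Phi>1_def intro!: mult_right_mono)
   then show "AE s in lborel. norm (\<Phi>2 s * (cmod (?T \<Phi>2 s))\<^sup>2) \<le> norm (2 * (indicat_real {a..b} s *\<^sub>R (cmod (?T \<Phi>2 s))\<^sup>2))"
    using g(1) by (intro AE_I2) (auto simp: abs_mult \<Phi>2_def \<Phi>1_def intro: abs_of_nonneg)
  qed measurable
  show "indicat_real {a..b} s *\<^sub>R (cmod (?T \<Phi>2 s))\<^sup>2 \<le> \<Phi>2 s * (cmod (?T \<Phi>2 s))\<^sup>2" for s
   using g(1)[of s] by (auto simp: \<Phi>2_def \<Phi>1_def intro!: mult_right_mono)
 qed
 also have "... \<le> 2 ^ 3 * ?C"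
  using g by (intro norm_T_sq_weighted[OF eps ab]) (auto simp: \<Phi>2_def \<Phi>1_def indicator_def)
 finally have b2: "(LBINT s:{a..b}. (cmod (?T \<Phi>2 s))\<^sup>2) \<le> 8 * ?C" by simp
 have Tg: "?T g s = ?T \<Phi>2 s - ?T \<Phi>1 s" for s
  using T_diff[OF int(2,1) eps, of s] by (simp add: \<Phi>2_def)
 have sq: "(cmod (u - v))\<^sup>2 \<le> 2 * (cmod u)\<^sup>2 + 2 * (cmod v)\<^sup>2" for u v
 proof -
  have "(cmod (u - v))\<^sup>2 \<le> (cmod u + cmod v)\<^sup>2" by (intro power_mono norm_triangle_ineq4) simp
  also have "... \<le> 2 * (cmod u)\<^sup>2 + 2 * (cmod v)\<^sup>2"
   using zero_le_power2[of "cmod u - cmod v"] by (simp add: power2_eq_square algebra_simps)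
  finally show ?thesis .
 qed
 have "(LBINT s:{a..b}. (cmod (?T g s))\<^sup>2) \<le> (LBINT s:{a..b}. 2 * (cmod (?T \<Phi>2 s))\<^sup>2 + 2 * (cmod (?T \<Phi>1 s))\<^sup>2)"
  by (intro set_integral_mono set_integral_add set_integrable_mult_right T_sq_set_integrable int eps)
   (auto simp: Tg sq)
 also have "... = 2 * (LBINT s:{a..b}. (cmod (?T \<Phi>2 s))\<^sup>2) + 2 * (LBINT s:{a..b}. (cmod (?T \<Phi>1 s))\<^sup>2)"
  by (subst set_integral_add) (auto intro!: set_integrable_mult_right T_sq_set_integrable int eps)
 also have "... \<le> 18 * ?C" using b1 b2 by linarith
 finally show ?thesis .
qed

text \<open>A complex function is a combination of four nonnegative ones: \<open>288 = 4 * 4 *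
  18\<close>.\<close>
definition C2 :: real where "C2 = 288 * (32 * L\<^sup>2 + pi\<^sup>2)"

lemma C2_nonneg: "C2 \<ge> 0" by (simp add: C2_def)

lemma T_sq_bound:
 assumes eps: "e > 0" and ab: "a < b" and [measurable]: "g \<in> borel_measurable borel"
  and g: "\<And>x. cmod (g x) \<le> 1" "\<And>x. x \<notin> {a..b} ==> g x = 0"
 shows "(LBINT s:{a..b}. (cmod (T e g s))\<^sup>2) \<le> C2 * (b - a)"
proof -
 define h where "h i x = (if i = 0 then max (Re (g x)) 0 else if i = 1 then max (- Re (g x)) 0
  else if i = 2 then max (Im (g x)) 0 else max (- Im (g x)) 0)" for i :: nat and x
 have hm[measurable]: "h i \<in> borel_measurable borel" for i unfolding h_def by measurable
 have h01: "0 \<le> h i x" "h i x \<le> 1" for i x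
  using g(1)[of x] abs_Re_le_cmod[of "g x"] abs_Im_le_cmod[of "g x"] by (auto simp: h_def)
 have hs: "h i x = 0" if "x \<notin> {a..b}" for i x using g(2)[OF that] by (simp add: h_def)
 have hi: "integrable lborel (\<lambda>t. complex_of_real (h i t))" for i
  by (rule integrable_bounded_support[where B=1 and a=a and b=b]) (use h01 hs in auto)
 have hi': "integrable lborel (\<lambda>t. c * complex_of_real (h i t))" for i c using hi by simp
 have geq: "g = (\<lambda>t. (complex_of_real (h 0 t) - complex_of_real (h 1 t)) + \<i> * (complex_of_real (h 2 t) - complex_of_real (h 3 t)))"
  by (rule ext) (auto simp: h_def complex_eq_iff max_def)
 define U where "U i s = T e (\<lambda>t. complex_of_real (h i t)) s" for i s
 have Tg: "T e g s = (U 0 s - U 1 s) + \<i> * (U 2 s - U 3 s)" for s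
  unfolding U_def
  by (subst geq, subst T_add) (auto simp: T_diff T_cmult hi eps)
 have sq: "(cmod (T e g s))\<^sup>2 \<le> 4 * ((cmod (U 0 s))\<^sup>2 + (cmod (U 1 s))\<^sup>2 + ((cmod (U 2 s))\<^sup>2 + (cmod (U 3 s))\<^sup>2))" for s
 proof -
  have "cmod (T e g s) \<le> cmod (U 0 s - U 1 s) + cmod (\<i> * (U 2 s - U 3 s))" unfolding Tg by (rule norm_triangle_ineq)
  also have "... \<le> (cmod (U 0 s) + cmod (U 1 s)) + (cmod (U 2 s) + cmod (U 3 s))"
   unfolding norm_mult by (intro add_mono) (auto intro: norm_triangle_ineq4)
  finally have "(cmod (T e g s))\<^sup>2 \<le> ((cmod (U 0 s) + cmod (U 1 s)) + (cmod (U 2 s) + cmod (U 3 s)))\<^sup>2"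
   by (intro power_mono) auto
  also have "... \<le> 4 * ((cmod (U 0 s))\<^sup>2 + (cmod (U 1 s))\<^sup>2 + ((cmod (U 2 s))\<^sup>2 + (cmod (U 3 s))\<^sup>2))"
  proof -
   have "(w + x + (y + v))\<^sup>2 \<le> 4 * (w\<^sup>2 + x\<^sup>2 + (y\<^sup>2 + v\<^sup>2))" for w x y v :: real
   proof -
    have "4 * (w\<^sup>2 + x\<^sup>2 + (y\<^sup>2 + v\<^sup>2)) - (w + x + (y + v))\<^sup>2 = (w - x)\<^sup>2 + (w - y)\<^sup>2 + (w - v)\<^sup>2 + (x - y)\<^sup>2 + (x - v)\<^sup>2 + (y - v)\<^sup>2"
     by (simp add: power2_eq_square algebra_simps)
    then show ?thesis by (smt (verit) zero_le_power2)
   qed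
   then show ?thesis .
  qed
  finally show ?thesis .
 qed
 have iU: "set_integrable lborel {a..b} (\<lambda>s. (cmod (U i s))\<^sup>2)" for i
  unfolding U_def by (rule T_sq_set_integrable[OF hi eps])
 have bU: "(LBINT s:{a..b}. (cmod (U i s))\<^sup>2) \<le> 18 * ((32 * L\<^sup>2 + pi\<^sup>2) * (b - a))" for i
  unfolding U_def by (rule T_sq_bound_unit[OF eps ab]) (use h01 hs in auto)
 have gi: "integrable lborel g" by (rule integrable_bounded_support[where B=1 and a=a and b=b]) (use g in auto)
 have "(LBINT s:{a..b}. (cmod (T e g s))\<^sup>2) \<le> (LBINT s:{a..b}. 4 * ((cmod (U 0 s))\<^sup>2 + (cmod (U 1 s))\<^sup>2 + ((cmod (U 2 s))\<^sup>2 + (cmod (U 3 s))\<^sup>2)))"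
  by (intro set_integral_mono set_integral_add set_integrable_mult_right T_sq_set_integrable gi eps iU sq)
 also have "... = 4 * ((LBINT s:{a..b}. (cmod (U 0 s))\<^sup>2) + (LBINT s:{a..b}. (cmod (U 1 s))\<^sup>2)
   + ((LBINT s:{a..b}. (cmod (U 2 s))\<^sup>2) + (LBINT s:{a..b}. (cmod (U 3 s))\<^sup>2)))"
  using iU by (simp add: set_integral_add)
 also have "... \<le> 4 * (72 * ((32 * L\<^sup>2 + pi\<^sup>2) * (b - a)))"
  using bU[of 0] bU[of 1] bU[of 2] bU[of 3] unfolding distrib_left by linarith
 also have "... = C2 * (b - a)" unfolding C2_def by simp
 finally show ?thesis .
qed

lemma T_pairing_bound:
 assumes eps: "d > 0" and ab: "a < b" and [measurable]: "g \<in> borel_measurable borel" "f \<in> borel_measurable borel"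
  and g: "\<And>x. cmod (g x) \<le> 1" "\<And>x. x \<notin> {a..b} ==> g x = 0"
  and f: "set_integrable lborel {a..b} (\<lambda>x. (cmod (f x))\<^sup>2)" and e: "n > 0"
 shows "set_integrable lborel {a..b} (\<lambda>t. f t * T d g t)"
  and "cmod (LBINT t:{a..b}. f t * T d g t) \<le> n * (C2 * (b - a)) + (LBINT t:{a..b}. (cmod (f t))\<^sup>2) / n"
proof -
 have gi: "integrable lborel g" by (rule integrable_bounded_support[where B=1 and a=a and b=b]) (use g in auto)
 have b: "cmod (f t * T d g t) \<le> n * (cmod (T d g t))\<^sup>2 + (cmod (f t))\<^sup>2 / n" for t
 proof -
  have "0 \<le> (n * cmod (T d g t) - cmod (f t))\<^sup>2 / n" using e by simp
  also have "... = n * (cmod (T d g t))\<^sup>2 + (cmod (f t))\<^sup>2 / n - 2 * (cmod (f t) * cmod (T d g t))"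
   using e by (simp add: power2_eq_square field_simps)
  finally show ?thesis
   using mult_nonneg_nonneg[OF norm_ge_zero[of "f t"] norm_ge_zero[of "T d g t"]] unfolding norm_mult by linarith
 qed
 have i: "set_integrable lborel {a..b} (\<lambda>t. n * (cmod (T d g t))\<^sup>2 + (cmod (f t))\<^sup>2 / n)"
  using f by (intro set_integral_add set_integrable_mult_right T_sq_set_integrable gi eps set_integrable_divide)
 show j: "set_integrable lborel {a..b} (\<lambda>t. f t * T d g t)"
  unfolding set_integrable_def
  by (rule Bochner_Integration.integrable_bound[OF i[unfolded set_integrable_def]])
   (use b in \<open>auto simp: indicator_def intro: order_trans[OF _ abs_ge_self]\<close>)
 have "cmod (LBINT t:{a..b}. f t * T d g t) \<le> (LBINT t:{a..b}. cmod (f t * T d g t))"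
  using set_integral_norm_bound[OF j] .
 also have "... \<le> (LBINT t:{a..b}. n * (cmod (T d g t))\<^sup>2 + (cmod (f t))\<^sup>2 / n)"
  by (rule set_integral_mono[OF set_integrable_norm[OF j] i b])
 also have "... = n * (LBINT t:{a..b}. (cmod (T d g t))\<^sup>2) + (LBINT t:{a..b}. (cmod (f t))\<^sup>2) / n"
  using f by (subst set_integral_add) (auto intro!: set_integrable_mult_right T_sq_set_integrable gi eps set_integrable_divide)
 also have "... \<le> n * (C2 * (b - a)) + (LBINT t:{a..b}. (cmod (f t))\<^sup>2) / n"
  using e by (intro add_right_mono mult_left_mono T_sq_bound eps ab g) auto
 finally show "cmod (LBINT t:{a..b}. f t * T d g t) \<le> n * (C2 * (b - a)) + (LBINT t:{a..b}. (cmod (f t))\<^sup>2) / n" .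
qed

lemma T_transpose:
 assumes eps: "e > 0" and f: "integrable lborel f" and g: "integrable lborel g"
 shows "(LINT s|lborel. g s * T e f s) = - (LINT t|lborel. f t * T e g t)"
proof -
 have [measurable]: "f \<in> borel_measurable borel" "g \<in> borel_measurable borel"
  using f g by (auto dest: borel_measurable_integrable)
 have "integrable (lborel \<Otimes>\<^sub>M lborel) (\<lambda>(s, t). g s * (ker e s t * f t))"
 proof (rule lborel_pair.Fubini_integrable)
  show "AE x in lborel. integrable lborel (\<lambda>y. case (x, y) of (s, t) => g s * (ker e s t * f t))"
   using ker_mult_integrable[OF f eps] by auto
  show "integrable lborel (\<lambda>x. LINT y|lborel. norm (case (x, y) of (s, t) => g s * (ker e s t * f t)))"
  proof (rule Bochner_Integration.integrable_bound)
   show "integrable lborel (\<lambda>x. cmod (g x) * (1 / e * (LINT t|lborel. cmod (f t))))" using g by simp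
   have le: "(LINT y|lborel. cmod (ker e x y * f y)) \<le> 1 / e * (LINT t|lborel. cmod (f t))" for x
   proof -
    have "(LINT y|lborel. cmod (ker e x y * f y)) \<le> (LINT y|lborel. 1 / e * cmod (f y))"
    proof (rule integral_mono)
     show "cmod (ker e x y * f y) \<le> 1 / e * cmod (f y)" for y
      unfolding norm_mult by (rule mult_right_mono[OF norm_ker_le[OF eps]]) simp
    qed (use f in \<open>auto intro!: integrable_norm ker_mult_integrable eps\<close>)
    then show ?thesis by simp
   qed
   show "AE x in lborel. norm (LINT y|lborel. norm (case (x, y) of (s, t) => g s * (ker e s t * f t)))
     \<le> norm (cmod (g x) * (1 / e * (LINT t|lborel. cmod (f t))))"
    using mult_left_mono[OF le norm_ge_zero] eps by (intro AE_I2) (simp add: norm_mult)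
  qed measurable
 qed measurable
 from lborel_pair.Fubini_integral[OF this]
 have "(LINT s|lborel. LINT t|lborel. g s * (ker e s t * f t)) = (LINT t|lborel. LINT s|lborel. g s * (ker e s t * f t))"
  by simp
 also have "(LINT s|lborel. LINT t|lborel. g s * (ker e s t * f t)) = (LINT s|lborel. g s * T e f s)"
  unfolding T_def by simp
 also have "(LINT t|lborel. LINT s|lborel. g s * (ker e s t * f t)) = (LINT t|lborel. - (f t * T e g t))"
 proof (rule Bochner_Integration.integral_cong[OF refl])
  fix t
  have "(LINT s|lborel. g s * (ker e s t * f t)) = (LINT s|lborel. (- f t) * (ker e t s * g s))"
   by (subst ker_antisym) (simp add: mult_ac)
  also have "... = (- f t) * T e g t" unfolding T_def by (rule integral_mult_right_zero)
  finally show "(LINT s|lborel. g s * (ker e s t * f t)) = - (f t * T e g t)" by simp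
 qed
 finally show ?thesis by simp
qed

text \<open>Duality: the sign of \<open>T e f\<close> is a bounded function, and the transpose of \<open>T
  e\<close> is \<open>- T e\<close>.\<close>
lemma T_L1_bound:
 assumes eps: "e > 0" and ab: "a < b" and [measurable]: "f \<in> borel_measurable borel"
  and f: "integrable lborel (\<lambda>x. (cmod (f x))\<^sup>2)" and fi: "integrable lborel f" and supp: "\<And>x. x \<notin> {a..b} ==> f x = 0"
 shows "(LBINT s:{a..b}. cmod (T e f s)) \<le> C2 * (b - a) + (LINT t|lborel. (cmod (f t))\<^sup>2)"
proof -
 define g where "g s = indicator {a..b} s * cnj (sgn (T e f s))" for s
 have [measurable]: "g \<in> borel_measurable borel"
  unfolding g_def sgn_div_norm by measurable
 have g1: "cmod (g s) \<le> 1" for s by (auto simp: g_def norm_mult indicator_def norm_sgn)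
 have g0: "g s = 0" if "s \<notin> {a..b}" for s using that by (simp add: g_def)
 have gi: "integrable lborel g" by (rule integrable_bounded_support[where B=1 and a=a and b=b]) (use g1 g0 in auto)
 have gT: "g s * T e f s = complex_of_real (indicator {a..b} s *\<^sub>R cmod (T e f s))" for s
 proof -
  have "cnj (sgn w) * w = complex_of_real (cmod w)" for w :: complex
  proof (cases "w = 0")
   case False
   have "cnj (sgn w) * w = (w * cnj w) / of_real (cmod w)" by (simp add: sgn_eq)
   also have "... = of_real (cmod w)" using False by (simp add: complex_norm_square[symmetric] power2_eq_square)
   finally show ?thesis .
  qed simp
  then show ?thesis by (auto simp: g_def indicator_def)
 qed
 have "complex_of_real (LBINT s:{a..b}. cmod (T e f s)) = (LINT s|lborel. g s * T e f s)"
  unfolding gT set_lebesgue_integral_def by (rule integral_complex_of_real[symmetric])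
 also have "... = - (LINT t|lborel. f t * T e g t)" by (rule T_transpose[OF eps fi gi])
 also have "(LINT t|lborel. f t * T e g t) = (LBINT t:{a..b}. f t * T e g t)"
  unfolding set_lebesgue_integral_def using supp by (intro Bochner_Integration.integral_cong) (auto simp: indicator_def)
 finally have "(LBINT s:{a..b}. cmod (T e f s)) \<le> cmod (LBINT t:{a..b}. f t * T e g t)"
  by (metis norm_minus_cancel norm_of_real abs_ge_self)
 also have "... \<le> 1 * (C2 * (b - a)) + (LBINT t:{a..b}. (cmod (f t))\<^sup>2) / 1"
  using f by (intro T_pairing_bound eps ab g1 g0) (auto intro!: set_integrable_restrict)
 also have "(LBINT t:{a..b}. (cmod (f t))\<^sup>2) = (LINT t|lborel. (cmod (f t))\<^sup>2)"
  unfolding set_lebesgue_integral_def using supp by (intro Bochner_Integration.integral_cong) (auto simp: indicator_def)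
 finally show ?thesis by simp
qed

end

section \<open>Dilated kernels at a Lebesgue point\<close>

lemma integrable_inverse_one_plus_square: "integrable lborel (\<lambda>x::real. 1 / (1 + x\<^sup>2))"
 using integrable_inverse_1_plus_square by (simp add: set_integrable_def einterval_eq inverse_eq_divide)

text \<open>The weight \<open>1 / (1 + w\<^sup>2)\<close> is a superposition of indicators of centred
  intervals, on each of which the scaled average tends to zero.\<close>
lemma lebesgue_point_weighted:
 fixes F :: "real => complex"
 assumes int: "integrable lborel F"
  and lim: "((\<lambda>h. (LBINT x:{s-h..s+h}. cmod (F x - F s)) / h) \<longlongrightarrow> 0) (at_right 0)"
  and h: "\<And>j. h j > 0" "h \<longlonglongrightarrow> 0"
 shows "integrable lborel (\<lambda>w. cmod (F (s + h j * w) - F s) / (1 + w\<^sup>2))"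
  and "(\<lambda>j. LINT w|lborel. cmod (F (s + h j * w) - F s) / (1 + w\<^sup>2)) \<longlonglongrightarrow> 0"
proof -
 have [measurable]: "F \<in> borel_measurable borel" using int by (auto dest: borel_measurable_integrable)
 define f where "f x = cmod (F x - F s)" for x
 have [measurable]: "f \<in> borel_measurable borel" unfolding f_def by measurable
 have f0: "f x \<ge> 0" for x by (simp add: f_def)
 have fle: "f x \<le> cmod (F x) + cmod (F s)" for x unfolding f_def by (rule norm_triangle_ineq4)
 have I1: "set_integrable lborel {a..b} (\<lambda>x. cmod (F x))" for a b
  by (rule set_integrable_restrict[OF integrable_norm[OF int]]) simp
 have I2: "set_integrable lborel {a..b} (\<lambda>x. cmod (F s))" for a b :: real by (simp add: set_integrable_def)
 have fi: "set_integrable lborel {a..b} f" for a b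
 proof -
  have "set_integrable lborel {a..b} (\<lambda>x. cmod (F x) + cmod (F s))" by (rule set_integral_add(1)[OF I1 I2])
  then show ?thesis unfolding set_integrable_def
   by (rule Bochner_Integration.integrable_bound) (use f0 fle in \<open>auto simp: indicator_def\<close>)
 qed
 define \<alpha> where "\<alpha> r = (LBINT x:{s-r..s+r}. f x) / r" for r
 have [measurable]: "\<alpha> \<in> borel_measurable borel"
 proof -
  have "(\<lambda>r. LINT x|lborel. (if s - r \<le> x \<and> x \<le> s + r then f x else 0)) \<in> borel_measurable borel" by measurable
  moreover have "(\<lambda>r. LINT x|lborel. (if s - r \<le> x \<and> x \<le> s + r then f x else 0)) = (\<lambda>r. LBINT x:{s-r..s+r}. f x)"
   unfolding set_lebesgue_integral_def by (intro ext Bochner_Integration.integral_cong) (auto simp: indicator_def)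
  ultimately show ?thesis unfolding \<alpha>_def by simp
 qed
 have \<alpha>0: "\<alpha> r \<ge> 0" if "r > 0" for r
  unfolding \<alpha>_def set_lebesgue_integral_def using that f0 by (intro divide_nonneg_nonneg integral_nonneg_AE) auto
 have \<alpha>lim: "(\<alpha> \<longlongrightarrow> 0) (at_right 0)" using lim unfolding \<alpha>_def f_def .
 obtain B where B: "\<And>r. r > 0 ==> \<alpha> r \<le> B"
 proof -
  obtain d where d: "d > 0" "\<And>r. 0 < r ==> r < d ==> \<alpha> r < 1"
   using order_tendstoD(2)[OF \<alpha>lim, of 1] unfolding eventually_at_right_field by auto
  define B where "B = max 1 ((LINT x|lborel. cmod (F x)) / d + 2 * cmod (F s))"
  have "\<alpha> r \<le> B" if r: "r > 0" for r
  proof (cases "r < d")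
   case True then show ?thesis using d(2)[OF r] by (simp add: B_def)
  next
   case False
   have "(LBINT x:{s-r..s+r}. f x) \<le> (LBINT x:{s-r..s+r}. cmod (F x) + cmod (F s))"
    by (rule set_integral_mono[OF fi set_integral_add(1)[OF I1 I2] fle])
   also have "... = (LBINT x:{s-r..s+r}. cmod (F x)) + 2 * r * cmod (F s)"
    using r by (subst set_integral_add(2)[OF I1 I2]) (simp add: set_integral_const)
   also have "(LBINT x:{s-r..s+r}. cmod (F x)) \<le> (LINT x|lborel. cmod (F x))"
    unfolding set_lebesgue_integral_def
    by (intro integral_mono integrable_mult_indicator integrable_norm int) (auto simp: indicator_def)
   finally have "\<alpha> r \<le> ((LINT x|lborel. cmod (F x)) + 2 * r * cmod (F s)) / r"
    unfolding \<alpha>_def using r by (intro divide_right_mono) auto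
   also have "... = (LINT x|lborel. cmod (F x)) / r + 2 * cmod (F s)" using r by (simp add: add_divide_distrib)
   also have "... \<le> (LINT x|lborel. cmod (F x)) / d + 2 * cmod (F s)"
    using False d(1) by (intro add_right_mono divide_left_mono) (auto intro: integral_nonneg_AE)
   finally show ?thesis by (simp add: B_def)
  qed
  then show ?thesis using that by blast
 qed
 have layer: "(NN x. ennreal (2 * x / (1 + x\<^sup>2)\<^sup>2) * indicator {\<bar>w\<bar>..} x) = ennreal (1 / (1 + w\<^sup>2))" for w :: real
 proof -
  have "(NN x. ennreal (2 * x / (1 + x\<^sup>2)\<^sup>2) * indicator {\<bar>w\<bar>..} x) = ennreal (0 - (- 1 / (1 + \<bar>w\<bar>\<^sup>2)))"
  proof (rule nn_integral_FTC_atLeast)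
   fix x :: real assume "\<bar>w\<bar> \<le> x"
   then have "x \<ge> 0" by linarith
   then show "0 \<le> 2 * x / (1 + x\<^sup>2)\<^sup>2" by simp
   have "1 + x\<^sup>2 \<noteq> 0" by (smt (verit) zero_le_power2)
   then show "((\<lambda>x. - 1 / (1 + x\<^sup>2)) has_real_derivative 2 * x / (1 + x\<^sup>2)\<^sup>2) (at x)"
    by (auto intro!: derivative_eq_intros simp: power2_eq_square)
  next
   show "((\<lambda>x::real. - 1 / (1 + x\<^sup>2)) \<longlongrightarrow> 0) at_top"
    by (intro tendsto_divide_0[OF tendsto_const] filterlim_at_top_imp_at_infinity
      filterlim_tendsto_add_at_top[OF tendsto_const] filterlim_pow_at_top filterlim_ident) simp
  qed measurable
  then show ?thesis by simp
 qed
 define g where "g j x = indicator {0<..} x * (2 * x\<^sup>2 / (1 + x\<^sup>2)\<^sup>2) * \<alpha> (h j * x)" for j x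
 have [measurable]: "g j \<in> borel_measurable borel" for j unfolding g_def by measurable
 have g0: "g j x \<ge> 0" for j x using \<alpha>0[of "h j * x"] h(1)[of j] by (auto simp: g_def indicator_def)
 have gle: "g j x \<le> 2 * B * (1 / (1 + x\<^sup>2))" for j x
 proof (cases "x > 0")
  case True
  have B0: "0 \<le> B" using \<alpha>0[of 1] B[of 1] by simp
  have p: "1 + x\<^sup>2 > 0" by (smt (verit) zero_le_power2)
  have "x\<^sup>2 / (1 + x\<^sup>2)\<^sup>2 \<le> (1 + x\<^sup>2) / (1 + x\<^sup>2)\<^sup>2" by (intro divide_right_mono) auto
  also have "... = 1 / (1 + x\<^sup>2)" using p by (simp add: power2_eq_square)
  finally have q: "x\<^sup>2 / (1 + x\<^sup>2)\<^sup>2 \<le> 1 / (1 + x\<^sup>2)" .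
  have "g j x = 2 * (x\<^sup>2 / (1 + x\<^sup>2)\<^sup>2) * \<alpha> (h j * x)" using True by (simp add: g_def)
  also have "... \<le> 2 * (1 / (1 + x\<^sup>2)) * B"
   using q True h(1)[of j] B[of "h j * x"] \<alpha>0[of "h j * x"] p by (intro mult_mono) auto
  finally show ?thesis by (simp add: mult_ac)
 next
  case False
  have B0: "0 \<le> B" using \<alpha>0[of 1] B[of 1] by simp
  then show ?thesis using False by (simp add: g_def)
 qed
 have gi: "integrable lborel (g j)" for j
  by (rule Bochner_Integration.integrable_bound[OF integrable_mult_right[OF integrable_inverse_one_plus_square, of "2 * B"]])
   (use g0 gle \<alpha>0[of 1] B[of 1] in auto)
 have nn: "(NN w. ennreal (f (s + h j * w) / (1 + w\<^sup>2))) = ennreal (LINT x|lborel. g j x)" for j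
 proof -
  note hj = h(1)[of j]
  have "(NN w. ennreal (f (s + h j * w) / (1 + w\<^sup>2))) =
   (NN w. NN x. ennreal (f (s + h j * w)) * (ennreal (2 * x / (1 + x\<^sup>2)\<^sup>2) * indicator {\<bar>w\<bar>..} x))"
  proof (rule nn_integral_cong)
   fix w :: real
   have "ennreal (f (s + h j * w) / (1 + w\<^sup>2)) = ennreal (f (s + h j * w)) * ennreal (1 / (1 + w\<^sup>2))"
    using f0 by (subst ennreal_mult[symmetric]) auto
   also have "... = (NN x. ennreal (f (s + h j * w)) * (ennreal (2 * x / (1 + x\<^sup>2)\<^sup>2) * indicator {\<bar>w\<bar>..} x))"
    unfolding layer[symmetric] by (rule nn_integral_cmult[symmetric]) measurable
   finally show "ennreal (f (s + h j * w) / (1 + w\<^sup>2)) = (NN x. ennreal (f (s + h j * w)) * (ennreal (2 * x / (1 + x\<^sup>2)\<^sup>2) * indicator {\<bar>w\<bar>..} x))" .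
  qed
  also have "... = (NN w. NN x. ennreal (f (s + h j * w)) * (if \<bar>w\<bar> \<le> x then ennreal (2 * x / (1 + x\<^sup>2)\<^sup>2) else 0))"
   by (intro nn_integral_cong) (auto simp: indicator_def)
  also have "... = (NN x. NN w. ennreal (f (s + h j * w)) * (if \<bar>w\<bar> \<le> x then ennreal (2 * x / (1 + x\<^sup>2)\<^sup>2) else 0))"
   by (rule nn_integral_lborel_swap) measurable
  also have "... = (NN x. ennreal (g j x))"
  proof (rule nn_integral_cong_AE)
   have "AE x in lborel. x \<noteq> (0::real)" by (rule AE_lborel_singleton)
   then show "AE x in lborel. (NN w. ennreal (f (s + h j * w)) * (if \<bar>w\<bar> \<le> x then ennreal (2 * x / (1 + x\<^sup>2)\<^sup>2) else 0)) = ennreal (g j x)"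
   proof eventually_elim
    case (elim x)
    show ?case
    proof (cases "x > 0")
     case False
     then have "(NN w. ennreal (f (s + h j * w)) * (if \<bar>w\<bar> \<le> x then ennreal (2 * x / (1 + x\<^sup>2)\<^sup>2) else 0)) = (\<integral>\<^sup>+w. 0 \<partial>(lborel :: real measure))"
      using elim by (intro nn_integral_cong) auto
     then show ?thesis using False by (simp add: g_def)
    next
     case True
     have hx: "h j * x > 0" using True hj by simp
     have "(NN w. ennreal (f (s + h j * w)) * (if \<bar>w\<bar> \<le> x then ennreal (2 * x / (1 + x\<^sup>2)\<^sup>2) else 0))
      = (NN w. ennreal (2 * x / (1 + x\<^sup>2)\<^sup>2) * (ennreal (f (s + h j * w)) * indicator {- x..x} w))"
      by (intro nn_integral_cong) (auto simp: indicator_def mult_ac)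
     also have "... = ennreal (2 * x / (1 + x\<^sup>2)\<^sup>2) * (NN w. ennreal (f (s + h j * w)) * indicator {- x..x} w)"
      by (rule nn_integral_cmult) measurable
     also have "(NN w. ennreal (f (s + h j * w)) * indicator {- x..x} w) = ennreal (x * \<alpha> (h j * x))"
     proof -
      have "(NN t. ennreal (indicator {s - h j * x..s + h j * x} t *\<^sub>R f t)) = ennreal (h j * x * \<alpha> (h j * x))"
       using fi[of "s - h j * x" "s + h j * x"] hx f0
       by (subst nn_integral_eq_integral) (auto simp: set_integrable_def set_lebesgue_integral_def \<alpha>_def)
      moreover have "(NN t. ennreal (indicator {s - h j * x..s + h j * x} t *\<^sub>R f t)) =
        ennreal (h j) * (NN w. ennreal (indicator {s - h j * x..s + h j * x} (s + h j * w) *\<^sub>R f (s + h j * w)))"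
       using hj by (subst nn_integral_real_affine[where c="h j" and t=s]) auto
      moreover have "(NN w. ennreal (indicator {s - h j * x..s + h j * x} (s + h j * w) *\<^sub>R f (s + h j * w)))
       = (NN w. ennreal (f (s + h j * w)) * indicator {- x..x} w)"
      proof (rule nn_integral_cong)
       fix w :: real
       have "s - h j * x \<le> s + h j * w \<longleftrightarrow> - x \<le> w"
        using hj mult_le_cancel_left_pos[of "h j" "-x" w] by simp
       moreover have "s + h j * w \<le> s + h j * x \<longleftrightarrow> w \<le> x" using hj by simp
       ultimately show "ennreal (indicator {s - h j * x..s + h j * x} (s + h j * w) *\<^sub>R f (s + h j * w)) = ennreal (f (s + h j * w)) * indicator {- x..x} w"
        by (auto simp: indicator_def)
      qed
      ultimately have "ennreal (h j) * (NN w. ennreal (f (s + h j * w)) * indicator {- x..x} w) = ennreal (h j * (x * \<alpha> (h j * x)))"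
       by (simp add: mult.assoc)
      also have "... = ennreal (h j) * ennreal (x * \<alpha> (h j * x))"
       using hj True \<alpha>0[OF hx] by (intro ennreal_mult) auto
      finally show ?thesis using hj by (auto simp: ennreal_mult_cancel_left)
     qed
     also have "ennreal (2 * x / (1 + x\<^sup>2)\<^sup>2) * ennreal (x * \<alpha> (h j * x)) = ennreal (g j x)"
      using True \<alpha>0[OF hx] by (subst ennreal_mult[symmetric]) (auto simp: g_def power2_eq_square)
     finally show ?thesis .
    qed
   qed
  qed
  also have "... = ennreal (LINT x|lborel. g j x)" by (rule nn_integral_eq_integral[OF gi]) (use g0 in auto)
  finally show ?thesis .
 qed
 have int2: "integrable lborel (\<lambda>w. f (s + h j * w) / (1 + w\<^sup>2))" for j
  by (rule integrableI_nonneg) (use nn[of j] f0 in auto)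
 then show "integrable lborel (\<lambda>w. cmod (F (s + h j * w) - F s) / (1 + w\<^sup>2))" unfolding f_def .
 have eq: "(LINT w|lborel. f (s + h j * w) / (1 + w\<^sup>2)) = (LINT x|lborel. g j x)" for j
 proof -
  have "ennreal (LINT w|lborel. f (s + h j * w) / (1 + w\<^sup>2)) = ennreal (LINT x|lborel. g j x)"
   using nn_integral_eq_integral[OF int2[of j]] nn[of j] f0 by simp
  then show ?thesis using f0 g0 by (subst (asm) ennreal_inj) (auto intro!: integral_nonneg_AE)
 qed
 have "(\<lambda>j. LINT x|lborel. g j x) \<longlonglongrightarrow> (LINT x|(lborel :: real measure). (0::real))"
 proof (rule integral_dominated_convergence)
  show "integrable lborel (\<lambda>x. 2 * B * (1 / (1 + x\<^sup>2)))" by (intro integrable_mult_right integrable_inverse_one_plus_square)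
  show "AE x in lborel. norm (g j x) \<le> 2 * B * (1 / (1 + x\<^sup>2))" for j using g0 gle by (intro AE_I2) simp
  show "AE x in lborel. (\<lambda>j. g j x) \<longlonglongrightarrow> 0"
  proof (rule AE_I2)
   fix x :: real
   show "(\<lambda>j. g j x) \<longlonglongrightarrow> 0"
   proof (cases "x > 0")
    case True
    have "filterlim (\<lambda>j. h j * x) (at_right 0) sequentially"
     using tendsto_mult_right_zero[OF h(2), of x] h(1) True less_imp_neq[OF h(1)]
     by (auto simp: filterlim_at mult.commute intro!: always_eventually)
    from filterlim_compose[OF \<alpha>lim this] have "(\<lambda>j. \<alpha> (h j * x)) \<longlonglongrightarrow> 0" .
    then show ?thesis unfolding g_def by (rule tendsto_mult_right_zero)
   qed (simp add: g_def)
  qed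
 qed measurable
 then show "(\<lambda>j. LINT w|lborel. cmod (F (s + h j * w) - F s) / (1 + w\<^sup>2)) \<longlonglongrightarrow> 0"
  using eq unfolding f_def by simp
qed

text \<open>The constant \<open>f s\<close> sees only the limit kernel, whose integral vanishes; the
  oscillation of \<open>f\<close> is controlled by the quadratic decay of the kernels.\<close>
lemma odd_kernel_at_lebesgue_point:
 fixes f :: "real => complex" and M :: "nat => real => complex"
 assumes int: "integrable lborel f"
  and lim: "((\<lambda>h. (LBINT x:{s-h..s+h}. cmod (f x - f s)) / h) \<longlongrightarrow> 0) (at_right 0)"
  and h: "\<And>j. h j > 0" "h \<longlonglongrightarrow> 0"
  and Mm[measurable]: "\<And>j. M j \<in> borel_measurable borel" "M' \<in> borel_measurable borel"
  and Mb: "\<And>j y. cmod (M j y) \<le> C / (1 + y\<^sup>2)"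
  and Mlim: "AE y in lborel. (\<lambda>j. M j y) \<longlonglongrightarrow> M' y"
  and odd: "\<And>y. M' (- y) = - M' y"
 shows "(\<lambda>j. LINT y|lborel. f (s + h j * y) * M j y) \<longlonglongrightarrow> 0"
proof -
 have [measurable]: "f \<in> borel_measurable borel" using int by (auto dest: borel_measurable_integrable)
 note lp = lebesgue_point_weighted[OF int lim h]
 have C0: "C \<ge> 0" using order_trans[OF norm_ge_zero Mb[of 0 0]] by simp
 have Mi: "integrable lborel (M j)" for j
  by (rule Bochner_Integration.integrable_bound[OF integrable_mult_right[OF integrable_inverse_one_plus_square, of C]])
   (use Mb C0 in auto)
 have b: "cmod ((f (s + h j * y) - f s) * M j y) \<le> C * (cmod (f (s + h j * y) - f s) / (1 + y\<^sup>2))" for j y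
  using mult_left_mono[OF Mb[of j y], of "cmod (f (s + h j * y) - f s)"] by (simp add: norm_mult mult_ac)
 have i1: "integrable lborel (\<lambda>y. (f (s + h j * y) - f s) * M j y)" for j
  by (rule Bochner_Integration.integrable_bound[OF integrable_mult_right[OF lp(1)[of j], of C]])
   (use b C0 in \<open>auto simp: abs_mult\<close>)
 have "(\<lambda>j. LINT y|lborel. (f (s + h j * y) - f s) * M j y) \<longlonglongrightarrow> 0"
 proof (rule Lim_null_comparison)
  show "(\<lambda>j. C * (LINT y|lborel. cmod (f (s + h j * y) - f s) / (1 + y\<^sup>2))) \<longlonglongrightarrow> 0"
   using lp(2) by (rule tendsto_mult_right_zero)
  have "norm (LINT y|lborel. (f (s + h j * y) - f s) * M j y) \<le> C * (LINT y|lborel. cmod (f (s + h j * y) - f s) / (1 + y\<^sup>2))" for j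
  proof -
   have "norm (LINT y|lborel. (f (s + h j * y) - f s) * M j y) \<le> (LINT y|lborel. cmod ((f (s + h j * y) - f s) * M j y))"
    by (rule integral_norm_bound)
   also have "... \<le> (LINT y|lborel. C * (cmod (f (s + h j * y) - f s) / (1 + y\<^sup>2)))"
    by (intro integral_mono integrable_norm i1 integrable_mult_right lp(1) b)
   also have "... = C * (LINT y|lborel. cmod (f (s + h j * y) - f s) / (1 + y\<^sup>2))"
    by (rule integral_mult_right_zero)
   finally show ?thesis .
  qed
  then show "\<forall>\<^sub>F j in sequentially. norm (LINT y|lborel. (f (s + h j * y) - f s) * M j y) \<le> C * (LINT y|lborel. cmod (f (s + h j * y) - f s) / (1 + y\<^sup>2))"
   by simp
 qed
 moreover have "(\<lambda>j. f s * (LINT y|lborel. M j y)) \<longlonglongrightarrow> f s * (LINT y|lborel. M' y)"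
  by (intro tendsto_mult tendsto_const integral_dominated_convergence[where w="\<lambda>y. C * (1 / (1 + y\<^sup>2))"]
   integrable_mult_right integrable_inverse_one_plus_square Mlim) (use Mb in auto)
 moreover have "(LINT y|lborel. M' y) = 0"
 proof -
  have "(LINT y|lborel. M' y) = (LINT y|lborel. M' (- y))"
   using lborel_integral_real_affine[of "-1" M' 0] by simp
  then show ?thesis unfolding odd by simp
 qed
 ultimately have "(\<lambda>j. (LINT y|lborel. (f (s + h j * y) - f s) * M j y) + f s * (LINT y|lborel. M j y)) \<longlonglongrightarrow> 0 + f s * 0"
  by (intro tendsto_add) auto
 moreover have "(LINT y|lborel. f (s + h j * y) * M j y) = (LINT y|lborel. (f (s + h j * y) - f s) * M j y) + f s * (LINT y|lborel. M j y)" for j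
 proof -
  have "(LINT y|lborel. f (s + h j * y) * M j y) = (LINT y|lborel. (f (s + h j * y) - f s) * M j y + f s * M j y)"
   by (simp add: algebra_simps)
  also have "... = (LINT y|lborel. (f (s + h j * y) - f s) * M j y) + (LINT y|lborel. f s * M j y)"
   by (intro Bochner_Integration.integral_add i1 integrable_mult_right Mi)
  finally show ?thesis by simp
 qed
 ultimately show ?thesis by simp
qed

section \<open>Blow up of the kernel at a point of differentiability\<close>

context lipschitz_graph
begin

definition tent :: "real => real" where "tent x = max 0 (1 - \<bar>x\<bar>)"

lemma tent_measurable [measurable]: "tent \<in> borel_measurable borel" unfolding tent_def by measurable
lemma tent_bounds: "0 \<le> tent x" "tent x \<le> 1" by (auto simp: tent_def)
lemma tent_minus: "tent (- x) = tent x" by (simp add: tent_def)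
lemma tent_zero: "\<bar>x\<bar> \<ge> 1 ==> tent x = 0" by (simp add: tent_def)
lemma tent_lipschitz: "\<bar>tent x - tent y\<bar> \<le> \<bar>x - y\<bar>" unfolding tent_def by linarith

lemma tent_integral: "integrable lborel tent" "(LINT x|lborel. tent x) = 1"
proof -
 have 1: "has_bochner_integral lborel (\<lambda>x::real. (1 + x) * indicator {-1..0} x) ((0 + 0\<^sup>2/2) - (-1 + (-1)\<^sup>2/2))"
  by (rule has_bochner_integral_FTC_Icc_real[where F="\<lambda>x. x + x\<^sup>2/2"]) (auto intro!: derivative_eq_intros)
 have 2: "has_bochner_integral lborel (\<lambda>x::real. (1 - x) * indicator {0..1} x) ((1 - 1\<^sup>2/2) - (0 - 0\<^sup>2/2))"
  by (rule has_bochner_integral_FTC_Icc_real[where F="\<lambda>x. x - x\<^sup>2/2"]) (auto intro!: derivative_eq_intros)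
 have "has_bochner_integral lborel (\<lambda>x::real. (1 + x) * indicator {-1..0} x + (1 - x) * indicator {0..1} x)
   (((0 + 0\<^sup>2/2) - (-1 + (-1)\<^sup>2/2)) + ((1 - 1\<^sup>2/2) - (0 - 0\<^sup>2/2)))"
  by (rule has_bochner_integral_add[OF 1 2])
 moreover have "AE x in lborel. (1 + x) * indicator {-1..0} x + (1 - x) * indicator {0..1} x = tent x"
  using AE_lborel_singleton[of "0::real"] by eventually_elim (auto simp: tent_def indicator_def)
 ultimately have "has_bochner_integral lborel tent (((0 + 0\<^sup>2/2) - (-1 + (-1)\<^sup>2/2)) + ((1 - 1\<^sup>2/2) - (0 - 0\<^sup>2/2)))"
  by (subst has_bochner_integral_cong_AE[symmetric, where f="\<lambda>x::real. (1 + x) * indicator {-1..0} x + (1 - x) * indicator {0..1} x"]) auto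
 then show "integrable lborel tent" "(LINT x|lborel. tent x) = 1"
  by (auto simp: has_bochner_integral_iff)
qed

text \<open>The kernel in blown up coordinates \<open>s + h v\<close> around \<open>s\<close>.\<close>
definition kap :: "real => real => real => real => real => complex" where
 "kap h e s v w = of_real h * ker e (s + h * v) (s + h * w)"

lemma kap_measurable [measurable (raw)]:
 assumes [measurable]: "f \<in> borel_measurable M" "g \<in> borel_measurable M"
 shows "(\<lambda>p. kap h e s (f p) (g p)) \<in> borel_measurable M"
 unfolding kap_def by measurable

lemma kap_antisym: "kap h e s w v = - kap h e s v w"
 unfolding kap_def by (subst ker_antisym) simp

lemma kap_eq:
 fixes s h e v x :: real
 assumes "h > 0"
 defines "a \<equiv> (z (s + h * x) - z (s + h * v)) / of_real h"
 shows "kap h e s v x = cnj a / of_real ((cmod a)\<^sup>2 + (e / h)\<^sup>2)"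
proof -
 have w: "z (s + h * x) - z (s + h * v) = of_real h * a" using assms by simp
 have "kap h e s v x = (of_real h * (of_real h * cnj a)) / of_real ((h * cmod a)\<^sup>2 + e\<^sup>2)"
  unfolding kap_def ker_def w norm_mult complex_cnj_mult complex_cnj_complex_of_real norm_of_real
  using assms(1) by simp
 also have "(h * cmod a)\<^sup>2 + e\<^sup>2 = h * h * ((cmod a)\<^sup>2 + (e / h)\<^sup>2)"
  using assms(1) by (simp add: power2_eq_square field_simps)
 also have "(of_real h * (of_real h * cnj a)) / complex_of_real (h * h * ((cmod a)\<^sup>2 + (e / h)\<^sup>2)) = cnj a / of_real ((cmod a)\<^sup>2 + (e / h)\<^sup>2)"
  using assms(1) by (simp del: of_real_add of_real_power of_real_divide add: mult.assoc)
 finally show ?thesis .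
qed

lemma kap_bound: "h > 0 ==> cmod (kap h e s v w) \<le> 1 / \<bar>w - v\<bar>"
proof (cases "v = w")
 case True then show ?thesis by (simp add: kap_def ker_def)
next
 case False
 assume h: "h > 0"
 have "cmod (kap h e s v w) \<le> h * (1 / cmod (z (s + h * w) - z (s + h * v)))"
  unfolding kap_def norm_mult using norm_ker_le2 h by (simp add: mult_left_mono del: times_divide_eq_right)
 also have "... \<le> h * (1 / (h * \<bar>w - v\<bar>))"
 proof (intro mult_left_mono divide_left_mono)
  have "\<bar>(s + h * w) - (s + h * v)\<bar> = h * \<bar>w - v\<bar>" using h by (simp add: abs_mult right_diff_distrib[symmetric])
  then show le: "h * \<bar>w - v\<bar> \<le> cmod (z (s + h * w) - z (s + h * v))" using norm_z_ge by metis
  have "0 < h * \<bar>w - v\<bar>" using h False by simp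
  moreover from this le have "0 < cmod (z (s + h * w) - z (s + h * v))" by linarith
  ultimately show "0 < cmod (z (s + h * w) - z (s + h * v)) * (h * \<bar>w - v\<bar>)" by (rule mult_pos_pos[rotated])
 qed (use h in auto)
 also have "... = 1 / \<bar>w - v\<bar>" using h by simp
 finally show ?thesis .
qed

lemma blowup_limit:
 assumes A: "(A has_real_derivative a) (at s)" and h: "\<And>j. h j > 0" "h \<longlonglongrightarrow> 0"
 shows "(\<lambda>j. (z (s + h j * w) - z (s + h j * v)) / of_real (h j)) \<longlonglongrightarrow> Complex 1 a * of_real (w - v)"
proof -
 have lin: "(\<lambda>j. (A (s + h j * x) - A s) / h j) \<longlonglongrightarrow> a * x" for x
 proof (cases "x = 0")
  case False
  have "filterlim (\<lambda>j. h j * x) (at 0) sequentially"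
   using tendsto_mult_right_zero[OF h(2), of x] less_imp_neq[OF h(1)] False
   by (auto simp: filterlim_at mult.commute intro!: always_eventually)
  from filterlim_compose[OF A[unfolded DERIV_def] this]
  have "(\<lambda>j. (A (s + h j * x) - A s) / (h j * x)) \<longlonglongrightarrow> a" .
  from tendsto_mult[OF this tendsto_const[of x]]
  have "(\<lambda>j. (A (s + h j * x) - A s) / (h j * x) * x) \<longlonglongrightarrow> a * x" .
  then show ?thesis using False by simp
 qed simp
 have d: "(\<lambda>j. (A (s + h j * w) - A (s + h j * v)) / h j) \<longlonglongrightarrow> a * (w - v)"
  using tendsto_diff[OF lin[of w] lin[of v]] by (simp add: diff_divide_distrib[symmetric] right_diff_distrib)
 have e: "(z (s + h j * w) - z (s + h j * v)) / of_real (h j) = of_real (w - v) + \<i> * of_real ((A (s + h j * w) - A (s + h j * v)) / h j)" for j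
  using h(1)[of j] by (simp add: z_def complex_eq_iff field_simps)
 have "(\<lambda>j. of_real (w - v) + \<i> * of_real ((A (s + h j * w) - A (s + h j * v)) / h j)) \<longlonglongrightarrow> of_real (w - v) + \<i> * complex_of_real (a * (w - v))"
  by (intro tendsto_intros d)
 moreover have "of_real (w - v) + \<i> * complex_of_real (a * (w - v)) = Complex 1 a * of_real (w - v)"
  by (simp add: complex_eq_iff)
 ultimately show ?thesis unfolding e by simp
qed

text \<open>Since \<open>e / h\<close> tends to zero, the smoothing disappears in the limit, and the graph
  is replaced by its tangent.\<close>
lemma kap_limit:
 assumes A: "(A has_real_derivative a) (at s)" and h: "\<And>j. h j > 0" "h \<longlonglongrightarrow> 0"
  and e: "\<And>j. 0 < e j" "\<And>j. e j \<le> (h j)\<^sup>2" and ne: "v \<noteq> x"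
 shows "(\<lambda>j. kap (h j) (e j) s v x) \<longlonglongrightarrow> 1 / (Complex 1 a * of_real (x - v))"
proof -
 let ?w = "Complex 1 a * of_real (x - v)"
 have w0: "?w \<noteq> 0" using ne by (auto simp: complex_eq_iff)
 note wl = blowup_limit[OF A h, of x v]
 have "(\<lambda>j. e j / h j) \<longlonglongrightarrow> 0"
 proof (rule Lim_null_comparison[OF _ h(2)])
  show "\<forall>\<^sub>F j in sequentially. norm (e j / h j) \<le> h j"
   using e h(1) by (intro always_eventually allI) (simp add: pos_divide_le_eq power2_eq_square less_imp_le)
 qed
 then have lim: "(\<lambda>j. cnj ((z (s + h j * x) - z (s + h j * v)) / of_real (h j)) /
   of_real ((cmod ((z (s + h j * x) - z (s + h j * v)) / of_real (h j)))\<^sup>2 + (e j / h j)\<^sup>2)) \<longlonglongrightarrow> cnj ?w / of_real ((cmod ?w)\<^sup>2 + 0\<^sup>2)"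
  using w0 by (intro tendsto_intros wl) auto
 have rec: "cnj w / of_real ((cmod w)\<^sup>2 + 0\<^sup>2) = 1 / w" if "w \<noteq> 0" for w
 proof -
  have "complex_of_real ((cmod w)\<^sup>2 + 0\<^sup>2) = w * cnj w" by (simp add: complex_norm_square del: of_real_power)
  then show ?thesis using that by simp
 qed
 show ?thesis unfolding kap_eq[OF h(1)] using lim unfolding rec[OF w0] .
qed

text \<open>By antisymmetry the potential of the tent may be computed with the difference of two tent
  values, which cancels the singularity. The blow up limit then passes under the integral, and the
  limiting expression vanishes because the kernel of the tangent line is odd.\<close>
lemma tent_potential_near:
 assumes A: "(A has_real_derivative a) (at s)" and h: "\<And>j. h j > 0" "h \<longlonglongrightarrow> 0"
  and e: "\<And>j. 0 < e j" "\<And>j. e j \<le> (h j)\<^sup>2"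
 shows "(\<lambda>j. (LBINT t:{s - 2 * h j..s + 2 * h j}. T (e j) (\<lambda>t. of_real (tent ((t - s) / h j))) t) / of_real (h j)) \<longlonglongrightarrow> 0"
proof -
 define I :: "real => complex" where "I = indicator {-2..2}"
 have [measurable]: "I \<in> borel_measurable borel" by (simp add: I_def)
 define W where "W j w = (LINT v|lborel. kap (h j) (e j) s w v * (of_real (tent v - tent w) * I v))" for j w
 have [measurable]: "W j \<in> borel_measurable borel" for j unfolding W_def by measurable
 have eq: "(LBINT t:{s - 2 * h j..s + 2 * h j}. T (e j) (\<lambda>t. of_real (tent ((t - s) / h j))) t) / of_real (h j)
  = (1/2) * (LINT w|lborel. I w * W j w)" for j
 proof -
  note hj = h(1)[of j] and ej = e(1)[of j]
  define G :: "real => complex" where "G = indicator {s - 2 * h j..s + 2 * h j}"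
  define f :: "real => complex" where "f t = of_real (tent ((t - s) / h j))" for t
  have [measurable]: "G \<in> borel_measurable borel" by (simp add: G_def)
  have [measurable]: "f \<in> borel_measurable borel" unfolding f_def[abs_def] by measurable
  have fG: "f t * G t = f t" for t
  proof (cases "t \<in> {s - 2 * h j..s + 2 * h j}")
   case False
   then have "1 \<le> \<bar>(t - s) / h j\<bar>" using hj by (auto simp: abs_divide pos_le_divide_eq)
   then show ?thesis by (simp add: f_def tent_zero)
  qed (simp add: G_def)
  have f1: "cmod (f t) \<le> 1" for t using tent_bounds[of "(t - s) / h j"] by (simp add: f_def)
  have f0: "f t = 0" if "t \<notin> {s - 2 * h j..s + 2 * h j}" for t using fG[of t] that by (simp add: G_def)
  have fi: "integrable lborel f" by (rule integrable_bounded_support[where B=1]) (use f1 f0 in auto)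
  have Gi: "integrable lborel G" by (rule integrable_bounded_support[where B=1 and a="s - 2 * h j" and b="s + 2 * h j"]) (auto simp: G_def indicator_def)
  have iGT: "integrable lborel (\<lambda>t. G t * T (e j) f t)"
  proof (rule integrable_bounded_support[where a="s - 2 * h j" and b="s + 2 * h j" and B="1 / e j * (LINT t|lborel. cmod (f t))"])
   show "cmod (G x * T (e j) f x) \<le> 1 / e j * (LINT t|lborel. cmod (f t))" for x
    using norm_T_le[OF fi ej, of x] order_trans[OF norm_ge_zero norm_T_le[OF fi ej, of x]] by (auto simp: G_def indicator_def norm_mult)
  qed (auto simp: G_def)
  have ifT: "integrable lborel (\<lambda>t. f t * T (e j) G t)"
  proof (rule integrable_bounded_support[where a="s - 2 * h j" and b="s + 2 * h j" and B="1 / e j * (LINT t|lborel. cmod (G t))"])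
   show "cmod (f x * T (e j) G x) \<le> 1 / e j * (LINT t|lborel. cmod (G t))" for x
    using mult_mono[OF f1[of x] norm_T_le[OF Gi ej, of x]] by (simp add: norm_mult)
   show "f x * T (e j) G x = 0" if "x \<notin> {s - 2 * h j..s + 2 * h j}" for x using f0[OF that] by simp
  qed measurable
  have "(LINT t|lborel. G t * T (e j) f t) = - (LINT t|lborel. f t * T (e j) G t)"
   by (rule T_transpose[OF ej fi Gi])
  then have "2 * (LINT t|lborel. G t * T (e j) f t) = (LINT t|lborel. G t * T (e j) f t) - (LINT t|lborel. f t * T (e j) G t)" by simp
  also have "... = (LINT t|lborel. G t * T (e j) f t - f t * T (e j) G t)"
   by (rule Bochner_Integration.integral_diff[OF iGT ifT, symmetric])
  also have "... = (LINT t|lborel. G t * (LINT u|lborel. ker (e j) t u * ((f u - f t) * G u)))"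
  proof (rule Bochner_Integration.integral_cong[OF refl])
   fix t
   have "(LINT u|lborel. ker (e j) t u * ((f u - f t) * G u)) = (LINT u|lborel. ker (e j) t u * f u - f t * (ker (e j) t u * G u))"
   proof (rule Bochner_Integration.integral_cong[OF refl])
    fix u
    have *: "(f u - f t) * G u = f u - f t * G u" by (simp add: left_diff_distrib fG)
    show "ker (e j) t u * ((f u - f t) * G u) = ker (e j) t u * f u - f t * (ker (e j) t u * G u)"
     unfolding * by (simp only: right_diff_distrib mult_ac)
   qed
   also have "... = T (e j) f t - f t * T (e j) G t"
    unfolding T_def by (subst Bochner_Integration.integral_diff)
     (auto intro!: ker_mult_integrable fi Gi ej integrable_mult_right)
   finally have inner: "(LINT u|lborel. ker (e j) t u * ((f u - f t) * G u)) = T (e j) f t - f t * T (e j) G t" .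
   show "G t * T (e j) f t - f t * T (e j) G t = G t * (LINT u|lborel. ker (e j) t u * ((f u - f t) * G u))"
   proof -
    have "f t * T (e j) G t = G t * (f t * T (e j) G t)"
     by (subst fG[of t, symmetric]) (simp only: mult_ac)
    then show ?thesis unfolding inner by (simp add: right_diff_distrib)
   qed
  qed
  also have "... = \<bar>h j\<bar> *\<^sub>R (LINT w|lborel. G (s + h j * w) * (LINT u|lborel. ker (e j) (s + h j * w) u * ((f u - f (s + h j * w)) * G u)))"
   by (rule lborel_integral_real_affine) (use hj in simp)
  also have "... = h j *\<^sub>R (LINT w|lborel. I w * W j w)"
  proof -
   have Gs: "G (s + h j * w) = I w" for w
   proof -
    have "s - 2 * h j \<le> s + h j * w \<longleftrightarrow> - 2 \<le> w" using hj mult_le_cancel_left_pos[of "h j" "-2" w] by (simp add: mult.commute)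
    moreover have "s + h j * w \<le> s + 2 * h j \<longleftrightarrow> w \<le> 2" using hj mult_le_cancel_left_pos[of "h j" w 2] by (simp add: mult.commute)
    ultimately show ?thesis by (simp add: G_def I_def indicator_def)
   qed
   have fs: "f (s + h j * w) = of_real (tent w)" for w using hj by (simp add: f_def)
   have "(LINT u|lborel. ker (e j) (s + h j * w) u * ((f u - f (s + h j * w)) * G u)) = W j w" for w
   proof -
    have "(LINT u|lborel. ker (e j) (s + h j * w) u * ((f u - f (s + h j * w)) * G u))
     = \<bar>h j\<bar> *\<^sub>R (LINT v|lborel. ker (e j) (s + h j * w) (s + h j * v) * ((f (s + h j * v) - f (s + h j * w)) * G (s + h j * v)))"
     by (rule lborel_integral_real_affine) (use hj in simp)
    also have "... = W j w" unfolding W_def Gs fs kap_def using hj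
     by (simp add: scaleR_conv_of_real mult.assoc)
    finally show ?thesis .
   qed
   then show ?thesis using hj Gs by simp
  qed
  finally have "2 * (LINT t|lborel. G t * T (e j) f t) = of_real (h j) * (LINT w|lborel. I w * W j w)"
   by (simp add: scaleR_conv_of_real)
  then have "(LINT t|lborel. G t * T (e j) f t) / of_real (h j) = (1/2) * (LINT w|lborel. I w * W j w)"
   using hj by (simp add: field_simps)
  moreover have "(LBINT t:{s - 2 * h j..s + 2 * h j}. T (e j) (\<lambda>t. of_real (tent ((t - s) / h j))) t) = (LINT t|lborel. G t * T (e j) f t)"
   unfolding set_lebesgue_integral_def G_def f_def[abs_def] by (intro Bochner_Integration.integral_cong) (auto simp: indicator_def)
  ultimately show ?thesis by simp
 qed
 define W' where "W' w = (LINT v|lborel. 1 / (Complex 1 a * of_real (v - w)) * (of_real (tent v - tent w) * I v))" for w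
 have [measurable]: "W' \<in> borel_measurable borel" unfolding W'_def by measurable
 have nI: "cmod (I w) = indicator {-2..2} w" for w by (simp add: I_def indicator_def)
 have ib: "cmod (kap (h j) (e j) s w v * (of_real (tent v - tent w) * I v)) \<le> indicator {-2..2} v" for j w v
 proof (cases "v = w")
  case False
  have "cmod (kap (h j) (e j) s w v) * \<bar>tent v - tent w\<bar> \<le> 1 / \<bar>v - w\<bar> * \<bar>v - w\<bar>"
   by (intro mult_mono kap_bound h tent_lipschitz) auto
  then have "cmod (kap (h j) (e j) s w v) * \<bar>tent v - tent w\<bar> \<le> 1" using False by simp
  then show ?thesis using mult_right_mono[of "cmod (kap (h j) (e j) s w v) * \<bar>tent v - tent w\<bar>" 1 "indicator {-2..2} v"]
   by (simp add: norm_mult nI mult.assoc flip: of_real_diff)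
 qed simp
 have ii: "integrable lborel (indicator {-2..2} :: real => real)" by simp
 have Wlim: "(\<lambda>j. W j w) \<longlonglongrightarrow> W' w" for w
  unfolding W_def W'_def
 proof (rule integral_dominated_convergence[OF _ _ ii])
  show "AE v in lborel. (\<lambda>j. kap (h j) (e j) s w v * (of_real (tent v - tent w) * I v)) \<longlonglongrightarrow> 1 / (Complex 1 a * of_real (v - w)) * (of_real (tent v - tent w) * I v)"
   using AE_lborel_singleton[of w]
   by eventually_elim (intro tendsto_mult tendsto_const kap_limit[OF A h e], auto)
 qed (use ib in auto)
 have Wb: "cmod (W j w) \<le> 4" for j w
 proof -
  have "cmod (W j w) \<le> (LINT v|lborel. cmod (kap (h j) (e j) s w v * (of_real (tent v - tent w) * I v)))"
   unfolding W_def by (rule integral_norm_bound)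
  also have "... \<le> (LINT v|lborel. indicat_real {-2..2::real} v)"
  proof (rule integral_mono[OF _ ii ib])
   show "integrable lborel (\<lambda>v. cmod (kap (h j) (e j) s w v * (of_real (tent v - tent w) * I v)))"
    by (rule Bochner_Integration.integrable_bound[OF ii]) (use ib in auto)
  qed
  finally show ?thesis by simp
 qed
 have "(\<lambda>j. LINT w|lborel. I w * W j w) \<longlonglongrightarrow> (LINT w|lborel. I w * W' w)"
 proof (rule integral_dominated_convergence[OF _ _ integrable_mult_right[OF ii, of 4]])
  show "AE w in lborel. cmod (I w * W j w) \<le> 4 * indicator {-2..2} w" for j
   using Wb by (intro AE_I2) (simp add: norm_mult nI indicator_def)
 qed (auto intro!: tendsto_intros Wlim)
 moreover have "(LINT w|lborel. I w * W' w) = 0"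
 proof -
  have Im: "I (- x) = I x" for x by (auto simp: I_def indicator_def)
  have "W' (- w) = - W' w" for w
  proof -
   have "W' (- w) = (LINT v|lborel. 1 / (Complex 1 a * of_real (- v - - w)) * (of_real (tent (- v) - tent (- w)) * I (- v)))"
    unfolding W'_def using lborel_integral_real_affine[of "-1" "\<lambda>v. 1 / (Complex 1 a * of_real (v - - w)) * (of_real (tent v - tent (- w)) * I v)" 0] by simp
   also have "... = (LINT v|lborel. - (1 / (Complex 1 a * of_real (v - w)) * (of_real (tent v - tent w) * I v)))"
   proof (rule Bochner_Integration.integral_cong[OF refl])
    fix v :: real
    have "complex_of_real (- v - - w) = - of_real (v - w)" by simp
    then show "1 / (Complex 1 a * of_real (- v - - w)) * (of_real (tent (- v) - tent (- w)) * I (- v)) = - (1 / (Complex 1 a * of_real (v - w)) * (of_real (tent v - tent w) * I v))"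
     unfolding tent_minus Im by (simp only: mult_minus_right divide_minus_right mult_minus_left)
   qed
   finally show ?thesis by (simp add: W'_def)
  qed
  then have "(LINT w|lborel. I w * W' w) = - (LINT w|lborel. I w * W' w)"
   using lborel_integral_real_affine[of "-1" "\<lambda>w. I w * W' w" 0] by (simp add: Im)
  then show ?thesis by simp
 qed
 ultimately have "(\<lambda>j. (1/2) * (LINT w|lborel. I w * W j w)) \<longlonglongrightarrow> (1/2) * 0"
  by (intro tendsto_mult tendsto_const) simp
 then show ?thesis unfolding eq by simp
qed

end

section \<open>Truncated integrals and averages of regularized integrals\<close>

context lipschitz_graph
begin

definition trunc :: "real => real => real => complex" where
 "trunc h s t = (if cmod (z t - z s) > h then 1 / (z t - z s) else 0)"

lemma trunc_measurable [measurable]: "trunc h s \<in> borel_measurable borel"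
 unfolding trunc_def by measurable

lemma norm_trunc_le: "h > 0 ==> cmod (trunc h s t) \<le> 1 / h"
 unfolding trunc_def by (auto simp: norm_divide intro!: divide_left_mono mult_pos_pos)

text \<open>Away from the tent the smoothing and the spread of the tent over \<open>[-1, 1]\<close> are
  both second order in \<open>1/y\<close>.\<close>
lemma kap_far_estimate:
 assumes h: "0 < h" "h \<le> 1" and e: "0 < e" "e \<le> h\<^sup>2" and q: "\<bar>q\<bar> \<le> 1" and y: "\<bar>y\<bar> > 2"
 shows "cmod (kap h e s q y - 1 / ((z (s + h * y) - z s) / of_real h)) \<le> (6 + 2 * L) / y\<^sup>2"
proof -
 define w where "w = (z (s + h * y) - z (s + h * q)) / of_real h"
 define v where "v = (z (s + h * y) - z s) / of_real h"
 define d where "d = e / h"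
 have d: "0 < d" "d \<le> 1"
 proof -
  have "e \<le> h * 1" using e h by (simp add: power2_eq_square) (smt (verit) mult_left_le)
  then show "0 < d" "d \<le> 1" using e h by (auto simp: d_def)
 qed
 have scale: "\<bar>y - x\<bar> \<le> cmod ((z (s + h * y) - z (s + h * x)) / of_real h)" for x
 proof -
  have "\<bar>(s + h * y) - (s + h * x)\<bar> = h * \<bar>y - x\<bar>" using h by (simp add: abs_mult right_diff_distrib[symmetric])
  then have "h * \<bar>y - x\<bar> \<le> cmod (z (s + h * y) - z (s + h * x))" using norm_z_ge by metis
  then show ?thesis using h by (simp add: norm_divide pos_le_divide_eq mult.commute)
 qed
 have w: "cmod w \<ge> \<bar>y\<bar> / 2" using scale[of q] q y unfolding w_def by linarith
 have v: "cmod v \<ge> \<bar>y\<bar>" using scale[of 0] by (simp add: v_def)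
 have w0: "cmod w > 0" "cmod w \<ge> 1" and v0: "cmod v > 0" using w v y by linarith+
 have vw: "cmod (v - w) \<le> 1 + L"
 proof -
  have "v - w = (z (s + h * q) - z s) / of_real h" by (simp add: v_def w_def diff_divide_distrib[symmetric])
  also have "cmod ... \<le> (1 + L) * (h * \<bar>q\<bar>) / h"
   using norm_z_le[of "s + h * q" s] h by (simp add: norm_divide abs_mult pos_divide_le_eq mult_ac)
  also have "... \<le> (1 + L) * 1" using h q L_nonneg by (simp add: mult_left_le)
  finally show ?thesis by simp
 qed
 have t2: "y\<^sup>2 = \<bar>y\<bar> * \<bar>y\<bar>" by (simp add: power2_eq_square)
 have a: "cmod (kap h e s q y - 1 / w) \<le> 4 / y\<^sup>2"
 proof -
  define D where "D = (cmod w)\<^sup>2 + d\<^sup>2"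
  have D: "D > 0" "(cmod w)\<^sup>2 \<le> D" using w0 by (auto simp: D_def add_pos_nonneg)
  have "kap h e s q y - 1 / w = cnj w / of_real D - 1 / w"
   using kap_eq[OF h(1), of e s q y] by (simp add: w_def d_def D_def)
  also have "... = (w * cnj w - of_real D) / (w * of_real D)" using w0 D by (simp add: divide_simps)
  also have "w * cnj w - of_real D = - of_real (d\<^sup>2)"
   by (simp add: D_def complex_norm_square[symmetric] del: of_real_power)
  finally have "cmod (kap h e s q y - 1 / w) = d\<^sup>2 / (cmod w * D)"
   using D by (simp add: norm_divide norm_mult norm_power)
  also have "... \<le> 1 / (1 * (cmod w)\<^sup>2)"
   using d w0 D by (intro frac_le mult_mono) (auto simp: power_le_one)
  also have "... \<le> 1 / (\<bar>y\<bar> / 2)\<^sup>2" using w w0 y by (simp add: frac_le power_mono del: power_divide)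
  also have "... = 4 / y\<^sup>2" by (simp add: power_divide)
  finally show ?thesis .
 qed
 have b: "cmod (1 / w - 1 / v) \<le> (2 + 2 * L) / y\<^sup>2"
 proof -
  have "1 / w - 1 / v = (v - w) / (w * v)" using w0 v0 by (auto simp: divide_simps)
  then have "cmod (1 / w - 1 / v) = cmod (v - w) / (cmod w * cmod v)" by (simp add: norm_divide norm_mult)
  also have "... \<le> (1 + L) / ((\<bar>y\<bar> / 2) * \<bar>y\<bar>)"
   using vw w v y L_nonneg by (intro frac_le mult_mono mult_pos_pos) auto
  also have "... = (2 + 2 * L) / y\<^sup>2" unfolding t2 using y by (simp add: field_simps)
  finally show ?thesis .
 qed
 have "cmod (kap h e s q y - 1 / v) \<le> cmod (kap h e s q y - 1 / w) + cmod (1 / w - 1 / v)"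
  using norm_triangle_ineq[of "kap h e s q y - 1 / w" "1 / w - 1 / v"] by simp
 also have "... \<le> 4 / y\<^sup>2 + (2 + 2 * L) / y\<^sup>2" by (rule add_mono[OF a b])
 also have "... = (6 + 2 * L) / y\<^sup>2" by (simp add: add_divide_distrib[symmetric])
 finally show ?thesis by (simp add: v_def)
qed

text \<open>The difference of the tent average of the smoothed kernel and the truncated kernel decays
  quadratically and becomes odd in the limit.\<close>
lemma far_kernel_limit:
 assumes A: "(A has_real_derivative a) (at s)" and h: "\<And>j. h j > 0" "\<And>j. h j \<le> 1" "h \<longlonglongrightarrow> 0"
  and e: "\<And>j. 0 < e j" "\<And>j. e j \<le> (h j)\<^sup>2"
  and int: "integrable lborel f" and leb: "((\<lambda>h. (LBINT x:{s-h..s+h}. cmod (f x - f s)) / h) \<longlongrightarrow> 0) (at_right 0)"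
 defines "M \<equiv> \<lambda>j w. (if \<bar>w\<bar> > 2 then LINT y|lborel. of_real (tent y) * kap (h j) (e j) s y w else 0)
   - of_real (h j) * trunc (h j) s (s + h j * w)"
 shows "(\<lambda>j. LINT w|lborel. f (s + h j * w) * M j w) \<longlonglongrightarrow> 0"
proof -
 let ?c = "Complex 1 a"
 have c0: "?c \<noteq> 0" by (simp add: complex_eq_iff)
 define M' where "M' w = (if \<bar>w\<bar> > 2 then LINT y|lborel. of_real (tent y) * (1 / (?c * of_real (w - y))) else 0)
   - (if cmod (?c * of_real w) > 1 then 1 / (?c * of_real w) else 0)" for w
 have ht: "of_real (h j) * trunc (h j) s (s + h j * w) =
   (if cmod ((z (s + h j * w) - z s) / of_real (h j)) > 1 then 1 / ((z (s + h j * w) - z s) / of_real (h j)) else 0)" for j w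
  using h(1)[of j] by (simp add: trunc_def norm_divide pos_less_divide_eq)
 have tint: "integrable lborel (\<lambda>y. complex_of_real (tent y))" using tent_integral(1) by simp
 have tk: "cmod (of_real (tent y) * kap (h j) (e j) s y w) \<le> tent y" if "\<bar>w\<bar> > 2" for y w j
 proof (cases "\<bar>y\<bar> < 1")
  case True
  have "cmod (kap (h j) (e j) s y w) \<le> 1 / \<bar>w - y\<bar>" by (rule kap_bound[OF h(1)])
  also have "... \<le> 1" using True that by simp
  finally show ?thesis using tent_bounds[of y] by (simp add: norm_mult mult_left_le)
 qed (simp add: tent_zero)
 have bound: "cmod (M j w) \<le> (8 + 3 * L) / (1 + w\<^sup>2)" for j w
 proof (cases "\<bar>w\<bar> > 2")
  case False
  have "cmod (if cmod v > 1 then 1 / v else 0) \<le> 1" for v by (auto simp: norm_divide divide_simps)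
  then have "cmod (M j w) \<le> 1" using False unfolding M_def ht by simp
  also have "1 \<le> (8 + 3 * L) / (1 + w\<^sup>2)"
  proof -
   have "w\<^sup>2 \<le> 2\<^sup>2" using False by (metis abs_le_square_iff abs_numeral not_less)
   then show ?thesis using L_nonneg by (simp add: pos_le_divide_eq add_pos_nonneg)
  qed
  finally show ?thesis .
 next
  case True
  define v where "v = (z (s + h j * w) - z s) / of_real (h j)"
  have v1: "cmod v > 1"
  proof -
   have "h j * \<bar>w\<bar> \<le> cmod (z (s + h j * w) - z s)" using norm_z_ge[of "s + h j * w" s] h(1)[of j] by (simp add: abs_mult)
   then have "\<bar>w\<bar> \<le> cmod v" using h(1)[of j] by (simp add: v_def norm_divide pos_le_divide_eq mult.commute)
   then show ?thesis using True by linarith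
  qed
  have ik: "integrable lborel (\<lambda>y. of_real (tent y) * kap (h j) (e j) s y w)"
   by (rule Bochner_Integration.integrable_bound[OF tent_integral(1)]) (use tk[OF True] tent_bounds in auto)
  have iv: "integrable lborel (\<lambda>y. of_real (tent y) * (1 / v))" by (rule integrable_mult_left) (rule tint)
  have "M j w = (LINT y|lborel. of_real (tent y) * kap (h j) (e j) s y w) - 1 / v"
   using True v1 unfolding M_def ht v_def[symmetric] by simp
  also have "1 / v = (LINT y|lborel. of_real (tent y) * (1 / v))"
   by (subst integral_mult_left_zero) (simp add: tent_integral)
  also have "(LINT y|lborel. of_real (tent y) * kap (h j) (e j) s y w) - ... = (LINT y|lborel. of_real (tent y) * kap (h j) (e j) s y w - of_real (tent y) * (1 / v))"
   by (rule Bochner_Integration.integral_diff[OF ik iv, symmetric])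
  finally have "cmod (M j w) \<le> (LINT y|lborel. cmod (of_real (tent y) * kap (h j) (e j) s y w - of_real (tent y) * (1 / v)))"
   by (metis integral_norm_bound)
  also have "... \<le> (LINT y|lborel. tent y * ((6 + 2 * L) / w\<^sup>2))"
  proof (rule integral_mono)
   show "integrable lborel (\<lambda>y. cmod (of_real (tent y) * kap (h j) (e j) s y w - of_real (tent y) * (1 / v)))"
    by (intro integrable_norm Bochner_Integration.integrable_diff ik iv)
   show "integrable lborel (\<lambda>y. tent y * ((6 + 2 * L) / w\<^sup>2))" by (rule integrable_mult_left) (rule tent_integral(1))
   fix y
   show "cmod (of_real (tent y) * kap (h j) (e j) s y w - of_real (tent y) * (1 / v)) \<le> tent y * ((6 + 2 * L) / w\<^sup>2)"
   proof (cases "\<bar>y\<bar> \<le> 1")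
    case le: True
    have "cmod (kap (h j) (e j) s y w - 1 / v) \<le> (6 + 2 * L) / w\<^sup>2"
     unfolding v_def by (rule kap_far_estimate[OF h(1,2) e le True])
    then show ?thesis unfolding right_diff_distrib[symmetric] norm_mult norm_of_real
     using tent_bounds[of y] by (simp add: mult_left_mono del: times_divide_eq_right)
   qed (simp add: tent_zero)
  qed
  also have "... = (6 + 2 * L) / w\<^sup>2" by (subst integral_mult_left_zero) (simp add: tent_integral)
  also have "... \<le> (8 + 3 * L) / (1 + w\<^sup>2)"
  proof -
   have "w\<^sup>2 > 4" using True abs_le_square_iff[of w 2] by (simp add: not_le)
   then have "(6 + 2 * L) * (1 + w\<^sup>2) \<le> (6 + 2 * L) * (5 / 4 * w\<^sup>2)" using L_nonneg by (intro mult_left_mono) auto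
   also have "... = (15/2 + 5/2 * L) * w\<^sup>2" by (simp add: algebra_simps)
   also have "... \<le> (8 + 3 * L) * w\<^sup>2" using L_nonneg by (intro mult_right_mono) auto
   finally have "(6 + 2 * L) * (1 + w\<^sup>2) \<le> (8 + 3 * L) * w\<^sup>2" .
   moreover have "0 < w\<^sup>2" "0 < 1 + w\<^sup>2" using \<open>w\<^sup>2 > 4\<close> by linarith+
   ultimately show ?thesis by (simp add: pos_divide_le_eq pos_le_divide_eq)
  qed
  finally show ?thesis .
 qed
 show ?thesis
 proof (rule odd_kernel_at_lebesgue_point[OF int leb h(1,3)])
  show "M j \<in> borel_measurable borel" for j unfolding M_def by measurable
  show "M' \<in> borel_measurable borel" unfolding M'_def by measurable
  show "cmod (M j w) \<le> (8 + 3 * L) / (1 + w\<^sup>2)" for j w by (rule bound)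
  show "M' (- w) = - M' w" for w
  proof -
   have "(LINT y|lborel. of_real (tent y) * (1 / (?c * of_real (- w - y)))) = (LINT y|lborel. of_real (tent (- y)) * (1 / (?c * of_real (- w - - y))))"
    using lborel_integral_real_affine[of "-1" "\<lambda>y. of_real (tent y) * (1 / (?c * of_real (- w - y)))" 0] by simp
   also have "... = (LINT y|lborel. - (of_real (tent y) * (1 / (?c * of_real (w - y)))))"
   proof (rule Bochner_Integration.integral_cong[OF refl])
    fix y :: real
    have "complex_of_real (- w - - y) = - of_real (w - y)" by simp
    then show "of_real (tent (- y)) * (1 / (?c * of_real (- w - - y))) = - (of_real (tent y) * (1 / (?c * of_real (w - y))))"
     unfolding tent_minus by (simp only: mult_minus_right divide_minus_right)
   qed
   finally have "(LINT y|lborel. of_real (tent y) * (1 / (?c * of_real (- w - y)))) = - (LINT y|lborel. of_real (tent y) * (1 / (?c * of_real (w - y))))"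
    by simp
   then show ?thesis unfolding M'_def by (simp add: norm_mult)
  qed
  have "AE w in lborel. w \<noteq> 1 / cmod ?c \<and> w \<noteq> - (1 / cmod ?c)"
   using AE_lborel_singleton[of "1 / cmod ?c"] AE_lborel_singleton[of "- (1 / cmod ?c)"] by eventually_elim simp
  then show "AE w in lborel. (\<lambda>j. M j w) \<longlonglongrightarrow> M' w"
  proof eventually_elim
   case (elim w)
   have ne1: "cmod (?c * of_real w) \<noteq> 1"
   proof
    assume "cmod (?c * of_real w) = 1"
    then have "\<bar>w\<bar> = 1 / cmod ?c" using c0 by (simp add: norm_mult field_simps)
    then show False using elim by linarith
   qed
   have vl: "(\<lambda>j. (z (s + h j * w) - z s) / of_real (h j)) \<longlonglongrightarrow> ?c * of_real w"
    using blowup_limit[OF A h(1,3), of w 0] by simp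
   have t: "(\<lambda>j. of_real (h j) * trunc (h j) s (s + h j * w)) \<longlonglongrightarrow> (if cmod (?c * of_real w) > 1 then 1 / (?c * of_real w) else 0)"
   proof (cases "cmod (?c * of_real w) > 1")
    case True
    have "\<forall>\<^sub>F j in sequentially. cmod ((z (s + h j * w) - z s) / of_real (h j)) > 1"
     by (rule order_tendstoD(1)[OF tendsto_norm[OF vl] True])
    then have ev: "\<forall>\<^sub>F j in sequentially. 1 / ((z (s + h j * w) - z s) / of_real (h j)) = of_real (h j) * trunc (h j) s (s + h j * w)"
     by eventually_elim (simp only: ht if_True)
    have "(\<lambda>j. 1 / ((z (s + h j * w) - z s) / of_real (h j))) \<longlonglongrightarrow> 1 / (?c * of_real w)"
     by (rule tendsto_divide[OF tendsto_const vl]) (use True in auto)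
    from Lim_transform_eventually[OF this ev] show ?thesis using True by simp
   next
    case False
    then have "cmod (?c * of_real w) < 1" using ne1 by simp
    then have "\<forall>\<^sub>F j in sequentially. cmod ((z (s + h j * w) - z s) / of_real (h j)) < 1"
     by (rule order_tendstoD(2)[OF tendsto_norm[OF vl]])
    then have ev: "\<forall>\<^sub>F j in sequentially. 0 = of_real (h j) * trunc (h j) s (s + h j * w)"
     by eventually_elim (simp only: ht not_less_iff_gr_or_eq, simp)
    from Lim_transform_eventually[OF tendsto_const ev] show ?thesis using False by simp
   qed
   have k: "(\<lambda>j. if \<bar>w\<bar> > 2 then LINT y|lborel. of_real (tent y) * kap (h j) (e j) s y w else 0)
    \<longlonglongrightarrow> (if \<bar>w\<bar> > 2 then LINT y|lborel. of_real (tent y) * (1 / (?c * of_real (w - y))) else 0)"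
   proof (cases "\<bar>w\<bar> > 2")
    case True
    have "(\<lambda>j. LINT y|lborel. of_real (tent y) * kap (h j) (e j) s y w) \<longlonglongrightarrow> (LINT y|lborel. of_real (tent y) * (1 / (?c * of_real (w - y))))"
    proof (rule integral_dominated_convergence[OF _ _ tent_integral(1)])
     show "AE y in lborel. (\<lambda>j. of_real (tent y) * kap (h j) (e j) s y w) \<longlonglongrightarrow> of_real (tent y) * (1 / (?c * of_real (w - y)))"
      using AE_lborel_singleton[of w]
      by eventually_elim (intro tendsto_mult tendsto_const kap_limit[OF A h(1,3) e], auto)
    qed (use tk[OF True] in auto)
    then show ?thesis using True by simp
   qed simp
   show ?case unfolding M_def M'_def by (rule tendsto_diff[OF k t])
  qed
 qed
qed

text \<open>Transposition moves \<open>T e\<close> onto the tent. Far from \<open>s\<close> the potential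
  of the tent is the truncated kernel up to a harmless error. Near \<open>s\<close> the function
  \<open>f\<close> is written as \<open>f s\<close> plus a remainder: the constant meets a vanishing
  potential, and the remainder is small in mean square, which the square bound for \<open>T e\<close> can
  exploit.\<close>
theorem tent_average_vs_truncation:
 assumes A: "(A has_real_derivative a) (at s)" and h: "\<And>j. h j > 0" "\<And>j. h j \<le> 1" "h \<longlonglongrightarrow> 0"
  and e: "\<And>j. 0 < e j" "\<And>j. e j \<le> (h j)\<^sup>2"
  and int: "integrable lborel f" and int2: "integrable lborel (\<lambda>x. (cmod (f x))\<^sup>2)"
  and leb: "((\<lambda>h. (LBINT x:{s-h..s+h}. cmod (f x - f s)) / h) \<longlongrightarrow> 0) (at_right 0)"
  and leb2: "((\<lambda>h. (LBINT x:{s-h..s+h}. (cmod (f x - f s))\<^sup>2) / h) \<longlongrightarrow> 0) (at_right 0)"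
 shows "(\<lambda>j. (LINT t|lborel. of_real (tent ((t - s) / h j)) * T (e j) f t) / of_real (h j)
   - (LINT t|lborel. trunc (h j) s t * f t)) \<longlonglongrightarrow> 0"
proof -
 have [measurable]: "f \<in> borel_measurable borel" using int by (auto dest: borel_measurable_integrable)
 define \<rho> where "\<rho> j t = complex_of_real (tent ((t - s) / h j))" for j t
 have [measurable]: "\<rho> j \<in> borel_measurable borel" for j unfolding \<rho>_def[abs_def] by measurable
 have \<rho>1: "cmod (\<rho> j t) \<le> 1" for j t using tent_bounds[of "(t - s) / h j"] by (simp add: \<rho>_def)
 have \<rho>0: "\<rho> j t = 0" if "t \<notin> {s - 2 * h j..s + 2 * h j}" for j t
 proof -
  have "1 \<le> \<bar>(t - s) / h j\<bar>" using h(1)[of j] that by (auto simp: abs_divide pos_le_divide_eq)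
  then show ?thesis by (simp add: \<rho>_def tent_zero)
 qed
 have \<rho>i: "integrable lborel (\<rho> j)" for j by (rule integrable_bounded_support[where B=1]) (use \<rho>1 \<rho>0 in auto)
 define X where "X j = T (e j) (\<rho> j)" for j
 have [measurable]: "X j \<in> borel_measurable borel" for j unfolding X_def by measurable
 define G :: "nat => real => complex" where "G j = indicator {s - 2 * h j..s + 2 * h j}" for j
 have [measurable]: "G j \<in> borel_measurable borel" for j by (simp add: G_def)
 define a1 where "a1 j = (LBINT t:{s - 2 * h j..s + 2 * h j}. (f t - f s) * X j t) / of_real (h j)" for j
 define b1 where "b1 j = (LBINT t:{s - 2 * h j..s + 2 * h j}. X j t) / of_real (h j)" for j
 define M where "M j w = (if \<bar>w\<bar> > 2 then LINT v|lborel. of_real (tent v) * kap (h j) (e j) s v w else 0)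
   - of_real (h j) * trunc (h j) s (s + h j * w)" for j w
 define c1 where "c1 j = (LINT w|lborel. f (s + h j * w) * M j w)" for j
 have c1: "c1 \<longlonglongrightarrow> 0" unfolding c1_def M_def by (rule far_kernel_limit[OF A h e int leb])
 have b1: "b1 \<longlonglongrightarrow> 0" unfolding b1_def X_def \<rho>_def[abs_def] by (rule tent_potential_near[OF A h(1,3) e])
 have fs2: "set_integrable lborel {s - 2 * h j..s + 2 * h j} (\<lambda>t. (cmod (f t - f s))\<^sup>2)" for j
 proof -
  have i: "set_integrable lborel {s - 2 * h j..s + 2 * h j} (\<lambda>t. 2 * (cmod (f t))\<^sup>2 + 2 * (cmod (f s))\<^sup>2)"
   using set_integrable_restrict[OF int2, of "{s - 2 * h j..s + 2 * h j}"]
   by (intro set_integral_add set_integrable_mult_right) (auto simp: set_integrable_def)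
  have le: "(cmod (f t - f s))\<^sup>2 \<le> 2 * (cmod (f t))\<^sup>2 + 2 * (cmod (f s))\<^sup>2" for t
  proof -
   have "(cmod (f t - f s))\<^sup>2 \<le> (cmod (f t) + cmod (f s))\<^sup>2" by (intro power_mono norm_triangle_ineq4) simp
   also have "... \<le> 2 * (cmod (f t))\<^sup>2 + 2 * (cmod (f s))\<^sup>2"
    using zero_le_power2[of "cmod (f t) - cmod (f s)"] by (simp add: power2_eq_square algebra_simps)
   finally show ?thesis .
  qed
  show ?thesis unfolding set_integrable_def
   by (rule Bochner_Integration.integrable_bound[OF i[unfolded set_integrable_def]]) (use le in \<open>auto simp: indicator_def\<close>)
 qed
 have pair: "set_integrable lborel {s - 2 * h j..s + 2 * h j} (\<lambda>t. (f t - f s) * X j t)"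
  "cmod (LBINT t:{s - 2 * h j..s + 2 * h j}. (f t - f s) * X j t)
   \<le> \<eta> * (C2 * (s + 2 * h j - (s - 2 * h j))) + (LBINT t:{s - 2 * h j..s + 2 * h j}. (cmod (f t - f s))\<^sup>2) / \<eta>"
  if "\<eta> > 0" for j \<eta>
 proof -
  have ab: "s - 2 * h j < s + 2 * h j" using h(1)[of j] by simp
  have m: "(\<lambda>t. f t - f s) \<in> borel_measurable borel" by measurable
  show "set_integrable lborel {s - 2 * h j..s + 2 * h j} (\<lambda>t. (f t - f s) * X j t)"
   unfolding X_def by (rule T_pairing_bound(1)[OF e(1) ab _ m \<rho>1 \<rho>0 fs2 that]) measurable
  show "cmod (LBINT t:{s - 2 * h j..s + 2 * h j}. (f t - f s) * X j t)
   \<le> \<eta> * (C2 * (s + 2 * h j - (s - 2 * h j))) + (LBINT t:{s - 2 * h j..s + 2 * h j}. (cmod (f t - f s))\<^sup>2) / \<eta>"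
   unfolding X_def by (rule T_pairing_bound(2)[OF e(1) ab _ m \<rho>1 \<rho>0 fs2 that]) measurable
 qed
 have ipair: "set_integrable lborel {s - 2 * h j..s + 2 * h j} (\<lambda>t. (f t - f s) * X j t)" for j
  by (rule pair(1)[where \<eta>=1]) simp
 have a1: "a1 \<longlonglongrightarrow> 0"
 proof (rule LIMSEQ_I)
  fix r :: real assume r: "r > 0"
  define D where "D = C2 + 1"
  have D: "D > 0" "C2 \<le> D" using C2_nonneg by (auto simp: D_def)
  define \<eta> where "\<eta> = r / (8 * D)"
  have \<eta>0: "\<eta> > 0" using r D by (simp add: \<eta>_def)
  have "\<eta> * (C2 * 4) \<le> \<eta> * (D * 4)" using \<eta>0 D by (intro mult_left_mono) auto
  also have "... = r / 2" using D(1) by (simp add: \<eta>_def)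
  finally have \<eta>: "\<eta> > 0" "\<eta> * (C2 * 4) < r / 2 + r/4" using r \<eta>0 by auto
  have "filterlim (\<lambda>j. 2 * h j) (at_right 0) sequentially"
   using tendsto_mult_right_zero[OF h(3), of 2] h(1) less_imp_neq[OF h(1)] by (auto simp: filterlim_at intro!: always_eventually)
  from filterlim_compose[OF leb2 this]
  have "(\<lambda>j. (LBINT x:{s - 2 * h j..s + 2 * h j}. (cmod (f x - f s))\<^sup>2) / (2 * h j)) \<longlonglongrightarrow> 0" .
  moreover have "\<eta> * r / 8 > 0" using \<eta> r by simp
  ultimately have "\<forall>\<^sub>F j in sequentially. (LBINT x:{s - 2 * h j..s + 2 * h j}. (cmod (f x - f s))\<^sup>2) / (2 * h j) < \<eta> * r / 8"
   by (rule order_tendstoD(2))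
  then obtain N where N: "\<And>j. j \<ge> N ==> (LBINT x:{s - 2 * h j..s + 2 * h j}. (cmod (f x - f s))\<^sup>2) / (2 * h j) < \<eta> * r / 8"
   unfolding eventually_sequentially by blast
  have "norm (a1 j - 0) < r" if "j \<ge> N" for j
  proof -
   note hj = h(1)[of j]
   let ?F = "LBINT x:{s - 2 * h j..s + 2 * h j}. (cmod (f x - f s))\<^sup>2"
   have "cmod (LBINT t:{s - 2 * h j..s + 2 * h j}. (f t - f s) * X j t) \<le> \<eta> * (C2 * (s + 2 * h j - (s - 2 * h j))) + ?F / \<eta>"
    by (rule pair(2)[OF \<eta>(1)])
   then have "cmod (a1 j) \<le> (\<eta> * (C2 * (4 * h j)) + ?F / \<eta>) / h j"
    unfolding a1_def norm_divide using hj by (simp add: divide_right_mono)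
   also have "... = \<eta> * (C2 * 4) + 2 * (?F / (2 * h j)) / \<eta>" using hj \<eta> by (simp add: field_simps)
   also have "2 * (?F / (2 * h j)) / \<eta> \<le> 2 * (\<eta> * r / 8) / \<eta>"
    using N[OF that] \<eta> by (intro divide_right_mono mult_left_mono) auto
   also have "... = r / 4" using \<eta> by simp
   finally show ?thesis using \<eta> by simp
  qed
  then show "\<exists>N. \<forall>j\<ge>N. norm (a1 j - 0) < r" by blast
 qed
 have eq: "(LINT t|lborel. of_real (tent ((t - s) / h j)) * T (e j) f t) / of_real (h j) - (LINT t|lborel. trunc (h j) s t * f t)
   = - a1 j - f s * b1 j + c1 j" for j
 proof -
  note hj = h(1)[of j] and ej = e(1)[of j]
  obtain B where B: "\<And>t. cmod (X j t) \<le> B" unfolding X_def using norm_T_le[OF \<rho>i ej] by blast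
  have ifX: "integrable lborel (\<lambda>t. f t * X j t)"
  proof (rule Bochner_Integration.integrable_bound[OF integrable_mult_right[OF integrable_norm[OF int], of B]])
   have "cmod (f t * X j t) \<le> B * cmod (f t)" for t using mult_left_mono[OF B[of t], of "cmod (f t)"] by (simp add: norm_mult mult.commute)
   then show "AE t in lborel. norm (f t * X j t) \<le> norm (B * cmod (f t))" by (intro AE_I2) (auto intro: order_trans[OF _ abs_ge_self])
  qed measurable
  have iGX: "integrable lborel (\<lambda>t. G j t * X j t)"
   by (rule integrable_bounded_support[where B=B and a="s - 2 * h j" and b="s + 2 * h j"])
    (use B order_trans[OF norm_ge_zero B] in \<open>auto simp: G_def indicator_def norm_mult\<close>)
  have iGfX: "integrable lborel (\<lambda>t. G j t * ((f t - f s) * X j t))"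
  proof -
   have "(\<lambda>t. G j t * ((f t - f s) * X j t)) = (\<lambda>t. indicat_real {s - 2 * h j..s + 2 * h j} t *\<^sub>R ((f t - f s) * X j t))"
    by (auto simp: G_def indicator_def)
   then show ?thesis using ipair[of j] by (simp add: set_integrable_def)
  qed
  have isum: "integrable lborel (\<lambda>t. G j t * ((f t - f s) * X j t) + f s * (G j t * X j t))"
   by (intro Bochner_Integration.integrable_add iGfX integrable_mult_right iGX)
  have iT: "integrable lborel (\<lambda>t. trunc (h j) s t * f t)"
  proof (rule Bochner_Integration.integrable_bound[OF integrable_mult_right[OF integrable_norm[OF int], of "1 / h j"]])
   have "cmod (trunc (h j) s t * f t) \<le> 1 / h j * cmod (f t)" for t
    unfolding norm_mult by (rule mult_right_mono[OF norm_trunc_le[OF hj]]) simp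
   then show "AE t in lborel. norm (trunc (h j) s t * f t) \<le> norm (1 / h j * cmod (f t))"
    using hj by (intro AE_I2) auto
  qed measurable
  have "(LINT t|lborel. \<rho> j t * T (e j) f t) = - (LINT t|lborel. f t * X j t)"
   unfolding X_def by (rule T_transpose[OF ej int \<rho>i])
  moreover have "(LINT t|lborel. f t * X j t) = (LINT t|lborel. (G j t * ((f t - f s) * X j t) + f s * (G j t * X j t)) + (1 - G j t) * (f t * X j t))"
   by (intro Bochner_Integration.integral_cong) (auto simp: algebra_simps)
  moreover have i3: "integrable lborel (\<lambda>t. (1 - G j t) * (f t * X j t))"
  proof -
   have "(\<lambda>t. (1 - G j t) * (f t * X j t)) = (\<lambda>t. f t * X j t - (G j t * ((f t - f s) * X j t) + f s * (G j t * X j t)))"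
    by (auto simp: algebra_simps)
   then show ?thesis using Bochner_Integration.integrable_diff[OF ifX isum] by simp
  qed
  moreover have "(LINT t|lborel. (G j t * ((f t - f s) * X j t) + f s * (G j t * X j t)) + (1 - G j t) * (f t * X j t))
   = (LINT t|lborel. G j t * ((f t - f s) * X j t)) + f s * (LINT t|lborel. G j t * X j t) + (LINT t|lborel. (1 - G j t) * (f t * X j t))"
   by (simp add: Bochner_Integration.integral_add[OF isum i3] Bochner_Integration.integral_add[OF iGfX integrable_mult_right[OF iGX]])
  ultimately have 1: "(LINT t|lborel. \<rho> j t * T (e j) f t) = - ((LINT t|lborel. G j t * ((f t - f s) * X j t)) + f s * (LINT t|lborel. G j t * X j t) + (LINT t|lborel. (1 - G j t) * (f t * X j t)))"
   by simp
  have a1': "(LINT t|lborel. G j t * ((f t - f s) * X j t)) = a1 j * of_real (h j)"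
   unfolding a1_def set_lebesgue_integral_def G_def using hj by (simp, intro Bochner_Integration.integral_cong) (auto simp: indicator_def)
  have b1': "(LINT t|lborel. G j t * X j t) = b1 j * of_real (h j)"
   unfolding b1_def set_lebesgue_integral_def G_def using hj by (simp, intro Bochner_Integration.integral_cong) (auto simp: indicator_def)
  have MX: "M j w = - ((1 - G j (s + h j * w)) * X j (s + h j * w)) - of_real (h j) * trunc (h j) s (s + h j * w)" for w
  proof -
   have "X j (s + h j * w) = \<bar>h j\<bar> *\<^sub>R (LINT v|lborel. ker (e j) (s + h j * w) (s + h j * v) * \<rho> j (s + h j * v))"
    unfolding X_def T_def by (rule lborel_integral_real_affine) (use hj in simp)
   also have "... = (LINT v|lborel. - (of_real (tent v) * kap (h j) (e j) s v w))"
    unfolding scaleR_conv_of_real integral_mult_right_zero[symmetric]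
   proof (rule Bochner_Integration.integral_cong[OF refl])
    fix v
    have "\<rho> j (s + h j * v) = of_real (tent v)" using hj by (simp add: \<rho>_def)
    moreover have "of_real \<bar>h j\<bar> * ker (e j) (s + h j * w) (s + h j * v) = - kap (h j) (e j) s v w"
     using hj kap_antisym[of "h j" "e j" s w v] by (simp add: kap_def)
    ultimately show "of_real \<bar>h j\<bar> * (ker (e j) (s + h j * w) (s + h j * v) * \<rho> j (s + h j * v)) = - (of_real (tent v) * kap (h j) (e j) s v w)"
     by (metis mult.assoc mult.commute mult_minus_right)
   qed
   finally have X: "X j (s + h j * w) = - (LINT v|lborel. of_real (tent v) * kap (h j) (e j) s v w)" by simp
   have "1 - G j (s + h j * w) = (if \<bar>w\<bar> > 2 then 1 else 0)"
   proof -
    have "s - 2 * h j \<le> s + h j * w \<longleftrightarrow> - 2 \<le> w" using hj mult_le_cancel_left_pos[of "h j" "-2" w] by (simp add: mult.commute)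
    moreover have "s + h j * w \<le> s + 2 * h j \<longleftrightarrow> w \<le> 2" using hj mult_le_cancel_left_pos[of "h j" w 2] by (simp add: mult.commute)
    ultimately show ?thesis by (auto simp: G_def indicator_def)
   qed
   then show ?thesis unfolding M_def X by simp
  qed
  have s1: "(LINT t|lborel. f t * (- ((1 - G j t) * X j t) - of_real (h j) * trunc (h j) s t)) = \<bar>h j\<bar> *\<^sub>R c1 j"
   unfolding c1_def MX by (rule lborel_integral_real_affine) (use hj in simp)
  have "(LINT t|lborel. f t * (- ((1 - G j t) * X j t) - of_real (h j) * trunc (h j) s t))
    = (LINT t|lborel. - ((1 - G j t) * (f t * X j t)) - of_real (h j) * (trunc (h j) s t * f t))"
   by (intro Bochner_Integration.integral_cong) (auto simp: algebra_simps)
  also have "... = - (LINT t|lborel. (1 - G j t) * (f t * X j t)) - of_real (h j) * (LINT t|lborel. trunc (h j) s t * f t)"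
   by (subst Bochner_Integration.integral_diff) (auto intro: i3 iT integrable_mult_right)
  finally have "\<bar>h j\<bar> *\<^sub>R c1 j = - (LINT t|lborel. (1 - G j t) * (f t * X j t)) - of_real (h j) * (LINT t|lborel. trunc (h j) s t * f t)"
   unfolding s1 .
  then have E: "of_real (h j) * c1 j = - (LINT t|lborel. (1 - G j t) * (f t * X j t)) - of_real (h j) * (LINT t|lborel. trunc (h j) s t * f t)"
   using hj by (simp only: scaleR_conv_of_real abs_of_pos)
  have c1': "(LINT t|lborel. (1 - G j t) * (f t * X j t)) = - (of_real (h j) * c1 j) - of_real (h j) * (LINT t|lborel. trunc (h j) s t * f t)"
   unfolding E by simp
  have "(LINT t|lborel. \<rho> j t * T (e j) f t) = of_real (h j) * (- a1 j - f s * b1 j + c1 j + (LINT t|lborel. trunc (h j) s t * f t))"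
   unfolding 1 a1' b1' c1' by (simp add: algebra_simps)
  then have "(LINT t|lborel. \<rho> j t * T (e j) f t) / of_real (h j) = - a1 j - f s * b1 j + c1 j + (LINT t|lborel. trunc (h j) s t * f t)"
   using hj by simp
  then show ?thesis unfolding \<rho>_def by simp
 qed
 have "(\<lambda>j. - a1 j - f s * b1 j + c1 j) \<longlonglongrightarrow> - 0 - f s * 0 + 0" by (intro tendsto_intros a1 b1 c1)
 then show ?thesis unfolding eq by simp
qed

end

section \<open>Selection of limits and averages of monotone functions\<close>

lemma Helly_selection_family:
 fixes F :: "nat => nat => real => real"
 assumes rc: "\<And>n j x. continuous (at_right x) (F n j)" and mono: "\<And>n j. mono (F n j)"
  and bd: "\<And>n j x. \<bar>F n j x\<bar> \<le> K"
 shows "\<exists>r. strict_mono (r :: nat => nat) \<and> (\<forall>j<k. \<exists>G. (\<forall>x. continuous (at_right x) G) \<and> mono G \<and> (\<forall>x. \<bar>G x\<bar> \<le> K) \<and>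
   (\<forall>x. continuous (at x) G \<longrightarrow> (\<lambda>n. F (r n) j x) \<longlonglongrightarrow> G x))"
proof (induction k)
 case 0
 show ?case by (intro exI[of _ "\<lambda>n. n"]) (simp add: strict_mono_def)
next
 case (Suc k)
 then obtain r where r: "strict_mono (r :: nat => nat)" "\<And>j. j < k ==> \<exists>G. (\<forall>x. continuous (at_right x) G) \<and> mono G \<and> (\<forall>x. \<bar>G x\<bar> \<le> K) \<and>
   (\<forall>x. continuous (at x) G \<longrightarrow> (\<lambda>n. F (r n) j x) \<longlonglongrightarrow> G x)" by blast
 obtain r' G' where r': "strict_mono (r' :: nat => nat)" "\<And>x. continuous (at_right x) G'" "mono G'" "\<And>x. \<bar>G' x\<bar> \<le> K"
   "\<And>x. continuous (at x) G' ==> (\<lambda>n. F (r (r' n)) k x) \<longlonglongrightarrow> G' x"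
  using Helly_selection[of "\<lambda>n. F (r n) k" K] rc mono bd by blast
 show ?case
 proof (intro exI[of _ "r \<circ> r'"] conjI allI impI)
  show "strict_mono (r \<circ> r')" by (rule strict_mono_o[OF r(1) r'(1)])
  fix j assume "j < Suc k"
  then consider "j < k" | "j = k" by linarith
  then show "\<exists>G. (\<forall>x. continuous (at_right x) G) \<and> mono G \<and> (\<forall>x. \<bar>G x\<bar> \<le> K) \<and>
   (\<forall>x. continuous (at x) G \<longrightarrow> (\<lambda>n. F ((r \<circ> r') n) j x) \<longlonglongrightarrow> G x)"
  proof cases
   case 1
   then obtain G where G: "\<forall>x. continuous (at_right x) G" "mono G" "\<forall>x. \<bar>G x\<bar> \<le> K"
    "\<And>x. continuous (at x) G ==> (\<lambda>n. F (r n) j x) \<longlonglongrightarrow> G x" using r(2) by blast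
   have "(\<lambda>n. F ((r \<circ> r') n) j x) \<longlonglongrightarrow> G x" if "continuous (at x) G" for x
    using LIMSEQ_subseq_LIMSEQ[OF G(4)[OF that] r'(1)] by (simp add: o_def)
   then show ?thesis using G by blast
  next
   case 2
   then show ?thesis using r' by (intro exI[of _ G']) (auto simp: o_def)
  qed
 qed
qed

lemma indefinite_integral_continuous:
 fixes p :: "real => real"
 assumes p: "integrable lborel p"
 shows "continuous (at x) (\<lambda>x. LINT y|lborel. indicator {..x} y * p y)"
 unfolding continuous_at_sequentially
proof (intro allI impI)
 fix u :: "nat => real" assume u: "u \<longlonglongrightarrow> x"
 have [measurable]: "p \<in> borel_measurable borel" using p by (auto dest: borel_measurable_integrable)
 have "(\<lambda>k. LINT y|lborel. indicator {..u k} y * p y) \<longlonglongrightarrow> (LINT y|lborel. indicator {..x} y * p y)"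
 proof (rule integral_dominated_convergence[OF _ _ integrable_norm[OF p]])
  show "AE y in lborel. (\<lambda>k. indicator {..u k} y * p y) \<longlonglongrightarrow> indicator {..x} y * p y"
   using AE_lborel_singleton[of x]
  proof eventually_elim
   case (elim y)
   have "\<forall>\<^sub>F k in sequentially. indicator {..x} y * p y = indicator {..u k} y * p y"
   proof (cases "y < x")
    case True
    from order_tendstoD(1)[OF u this] show ?thesis by eventually_elim (use True in auto)
   next
    case False
    then have "x < y" using elim by simp
    from order_tendstoD(2)[OF u this] show ?thesis by eventually_elim (use \<open>x < y\<close> in auto)
   qed
   then show ?case by (rule Lim_transform_eventually[OF tendsto_const])
  qed
 qed (auto simp: indicator_def)
 then show "((\<lambda>x. LINT y|lborel. indicator {..x} y * p y) \<circ> u) \<longlonglongrightarrow> (LINT y|lborel. indicator {..x} y * p y)"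
  by (simp add: o_def)
qed

context lipschitz_graph
begin

lemma tent_layers: "(LINT l|lborel. indicat_real {0..1::real} l * (if \<bar>x\<bar> \<le> l then 1 else 0)) = tent x"
proof -
 have "(LINT l|lborel. indicat_real {0..1::real} l * (if \<bar>x\<bar> \<le> l then 1 else 0)) = (LINT l|lborel. indicat_real {\<bar>x\<bar>..1} l)"
  by (intro Bochner_Integration.integral_cong) (auto simp: indicator_def)
 also have "... = tent x" by (auto simp: tent_def measure_def emeasure_lborel_Icc_eq)
 finally show ?thesis .
qed

text \<open>A tent average is a mean of averages over intervals, and these are increments of a
  primitive.\<close>
lemma tent_average_layers:
 assumes v: "integrable lborel (v :: real => complex)" and h: "h > 0"
 shows "(LINT t|lborel. of_real (tent ((t - s) / h)) * v t) =
  (LINT l|lborel. of_real (indicat_real {0..1::real} l) * (LBINT t:{s - l * h<..s + l * h}. v t))"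
  and "integrable lborel (\<lambda>l. of_real (indicat_real {0..1::real} l) * (LBINT t:{s - l * h<..s + l * h}. v t))"
proof -
 have [measurable]: "v \<in> borel_measurable borel" using v by (auto dest: borel_measurable_integrable)
 define k where "k t l = complex_of_real (indicat_real {0..1::real} l * (if \<bar>(t - s) / h\<bar> \<le> l then 1 else 0)) * v t" for t l
 have km: "case_prod k \<in> borel_measurable (lborel \<Otimes>\<^sub>M lborel)" unfolding k_def by measurable
 have kb: "cmod (k t l) \<le> indicat_real {0..1::real} l * cmod (v t)" for t l by (auto simp: k_def norm_mult indicator_def)
 have ki: "integrable lborel (k t)" for t
 proof -
  have "integrable lborel (\<lambda>l. indicat_real {0..1::real} l * cmod (v t))" by (intro integrable_mult_left) simp
  then show ?thesis by (rule Bochner_Integration.integrable_bound) (use kb in \<open>auto simp: k_def[abs_def]\<close>)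
 qed
 have kn: "(LINT l|lborel. cmod (k t l)) \<le> cmod (v t)" for t
 proof -
  have "(LINT l|lborel. cmod (k t l)) \<le> (LINT l|lborel. indicat_real {0..1::real} l * cmod (v t))"
   by (intro integral_mono integrable_norm ki kb integrable_mult_left) simp
  then show ?thesis by simp
 qed
 have prod: "integrable (lborel \<Otimes>\<^sub>M lborel) (case_prod k)"
 proof (rule lborel_pair.Fubini_integrable[OF km])
  show "AE t in lborel. integrable lborel (\<lambda>l. case (t, l) of (t, l) => k t l)" using ki by simp
  have "(\<lambda>t. LINT l|lborel. norm (case (t, l) of (t, l) => k t l)) \<in> borel_measurable lborel"
   unfolding k_def by measurable
  then show "integrable lborel (\<lambda>t. LINT l|lborel. norm (case (t, l) of (t, l) => k t l))"
   by (rule Bochner_Integration.integrable_bound[OF integrable_norm[OF v]])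
    (use kn in \<open>auto intro!: AE_I2 simp: abs_of_nonneg integral_nonneg_AE\<close>)
 qed
 have inner: "(LINT t|lborel. k t l) = of_real (indicat_real {0..1::real} l) * (LBINT t:{s - l * h<..s + l * h}. v t)" for l
 proof -
  have "(LINT t|lborel. k t l) = of_real (indicat_real {0..1::real} l) * (LINT t|lborel. of_real (if \<bar>(t - s) / h\<bar> \<le> l then 1 else 0) * v t)"
   unfolding k_def by (simp add: mult.assoc)
  also have "(LINT t|lborel. of_real (if \<bar>(t - s) / h\<bar> \<le> l then 1 else 0) * v t) = (LBINT t:{s - l * h<..s + l * h}. v t)"
   unfolding set_lebesgue_integral_def
  proof (rule integral_cong_AE)
   show "AE t in lborel. of_real (if \<bar>(t - s) / h\<bar> \<le> l then 1 else 0) * v t = indicat_real {s - l * h<..s + l * h} t *\<^sub>R v t"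
    using AE_lborel_singleton[of "s - l * h"]
   proof eventually_elim
    case (elim t)
    have "\<bar>(t - s) / h\<bar> \<le> l \<longleftrightarrow> \<bar>t - s\<bar> \<le> l * h" using h by (simp add: abs_divide pos_divide_le_eq)
    also have "... \<longleftrightarrow> t \<in> {s - l * h<..s + l * h}" using elim by auto
    finally show ?case by (auto simp: indicator_def)
   qed
  qed measurable
  finally show ?thesis .
 qed
 have "(LINT t|lborel. of_real (tent ((t - s) / h)) * v t) = (LINT t|lborel. LINT l|lborel. k t l)"
 proof (rule Bochner_Integration.integral_cong[OF refl])
  fix t
  have "(LINT l|lborel. k t l) = (LINT l|lborel. complex_of_real (indicat_real {0..1::real} l * (if \<bar>(t - s) / h\<bar> \<le> l then 1 else 0))) * v t"
   unfolding k_def by (rule integral_mult_left_zero)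
  then show "of_real (tent ((t - s) / h)) * v t = (LINT l|lborel. k t l)"
   unfolding integral_complex_of_real tent_layers by simp
 qed
 also have "... = (LINT l|lborel. LINT t|lborel. k t l)"
  using lborel_pair.Fubini_integral[OF prod] by simp
 finally show "(LINT t|lborel. of_real (tent ((t - s) / h)) * v t) =
  (LINT l|lborel. of_real (indicat_real {0..1::real} l) * (LBINT t:{s - l * h<..s + l * h}. v t))" unfolding inner .
 show "integrable lborel (\<lambda>l. of_real (indicat_real {0..1::real} l) * (LBINT t:{s - l * h<..s + l * h}. v t))"
  using lborel_pair.integrable_snd[OF prod] unfolding inner .
qed

definition layer_avg :: "(real => real) => real => real => real" where
 "layer_avg F s h = (LINT l|lborel. indicat_real {0..1::real} l * (F (s + l * h) - F (s - l * h))) / h"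

lemma layer_avg_integrable:
 fixes F :: "real => real"
 assumes "mono F" "\<And>x. \<bar>F x\<bar> \<le> K"
 shows "integrable lborel (\<lambda>l. indicat_real {0..1::real} l * (F (s + l * h) - F (s - l * h)))"
proof -
 have [measurable]: "F \<in> borel_measurable borel" by (rule borel_measurable_mono[OF assms(1)])
 have K0: "K \<ge> 0" using assms(2)[of 0] by linarith
 show ?thesis
 proof (rule Bochner_Integration.integrable_bound)
  show "integrable lborel (\<lambda>l. 2 * K * indicat_real {0..1::real} l)" by (intro integrable_mult_right) simp
  have "\<bar>F (s + l * h) - F (s - l * h)\<bar> \<le> 2 * K" for l using assms(2)[of "s + l * h"] assms(2)[of "s - l * h"] by linarith
  then show "AE l in lborel. norm (indicat_real {0..1::real} l * (F (s + l * h) - F (s - l * h))) \<le> norm (2 * K * indicat_real {0..1::real} l)"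
   using K0 by (intro AE_I2) (auto simp: indicator_def)
 qed measurable
qed

text \<open>The limit is known only at continuity points of \<open>G\<close>; the exceptions are countable
  and do not affect the integral over the layers.\<close>
lemma layer_avg_converges:
 assumes m: "\<And>n. mono (F n)" "mono G" and b: "\<And>n x. \<bar>F n x\<bar> \<le> K" and h: "h > 0"
  and lim: "\<And>x. continuous (at x) G ==> (\<lambda>n. F n x) \<longlonglongrightarrow> G x"
 shows "(\<lambda>n. layer_avg (F n) s h) \<longlonglongrightarrow> layer_avg G s h"
proof -
 have [measurable]: "F n \<in> borel_measurable borel" "G \<in> borel_measurable borel" for n
  using m by (auto intro: borel_measurable_mono)
 have K0: "K \<ge> 0" using b[of 0 0] by linarith
 define D where "D = {x. \<not> isCont G x}"
 have cD: "countable D" unfolding D_def by (rule mono_ctble_discont[OF m(2)])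
 define E where "E = (\<lambda>x. (x - s) / h) ` D \<union> (\<lambda>x. (s - x) / h) ` D"
 have "AE l in lborel. l \<notin> E"
  by (rule AE_not_in, rule countable_imp_null_set_lborel) (use cD in \<open>auto simp: E_def\<close>)
 then have ae: "AE l in lborel. (\<lambda>n. indicat_real {0..1::real} l * (F n (s + l * h) - F n (s - l * h))) \<longlonglongrightarrow> indicat_real {0..1::real} l * (G (s + l * h) - G (s - l * h))"
 proof eventually_elim
  case (elim l)
  have "s + l * h \<notin> D"
  proof
   assume "s + l * h \<in> D"
   then have "(s + l * h - s) / h \<in> E" unfolding E_def by blast
   then show False using elim h by simp
  qed
  moreover have "s - l * h \<notin> D"
  proof
   assume "s - l * h \<in> D"
   then have "(s - (s - l * h)) / h \<in> E" unfolding E_def by blast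
   then show False using elim h by simp
  qed
  ultimately show ?case unfolding D_def by (intro tendsto_intros lim) auto
 qed
 have "(\<lambda>n. LINT l|lborel. indicat_real {0..1::real} l * (F n (s + l * h) - F n (s - l * h))) \<longlonglongrightarrow> (LINT l|lborel. indicat_real {0..1::real} l * (G (s + l * h) - G (s - l * h)))"
 proof (rule integral_dominated_convergence[OF _ _ _ ae])
  show "integrable lborel (\<lambda>l. 2 * K * indicat_real {0..1::real} l)" by (intro integrable_mult_right) simp
  have "\<bar>F n (s + l * h) - F n (s - l * h)\<bar> \<le> 2 * K" for l n using b[of n "s + l * h"] b[of n "s - l * h"] by linarith
  then show "AE l in lborel. norm (indicat_real {0..1::real} l * (F n (s + l * h) - F n (s - l * h))) \<le> 2 * K * indicat_real {0..1::real} l" for n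
   using K0 by (intro AE_I2) (auto simp: indicator_def)
 qed measurable
 then show ?thesis unfolding layer_avg_def using h by (intro tendsto_divide tendsto_const) auto
qed

lemma layer_avg_derivative:
 assumes G: "(G has_real_derivative d) (at s)" and m: "mono G"
  and h: "\<And>i. h i > 0" "h \<longlonglongrightarrow> 0"
 shows "(\<lambda>i. layer_avg G s (h i)) \<longlonglongrightarrow> d"
proof -
 have [measurable]: "G \<in> borel_measurable borel" by (rule borel_measurable_mono[OF m])
 have q: "((\<lambda>y. (G (s + y) - G s) / y) \<longlongrightarrow> d) (at 0)" using G by (simp add: DERIV_def)
 then have "\<forall>\<^sub>F y in at 0. dist ((G (s + y) - G s) / y) d < 1" by (rule tendstoD) simp
 then obtain e where e: "e > 0" "\<And>y. y \<noteq> 0 ==> \<bar>y\<bar> < e ==> dist ((G (s + y) - G s) / y) d < 1"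
  unfolding eventually_at by (auto simp: dist_real_def)
 have Gb: "\<bar>G (s + y) - G s\<bar> \<le> (\<bar>d\<bar> + 1) * \<bar>y\<bar>" if "\<bar>y\<bar> < e" for y
 proof (cases "y = 0")
  case False
  have "\<bar>(G (s + y) - G s) / y\<bar> \<le> \<bar>d\<bar> + 1" using e(2)[OF False that] by (auto simp: dist_real_def)
  then show ?thesis using False by (simp add: abs_divide pos_divide_le_eq)
 qed simp
 have "\<forall>\<^sub>F i in sequentially. h i < e" by (rule order_tendstoD(2)[OF h(2) e(1)])
 then obtain N where N: "\<And>i. i \<ge> N ==> h i < e" unfolding eventually_sequentially by blast
 define f where "f i l = indicat_real {0..1::real} l * ((G (s + l * h (i + N)) - G (s - l * h (i + N))) / h (i + N))" for i l
 have "(\<lambda>i. LINT l|lborel. f i l) \<longlonglongrightarrow> (LINT l|lborel. indicat_real {0..1::real} l * (2 * l * d))"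
 proof (rule integral_dominated_convergence)
  show "integrable lborel (\<lambda>l. 2 * (\<bar>d\<bar> + 1) * indicat_real {0..1::real} l)" by (intro integrable_mult_right) simp
  show "AE l in lborel. norm (f i l) \<le> 2 * (\<bar>d\<bar> + 1) * indicat_real {0..1::real} l" for i
  proof (rule AE_I2)
   fix l :: real
   show "norm (f i l) \<le> 2 * (\<bar>d\<bar> + 1) * indicat_real {0..1::real} l"
   proof (cases "l \<in> {0..1}")
    case True
    let ?h = "h (i + N)"
    have hp: "?h > 0" "?h < e" using h(1) N by auto
    have "l * ?h \<le> ?h" using True hp by (simp add: mult_left_le_one_le)
    moreover have "0 \<le> l * ?h" using True hp by simp
    ultimately have l: "\<bar>l * ?h\<bar> < e" "\<bar>l * ?h\<bar> \<le> ?h" using hp by linarith+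
    have "\<bar>G (s + l * ?h) - G (s - l * ?h)\<bar> \<le> \<bar>G (s + l * ?h) - G s\<bar> + \<bar>G (s + - (l * ?h)) - G s\<bar>" by simp
    also have "... \<le> (\<bar>d\<bar> + 1) * \<bar>l * ?h\<bar> + (\<bar>d\<bar> + 1) * \<bar>- (l * ?h)\<bar>" using l by (intro add_mono Gb) auto
    also have "... = 2 * (\<bar>d\<bar> + 1) * \<bar>l * ?h\<bar>" by simp
    also have "... \<le> 2 * (\<bar>d\<bar> + 1) * ?h" using l by (intro mult_left_mono) auto
    finally show ?thesis using True hp by (simp add: f_def abs_divide pos_divide_le_eq)
   qed (simp add: f_def)
  qed
  show "AE l in lborel. (\<lambda>i. f i l) \<longlonglongrightarrow> indicat_real {0..1::real} l * (2 * l * d)"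
   using AE_lborel_singleton[of "0::real"]
  proof eventually_elim
   case (elim l)
   have hN: "(\<lambda>i. h (i + N)) \<longlonglongrightarrow> 0" using h(2) by (rule LIMSEQ_ignore_initial_segment)
   have hne: "h i \<noteq> 0" for i using h(1)[of i] by simp
   have 1: "(\<lambda>i. (G (s + x * h (i + N)) - G s) / (x * h (i + N))) \<longlonglongrightarrow> d" if "x \<noteq> 0" for x
   proof -
    have "filterlim (\<lambda>i. x * h (i + N)) (at 0) sequentially"
     using tendsto_mult_right_zero[OF hN, of x] hne that by (auto simp: filterlim_at intro!: always_eventually)
    from filterlim_compose[OF q this] show ?thesis .
   qed
   have "(\<lambda>i. l * ((G (s + l * h (i + N)) - G s) / (l * h (i + N))) - (- l) * ((G (s + (- l) * h (i + N)) - G s) / ((- l) * h (i + N)))) \<longlonglongrightarrow> l * d - (- l) * d"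
    using elim by (intro tendsto_intros 1) auto
   moreover have "l * ((G (s + l * h (i + N)) - G s) / (l * h (i + N))) - (- l) * ((G (s + (- l) * h (i + N)) - G s) / ((- l) * h (i + N)))
     = (G (s + l * h (i + N)) - G (s - l * h (i + N))) / h (i + N)" for i
    using elim hne[of "i + N"] by (simp add: diff_divide_distrib[symmetric])
   ultimately have "(\<lambda>i. (G (s + l * h (i + N)) - G (s - l * h (i + N))) / h (i + N)) \<longlonglongrightarrow> 2 * l * d" by (simp add: mult_ac)
   then show ?case unfolding f_def by (intro tendsto_mult tendsto_const)
  qed
 qed (auto simp: f_def[abs_def])
 also have "(LINT l|lborel. indicat_real {0..1::real} l * (2 * l * d)) = d"
 proof -
  have "has_bochner_integral lborel (\<lambda>l. 2 * l * indicat_real {0..1::real} l) (1\<^sup>2 - 0\<^sup>2)"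
   by (rule has_bochner_integral_FTC_Icc_real[where F="\<lambda>x. x\<^sup>2"]) (auto intro!: derivative_eq_intros)
  then have "(LINT l|lborel. 2 * l * indicat_real {0..1::real} l) = 1" by (simp add: has_bochner_integral_iff)
  then have "(LINT l|lborel. d * (2 * l * indicat_real {0..1::real} l)) = d" by (subst integral_mult_right_zero) simp
  then show ?thesis by (simp add: mult_ac)
 qed
 finally have "(\<lambda>i. layer_avg G s (h (i + N))) \<longlonglongrightarrow> d" unfolding f_def layer_avg_def by simp
 then show ?thesis by (rule LIMSEQ_offset)
qed

end

section \<open>Principal values on a Lipschitz graph\<close>

context lipschitz_graph
begin

text \<open>The positive and negative parts of the real and imaginary part, so that primitives become
  monotone.\<close>
definition quart :: "nat => complex => real" where
 "quart j w = (if j = 0 then max (Re w) 0 else if j = 1 then max (- Re w) 0 else if j = 2 then max (Im w) 0 else max (- Im w) 0)"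

definition qcoeff :: "nat => complex" where
 "qcoeff j = (if j = 0 then 1 else if j = 1 then -1 else if j = 2 then \<i> else - \<i>)"

lemma quart_sum: "(\<Sum>j<4. qcoeff j * of_real (quart j w)) = w"
proof -
 have "{..<4} = {0, 1, 2, 3 :: nat}" by auto
 then show ?thesis by (simp add: qcoeff_def quart_def complex_eq_iff max_def)
qed

lemma quart_bounds: "0 \<le> quart j w" "quart j w \<le> cmod w"
 using abs_Re_le_cmod[of w] abs_Im_le_cmod[of w] by (auto simp: quart_def)

lemma quart_measurable [measurable]: "quart j \<in> borel_measurable borel"
 unfolding quart_def[abs_def] by measurable

text \<open>For a sequence of widths \<open>h\<^sub>j\<close> an index along the Helly subsequence can be
  taken so large that the smoothing is at most \<open>h\<^sub>j\<^sup>2\<close> and the tent average of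
  the approximant is close to that of the limit. The latter converges to a derivative, and the comparison
  with truncated integrals does the rest.\<close>
theorem AE_principal_value_L2:
 assumes [measurable]: "f \<in> borel_measurable borel" and int: "integrable lborel f"
  and int2: "integrable lborel (\<lambda>x. (cmod (f x))\<^sup>2)" and R: "R > 0" and supp: "\<And>x. x \<notin> {-R..R} ==> f x = 0"
 shows "AE s in lborel. \<bar>s\<bar> < R \<longrightarrow> (\<exists>l. ((\<lambda>k. LINT t|lborel. trunc k s t * f t) \<longlongrightarrow> l) (at_right 0))"
proof -
 define e where "e n = inverse (real (Suc n))" for n
 have e0: "e n > 0" for n by (simp add: e_def)
 have elim0: "e \<longlonglongrightarrow> 0" unfolding e_def by (rule LIMSEQ_inverse_real_of_nat)
 define v where "v n t = indicator {-R..R} t * T (e n) f t" for n t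
 have [measurable]: "v n \<in> borel_measurable borel" for n unfolding v_def[abs_def] by measurable
 have Ti: "integrable lborel (v n)" for n
 proof (rule integrable_bounded_support[where a="-R" and b=R and B="1 / e n * (LINT t|lborel. cmod (f t))"])
  show "cmod (v n x) \<le> 1 / e n * (LINT t|lborel. cmod (f t))" for x
   using norm_T_le[OF int e0, of n x] order_trans[OF norm_ge_zero norm_T_le[OF int e0, of n x]]
   by (auto simp: v_def indicator_def)
 qed (auto simp: v_def)
 (* One bound for all n: this is the only place where the size of f enters. *)
 define K where "K = C2 * (R - (-R)) + (LINT t|lborel. (cmod (f t))\<^sup>2)"
 have vK: "(LINT t|lborel. cmod (v n t)) \<le> K" for n
 proof -
  have "(LINT t|lborel. cmod (v n t)) = (LBINT t:{-R..R}. cmod (T (e n) f t))"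
   unfolding set_lebesgue_integral_def v_def by (intro Bochner_Integration.integral_cong) (auto simp: indicator_def)
  also have "... \<le> K" unfolding K_def using R by (intro T_L1_bound e0 int2 int supp) auto
  finally show ?thesis .
 qed
 define p where "p n j t = quart j (v n t)" for n j t
 have [measurable]: "p n j \<in> borel_measurable borel" for n j unfolding p_def[abs_def] by measurable
 have pi: "integrable lborel (p n j)" for n j
  by (rule Bochner_Integration.integrable_bound[OF integrable_norm[OF Ti[of n]]]) (use quart_bounds in \<open>auto simp: p_def\<close>)
 have p0: "p n j t \<ge> 0" for n j t by (simp add: p_def quart_bounds)
 define F where "F n j x = (LINT y|lborel. indicator {..x} y * p n j y)" for n j x
 have Fi: "integrable lborel (\<lambda>y. indicator {..x} y * p n j y)" for n j x
  using integrable_mult_indicator[OF _ pi, of "{..x}" n j] by simp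
 have Fc: "continuous (at_right x) (F n j)" for n j x
  unfolding F_def using continuous_at_imp_continuous_within[OF indefinite_integral_continuous[OF pi]] .
 have Fm: "mono (F n j)" for n j
  unfolding F_def by (intro monoI integral_mono Fi) (use p0 in \<open>auto simp: indicator_def\<close>)
 have Fb: "\<bar>F n j x\<bar> \<le> K" for n j x
 proof -
  have "F n j x \<le> (LINT y|lborel. cmod (v n y))"
   unfolding F_def by (intro integral_mono Fi integrable_norm Ti) (use quart_bounds in \<open>auto simp: indicator_def p_def\<close>)
  moreover have "F n j x \<ge> 0" unfolding F_def using p0 by (intro integral_nonneg_AE) auto
  ultimately show ?thesis using vK[of n] by linarith
 qed
 obtain r where r: "strict_mono (r :: nat => nat)"
  and ex: "\<forall>j<4. \<exists>G. (\<forall>x. continuous (at_right x) G) \<and> mono G \<and> (\<forall>x. \<bar>G x\<bar> \<le> K) \<and>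
   (\<forall>x. continuous (at x) G \<longrightarrow> (\<lambda>n. F (r n) j x) \<longlonglongrightarrow> G x)"
  using Helly_selection_family[of F K 4, OF Fc Fm Fb] by blast
 from ex have "\<exists>G. \<forall>j<4. (\<forall>x. continuous (at_right x) (G j)) \<and> mono (G j) \<and> (\<forall>x. \<bar>G j x\<bar> \<le> K) \<and>
   (\<forall>x. continuous (at x) (G j) \<longrightarrow> (\<lambda>n. F (r n) j x) \<longlonglongrightarrow> G j x)"
  by (intro choice_iff'[THEN iffD1]) simp
 then obtain G where G: "\<And>j x. j < 4 ==> continuous (at_right x) (G j)" "\<And>j. j < 4 ==> mono (G j)" "\<And>j x. j < 4 ==> \<bar>G j x\<bar> \<le> K"
   "\<And>j x. j < 4 ==> continuous (at x) (G j) ==> (\<lambda>n. F (r n) j x) \<longlonglongrightarrow> G j x" by blast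
 have er: "(\<lambda>n. e (r n)) \<longlonglongrightarrow> 0" using LIMSEQ_subseq_LIMSEQ[OF elim0 r] by (simp add: o_def)
 define B where "B n s h = (LINT t|lborel. of_real (tent ((t - s) / h)) * T (e n) f t) / of_real h" for n s h
 define b where "b s h = (\<Sum>j<4. qcoeff j * of_real (layer_avg (G j) s h))" for s h
 (* Tent averages of the approximants are layer averages of their primitives, provided that the tent
    stays inside the interval to which v is cut off. *)
 have Beq: "B n s h = (\<Sum>j<4. qcoeff j * of_real (layer_avg (F n j) s h))" if h: "h > 0" "\<bar>s\<bar> + h < R" for n s h
 proof -
  have "(LINT t|lborel. of_real (tent ((t - s) / h)) * T (e n) f t) = (LINT t|lborel. of_real (tent ((t - s) / h)) * v n t)"
  proof (rule Bochner_Integration.integral_cong[OF refl])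
   fix t
   show "of_real (tent ((t - s) / h)) * T (e n) f t = of_real (tent ((t - s) / h)) * v n t"
   proof (cases "t \<in> {-R..R}")
    case False
    then have "h \<le> \<bar>t - s\<bar>" using h by auto
    then have "1 \<le> \<bar>(t - s) / h\<bar>" using h by (simp add: abs_divide pos_le_divide_eq)
    then show ?thesis by (simp add: tent_zero)
   qed (simp add: v_def)
  qed
  also have "... = (LINT l|lborel. of_real (indicat_real {0..1} l) * (LBINT t:{s - l * h<..s + l * h}. v n t))"
   by (rule tent_average_layers(1)[OF Ti h(1)])
  also have "... = (LINT l|lborel. (\<Sum>j<4. qcoeff j * of_real (indicat_real {0..1} l * (F n j (s + l * h) - F n j (s - l * h)))))"
  proof (rule Bochner_Integration.integral_cong[OF refl])
   fix l :: real
   show "of_real (indicat_real {0..1} l) * (LBINT t:{s - l * h<..s + l * h}. v n t) =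
    (\<Sum>j<4. qcoeff j * of_real (indicat_real {0..1} l * (F n j (s + l * h) - F n j (s - l * h))))"
   proof (cases "l \<in> {0..1}")
    case True
    have lh: "s - l * h \<le> s + l * h" using True h by simp
    have 1: "(LBINT t:{s - l * h<..s + l * h}. p n j t) = F n j (s + l * h) - F n j (s - l * h)" for j
    proof -
     have "F n j (s + l * h) - F n j (s - l * h) = (LINT y|lborel. indicator {..s + l * h} y * p n j y - indicator {..s - l * h} y * p n j y)"
      unfolding F_def by (rule Bochner_Integration.integral_diff[OF Fi Fi, symmetric])
     also have "... = (LBINT t:{s - l * h<..s + l * h}. p n j t)"
      unfolding set_lebesgue_integral_def using lh by (intro Bochner_Integration.integral_cong) (auto simp: indicator_def)
     finally show ?thesis by simp
    qed
    have ipj: "set_integrable lborel {s - l * h<..s + l * h} (\<lambda>t. qcoeff j * complex_of_real (p n j t))" for j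
     using pi[of n j] by (intro set_integrable_restrict integrable_mult_right) auto
    have "(LBINT t:{s - l * h<..s + l * h}. v n t) = (LBINT t:{s - l * h<..s + l * h}. (\<Sum>j<4. qcoeff j * complex_of_real (p n j t)))"
     unfolding p_def quart_sum ..
    also have "... = (\<Sum>j<4. (LBINT t:{s - l * h<..s + l * h}. qcoeff j * complex_of_real (p n j t)))"
     unfolding set_lebesgue_integral_def scaleR_sum_right using ipj
     by (intro Bochner_Integration.integral_sum) (simp add: set_integrable_def)
    also have "... = (\<Sum>j<4. qcoeff j * of_real (F n j (s + l * h) - F n j (s - l * h)))"
     unfolding 1[symmetric] by (simp add: set_integral_complex_of_real)
    finally show ?thesis using True by simp
   qed simp
  qed
  also have "... = (\<Sum>j<4. LINT l|lborel. qcoeff j * complex_of_real (indicat_real {0..1} l * (F n j (s + l * h) - F n j (s - l * h))))"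
   using layer_avg_integrable[OF Fm Fb]
   by (intro Bochner_Integration.integral_sum integrable_mult_right) (simp del: of_real_mult of_real_diff)
  also have "... = (\<Sum>j<4. qcoeff j * of_real (layer_avg (F n j) s h * h))"
   using h by (intro sum.cong refl) (simp add: layer_avg_def del: of_real_mult of_real_diff)
  finally show ?thesis using h unfolding B_def by (simp add: sum_divide_distrib)
 qed
 have Blim: "(\<lambda>n. B (r n) s h) \<longlonglongrightarrow> b s h" if h: "h > 0" "\<bar>s\<bar> + h < R" for s h
  unfolding Beq[OF h] b_def
  by (intro tendsto_sum tendsto_mult tendsto_const tendsto_of_real layer_avg_converges[where K=K] Fm Fb h(1)) (use G in auto)
 have "AE s in lborel. \<forall>j<4. \<exists>d. (G j has_real_derivative d) (at s)"
  using AE_monotone_differentiable[OF G(2,1,3)] by (simp add: AE_all_countable)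
 moreover have "AE s in lborel. \<exists>d. (A has_real_derivative d) (at s)" by (rule AE_lipschitz_differentiable[OF lip])
 moreover have "AE s in lborel. ((\<lambda>h. (LBINT x:{s-h..s+h}. cmod (f x - f s) ^ 1) / h) \<longlongrightarrow> 0) (at_right 0)"
  by (rule AE_lebesgue_point_pow) (use int in auto)
 moreover have "AE s in lborel. ((\<lambda>h. (LBINT x:{s-h..s+h}. cmod (f x - f s) ^ 2) / h) \<longlongrightarrow> 0) (at_right 0)"
  by (rule AE_lebesgue_point_pow) (use int2 in auto)
 ultimately show ?thesis
 proof eventually_elim
  case (elim s)
  show ?case
  proof
   assume s: "\<bar>s\<bar> < R"
   from elim(1) obtain d where d: "\<And>j. j < 4 ==> (G j has_real_derivative d j) (at s)" by metis
   obtain a where a: "(A has_real_derivative a) (at s)" using elim(2) by blast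
   define D where "D = (\<Sum>j<4. qcoeff j * complex_of_real (d j))"
   have bD: "(\<lambda>i. b s (h i)) \<longlonglongrightarrow> D" if "\<And>i. h i > 0" "h \<longlonglongrightarrow> 0" for h
    unfolding b_def D_def by (intro tendsto_sum tendsto_mult tendsto_const tendsto_of_real layer_avg_derivative d G(2) that) auto
   have "((\<lambda>k. LINT t|lborel. trunc k s t * f t) \<longlongrightarrow> D) (at_right 0)"
    unfolding tendsto_at_iff_sequentially
   proof (intro allI impI)
    fix X :: "nat => real" assume X: "\<forall>i. X i \<in> {0<..} - {0}" "X \<longlonglongrightarrow> 0"
    define m where "m = min 1 ((R - \<bar>s\<bar>) / 2)"
    have m: "m > 0" "m \<le> 1" "\<bar>s\<bar> + m < R" using s by (auto simp: m_def min_def field_simps)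
    define h where "h i = min (X i) m" for i
    have h: "h i > 0" "h i \<le> 1" "\<bar>s\<bar> + h i < R" for i using X(1) m by (auto simp: h_def min_def)
    have "\<forall>\<^sub>F i in sequentially. X i < m" by (rule order_tendstoD(2)[OF X(2) m(1)])
    then have evh: "\<forall>\<^sub>F i in sequentially. h i = X i" by eventually_elim (simp add: h_def)
    have hlim: "h \<longlonglongrightarrow> 0"
     by (rule Lim_transform_eventually[OF X(2)]) (use evh in eventually_elim, simp)
    have "\<exists>n. e (r n) \<le> (h i)\<^sup>2 \<and> dist (B (r n) s (h i)) (b s (h i)) < h i" for i
    proof -
     have "\<forall>\<^sub>F n in sequentially. e (r n) < (h i)\<^sup>2" using h(1)[of i] by (intro order_tendstoD(2)[OF er]) simp
     moreover have "\<forall>\<^sub>F n in sequentially. dist (B (r n) s (h i)) (b s (h i)) < h i"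
      using h by (intro tendstoD[OF Blim]) auto
     ultimately have "\<forall>\<^sub>F n in sequentially. e (r n) \<le> (h i)\<^sup>2 \<and> dist (B (r n) s (h i)) (b s (h i)) < h i"
      by eventually_elim simp
     then show ?thesis by (rule eventually_happens'[rotated]) simp
    qed
    then obtain n where n: "\<And>i. e (r (n i)) \<le> (h i)\<^sup>2" "\<And>i. dist (B (r (n i)) s (h i)) (b s (h i)) < h i" by metis
    have "(\<lambda>i. B (r (n i)) s (h i) - (LINT t|lborel. trunc (h i) s t * f t)) \<longlonglongrightarrow> 0"
     unfolding B_def
     by (rule tent_average_vs_truncation[OF a h(1,2) hlim e0 n(1) int int2]) (use elim(3,4) in auto)
    moreover have "(\<lambda>i. B (r (n i)) s (h i) - b s (h i)) \<longlonglongrightarrow> 0"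
     by (rule Lim_null_comparison[OF _ hlim]) (use n(2) in \<open>auto simp: dist_norm less_imp_le\<close>)
    moreover note bD[OF h(1) hlim]
    ultimately have "(\<lambda>i. (B (r (n i)) s (h i) - b s (h i)) - (B (r (n i)) s (h i) - (LINT t|lborel. trunc (h i) s t * f t)) + b s (h i)) \<longlonglongrightarrow> 0 - 0 + D"
     by (intro tendsto_intros)
    then have "(\<lambda>i. LINT t|lborel. trunc (h i) s t * f t) \<longlonglongrightarrow> D" by simp
    moreover have "\<forall>\<^sub>F i in sequentially. (LINT t|lborel. trunc (h i) s t * f t) = ((\<lambda>k. LINT t|lborel. trunc k s t * f t) \<circ> X) i"
     using evh by eventually_elim simp
    ultimately show "((\<lambda>k. LINT t|lborel. trunc k s t * f t) \<circ> X) \<longlonglongrightarrow> D" by (rule Lim_transform_eventually)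
   qed
   then show "\<exists>l. ((\<lambda>k. LINT t|lborel. trunc k s t * f t) \<longlongrightarrow> l) (at_right 0)" by blast
  qed
 qed
qed

end

section \<open>Bessel functions, fundamental solution and cylindrical waves\<close>

lemma entire_series_C1:
 fixes a :: "nat => real"
 assumes a: "\<And>k. \<bar>a k\<bar> \<le> 1 / fact k"
 obtains P' where "\<And>x. ((\<lambda>x. \<Sum>k. a k * x ^ k) has_real_derivative P' x) (at x)" "continuous_on UNIV P'"
proof -
 have s: "summable (\<lambda>k. a k * x ^ k)" for x
 proof (rule summable_comparison_test')
  show "summable (\<lambda>k. \<bar>x\<bar> ^ k / fact k)" using summable_exp[of "\<bar>x\<bar>"] by (simp add: divide_inverse mult.commute)
  show "norm (a k * x ^ k) \<le> \<bar>x\<bar> ^ k / fact k" if "k \<ge> 0" for k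
   using mult_right_mono[OF a[of k], of "\<bar>x\<bar> ^ k"] by (simp add: abs_mult power_abs)
 qed
 have s': "summable (\<lambda>k. diffs a k * x ^ k)" for x
  by (rule termdiff_converges_all) (rule s)
 have d: "((\<lambda>x. \<Sum>k. a k * x ^ k) has_real_derivative (\<Sum>k. diffs a k * x ^ k)) (at x)" for x
  by (rule termdiffs_strong_converges_everywhere[OF s])
 have d': "((\<lambda>x. \<Sum>k. diffs a k * x ^ k) has_real_derivative (\<Sum>k. diffs (diffs a) k * x ^ k)) (at x)" for x
  by (rule termdiffs_strong_converges_everywhere[OF s'])
 have c: "continuous_on UNIV (\<lambda>x. \<Sum>k. diffs a k * x ^ k)"
  using d' by (intro continuous_at_imp_continuous_on ballI) (rule DERIV_isCont)
 show ?thesis by (rule that[OF d c])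
qed

lemma abs_rGamma_of_int_le: "\<bar>rGamma (of_int n :: real)\<bar> \<le> 1"
proof (cases "n \<le> 0")
 case True
 then have "(of_int n :: real) \<in> \<int>\<^sub>\<le>\<^sub>0" by (rule nonpos_Ints_of_int)
 then have "rGamma (of_int n :: real) = 0" unfolding rGamma_eq_zero_iff .
 then show ?thesis by simp
next
 case False
 define k where "k = nat (n - 1)"
 have "(of_int n :: real) = of_nat (Suc k)" using False by (simp add: k_def)
 then have "rGamma (of_int n :: real) = 1 / fact k"
  using Gamma_fact[of k, where 'a=real] by (simp add: rGamma_inverse_Gamma inverse_eq_divide)
 then show ?thesis by (simp add: fact_ge_1)
qed

text \<open>The power series is entire in \<open>r\<^sup>2\<close>, apart from the leading power.\<close>
lemma bessel_J_factor:
 obtains P P' :: "real => real" where "\<And>x. (P has_real_derivative P' x) (at x)" "continuous_on UNIV P'"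
  "\<And>r. r > 0 ==> bessel_J m r = (r / 2) powi m * P (r\<^sup>2)" "m = 0 ==> P 0 = 1"
proof -
 define a :: "nat => real" where "a k = (-1) ^ k / fact k * rGamma (of_int m + of_nat k + 1) * (1/4) ^ k" for k
 have ale: "\<bar>a k\<bar> \<le> 1 / fact k" for k
 proof -
  have g: "\<bar>rGamma (of_int m + of_nat k + 1 :: real)\<bar> \<le> 1"
   using abs_rGamma_of_int_le[of "m + int k + 1"] by simp
  have "\<bar>a k\<bar> = (1 / fact k * \<bar>rGamma (of_int m + of_nat k + 1 :: real)\<bar>) * (1/4) ^ k"
   by (simp add: a_def abs_mult power_abs)
  also have "... \<le> (1 / fact k * 1) * 1" using g by (intro mult_mono mult_left_mono power_le_one) auto
  finally show ?thesis by simp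
 qed
 from ale obtain P' where P': "\<And>x. ((\<lambda>x. \<Sum>k. a k * x ^ k) has_real_derivative P' x) (at x)" "continuous_on UNIV P'"
  using entire_series_C1[of a] by blast
 show ?thesis
 proof
  show "((\<lambda>x. \<Sum>k. a k * x ^ k) has_real_derivative P' x) (at x)" for x by (rule P')
  show "continuous_on UNIV P'" by (rule P')
  show "bessel_J m r = (r / 2) powi m * (\<Sum>k. a k * (r\<^sup>2) ^ k)" if r: "r > 0" for r
  proof -
   have t: "(-1) ^ k / fact k * rGamma (of_int m + of_nat k + 1) * (r / 2) powi (m + 2 * int k) = (r / 2) powi m * (a k * (r\<^sup>2) ^ k)" for k
   proof -
    have "(r / 2) powi (m + 2 * int k) = (r / 2) powi m * (r / 2) ^ (2 * k)"
     using r by (subst power_int_add) (auto simp: power_int_mult power_mult)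
    also have "(r / 2) ^ (2 * k) = (1/4) ^ k * (r\<^sup>2) ^ k"
     by (simp add: power_mult power_divide flip: power_mult_distrib)
    finally show ?thesis by (simp add: a_def mult_ac)
   qed
   have s: "summable (\<lambda>k. a k * (r\<^sup>2) ^ k)"
   proof (rule summable_comparison_test')
    show "summable (\<lambda>k. (r\<^sup>2) ^ k / fact k)" using summable_exp[of "r\<^sup>2"] by (simp add: divide_inverse mult.commute)
    show "norm (a k * (r\<^sup>2) ^ k) \<le> (r\<^sup>2) ^ k / fact k" if "k \<ge> 0" for k
     using mult_right_mono[OF ale[of k], of "(r\<^sup>2) ^ k"] by (simp add: abs_mult)
   qed
   show ?thesis unfolding bessel_J_def t using s by (rule suminf_mult)
  qed
  show "(\<Sum>k. a k * 0 ^ k) = 1" if "m = 0" using that powser_zero[of a] by (simp add: a_def rGamma_inverse_Gamma)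
 qed
qed

lemma bessel_Y0_factor:
 obtains Q Q' :: "real => real" where "\<And>x. (Q has_real_derivative Q' x) (at x)" "continuous_on UNIV Q'"
  "\<And>r. bessel_Y0 r = 2 / pi * (ln (r / 2) + euler_mascheroni) * bessel_J 0 r - 2 / pi * Q (r\<^sup>2)"
proof -
 define a :: "nat => real" where "a k = (-1) ^ k * harm k / (fact k)\<^sup>2 * (1/4) ^ k" for k
 have ale: "\<bar>a k\<bar> \<le> 1 / fact k" for k
 proof -
  have "harm k \<le> (\<Sum>i=1..k. 1 :: real)" unfolding harm_def by (rule sum_mono) (auto simp: field_simps)
  then have "harm k \<le> (of_nat k :: real)" by simp
  also have "... \<le> fact k" using fact_ge_self[of k] of_nat_mono[of k "fact k", where 'a=real] by simp
  finally have h: "0 \<le> (harm k :: real)" "harm k \<le> (fact k :: real)" by (auto simp: harm_nonneg)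
  have "\<bar>a k\<bar> = (harm k / (fact k)\<^sup>2) * (1/4) ^ k" using h by (simp add: a_def abs_mult power_abs)
  also have "... \<le> (fact k / (fact k)\<^sup>2) * 1"
   using h by (intro mult_mono divide_right_mono power_le_one) auto
  also have "... = 1 / fact k" by (simp add: power2_eq_square)
  finally show ?thesis .
 qed
 from ale obtain Q' where Q': "\<And>x. ((\<lambda>x. \<Sum>k. a k * x ^ k) has_real_derivative Q' x) (at x)" "continuous_on UNIV Q'"
  using entire_series_C1[of a] by blast
 have t: "(-1) ^ k * harm k / (fact k)\<^sup>2 * (r\<^sup>2 / 4) ^ k = a k * (r\<^sup>2) ^ k" for k r
  by (simp add: a_def power_divide)
 show ?thesis by (rule that[OF Q'], unfold bessel_Y0_def t, rule refl)
qed

lemma C1_difference_bound: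
 fixes P P' :: "real => real"
 assumes d: "\<And>x. (P has_real_derivative P' x) (at x)" and c: "continuous_on UNIV P'"
 shows "\<exists>C\<ge>0. \<forall>x\<in>{0..X}. \<bar>P' x\<bar> \<le> C \<and> \<bar>P x - P 0\<bar> \<le> C * x"
proof -
 have "compact (P' ` {0..X})" by (intro compact_continuous_image continuous_on_subset[OF c]) auto
 then obtain C where C: "\<And>y. y \<in> P' ` {0..X} ==> \<bar>y\<bar> \<le> C"
  using compact_imp_bounded bounded_iff by (metis real_norm_def)
 have "\<bar>P' x\<bar> \<le> \<bar>C\<bar> \<and> \<bar>P x - P 0\<bar> \<le> \<bar>C\<bar> * x" if x: "x \<in> {0..X}" for x
 proof
  show "\<bar>P' x\<bar> \<le> \<bar>C\<bar>" using C[OF imageI[OF x]] by linarith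
  show "\<bar>P x - P 0\<bar> \<le> \<bar>C\<bar> * x"
  proof (cases "x = 0")
   case False
   then have "x > 0" using x by simp
   then obtain y where y: "0 < y" "y < x" "P x - P 0 = (x - 0) * P' y" using MVT2[of 0 x P P'] d by blast
   have "\<bar>P' y\<bar> \<le> \<bar>C\<bar>" using C[OF imageI, of y] y x by auto
   then have "\<bar>(x - 0) * P' y\<bar> \<le> \<bar>x\<bar> * \<bar>C\<bar>" by (simp add: abs_mult mult_left_mono)
   then show ?thesis using y x by (simp add: mult.commute)
  qed simp
 qed
 then show ?thesis by (intro exI[of _ "\<bar>C\<bar>"]) auto
qed

text \<open>The logarithm in \<open>Y\<^sub>0\<close> produces the singular part \<open>1 / (2 pi
  r)\<close> of the radial derivative; all remaining terms are bounded near the origin, because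
  \<open>J\<^sub>0 - 1\<close> vanishes there to second order.\<close>
lemma fund_sol_has_derivative:
 assumes om: "\<omega> > 0"
 obtains \<rho> :: "real => complex" where "continuous_on {0<..} \<rho>" "\<And>R. \<exists>C. \<forall>r\<in>{0<..R}. cmod (\<rho> r) \<le> C"
  "\<And>w. w \<noteq> 0 ==> (fund_sol \<omega> has_derivative (\<lambda>v. (of_real (1 / (2 * pi * cmod w)) + \<rho> (cmod w)) * of_real ((v \<bullet> w) / cmod w))) (at w)"
proof -
 obtain P P' where P: "\<And>x. (P has_real_derivative P' x) (at x)" "continuous_on UNIV P'"
  "\<And>r. r > 0 ==> bessel_J 0 r = (r / 2) powi 0 * P (r\<^sup>2)" "P 0 = 1" by (rule bessel_J_factor[of 0]) auto
 obtain Q Q' where Q: "\<And>x. (Q has_real_derivative Q' x) (at x)" "continuous_on UNIV Q'"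
  "\<And>r. bessel_Y0 r = 2 / pi * (ln (r / 2) + euler_mascheroni) * bessel_J 0 r - 2 / pi * Q (r\<^sup>2)" by (rule bessel_Y0_factor) auto
 define l where "l r = ln (\<omega> * r / 2) + euler_mascheroni" for r :: real
 define j where "j r = P ((\<omega> * r)\<^sup>2)" for r
 define j1 where "j1 r = P' ((\<omega> * r)\<^sup>2) * (2 * \<omega>\<^sup>2 * r)" for r
 define q1 where "q1 r = Q' ((\<omega> * r)\<^sup>2) * (2 * \<omega>\<^sup>2 * r)" for r
 define y where "y r = 2 / pi * l r * j r - 2 / pi * Q ((\<omega> * r)\<^sup>2)" for r
 define yr where "yr r = 2 / pi * ((j r - 1) / r + l r * j1 r - q1 r)" for r
 have dj: "(j has_real_derivative j1 r) (at r)" for r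
  unfolding j_def j1_def
  by (rule DERIV_cong[OF DERIV_chain2[OF P(1)]]) (auto intro!: derivative_eq_intros simp: power2_eq_square)
 have dq: "((\<lambda>r. Q ((\<omega> * r)\<^sup>2)) has_real_derivative q1 r) (at r)" for r
  unfolding q1_def
  by (rule DERIV_cong[OF DERIV_chain2[OF Q(1)]]) (auto intro!: derivative_eq_intros simp: power2_eq_square)
 have dl: "(l has_real_derivative 1 / r) (at r)" if "r > 0" for r
  unfolding l_def using that om by (auto intro!: derivative_eq_intros simp: field_simps)
 have dy: "(y has_real_derivative (2 / (pi * r) + yr r)) (at r)" if "r > 0" for r
 proof -
  have "(y has_real_derivative (2 / pi * (1 / r * j r + l r * j1 r) - 2 / pi * q1 r)) (at r)"
   unfolding y_def
  proof (rule DERIV_diff[OF _ DERIV_cmult[OF dq]])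
   show "((\<lambda>r. 2 / pi * l r * j r) has_real_derivative 2 / pi * (1 / r * j r + l r * j1 r)) (at r)"
    by (rule DERIV_cong[OF DERIV_mult[OF DERIV_cmult[OF dl[OF that]] dj]]) (simp add: algebra_simps)
  qed
  moreover have "2 / pi * (1 / r * j r + l r * j1 r) - 2 / pi * q1 r = 2 / (pi * r) + yr r"
   using that by (simp add: yr_def field_simps)
  ultimately show ?thesis by simp
 qed
 have J: "bessel_J 0 (\<omega> * r) = j r" if "r > 0" for r using P(3)[of "\<omega> * r"] that om by (simp add: j_def)
 have Y: "bessel_Y0 (\<omega> * r) = y r" if "r > 0" for r
  using Q(3)[of "\<omega> * r"] J[OF that] by (simp add: y_def l_def)
 define \<rho> where "\<rho> r = of_real (yr r / 4) - \<i> * of_real (j1 r / 4)" for r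
 define g where "g r = complex_of_real (y r / 4) - \<i> * of_real (j r / 4)" for r
 have fg: "fund_sol \<omega> w = g (cmod w)" if "w \<noteq> 0" for w
  using that J[of "cmod w"] Y[of "cmod w"] by (simp add: fund_sol_def hankel1_0_def g_def complex_eq_iff)
 have dg: "(g has_vector_derivative (of_real (1 / (2 * pi * r)) + \<rho> r)) (at r)" if "r > 0" for r
 proof -
  have "(g has_vector_derivative (of_real ((2 / (pi * r) + yr r) / 4) - \<i> * of_real (j1 r / 4))) (at r)"
   unfolding g_def
   by (intro has_vector_derivative_diff has_vector_derivative_mult_right has_vector_derivative_of_real)
    (auto intro!: DERIV_cdivide dy dj that simp: has_real_derivative_iff_has_vector_derivative[symmetric])
  moreover have "of_real ((2 / (pi * r) + yr r) / 4) - \<i> * of_real (j1 r / 4) = of_real (1 / (2 * pi * r)) + \<rho> r"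
   by (simp add: \<rho>_def add_divide_distrib)
  ultimately show ?thesis by simp
 qed
 show ?thesis
 proof (rule that)
  have cj: "continuous_on {0<..} j" by (intro continuous_at_imp_continuous_on ballI DERIV_isCont[OF dj])
  have cl: "continuous_on {0<..} l" by (intro continuous_at_imp_continuous_on ballI DERIV_isCont[OF dl]) simp
  have cj1: "continuous_on {0<..} j1" unfolding j1_def by (intro continuous_intros continuous_on_compose2[OF P(2)]) auto
  have cq1: "continuous_on {0<..} q1" unfolding q1_def by (intro continuous_intros continuous_on_compose2[OF Q(2)]) auto
  show "continuous_on {0<..} \<rho>" unfolding \<rho>_def yr_def
   by (intro continuous_intros cj cl cj1 cq1) auto
  show "\<exists>C. \<forall>r\<in>{0<..R}. cmod (\<rho> r) \<le> C" for R
  proof -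
   obtain C where C: "C \<ge> 0" "\<And>x. x \<in> {0..(\<omega> * R)\<^sup>2} ==> \<bar>P' x\<bar> \<le> C \<and> \<bar>P x - P 0\<bar> \<le> C * x"
    using C1_difference_bound[OF P(1,2)] by blast
   obtain D where D: "D \<ge> 0" "\<And>x. x \<in> {0..(\<omega> * R)\<^sup>2} ==> \<bar>Q' x\<bar> \<le> D \<and> \<bar>Q x - Q 0\<bar> \<le> D * x"
    using C1_difference_bound[OF Q(1,2)] by blast
   define E where "E = 2 / pi * (C * \<omega>\<^sup>2 * R + (\<omega> * R\<^sup>2 / 2 + 2 / \<omega> + \<bar>euler_mascheroni\<bar> * R) * (C * (2 * \<omega>\<^sup>2)) + D * (2 * \<omega>\<^sup>2 * R))"
   have "cmod (\<rho> r) \<le> E / 4 + C * (2 * \<omega>\<^sup>2 * R) / 4" if r: "r \<in> {0<..R}" for r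
   proof -
    have r0: "r > 0" "r \<le> R" using r by auto
    have x: "(\<omega> * r)\<^sup>2 \<in> {0..(\<omega> * R)\<^sup>2}" using r0 om by (auto intro!: power_mono mult_left_mono)
    have a: "\<bar>(j r - 1) / r\<bar> \<le> C * \<omega>\<^sup>2 * R"
    proof -
     have "\<bar>j r - 1\<bar> \<le> C * (\<omega> * r)\<^sup>2" using C(2)[OF x] P(4) by (simp add: j_def)
     also have "... \<le> C * \<omega>\<^sup>2 * R * r" using r0 C(1) mult_mono[of r R r r]
      by (simp add: power_mult_distrib power2_eq_square[of r] mult.assoc mult_left_mono)
     finally show ?thesis using r0 by (simp add: abs_divide pos_divide_le_eq)
    qed
    have b: "\<bar>j1 r\<bar> \<le> C * (2 * \<omega>\<^sup>2) * r"
     using mult_right_mono[of "\<bar>P' ((\<omega> * r)\<^sup>2)\<bar>" C "2 * \<omega>\<^sup>2 * r"] C(2)[OF x] r0 by (simp add: j1_def abs_mult mult_ac)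
    have b': "C * (2 * \<omega>\<^sup>2) * r \<le> C * (2 * \<omega>\<^sup>2 * R)" using r0 C(1) by (simp add: mult.assoc mult_left_mono)
    have lr: "\<bar>l r\<bar> * r \<le> \<omega> * R\<^sup>2 / 2 + 2 / \<omega> + \<bar>euler_mascheroni\<bar> * R"
    proof -
     define t where "t = \<omega> * r / 2"
     have t: "t > 0" using r0 om by (simp add: t_def)
     have "ln t \<le> t" using ln_le_minus_one[OF t] by simp
     moreover have "- ln t \<le> 1 / t" using ln_le_minus_one[of "1 / t"] t by (simp add: ln_div)
     ultimately have "\<bar>ln t\<bar> \<le> t + 1 / t" using t by (smt (verit) divide_pos_pos)
     then have "\<bar>l r\<bar> \<le> t + 1 / t + \<bar>euler_mascheroni\<bar>" unfolding l_def t_def[symmetric] by linarith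
     then have "\<bar>l r\<bar> * r \<le> (t + 1 / t + \<bar>euler_mascheroni\<bar>) * r" using r0 by (intro mult_right_mono) auto
     also have "... = \<omega> * r\<^sup>2 / 2 + 2 / \<omega> + \<bar>euler_mascheroni\<bar> * r" using r0 om by (simp add: t_def field_simps power2_eq_square)
     also have "... \<le> \<omega> * R\<^sup>2 / 2 + 2 / \<omega> + \<bar>euler_mascheroni\<bar> * R"
      using r0 om by (intro add_mono divide_right_mono mult_left_mono power_mono) auto
     finally show ?thesis .
    qed
    have c: "\<bar>l r * j1 r\<bar> \<le> (\<omega> * R\<^sup>2 / 2 + 2 / \<omega> + \<bar>euler_mascheroni\<bar> * R) * (C * (2 * \<omega>\<^sup>2))"
    proof -
     have "\<bar>l r * j1 r\<bar> \<le> \<bar>l r\<bar> * (C * (2 * \<omega>\<^sup>2) * r)" unfolding abs_mult by (rule mult_left_mono[OF b]) simp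
     also have "... = (\<bar>l r\<bar> * r) * (C * (2 * \<omega>\<^sup>2))" by simp
     also have "... \<le> (\<omega> * R\<^sup>2 / 2 + 2 / \<omega> + \<bar>euler_mascheroni\<bar> * R) * (C * (2 * \<omega>\<^sup>2))"
      by (rule mult_right_mono[OF lr]) (use C(1) in auto)
     finally show ?thesis .
    qed
    have d: "\<bar>q1 r\<bar> \<le> D * (2 * \<omega>\<^sup>2 * R)"
    proof -
     have "\<bar>q1 r\<bar> \<le> D * (2 * \<omega>\<^sup>2 * r)"
      using mult_right_mono[of "\<bar>Q' ((\<omega> * r)\<^sup>2)\<bar>" D "2 * \<omega>\<^sup>2 * r"] D(2)[OF x] r0 by (simp add: q1_def abs_mult)
     also have "... \<le> D * (2 * \<omega>\<^sup>2 * R)" using r0 D(1) by (simp add: mult_left_mono)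
     finally show ?thesis .
    qed
    have "\<bar>(j r - 1) / r + l r * j1 r - q1 r\<bar> \<le> C * \<omega>\<^sup>2 * R + (\<omega> * R\<^sup>2 / 2 + 2 / \<omega> + \<bar>euler_mascheroni\<bar> * R) * (C * (2 * \<omega>\<^sup>2)) + D * (2 * \<omega>\<^sup>2 * R)"
     using a c d by linarith
    then have "\<bar>yr r\<bar> \<le> E" unfolding yr_def E_def abs_mult by (intro mult_mono) auto
    moreover have "cmod (\<rho> r) \<le> \<bar>yr r\<bar> / 4 + \<bar>j1 r\<bar> / 4"
     unfolding \<rho>_def by (rule order_trans[OF norm_triangle_ineq4]) (simp add: norm_mult)
    ultimately show ?thesis using b b' by linarith
   qed
   then show ?thesis by blast
  qed
  fix w :: complex assume w: "w \<noteq> 0"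
  have "(norm has_derivative (\<lambda>v. v \<bullet> sgn w)) (at w)" by (rule has_derivative_norm[OF w])
  moreover have "(g has_derivative (\<lambda>x. x *\<^sub>R (of_real (1 / (2 * pi * cmod w)) + \<rho> (cmod w)))) (at (norm w))"
   using dg[of "cmod w"] w by (simp add: has_vector_derivative_def)
  ultimately have "((\<lambda>w. g (norm w)) has_derivative (\<lambda>v. (v \<bullet> sgn w) *\<^sub>R (of_real (1 / (2 * pi * cmod w)) + \<rho> (cmod w)))) (at w)"
   by (rule has_derivative_compose)
  moreover have "(\<lambda>v. (v \<bullet> sgn w) *\<^sub>R (of_real (1 / (2 * pi * cmod w)) + \<rho> (cmod w))) =
    (\<lambda>v. (of_real (1 / (2 * pi * cmod w)) + \<rho> (cmod w)) * of_real ((v \<bullet> w) / cmod w))"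
  proof
   fix v
   have "v \<bullet> sgn w = (v \<bullet> w) / cmod w" by (simp only: sgn_div_norm inner_scaleR_right divide_inverse mult.commute)
   then show "(v \<bullet> sgn w) *\<^sub>R (of_real (1 / (2 * pi * cmod w)) + \<rho> (cmod w)) =
     (of_real (1 / (2 * pi * cmod w)) + \<rho> (cmod w)) * of_real ((v \<bullet> w) / cmod w)"
    by (simp only: scaleR_conv_of_real mult.commute)
  qed
  ultimately have D: "((\<lambda>w. g (norm w)) has_derivative (\<lambda>v. (of_real (1 / (2 * pi * cmod w)) + \<rho> (cmod w)) * of_real ((v \<bullet> w) / cmod w))) (at w)"
   by simp
  show "(fund_sol \<omega> has_derivative (\<lambda>v. (of_real (1 / (2 * pi * cmod w)) + \<rho> (cmod w)) * of_real ((v \<bullet> w) / cmod w))) (at w)"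
   by (rule has_derivative_transform_within_open[OF D, of "- {0}"]) (use w fg in auto)
 qed
qed

lemma cyl_wave_rotate:
 assumes c: "cmod c = 1" and x: "x \<noteq> 0"
 shows "cyl_wave \<omega> m (c * x) = c powi m * cyl_wave \<omega> m x"
proof -
 have e: "exp (\<i> * of_int m * of_real (Arg y)) = sgn y powi m" if "y \<noteq> 0" for y
 proof -
  have "exp (\<i> * of_int m * of_real (Arg y)) = exp (of_int m * (\<i> * of_real (Arg y)))" by (simp add: mult_ac)
  also have "... = cis (Arg y) powi m" by (simp only: exp_power_int[symmetric] cis_conv_exp)
  finally show ?thesis using cis_Arg[OF that] by simp
 qed
 have "c \<noteq> 0" using c by auto
 moreover have "sgn (c * x) = c * sgn x" using c by (simp add: sgn_mult sgn_div_norm[of c])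
 ultimately have "exp (\<i> * of_int m * of_real (Arg (c * x))) = c powi m * exp (\<i> * of_int m * of_real (Arg x))"
  using x by (simp only: e mult_eq_0_iff power_int_mult_distrib simp_thms)
 then show ?thesis using c by (simp only: cyl_wave_def norm_mult mult_1 mult.left_commute)
qed

text \<open>Away from the origin the wave is a smooth function of \<open>x \<bullet> x\<close> times the
  power \<open>x powi m\<close>; this avoids the cut of the argument.\<close>
lemma cyl_wave_differentiable:
 assumes om: "\<omega> > 0" and x: "x \<noteq> 0"
 shows "cyl_wave \<omega> m differentiable (at x)"
proof -
 obtain P P' :: "real => real" where P: "\<And>x. (P has_real_derivative P' x) (at x)"
   "\<And>r. r > 0 ==> bessel_J m r = (r / 2) powi m * P (r\<^sup>2)"
  using bessel_J_factor[of m] by metis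
 have e: "exp (\<i> * of_int m * of_real (Arg y)) = sgn y powi m" if "y \<noteq> 0" for y
 proof -
  have "exp (\<i> * of_int m * of_real (Arg y)) = exp (of_int m * (\<i> * of_real (Arg y)))" by (simp add: mult_ac)
  also have "... = cis (Arg y) powi m" by (simp only: exp_power_int[symmetric] cis_conv_exp)
  finally show ?thesis using cis_Arg[OF that] by simp
 qed
 have eq: "cyl_wave \<omega> m y = of_real (P (\<omega>\<^sup>2 * (y \<bullet> y))) * (of_real (\<omega> / 2) * y) powi m" if "y \<noteq> 0" for y
 proof -
  have "cyl_wave \<omega> m y = of_real (P ((\<omega> * cmod y)\<^sup>2)) * (of_real (\<omega> * cmod y / 2) powi m * sgn y powi m)"
   using that om P(2)[of "\<omega> * cmod y"] by (simp add: cyl_wave_def e of_real_power_int)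
  also have "of_real (\<omega> * cmod y / 2) powi m * sgn y powi m = (of_real (\<omega> / 2) * y) powi m"
   using that by (simp add: power_int_mult_distrib[symmetric] sgn_eq)
  finally show ?thesis by (simp add: power_mult_distrib power2_norm_eq_inner)
 qed
 have d1: "(\<lambda>y. complex_of_real (P (\<omega>\<^sup>2 * (y \<bullet> y)))) differentiable (at x)"
 proof -
  have "((\<lambda>y. \<omega>\<^sup>2 * (y \<bullet> y)) has_derivative (\<lambda>h. \<omega>\<^sup>2 * (x \<bullet> h + h \<bullet> x))) (at x)"
   by (auto intro!: derivative_eq_intros)
  from has_derivative_compose[OF this P(1)[unfolded has_field_derivative_def]]
  have "((\<lambda>y. P (\<omega>\<^sup>2 * (y \<bullet> y))) has_derivative (\<lambda>h. P' (\<omega>\<^sup>2 * (x \<bullet> x)) * (\<omega>\<^sup>2 * (x \<bullet> h + h \<bullet> x)))) (at x)" .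
  from has_derivative_of_real[OF this] show ?thesis by (rule differentiableI)
 qed
 have d2: "(\<lambda>y. (of_real (\<omega> / 2) * y) powi m) differentiable (at x)"
 proof -
  have "(\<lambda>y. of_real (\<omega> / 2) * y :: complex) differentiable (at x)"
   by (rule bounded_linear_imp_differentiable[OF bounded_linear_mult_right])
  then show ?thesis by (rule differentiable_power_int) (use x om in auto)
 qed
 have "(\<lambda>y. of_real (P (\<omega>\<^sup>2 * (y \<bullet> y))) * (of_real (\<omega> / 2) * y) powi m) differentiable (at x)"
  by (rule differentiable_mult[OF d1 d2])
 then obtain D where "((\<lambda>y. of_real (P (\<omega>\<^sup>2 * (y \<bullet> y))) * (of_real (\<omega> / 2) * y) powi m) has_derivative D) (at x)"
  by (auto simp: differentiable_def)
 then have "(cyl_wave \<omega> m has_derivative D) (at x)"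
  by (rule has_derivative_transform_within_open[of _ _ _ _ "- {0}"]) (use x eq in auto)
 then show ?thesis by (rule differentiableI)
qed

section \<open>One-dimensional Hausdorff measure of a Lipschitz curve\<close>

lemma sets_hausdorff1 [simp, measurable_cong]: "sets hausdorff1 = sets borel"
 unfolding hausdorff1_def by (simp add: sets_measure_of_conv sigma_algebra.sigma_sets_eq[OF sets.sigma_algebra_axioms, of borel, simplified])

lemma space_hausdorff1 [simp]: "space hausdorff1 = UNIV"
 using sets_eq_imp_space_eq[OF sets_hausdorff1] by simp

text \<open>An inequality suffices below, and it holds whether or not the outer measure is countably
  additive on Borel sets: by convention the measure is then zero.\<close>
lemma emeasure_hausdorff1_le: "emeasure hausdorff1 S \<le> hausdorff1_outer S"
 unfolding hausdorff1_def emeasure_measure_of_conv by simp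

lemma hausdorff1_outer_lipschitz_Icc:
 fixes f :: "real => complex"
 assumes f: "\<And>x y. dist (f x) (f y) \<le> K * \<bar>x - y\<bar>" and K: "K > 0" and ab: "a \<le> b"
 shows "hausdorff1_outer (f ` {a..b}) \<le> ennreal (K * (b - a))"
 unfolding hausdorff1_outer_def
proof (rule SUP_least)
 fix \<delta> :: real assume "\<delta> \<in> {0<..}"
 then have d: "\<delta> > 0" by simp
 obtain N :: nat where N: "K * (b - a) / \<delta> < real N" using reals_Archimedean2 by blast
 have N0: "real N > 0" using N K ab d by (smt (verit) divide_nonneg_pos mult_nonneg_nonneg)
 define w where "w = (b - a) / real N"
 have w0: "w \<ge> 0" using ab N0 by (simp add: w_def)
 have Kw: "K * w \<le> \<delta>" using N N0 d by (simp add: w_def field_simps)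
 define U where "U i = (if i < N then f ` {a + real i * w..a + real (Suc i) * w} else {})" for i
 have bd: "bounded (U i)" "diameter (U i) \<le> (if i < N then K * w else 0)" for i
 proof -
  have dd: "dist x y \<le> K * w" if "x \<in> U i" "y \<in> U i" "i < N" for x y
  proof -
   have "x \<in> f ` {a + real i * w..a + real (Suc i) * w}" "y \<in> f ` {a + real i * w..a + real (Suc i) * w}"
    using that unfolding U_def by (metis (lifting))+
   then obtain s t where st: "x = f s" "y = f t" "s \<in> {a + real i * w..a + real (Suc i) * w}" "t \<in> {a + real i * w..a + real (Suc i) * w}"
    by blast
   have "\<bar>s - t\<bar> \<le> w" using st(3,4) by (auto simp: algebra_simps)
   then show ?thesis using f[of s t] K st(1,2) by (metis mult_left_mono order_trans less_imp_le)
  qed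
  show "bounded (U i)"
  proof (cases "i < N")
   case True
   then show ?thesis using dd bounded_any_center[of "U i"] unfolding bounded_two_points by blast
  qed (simp add: U_def)
  show "diameter (U i) \<le> (if i < N then K * w else 0)"
  proof (cases "i < N")
   case True
   have "diameter (U i) \<le> K * w" by (rule diameter_le) (use dd[OF _ _ True] K w0 in \<open>auto simp: dist_norm\<close>)
   then show ?thesis using True by simp
  qed (simp add: U_def)
 qed
 have "f ` {a..b} \<subseteq> (\<Union>i. U i)"
 proof (clarsimp)
  fix x assume x: "a \<le> x" "x \<le> b"
  show "\<exists>i. f x \<in> U i"
  proof (cases "w = 0")
   case True
   then have "x = a" using x N0 by (simp add: w_def)
   then show ?thesis using N0 True by (intro exI[of _ 0]) (auto simp: U_def)
  next
   case False
   then have w: "w > 0" using w0 by simp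
   define m where "m = nat \<lfloor>(x - a) / w\<rfloor>"
   have q0: "(x - a) / w \<ge> 0" using x w by simp
   have m: "real m \<le> (x - a) / w" "(x - a) / w < real m + 1" using q0 by (auto simp: m_def)
   have qN: "(x - a) / w \<le> real N" using x w N0 by (simp add: w_def field_simps)
   define i where "i = min m (N - 1)"
   have iN: "i < N" using N0 by (auto simp: i_def)
   have "real i * w \<le> x - a"
   proof -
    have "real i * w \<le> real m * w" using w by (intro mult_right_mono) (auto simp: i_def)
    also have "... \<le> x - a" using m(1) w by (simp add: pos_le_divide_eq)
    finally show ?thesis .
   qed
   moreover have "x - a \<le> real (Suc i) * w"
   proof (cases "m \<le> N - 1")
    case True
    then show ?thesis using m(2) w by (simp add: i_def pos_divide_less_eq add.commute)
   next
    case False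
    then have "Suc i = N" using N0 by (auto simp: i_def)
    then show ?thesis using qN w by (simp add: pos_divide_le_eq del: of_nat_Suc)
   qed
   ultimately have "x \<in> {a + real i * w..a + real (Suc i) * w}" by (auto simp del: of_nat_Suc)
   then show ?thesis using iN by (intro exI[of _ i]) (auto simp: U_def)
  qed
 qed
 then have U: "U \<in> {U :: nat => complex set. f ` {a..b} \<subseteq> (\<Union>i. U i) \<and> (\<forall>i. bounded (U i) \<and> diameter (U i) \<le> \<delta>)}"
 proof -
  have "diameter (U i) \<le> \<delta>" for i using bd(2)[of i] Kw d by (cases "i < N") auto
  then show ?thesis using \<open>f ` {a..b} \<subseteq> (\<Union>i. U i)\<close> bd(1) by blast
 qed
 have "hausdorff1_pre \<delta> (f ` {a..b}) \<le> (\<Sum>i. ennreal (diameter (U i)))"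
  unfolding hausdorff1_pre_def by (rule INF_lower[OF U])
 also have "... = (\<Sum>i<N. ennreal (diameter (U i)))"
  by (rule suminf_finite) (auto simp: U_def)
 also have "... \<le> (\<Sum>i<N. ennreal (K * w))"
  using bd(2) by (intro sum_mono ennreal_leI) (metis lessThan_iff)
 also have "... = ennreal (\<Sum>i<N. K * w)" using K w0 by (intro sum_ennreal) simp
 also have "(\<Sum>i<N. K * w) = K * (b - a)" using N0 by (simp add: w_def)
 finally show "hausdorff1_pre \<delta> (f ` {a..b}) \<le> ennreal (K * (b - a))" .
qed

text \<open>Almost disjoint intervals covering \<open>S\<close> with little excess.\<close>
lemma measure_le_lborel_of_intervals:
 fixes P :: "real measure"
 assumes sP: "sets P = sets borel" and r: "r > 0" and conc: "emeasure P (- {-r..r}) = 0" and K: "K > 0"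
  and int: "\<And>c d. c \<le> d ==> emeasure P {c..d} \<le> ennreal (K * (d - c))" and S: "S \<in> sets borel"
 shows "emeasure P S \<le> ennreal K * emeasure lborel S"
proof -
 let ?S = "S \<inter> {-r..r}"
 have Sb: "?S \<in> sets borel" using S by auto
 have lm: "?S \<in> lmeasurable"
  by (rule fmeasurableI2[OF _ Int_lower2]) (use Sb in \<open>auto simp: fmeasurable_cbox[of "-r" r, simplified]\<close>)
 have bnd: "emeasure P ?S \<le> ennreal K * ennreal (measure lebesgue ?S + e)" if e: "e > 0" for e
 proof -
  obtain \<D> where D: "countable \<D>"
    "\<And>A. A \<in> \<D> ==> A \<subseteq> cbox (-r) r \<and> A \<noteq> {} \<and> (\<exists>c d. A = cbox c d)"
    "pairwise (\<lambda>A B. interior A \<inter> interior B = {}) \<D>"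
    "?S \<subseteq> \<Union>\<D>" "\<Union>\<D> \<in> lmeasurable" "measure lebesgue (\<Union>\<D>) \<le> measure lebesgue ?S + e"
   by (rule measurable_outer_intervals_bounded[OF lm _ e, of "-r" r]) auto
  have Db: "A \<in> sets borel" if "A \<in> \<D>" for A using D(2)[OF that] by auto
  have "emeasure P ?S \<le> emeasure P (\<Union>A\<in>\<D>. A)"
   using D(4) Db D(1) by (intro emeasure_mono) (auto simp: sP)
  also have "... \<le> (\<integral>\<^sup>+A. emeasure P A \<partial>count_space \<D>)"
  proof -
   have m: "indicator A \<in> borel_measurable P" if "A \<in> \<D>" for A :: "real set"
    using Db[OF that] sP by (intro borel_measurable_indicator) simp
   have "emeasure P (\<Union>A\<in>\<D>. A) = (\<integral>\<^sup>+x. indicator (\<Union>A\<in>\<D>. A) x \<partial>P)"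
    using Db D(1) sP by (intro nn_integral_indicator[symmetric] sets.countable_UN') auto
   also have "... \<le> (\<integral>\<^sup>+x. (\<integral>\<^sup>+A. indicator A x \<partial>count_space \<D>) \<partial>P)"
   proof (rule nn_integral_mono)
    fix x
    show "indicator (\<Union>A\<in>\<D>. A) x \<le> (\<integral>\<^sup>+A. (indicator A x :: ennreal) \<partial>count_space \<D>)"
    proof (cases "x \<in> (\<Union>A\<in>\<D>. A)")
     case True
     then obtain A where A: "A \<in> \<D>" "x \<in> A" by auto
     show ?thesis using nn_integral_ge_point[OF A(1), of "\<lambda>A. indicator A x"] A True by simp
    qed simp
   qed
   also have "... = (\<integral>\<^sup>+A. (\<integral>\<^sup>+x. indicator A x \<partial>P) \<partial>count_space \<D>)"
    by (rule nn_integral_count_space_nn_integral) (use D(1) m in auto)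
   also have "... = (\<integral>\<^sup>+A. emeasure P A \<partial>count_space \<D>)"
    using Db sP by (intro nn_integral_cong) (auto intro!: nn_integral_indicator)
   finally show ?thesis .
  qed
  also have "... \<le> (\<integral>\<^sup>+A. ennreal K * emeasure lborel (interior A) \<partial>count_space \<D>)"
  proof (rule nn_integral_mono)
   fix A assume "A \<in> space (count_space \<D>)"
   then obtain c d where A: "A = {c..d}" "c \<le> d" using D(2)[of A] by auto
   have "emeasure P A \<le> ennreal (K * (d - c))" using int A by simp
   also have "... = ennreal K * emeasure lborel (interior A)" using A K by (simp add: ennreal_mult)
   finally show "emeasure P A \<le> ennreal K * emeasure lborel (interior A)" .
  qed
  also have "... = ennreal K * (\<integral>\<^sup>+A. emeasure lborel (interior A) \<partial>count_space \<D>)"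
   by (rule nn_integral_cmult) simp
  also have "(\<integral>\<^sup>+A. emeasure lborel (interior A) \<partial>count_space \<D>) = emeasure lborel (\<Union>A\<in>\<D>. interior A)"
   by (rule emeasure_UN_countable[symmetric]) (use D(1,3) in \<open>auto simp: disjoint_family_on_def pairwise_def\<close>)
  also have "... = emeasure lebesgue (\<Union>A\<in>\<D>. interior A)"
  proof -
   have "(\<Union>A\<in>\<D>. interior A) \<in> sets lborel" by (simp add: borel_open open_UN)
   then show ?thesis by (subst emeasure_completion) (simp_all add: sets_completionI_sets)
  qed
  also have "... \<le> emeasure lebesgue (\<Union>\<D>)"
  proof (rule emeasure_mono[OF _ fmeasurableD[OF D(5)]])
   show "(\<Union>A\<in>\<D>. interior A) \<subseteq> \<Union>\<D>" by (meson UN_least Union_upper interior_subset order_trans)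
  qed
  also have "... = ennreal (measure lebesgue (\<Union>\<D>))" using D(5) by (simp add: emeasure_eq_measure2)
  also have "... \<le> ennreal (measure lebesgue ?S + e)" using D(6) by (rule ennreal_leI)
  finally show ?thesis by (metis mult_left_mono zero_le)
 qed
 have fin: "emeasure P ?S \<le> ennreal (K * measure lebesgue ?S)"
 proof (rule ennreal_le_epsilon)
  fix e :: real assume e: "e > 0"
  have "emeasure P ?S \<le> ennreal K * ennreal (measure lebesgue ?S + e / K)" using e K by (intro bnd) simp
  also have "... = ennreal (K * (measure lebesgue ?S + e / K))" using e K by (intro ennreal_mult[symmetric]) auto
  also have "K * (measure lebesgue ?S + e / K) = K * measure lebesgue ?S + e" using K by (simp add: field_simps)
  also have "ennreal ... = ennreal (K * measure lebesgue ?S) + ennreal e" using e K by (intro ennreal_plus) auto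
  finally show "emeasure P ?S \<le> ennreal (K * measure lebesgue ?S) + ennreal e" .
 qed
 have "emeasure P S \<le> emeasure P (?S \<union> - {-r..r})" using S by (intro emeasure_mono) (auto simp: sP)
 also have "... \<le> emeasure P ?S + emeasure P (- {-r..r})" using S by (intro emeasure_subadditive) (auto simp: sP)
 also have "... = emeasure P ?S" using conc by simp
 also have "... \<le> ennreal K * ennreal (measure lebesgue ?S)" using fin K by (simp add: ennreal_mult)
 also have "ennreal (measure lebesgue ?S) = emeasure lebesgue ?S" using lm by (simp add: emeasure_eq_measure2)
 also have "... = emeasure lborel ?S" using Sb by simp
 also have "... \<le> emeasure lborel S" using S by (intro emeasure_mono) auto
 finally show ?thesis by (metis mult_left_mono zero_le)
qed

lemma bounded_density_of_le:
 fixes P :: "real measure"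
 assumes sP: "sets P = sets borel" and fin: "finite_measure P" and K: "K \<ge> 0"
  and le: "\<And>S. S \<in> sets borel ==> emeasure P S \<le> ennreal K * emeasure lborel S"
 obtains D :: "real => real" where "D \<in> borel_measurable borel" "\<And>x. 0 \<le> D x" "\<And>x. D x \<le> K"
  "P = density lborel (\<lambda>x. ennreal (D x))"
proof -
 interpret finite_measure P by fact
 have "absolutely_continuous lborel P"
  unfolding absolutely_continuous_def
 proof
  fix A :: "real set" assume A: "A \<in> null_sets lborel"
  then have Ab: "A \<in> sets borel" "emeasure lborel A = 0" using null_setsD1[OF A] null_setsD2[OF A] by auto
  then have "emeasure P A \<le> 0" using le[OF Ab(1)] by simp
  then show "A \<in> null_sets P" using Ab sP by (intro null_setsI) auto
 qed
 from sigma_finite_measure.Radon_Nikodym[OF sigma_finite_lborel this] sP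
 obtain g where g[measurable]: "g \<in> borel_measurable lborel" and gP: "density lborel g = P" by auto
 have gK: "AE x in lborel. g x \<le> ennreal K"
 proof -
  define S where "S = {x. g x > ennreal K}"
  have Sb[measurable]: "S \<in> sets borel" unfolding S_def by measurable
  have finS: "emeasure P S < \<infinity>" using emeasure_finite[of S] by (simp only: infinity_ennreal_def less_top)
  have "emeasure P S = (NN x. g x * indicator S x)" unfolding gP[symmetric] by (subst emeasure_density) auto
  also have "... = (NN x. (g x - ennreal K) * indicator S x + ennreal K * indicator S x)"
  proof (rule nn_integral_cong)
   fix x
   show "g x * indicator S x = (g x - ennreal K) * indicator S x + ennreal K * indicator S x"
   proof (cases "x \<in> S")
    case True
    then have "ennreal K \<le> g x" by (simp add: S_def less_imp_le)
    then show ?thesis using True by (simp add: diff_add_cancel_ennreal)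
   qed simp
  qed
  also have "... = (NN x. (g x - ennreal K) * indicator S x) + ennreal K * emeasure lborel S"
  proof -
   have "(NN x. ennreal K * indicator S x) = ennreal K * emeasure lborel S"
    by (rule nn_integral_cmult_indicator) simp
   moreover have "(\<lambda>x. (g x - ennreal K) * indicator S x) \<in> borel_measurable lborel" by measurable
   ultimately show ?thesis by (subst nn_integral_add) simp_all
  qed
  finally have eq: "emeasure P S = (NN x. (g x - ennreal K) * indicator S x) + ennreal K * emeasure lborel S" .
  then have "(NN x. (g x - ennreal K) * indicator S x) + ennreal K * emeasure lborel S \<le> 0 + ennreal K * emeasure lborel S"
   using le[OF Sb] by (simp only: add_0_left)
  moreover have "ennreal K * emeasure lborel S < \<infinity>" using eq finS by (simp only: ennreal_add_less_top infinity_ennreal_def simp_thms)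
  ultimately have "(NN x. (g x - ennreal K) * indicator S x) \<le> 0"
   unfolding add.commute[of _ "ennreal K * emeasure lborel S"] ennreal_add_left_cancel_le by (auto simp only: infinity_ennreal_def less_irrefl)
  then have "(NN x. (g x - ennreal K) * indicator S x) = 0" by simp
  then have "AE x in lborel. (g x - ennreal K) * indicator S x = 0"
   by (rule nn_integral_0_iff_AE[THEN iffD1, rotated]) measurable
  then show ?thesis
  proof eventually_elim
   case (elim x)
   show ?case
   proof (rule ccontr)
    assume "\<not> g x \<le> ennreal K"
    then have "x \<in> S" "0 < g x - ennreal K" by (auto simp: S_def not_le intro: diff_gr0_ennreal)
    then show False using elim by simp
   qed
  qed
 qed
 define D where "D x = min K (enn2real (g x))" for x
 have Db: "D \<in> borel_measurable borel" unfolding D_def[abs_def] using g by measurable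
 have "density lborel g = density lborel (\<lambda>x. ennreal (D x))"
 proof (rule density_cong)
  show "AE x in lborel. g x = ennreal (D x)"
   using gK
  proof eventually_elim
   case (elim x)
   then have "g x < top" using ennreal_less_top le_less_trans by blast
   then have gx: "g x = ennreal (enn2real (g x))" by simp
   then have "enn2real (g x) \<le> K" using elim K by (metis ennreal_le_iff)
   then show ?case using gx by (simp add: D_def)
  qed
 qed (use Db g in \<open>simp_all add: measurable_lborel1\<close>)
 then have P: "P = density lborel (\<lambda>x. ennreal (D x))" using gP by simp
 show ?thesis
 proof (rule that[OF Db _ _ P])
  show "0 \<le> D x" for x using K by (simp add: D_def)
  show "D x \<le> K" for x by (simp add: D_def)
 qed
qed

section \<open>Charts of a Lipschitz boundary\<close>

abbreviation cut :: "(complex => complex) => complex => real => complex => complex"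
 where "cut f x e y \<equiv> if dist x y > e then f y / (y - x) else 0"

locale boundary_chart =
 fixes B :: "complex set" and p u :: complex and r h L :: real and g :: "real => real"
 assumes B_open: "open B" and u: "cmod u = 1" and r: "r > 0" and h: "h > 0"
  and lip: "L-lipschitz_on UNIV g"
  and epi: "\<And>s t. \<bar>s\<bar> < r ==> \<bar>t\<bar> < h ==> p + u * Complex s t \<in> B \<longleftrightarrow> g s < t"
begin

interpretation lg: lipschitz_graph g L by standard (rule lip)

definition coord :: "complex => complex" where "coord y = cnj u * (y - p)"
definition window :: "complex set" where "window = {y. \<bar>Re (coord y)\<bar> < r \<and> \<bar>Im (coord y)\<bar> < h}"
definition curve :: "real => complex" where "curve s = p + u * lg.z s"

lemma u_cnj: "u * cnj u = 1" using u by (simp add: complex_norm_square[symmetric])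

lemma coord_inverse: "p + u * coord y = y"
 using u_cnj by (simp add: coord_def mult.assoc[symmetric])

lemma coord_curve: "coord (curve s) = lg.z s"
 using u_cnj by (simp add: coord_def curve_def mult.assoc[symmetric] mult.commute[of "cnj u"])

lemma continuous_coord [continuous_intros]: "continuous_on S coord"
 unfolding coord_def by (intro continuous_intros)

lemma measurable_coord [measurable]: "coord \<in> borel_measurable borel"
 by (intro borel_measurable_continuous_onI continuous_coord)

lemma dist_curve: "dist (curve s) (curve t) = cmod (lg.z t - lg.z s)"
 using u by (simp add: curve_def dist_norm norm_mult right_diff_distrib[symmetric] norm_minus_commute)

lemma curve_lipschitz: "dist (curve s) (curve t) \<le> (1 + L) * \<bar>s - t\<bar>"
 unfolding dist_curve using lg.norm_z_le[of t s] by (metis abs_minus_commute norm_minus_commute)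

lemma continuous_curve: "continuous_on S curve"
 by (rule continuous_on_subset[OF lipschitz_on_continuous_on[of "1 + L" UNIV]])
  (use curve_lipschitz lg.L_nonneg in \<open>auto intro!: lipschitz_onI simp: dist_real_def\<close>)

lemma curve_measurable [measurable]: "curve \<in> borel_measurable borel"
 by (intro borel_measurable_continuous_onI continuous_curve)

lemma open_window: "open window"
proof -
 have "window = (\<lambda>y. \<bar>Re (coord y)\<bar>) -` {..<r} \<inter> (\<lambda>y. \<bar>Im (coord y)\<bar>) -` {..<h}" by (auto simp: window_def)
 then show ?thesis by (auto intro!: open_Int open_vimage continuous_intros)
qed

lemma window_borel [measurable]: "window \<in> sets borel" using open_window by simp

lemma center_in_window: "p \<in> window" using r h by (simp add: window_def coord_def)

lemma frontier_borel [measurable]: "frontier B \<in> sets borel" by simp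

text \<open>Below the graph there is an open set disjoint from \<open>B\<close>, above it one contained in
  \<open>B\<close>.\<close>
lemma frontier_window: "y = curve (Re (coord y))" if y: "y \<in> frontier B" "y \<in> window"
proof -
 define s t where "s = Re (coord y)" and "t = Im (coord y)"
 have st: "\<bar>s\<bar> < r" "\<bar>t\<bar> < h" using y by (auto simp: window_def s_def t_def)
 have c: "coord y = Complex s t" by (simp add: s_def t_def)
 have yy: "y = p + u * Complex s t" using coord_inverse[of y] by (simp add: c)
 have nB: "y \<notin> B" using y(1) B_open by (simp add: frontier_def interior_open)
 then have le: "\<not> g s < t" using epi[OF st] yy by simp
 have "\<not> t < g s"
 proof
  assume lt: "t < g s"
  define U where "U = window \<inter> {y. Im (coord y) < g (Re (coord y))}"
  have gc: "continuous_on UNIV g" using lip by (rule lipschitz_on_continuous_on)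
  have "open U" unfolding U_def
   by (intro open_Int open_window open_Collect_less continuous_intros continuous_on_compose2[OF gc]) auto
  moreover have "y \<in> U" using y(2) lt by (simp add: U_def s_def t_def)
  moreover have "U \<inter> B = {}"
  proof -
   have "x \<notin> B" if "x \<in> U" for x
   proof -
    have "\<bar>Re (coord x)\<bar> < r" "\<bar>Im (coord x)\<bar> < h" "\<not> g (Re (coord x)) < Im (coord x)"
     using that by (auto simp: U_def window_def)
    then have "p + u * Complex (Re (coord x)) (Im (coord x)) \<notin> B" using epi by blast
    then show ?thesis by (simp add: coord_inverse)
   qed
   then show ?thesis by blast
  qed
  ultimately have "y \<notin> closure B" by (metis disjoint_iff open_Int_closure_eq_empty)
  then show False using y(1) by (simp add: frontier_def)
 qed
 then have "t = g s" using le by simp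
 then have "coord y = lg.z s" by (simp add: c lg.z_def)
 then show ?thesis using coord_inverse[of y] by (simp add: curve_def s_def)
qed

text \<open>The surface measure in graph coordinates. Its density with respect to Lebesgue measure is
  bounded because the graph is Lipschitz.\<close>
definition chart_measure :: "real measure" where
 "chart_measure = distr (density hausdorff1 (indicator (window \<inter> frontier B))) borel (\<lambda>y. Re (coord y))"

lemma sets_chart_measure: "sets chart_measure = sets borel" by (simp add: chart_measure_def)

lemma emeasure_chart_measure:
 "S \<in> sets borel ==> emeasure chart_measure S = emeasure hausdorff1 ((\<lambda>y. Re (coord y)) -` S \<inter> (window \<inter> frontier B))"
proof -
 assume S: "S \<in> sets borel"
 let ?S = "(\<lambda>y. Re (coord y)) -` S"
 have S': "?S \<in> sets borel" using measurable_sets[of "\<lambda>y. Re (coord y)" borel borel S] S by simp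
 have "emeasure chart_measure S = emeasure (density hausdorff1 (indicator (window \<inter> frontier B))) ?S"
  unfolding chart_measure_def by (subst emeasure_distr) (use S in simp_all)
 also have "... = (\<integral>\<^sup>+y. indicator (window \<inter> frontier B) y * indicator ?S y \<partial>hausdorff1)"
  using S' by (intro emeasure_density) simp_all
 also have "... = (\<integral>\<^sup>+y. indicator (?S \<inter> (window \<inter> frontier B)) y \<partial>hausdorff1)"
  by (intro nn_integral_cong) (auto simp: indicator_def)
 also have "... = emeasure hausdorff1 (?S \<inter> (window \<inter> frontier B))"
  using S' by (intro nn_integral_indicator) simp
 finally show ?thesis .
qed

lemma chart_measure_le: "emeasure chart_measure {c..d} \<le> ennreal ((1 + L) * (d - c))" if "c \<le> d"
proof -
 have sub: "(\<lambda>y. Re (coord y)) -` {c..d} \<inter> (window \<inter> frontier B) \<subseteq> curve ` {c..d}"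
  using frontier_window by fastforce
 have comp: "compact (curve ` {c..d})" by (intro compact_continuous_image continuous_curve) simp
 have "emeasure chart_measure {c..d} \<le> emeasure hausdorff1 (curve ` {c..d})"
  unfolding emeasure_chart_measure[OF borel_closed[OF closed_atLeastAtMost]]
  using sub comp by (intro emeasure_mono) (auto intro: borel_compact)
 also have "... \<le> hausdorff1_outer (curve ` {c..d})" by (rule emeasure_hausdorff1_le)
 also have "... \<le> ennreal ((1 + L) * (d - c))"
  using lg.L_nonneg that by (intro hausdorff1_outer_lipschitz_Icc curve_lipschitz) auto
 finally show ?thesis .
qed

lemma chart_measure_outside: "emeasure chart_measure (- {-r..r}) = 0"
proof -
 have "(\<lambda>y. Re (coord y)) -` (- {-r..r}) \<inter> (window \<inter> frontier B) = {}" by (auto simp: window_def)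
 then show ?thesis by (subst emeasure_chart_measure) auto
qed

lemma finite_chart_measure: "finite_measure chart_measure"
proof
 have "emeasure chart_measure (space chart_measure) = emeasure chart_measure ({-r..r} \<union> - {-r..r})"
  using sets_eq_imp_space_eq[OF sets_chart_measure] by simp
 also have "... \<le> emeasure chart_measure {-r..r} + emeasure chart_measure (- {-r..r})"
  by (rule emeasure_subadditive) (auto simp: sets_chart_measure)
 also have "... \<le> ennreal ((1 + L) * (r - - r))" using chart_measure_le[of "-r" r] r by (simp add: chart_measure_outside)
 finally show "emeasure chart_measure (space chart_measure) \<noteq> \<infinity>" by (auto simp: top_unique)
qed

lemma surface_measure_window_finite: "emeasure hausdorff1 (window \<inter> frontier B) < \<infinity>"
proof -
 interpret finite_measure chart_measure by (rule finite_chart_measure)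
 have "emeasure hausdorff1 (window \<inter> frontier B) = emeasure chart_measure UNIV"
  by (simp add: emeasure_chart_measure)
 then show ?thesis by (simp add: less_top[symmetric])
qed

lemma chart_density:
 obtains D :: "real => real" where "D \<in> borel_measurable borel" "\<And>x. 0 \<le> D x" "\<And>x. D x \<le> 1 + L"
  "chart_measure = density lborel (\<lambda>x. ennreal (D x))"
 by (rule bounded_density_of_le[OF sets_chart_measure finite_chart_measure _ measure_le_lborel_of_intervals[OF sets_chart_measure r chart_measure_outside _ chart_measure_le]])
  (use lg.L_nonneg in auto)

lemma space_surface_measure: "space (surface_measure B) = frontier B"
 by (simp add: surface_measure_def space_restrict_space)

context
 fixes D :: "real => real"
 assumes D [measurable]: "D \<in> borel_measurable borel" and D0: "\<And>x. 0 \<le> D x" and D1: "\<And>x. D x \<le> 1 + L"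
  and chart_D: "chart_measure = density lborel (\<lambda>x. ennreal (D x))"
begin

lemma
 fixes H :: "complex => 'a :: {banach, second_countable_topology}"
 assumes H [measurable]: "H \<in> borel_measurable borel" and out: "\<And>y. y \<notin> window ==> H y = 0"
 shows chart_integrable: "integrable (surface_measure B) H \<longleftrightarrow> integrable lborel (\<lambda>t. D t *\<^sub>R H (curve t))"
  and chart_integral: "integral\<^sup>L (surface_measure B) H = (\<integral>t. D t *\<^sub>R H (curve t) \<partial>lborel)"
proof -
 let ?i = "\<lambda>y. indicator (window \<inter> frontier B) y :: real"
 have eq: "indicator (frontier B) y *\<^sub>R H y = ?i y *\<^sub>R H (curve (Re (coord y)))" for y
  using frontier_window[of y] out[of y] by (auto simp: indicator_def)
 have dens: "density hausdorff1 (indicator (window \<inter> frontier B)) = density hausdorff1 (\<lambda>y. ennreal (?i y))"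
  by (simp add: ennreal_indicator)
 have Hc [measurable]: "(\<lambda>t. H (curve t)) \<in> borel_measurable borel" by measurable
 have "integrable (surface_measure B) H \<longleftrightarrow> integrable hausdorff1 (\<lambda>y. ?i y *\<^sub>R H (curve (Re (coord y))))"
  unfolding surface_measure_def eq[symmetric] by (rule integrable_restrict_space) simp
 also have "... \<longleftrightarrow> integrable (density hausdorff1 (\<lambda>y. ennreal (?i y))) (\<lambda>y. H (curve (Re (coord y))))"
  by (rule integrable_density[symmetric]) (simp_all)
 also have "... \<longleftrightarrow> integrable chart_measure (\<lambda>t. H (curve t))"
  unfolding chart_measure_def dens by (rule integrable_distr_eq[symmetric]) simp_all
 also have "... \<longleftrightarrow> integrable lborel (\<lambda>t. D t *\<^sub>R H (curve t))"
  unfolding chart_D by (rule integrable_density) (use D0 in simp_all)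
 finally show "integrable (surface_measure B) H \<longleftrightarrow> integrable lborel (\<lambda>t. D t *\<^sub>R H (curve t))" .
 have "integral\<^sup>L (surface_measure B) H = (\<integral>y. ?i y *\<^sub>R H (curve (Re (coord y))) \<partial>hausdorff1)"
  unfolding surface_measure_def eq[symmetric] by (rule integral_restrict_space) simp
 also have "... = (\<integral>y. H (curve (Re (coord y))) \<partial>density hausdorff1 (\<lambda>y. ennreal (?i y)))"
  by (rule integral_density[symmetric]) simp_all
 also have "... = (\<integral>t. H (curve t) \<partial>chart_measure)"
  unfolding chart_measure_def dens by (rule integral_distr[symmetric]) simp_all
 also have "... = (\<integral>t. D t *\<^sub>R H (curve t) \<partial>lborel)"
  unfolding chart_D by (rule integral_density) (use D0 in simp_all)
 finally show "integral\<^sup>L (surface_measure B) H = (\<integral>t. D t *\<^sub>R H (curve t) \<partial>lborel)" .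
qed

lemma chart_AE:
 assumes "AE s in lborel. P s"
 shows "AE y in surface_measure B. y \<in> window \<longrightarrow> P (Re (coord y))"
proof -
 have "AE s in chart_measure. P s"
  unfolding chart_D using assms by (subst AE_density) auto
 then have "AE y in density hausdorff1 (indicator (window \<inter> frontier B)). P (Re (coord y))"
  unfolding chart_measure_def by (rule AE_distrD[rotated]) simp
 then have "AE y in hausdorff1. 0 < (indicator (window \<inter> frontier B) y :: ennreal) \<longrightarrow> P (Re (coord y))"
  by (subst (asm) AE_density) auto
 then have "AE y in hausdorff1. y \<in> frontier B \<longrightarrow> y \<in> window \<longrightarrow> P (Re (coord y))"
  by eventually_elim (auto simp: indicator_def)
 then show ?thesis unfolding surface_measure_def by (subst AE_restrict_space_iff) auto
qed

text \<open>The density of the chart measure is absorbed into the function: it is bounded, so square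
  integrability is preserved.\<close>
lemma chart_principal_value:
 assumes \<psi> [measurable]: "\<psi> \<in> borel_measurable borel"
  and L2: "integrable (surface_measure B) (\<lambda>y. (cmod (\<psi> y))\<^sup>2)"
  and out: "\<And>y. y \<notin> window ==> \<psi> y = 0"
 shows "AE x in surface_measure B. x \<in> window \<longrightarrow>
  (\<exists>l. ((\<lambda>\<epsilon>. \<integral>y. (cut \<psi> x \<epsilon> y) \<partial>surface_measure B) \<longlongrightarrow> l) (at_right 0))"
proof -
 define f where "f t = of_real (D t) * \<psi> (curve t)" for t
 have fb [measurable]: "f \<in> borel_measurable borel" unfolding f_def by measurable
 have f0: "f t = 0" if "t \<notin> {-r..r}" for t
 proof -
  have "curve t \<notin> window" using that by (auto simp: window_def coord_curve lg.z_def)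
  then show ?thesis by (simp add: f_def out)
 qed
 have L2f: "integrable lborel (\<lambda>t. (cmod (f t))\<^sup>2)"
 proof (rule Bochner_Integration.integrable_bound)
  have "integrable lborel (\<lambda>t. D t *\<^sub>R (cmod (\<psi> (curve t)))\<^sup>2)"
   using L2 by (subst (asm) chart_integrable) (auto simp: out)
  then show "integrable lborel (\<lambda>t. (1 + L) * (D t * (cmod (\<psi> (curve t)))\<^sup>2))" by simp
  have "(cmod (f t))\<^sup>2 \<le> (1 + L) * (D t * (cmod (\<psi> (curve t)))\<^sup>2)" for t
   using mult_right_mono[OF D1[of t], of "D t * (cmod (\<psi> (curve t)))\<^sup>2"] D0[of t]
   by (simp add: f_def norm_mult power_mult_distrib power2_eq_square mult_ac)
  then show "AE t in lborel. norm ((cmod (f t))\<^sup>2) \<le> norm ((1 + L) * (D t * (cmod (\<psi> (curve t)))\<^sup>2))"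
   using D0 lg.L_nonneg by (auto simp: abs_mult)
 qed simp
 have L1f: "integrable lborel f"
 proof (rule Bochner_Integration.integrable_bound)
  show "integrable lborel (\<lambda>t. indicator {-r..r} t + (cmod (f t))\<^sup>2)" using L2f by simp
  have "cmod (f t) \<le> indicator {-r..r} t + (cmod (f t))\<^sup>2" for t
  proof (cases "t \<in> {-r..r}")
   case True
   have "0 \<le> (cmod (f t) - 1)\<^sup>2 + (cmod (f t))\<^sup>2 + 1" by simp
   then show ?thesis using True by (simp add: power2_eq_square algebra_simps)
  qed (simp add: f0)
  then show "AE t in lborel. norm (f t) \<le> norm (indicator {-r..r} t + (cmod (f t))\<^sup>2)"
   by (simp add: abs_of_nonneg)
 qed simp
 from lg.AE_principal_value_L2[OF fb L1f L2f r f0]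
 have "AE s in lborel. \<bar>s\<bar> < r \<longrightarrow> (\<exists>l. ((\<lambda>\<epsilon>. LINT t|lborel. lg.trunc \<epsilon> s t * f t) \<longlongrightarrow> l) (at_right 0))" .
 from chart_AE[OF this] AE_space show ?thesis
 proof eventually_elim
  case (elim x)
  show ?case
  proof
   assume xw: "x \<in> window"
   define s where "s = Re (coord x)"
   have xs: "x = curve s" using frontier_window[of x] xw elim(2) by (simp add: s_def space_surface_measure)
   have "\<bar>s\<bar> < r" using xw by (simp add: window_def s_def)
   then obtain l where l: "((\<lambda>\<epsilon>. LINT t|lborel. lg.trunc \<epsilon> s t * f t) \<longlongrightarrow> l) (at_right 0)"
    using elim(1) xw s_def by auto
   have u0: "u \<noteq> 0" using u by auto
   have "(\<integral>y. (cut \<psi> x \<epsilon> y) \<partial>surface_measure B) = (LINT t|lborel. lg.trunc \<epsilon> s t * f t) / u" for \<epsilon>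
   proof -
    have "(\<integral>y. (cut \<psi> x \<epsilon> y) \<partial>surface_measure B) =
      (\<integral>t. D t *\<^sub>R (if dist x (curve t) > \<epsilon> then \<psi> (curve t) / (curve t - x) else 0) \<partial>lborel)"
     by (rule chart_integral) (auto simp: out)
    also have "... = (\<integral>t. lg.trunc \<epsilon> s t * f t / u \<partial>lborel)"
    proof (rule Bochner_Integration.integral_cong[OF refl])
     fix t
     have "curve t - x = u * (lg.z t - lg.z s)" by (simp add: xs curve_def algebra_simps)
     then show "D t *\<^sub>R (if dist x (curve t) > \<epsilon> then \<psi> (curve t) / (curve t - x) else 0) = lg.trunc \<epsilon> s t * f t / u"
      using u0 by (simp add: xs dist_curve lg.trunc_def f_def scaleR_conv_of_real mult_ac)
    qed
    finally show ?thesis by simp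
   qed
   then show "\<exists>l. ((\<lambda>\<epsilon>. \<integral>y. (cut \<psi> x \<epsilon> y) \<partial>surface_measure B) \<longlongrightarrow> l) (at_right 0)"
    using tendsto_divide[OF l tendsto_const u0] by auto
  qed
 qed
qed

end

end

section \<open>Principal values on the boundary of a Lipschitz domain\<close>

lemma boundary_window:
 assumes B: "bounded_lipschitz_domain B" and p: "p \<in> frontier B"
 obtains W where "open W" "p \<in> W" "emeasure hausdorff1 (W \<inter> frontier B) < \<infinity>"
  "\<And>\<psi>. \<psi> \<in> borel_measurable borel ==> integrable (surface_measure B) (\<lambda>y. (cmod (\<psi> y))\<^sup>2) ==>
   (\<And>y. y \<notin> W ==> \<psi> y = 0) ==> AE x in surface_measure B. x \<in> W \<longrightarrow>
   (\<exists>l. ((\<lambda>\<epsilon>. \<integral>y. (cut \<psi> x \<epsilon> y) \<partial>surface_measure B) \<longlongrightarrow> l) (at_right 0))"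
proof -
 obtain u r h g L where c: "cmod u = 1" "r > 0" "h > 0" "L-lipschitz_on UNIV g"
   "\<And>s t. \<bar>s\<bar> < r \<and> \<bar>t\<bar> < h \<longrightarrow> (p + u * Complex s t \<in> B \<longleftrightarrow> g s < t)"
  using B p unfolding bounded_lipschitz_domain_def lipschitz_boundary_def by meson
 interpret boundary_chart B p u r h L g
  by standard (use c B in \<open>auto simp: bounded_lipschitz_domain_def\<close>)
 obtain D :: "real => real" where D: "D \<in> borel_measurable borel" "\<And>x. 0 \<le> D x" "\<And>x. D x \<le> 1 + L"
  "chart_measure = density lborel (\<lambda>x. ennreal (D x))" by (rule chart_density) blast
 show ?thesis
  by (rule that[OF open_window center_in_window surface_measure_window_finite chart_principal_value[OF D]])
qed

lemma boundary_windows: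
 assumes B: "bounded_lipschitz_domain B"
 obtains \<W> where "finite \<W>" "frontier B \<subseteq> \<Union>\<W>"
  "\<And>W. W \<in> \<W> ==> open W" "\<And>W. W \<in> \<W> ==> emeasure hausdorff1 (W \<inter> frontier B) < \<infinity>"
  "\<And>W \<psi>. W \<in> \<W> ==> \<psi> \<in> borel_measurable borel ==> integrable (surface_measure B) (\<lambda>y. (cmod (\<psi> y))\<^sup>2) ==>
   (\<And>y. y \<notin> W ==> \<psi> y = 0) ==> AE x in surface_measure B. x \<in> W \<longrightarrow>
   (\<exists>l. ((\<lambda>\<epsilon>. \<integral>y. (cut \<psi> x \<epsilon> y) \<partial>surface_measure B) \<longlongrightarrow> l) (at_right 0))"
proof -
 define good where "good W \<longleftrightarrow> open W \<and> emeasure hausdorff1 (W \<inter> frontier B) < \<infinity> \<and>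
  (\<forall>\<psi>. \<psi> \<in> borel_measurable borel \<longrightarrow> integrable (surface_measure B) (\<lambda>y. (cmod (\<psi> y))\<^sup>2) \<longrightarrow>
   (\<forall>y. y \<notin> W \<longrightarrow> \<psi> y = 0) \<longrightarrow> (AE x in surface_measure B. x \<in> W \<longrightarrow>
   (\<exists>l. ((\<lambda>\<epsilon>. \<integral>y. (cut \<psi> x \<epsilon> y) \<partial>surface_measure B) \<longlongrightarrow> l) (at_right 0))))" for W
 have "\<exists>W. good W \<and> p \<in> W" if p: "p \<in> frontier B" for p
 proof -
  obtain W where W: "open W" "p \<in> W" "emeasure hausdorff1 (W \<inter> frontier B) < \<infinity>"
   "\<And>\<psi>. \<psi> \<in> borel_measurable borel ==> integrable (surface_measure B) (\<lambda>y. (cmod (\<psi> y))\<^sup>2) ==>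
    (\<And>y. y \<notin> W ==> \<psi> y = 0) ==> AE x in surface_measure B. x \<in> W \<longrightarrow>
    (\<exists>l. ((\<lambda>\<epsilon>. \<integral>y. (cut \<psi> x \<epsilon> y) \<partial>surface_measure B) \<longlongrightarrow> l) (at_right 0))"
   by (rule boundary_window[OF B p]) blast
  then have "good W" unfolding good_def by blast
  then show ?thesis using W(2) by blast
 qed
 then have cov: "frontier B \<subseteq> \<Union>{W. good W}" by blast
 have comp: "compact (frontier B)"
  using B by (intro compact_frontier_bounded) (simp add: bounded_lipschitz_domain_def)
 obtain \<W> where \<W>: "\<W> \<subseteq> {W. good W}" "finite \<W>" "frontier B \<subseteq> \<Union>\<W>"
  using compactE[OF comp cov] by (metis good_def mem_Collect_eq)
 show ?thesis
 proof (rule that[OF \<W>(2,3)])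
  show "open W" if "W \<in> \<W>" for W using that \<W>(1) by (auto simp: good_def)
  show "emeasure hausdorff1 (W \<inter> frontier B) < \<infinity>" if "W \<in> \<W>" for W using that \<W>(1) by (auto simp: good_def)
  show "AE x in surface_measure B. x \<in> W \<longrightarrow>
   (\<exists>l. ((\<lambda>\<epsilon>. \<integral>y. (cut \<psi> x \<epsilon> y) \<partial>surface_measure B) \<longlongrightarrow> l) (at_right 0))"
   if "W \<in> \<W>" "\<psi> \<in> borel_measurable borel" "integrable (surface_measure B) (\<lambda>y. (cmod (\<psi> y))\<^sup>2)"
    "\<And>y. y \<notin> W ==> \<psi> y = 0" for W \<psi>
  proof -
   have "good W" using that(1) \<W>(1) by blast
   then show ?thesis using that(2-4) unfolding good_def by blast
  qed
 qed
qed

lemma space_surface_measure: "space (surface_measure B) = frontier B"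
 by (simp add: surface_measure_def space_restrict_space)

lemma finite_surface_measure:
 assumes B: "bounded_lipschitz_domain B"
 shows "finite_measure (surface_measure B)"
proof
 obtain \<W> where W: "finite \<W>" "frontier B \<subseteq> \<Union>\<W>"
  "\<And>W. W \<in> \<W> ==> open W" "\<And>W. W \<in> \<W> ==> emeasure hausdorff1 (W \<inter> frontier B) < \<infinity>"
  by (rule boundary_windows[OF B]) blast
 have "emeasure (surface_measure B) (space (surface_measure B)) = emeasure hausdorff1 (frontier B)"
  unfolding space_surface_measure unfolding surface_measure_def by (rule emeasure_restrict_space) auto
 also have "... \<le> emeasure hausdorff1 (\<Union>W\<in>\<W>. W \<inter> frontier B)"
  using W(1-3) by (intro emeasure_mono sets.finite_UN) auto
 also have "... \<le> (\<Sum>W\<in>\<W>. emeasure hausdorff1 (W \<inter> frontier B))"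
  using W(1,3) by (intro emeasure_subadditive_finite) auto
 also have "... < \<infinity>" using W(1,4) by simp
 finally show "emeasure (surface_measure B) (space (surface_measure B)) \<noteq> \<infinity>" by simp
qed

lemma integrable_of_square:
 assumes "finite_measure M" and [measurable]: "f \<in> borel_measurable M" and f: "integrable M (\<lambda>x. (cmod (f x))\<^sup>2)"
 shows "integrable M f"
proof -
 interpret finite_measure M by fact
 show ?thesis
 proof (rule Bochner_Integration.integrable_bound)
  show "integrable M (\<lambda>x. 1 + (cmod (f x))\<^sup>2)" using f by simp
  have "cmod (f x) \<le> 1 + (cmod (f x))\<^sup>2" for x
  proof -
   have "0 \<le> (cmod (f x) - 1)\<^sup>2 + (cmod (f x))\<^sup>2 + 1" by simp
   then show ?thesis by (simp add: power2_eq_square algebra_simps)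
  qed
  then show "AE x in M. norm (f x) \<le> norm (1 + (cmod (f x))\<^sup>2)" by (simp add: abs_of_nonneg)
 qed simp
qed

lemma measurable_surface_measure: "f \<in> measurable borel N ==> f \<in> measurable (surface_measure B) N"
 unfolding surface_measure_def
 by (rule measurable_restrict_space1) (simp add: measurable_cong_sets[OF sets_hausdorff1 refl])

lemma truncated_kernel_integrable:
 assumes B: "bounded_lipschitz_domain B" and \<psi>: "\<psi> \<in> borel_measurable borel"
  and L1: "integrable (surface_measure B) \<psi>" and e: "\<epsilon> > 0"
 shows "integrable (surface_measure B) (\<lambda>y. cut \<psi> x \<epsilon> y)"
proof (rule Bochner_Integration.integrable_bound)
 show "integrable (surface_measure B) (\<lambda>y. cmod (\<psi> y) / \<epsilon>)" using L1 by simp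
 show "(\<lambda>y. cut \<psi> x \<epsilon> y) \<in> borel_measurable (surface_measure B)"
 proof (rule measurable_surface_measure)
  note \<psi>[measurable]
  show "(\<lambda>y. cut \<psi> x \<epsilon> y) \<in> borel_measurable borel" by measurable
 qed
 have "cmod (cut \<psi> x \<epsilon> y) \<le> cmod (\<psi> y) / \<epsilon>" for y
  using e by (auto simp: norm_divide dist_norm norm_minus_commute intro!: divide_left_mono mult_pos_pos)
 then show "AE y in surface_measure B. norm (cut \<psi> x \<epsilon> y) \<le> norm (cmod (\<psi> y) / \<epsilon>)"
  using e by auto
qed

text \<open>Near a boundary point only one window matters, because the contribution of its complement is
  eventually independent of the truncation.\<close>
lemma AE_principal_value_boundary:
 assumes B: "bounded_lipschitz_domain B" and \<psi> [measurable]: "\<psi> \<in> borel_measurable borel"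
  and L2: "integrable (surface_measure B) (\<lambda>y. (cmod (\<psi> y))\<^sup>2)"
 shows "AE x in surface_measure B.
  \<exists>l. ((\<lambda>\<epsilon>. \<integral>y. (cut \<psi> x \<epsilon> y) \<partial>surface_measure B) \<longlongrightarrow> l) (at_right 0)"
proof -
 let ?M = "surface_measure B"
 obtain \<W> where W: "finite \<W>" "frontier B \<subseteq> \<Union>\<W>" "\<And>W. W \<in> \<W> ==> open W"
  "\<And>W \<psi>. W \<in> \<W> ==> \<psi> \<in> borel_measurable borel ==> integrable (surface_measure B) (\<lambda>y. (cmod (\<psi> y))\<^sup>2) ==>
   (\<And>y. y \<notin> W ==> \<psi> y = 0) ==> AE x in surface_measure B. x \<in> W \<longrightarrow>
   (\<exists>l. ((\<lambda>\<epsilon>. \<integral>y. (cut \<psi> x \<epsilon> y) \<partial>surface_measure B) \<longlongrightarrow> l) (at_right 0))"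
  by (rule boundary_windows[OF B]) blast
 have L1: "integrable ?M \<psi>"
  by (rule integrable_of_square[OF finite_surface_measure[OF B] measurable_surface_measure[OF \<psi>] L2])
 have part: "integrable ?M (\<lambda>y. indicator A y * \<psi> y)" if [measurable]: "A \<in> sets borel" for A
  by (rule Bochner_Integration.integrable_bound[OF L1 measurable_surface_measure]) (auto simp: indicator_def)
 have "AE x in ?M. \<forall>W\<in>\<W>. x \<in> W \<longrightarrow>
   (\<exists>l. ((\<lambda>\<epsilon>. \<integral>y. (if dist x y > \<epsilon> then indicator W y * \<psi> y / (y - x) else 0) \<partial>?M) \<longlongrightarrow> l) (at_right 0))"
 proof (subst AE_finite_all[OF W(1)], rule ballI)
  fix W assume WW: "W \<in> \<W>"
  have [measurable]: "W \<in> sets borel" using W(3)[OF WW] by simp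
  show "AE x in ?M. x \<in> W \<longrightarrow>
   (\<exists>l. ((\<lambda>\<epsilon>. \<integral>y. (if dist x y > \<epsilon> then indicator W y * \<psi> y / (y - x) else 0) \<partial>?M) \<longlongrightarrow> l) (at_right 0))"
  proof (rule W(4)[OF WW])
   show "integrable ?M (\<lambda>y. (cmod (indicator W y * \<psi> y))\<^sup>2)"
    by (rule Bochner_Integration.integrable_bound[OF L2 measurable_surface_measure]) (auto simp: indicator_def)
  qed auto
 qed
 then show ?thesis using AE_space
 proof eventually_elim
  case (elim x)
  then obtain W where WW: "W \<in> \<W>" "x \<in> W" using W(2) by (auto simp: space_surface_measure)
  have [measurable]: "W \<in> sets borel" using W(3)[OF WW(1)] by simp
  obtain l where l: "((\<lambda>\<epsilon>. \<integral>y. (if dist x y > \<epsilon> then indicator W y * \<psi> y / (y - x) else 0) \<partial>?M) \<longlongrightarrow> l) (at_right 0)"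
   using elim(1) WW by blast
  obtain \<delta> where d: "\<delta> > 0" "ball x \<delta> \<subseteq> W" using W(3)[OF WW(1)] WW(2) open_contains_ball by blast
  define c where "c = (\<integral>y. (if dist x y > \<delta> / 2 then indicator (- W) y * \<psi> y / (y - x) else 0) \<partial>?M)"
  have "(\<integral>y. (cut \<psi> x \<epsilon> y) \<partial>?M) =
    (\<integral>y. (if dist x y > \<epsilon> then indicator W y * \<psi> y / (y - x) else 0) \<partial>?M) + c" if e: "\<epsilon> \<in> {0<..<\<delta> / 2}" for \<epsilon>
  proof -
   have "c = (\<integral>y. (if dist x y > \<epsilon> then indicator (- W) y * \<psi> y / (y - x) else 0) \<partial>?M)"
    unfolding c_def
   proof (rule Bochner_Integration.integral_cong[OF refl])
    fix y
    have "y \<in> W" if "dist x y \<le> \<delta> / 2" using that d by auto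
    then show "(if dist x y > \<delta> / 2 then indicator (- W) y * \<psi> y / (y - x) else 0) =
      (if dist x y > \<epsilon> then indicator (- W) y * \<psi> y / (y - x) else 0)"
     using e by (cases "y \<in> W") auto
   qed
   moreover have "(\<integral>y. (if dist x y > \<epsilon> then indicator W y * \<psi> y / (y - x) else 0) \<partial>?M) +
     (\<integral>y. (if dist x y > \<epsilon> then indicator (- W) y * \<psi> y / (y - x) else 0) \<partial>?M) =
     (\<integral>y. (if dist x y > \<epsilon> then indicator W y * \<psi> y / (y - x) else 0) +
      (if dist x y > \<epsilon> then indicator (- W) y * \<psi> y / (y - x) else 0) \<partial>?M)"
    using e by (intro Bochner_Integration.integral_add[symmetric] truncated_kernel_integrable[OF B] part) auto
   moreover have "(\<integral>y. (if dist x y > \<epsilon> then indicator W y * \<psi> y / (y - x) else 0) +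
      (if dist x y > \<epsilon> then indicator (- W) y * \<psi> y / (y - x) else 0) \<partial>?M) =
     (\<integral>y. (cut \<psi> x \<epsilon> y) \<partial>?M)"
    by (intro Bochner_Integration.integral_cong[OF refl]) (auto simp: indicator_def)
   ultimately show ?thesis by simp
  qed
  then have "eventually (\<lambda>\<epsilon>. (\<integral>y. (if dist x y > \<epsilon> then indicator W y * \<psi> y / (y - x) else 0) \<partial>?M) + c =
    (\<integral>y. (cut \<psi> x \<epsilon> y) \<partial>?M)) (at_right 0)"
   using d(1) by (intro eventually_at_rightI[of 0 "\<delta> / 2"]) auto
  from Lim_transform_eventually[OF tendsto_add[OF l tendsto_const] this] show ?case by blast
 qed
qed

lemma in_L2_surface_extend:
 assumes "in_L2 (surface_measure B) \<phi>"
 obtains \<psi> where "\<psi> \<in> borel_measurable borel" "\<And>y. y \<in> frontier B ==> \<psi> y = \<phi> y"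
  "integrable (surface_measure B) (\<lambda>y. (cmod (\<psi> y))\<^sup>2)"
proof -
 have "(\<lambda>y. indicator (frontier B) y *\<^sub>R \<phi> y) \<in> borel_measurable hausdorff1"
  using assms unfolding in_L2_def surface_measure_def by (subst (asm) borel_measurable_restrict_space_iff) auto
 then have 1: "(\<lambda>y. indicator (frontier B) y *\<^sub>R \<phi> y) \<in> borel_measurable borel"
  by (simp add: measurable_cong_sets[OF sets_hausdorff1 refl])
 have "integrable (surface_measure B) (\<lambda>y. (cmod (\<phi> y))\<^sup>2)" using assms by (simp add: in_L2_def)
 then have 2: "integrable (surface_measure B) (\<lambda>y. (cmod (indicator (frontier B) y *\<^sub>R \<phi> y))\<^sup>2)"
  by (rule iffD1[OF Bochner_Integration.integrable_cong[OF refl], rotated]) (simp add: space_surface_measure)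
 show ?thesis by (rule that[OF 1 _ 2]) simp
qed

lemma inner_div_norm_square: "complex_of_real ((N \<bullet> w) / (cmod w)\<^sup>2) = (N / w + cnj (N / w)) / 2"
proof -
 have "N / w + cnj (N / w) = of_real (2 * Re (N / w))" by (rule complex_add_cnj)
 moreover have "Re (N / w) = (N \<bullet> w) / (cmod w)\<^sup>2"
  by (simp add: Re_divide inner_complex_def cmod_power2)
 ultimately show ?thesis by simp
qed

text \<open>The singular part of the kernel, the inner product of \<open>N\<close> and \<open>w\<close>
  over \<open>\<bar>w\<bar>\<^sup>2\<close>, is the real part of \<open>N / w\<close>. So the truncated
  integrals reduce to Cauchy integrals of \<open>\<phi>\<close> and of its conjugate; the rest of the
  kernel is bounded.\<close>
lemma K_star_limit_exists:
 assumes om: "\<omega> > 0" and B: "bounded_lipschitz_domain B" and \<phi>: "in_L2 (surface_measure B) \<phi>"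
 shows "AE x in surface_measure B. \<exists>l. ((\<lambda>\<epsilon>. LINT y:{y. dist x y > \<epsilon>}|surface_measure B.
  frechet_derivative (fund_sol \<omega>) (at (x - y)) (outward_normal B x) * \<phi> y) \<longlongrightarrow> l) (at_right 0)"
proof -
 let ?M = "surface_measure B"
 obtain \<psi> where \<psi>[measurable]: "\<psi> \<in> borel_measurable borel" and \<psi>\<phi>: "\<And>y. y \<in> frontier B ==> \<psi> y = \<phi> y"
  and L2: "integrable ?M (\<lambda>y. (cmod (\<psi> y))\<^sup>2)" using in_L2_surface_extend[OF \<phi>] by blast
 have L1: "integrable ?M \<psi>"
  by (rule integrable_of_square[OF finite_surface_measure[OF B] measurable_surface_measure[OF \<psi>] L2])
 have cL1: "integrable ?M (\<lambda>y. cnj (\<psi> y))" using L1 by simp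
 obtain \<rho> :: "real => complex" where \<rho>: "continuous_on {0<..} \<rho>" "\<And>R. \<exists>C. \<forall>r\<in>{0<..R}. cmod (\<rho> r) \<le> C"
  "\<And>w. w \<noteq> 0 ==> (fund_sol \<omega> has_derivative (\<lambda>v. (of_real (1 / (2 * pi * cmod w)) + \<rho> (cmod w)) * of_real ((v \<bullet> w) / cmod w))) (at w)"
  using fund_sol_has_derivative[OF om] by metis
 have fd: "frechet_derivative (fund_sol \<omega>) (at w) N = (of_real (1 / (2 * pi * cmod w)) + \<rho> (cmod w)) * of_real ((N \<bullet> w) / cmod w)"
  if "w \<noteq> 0" for w N using frechet_derivative_at[OF \<rho>(3)[OF that]] by metis
 have "bounded (frontier B)" using B by (intro compact_imp_bounded[OF compact_frontier_bounded]) (simp add: bounded_lipschitz_domain_def)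
 then obtain R0 where R0: "\<And>y. y \<in> frontier B ==> cmod y \<le> R0" by (auto simp: bounded_iff)
 obtain C0 where C0: "\<And>r. r \<in> {0<..R0 + R0} ==> cmod (\<rho> r) \<le> C0" using \<rho>(2) by blast
 define C where "C = \<bar>C0\<bar>"
 have C: "C \<ge> 0" "\<And>r. r \<in> {0<..R0 + R0} ==> cmod (\<rho> r) \<le> C" using C0 by (fastforce simp: C_def)+
 have 1: "AE x in ?M. \<exists>l. ((\<lambda>\<epsilon>. \<integral>y. (cut \<psi> x \<epsilon> y) \<partial>?M) \<longlongrightarrow> l) (at_right 0)"
  by (rule AE_principal_value_boundary[OF B \<psi> L2])
 have 2: "AE x in ?M. \<exists>l. ((\<lambda>\<epsilon>. \<integral>y. (if dist x y > \<epsilon> then cnj (\<psi> y) / (y - x) else 0) \<partial>?M) \<longlongrightarrow> l) (at_right 0)"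
  by (rule AE_principal_value_boundary[OF B]) (use L2 in simp_all)
 show ?thesis using 1 2 AE_space
 proof eventually_elim
  case (elim x)
  define N where "N = outward_normal B x"
  obtain l1 where l1: "((\<lambda>\<epsilon>. \<integral>y. (cut \<psi> x \<epsilon> y) \<partial>?M) \<longlongrightarrow> l1) (at_right 0)" using elim(1) by blast
  obtain l2 where l2: "((\<lambda>\<epsilon>. \<integral>y. (if dist x y > \<epsilon> then cnj (\<psi> y) / (y - x) else 0) \<partial>?M) \<longlongrightarrow> l2) (at_right 0)" using elim(2) by blast
  have xF: "x \<in> frontier B" using elim(3) by (simp add: space_surface_measure)
  define K where "K y = (if y \<in> {x} then 0 else \<rho> (cmod (x - y)) * of_real ((N \<bullet> (x - y)) / cmod (x - y)))" for y
  have K[measurable]: "K \<in> borel_measurable borel"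
   unfolding K_def by (intro borel_measurable_continuous_on_if continuous_intros continuous_on_compose2[OF \<rho>(1)]) auto
  have Kle: "cmod (K y) \<le> C * cmod N" if y: "y \<in> frontier B" "y \<noteq> x" for y
  proof -
   have "cmod (x - y) \<le> R0 + R0" using norm_triangle_ineq4[of x y] R0[OF xF] R0[OF y(1)] by linarith
   then have c: "cmod (\<rho> (cmod (x - y))) \<le> C" using y by (intro C(2)) simp
   have "\<bar>N \<bullet> (x - y)\<bar> / cmod (x - y) \<le> cmod N"
    using Cauchy_Schwarz_ineq2[of N "x - y"] y by (simp add: pos_divide_le_eq)
   from mult_mono[OF c this C(1)] show ?thesis using y by (simp add: K_def norm_mult norm_divide)
  qed
  have bound: "cmod (K y * \<psi> y) \<le> C * cmod N * cmod (\<psi> y)" if "y \<in> frontier B" for y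
  proof (cases "y = x")
   case True
   then show ?thesis using C(1) by (simp add: K_def)
  next
   case False
   then show ?thesis using Kle[OF that] by (simp add: norm_mult mult_right_mono)
  qed
  have boundAE: "AE y in ?M. norm (if dist x y > \<epsilon> then K y * \<psi> y else 0) \<le> C * cmod N * cmod (\<psi> y)" for \<epsilon>
   using bound C(1) by (intro AE_I2) (auto simp: space_surface_measure)
  have bint: "integrable ?M (\<lambda>y. C * cmod N * cmod (\<psi> y))" using L1 by simp
  have Kmeas: "(\<lambda>y. if dist x y > \<epsilon> then K y * \<psi> y else 0) \<in> borel_measurable ?M" for \<epsilon>
   by (rule measurable_surface_measure) measurable
  have Kint: "integrable ?M (\<lambda>y. if dist x y > \<epsilon> then K y * \<psi> y else 0)" for \<epsilon>
   by (rule Bochner_Integration.integrable_bound[OF bint Kmeas]) (use boundAE[of \<epsilon>] C(1) in simp)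
  have l3: "((\<lambda>\<epsilon>. \<integral>y. (if dist x y > \<epsilon> then K y * \<psi> y else 0) \<partial>?M) \<longlongrightarrow> (\<integral>y. (if dist x y > 0 then K y * \<psi> y else 0) \<partial>?M)) (at_right 0)"
  proof (rule tendsto_at_right_sequentially[OF zero_less_one])
   fix S :: "nat => real" assume S: "\<And>n. 0 < S n" "S \<longlonglongrightarrow> 0"
   show "(\<lambda>n. \<integral>y. (if dist x y > S n then K y * \<psi> y else 0) \<partial>?M) \<longlonglongrightarrow> (\<integral>y. (if dist x y > 0 then K y * \<psi> y else 0) \<partial>?M)"
   proof (rule integral_dominated_convergence[OF Kmeas Kmeas bint _ boundAE])
    have "(\<lambda>n. if dist x y > S n then K y * \<psi> y else 0) \<longlonglongrightarrow> (if dist x y > 0 then K y * \<psi> y else 0)" for y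
    proof (cases "dist x y > 0")
     case True
     then have "eventually (\<lambda>n. S n < dist x y) sequentially" using S(2) by (rule order_tendstoD(2)[rotated])
     then have "eventually (\<lambda>n. (if dist x y > S n then K y * \<psi> y else 0) = K y * \<psi> y) sequentially"
      by eventually_elim simp
     then show ?thesis using True by (simp add: tendsto_eventually)
    next
     case False
     then have "\<not> dist x y > S n" for n using S(1)[of n] by linarith
     then show ?thesis using False by simp
    qed
    then show "AE y in ?M. (\<lambda>n. if dist x y > S n then K y * \<psi> y else 0) \<longlonglongrightarrow> (if dist x y > 0 then K y * \<psi> y else 0)" by simp
   qed
  qed
  have split: "(LINT y:{y. dist x y > \<epsilon>}|?M. frechet_derivative (fund_sol \<omega>) (at (x - y)) N * \<phi> y) =
    (- N / (4 * pi)) * (\<integral>y. (cut \<psi> x \<epsilon> y) \<partial>?M) +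
    (- cnj N / (4 * pi)) * cnj (\<integral>y. (if dist x y > \<epsilon> then cnj (\<psi> y) / (y - x) else 0) \<partial>?M) +
    (\<integral>y. (if dist x y > \<epsilon> then K y * \<psi> y else 0) \<partial>?M)" if e: "\<epsilon> > 0" for \<epsilon>
  proof -
   have i1: "integrable ?M (\<lambda>y. cut \<psi> x \<epsilon> y)"
    by (rule truncated_kernel_integrable[OF B \<psi> L1 e])
   have i2: "integrable ?M (\<lambda>y. if dist x y > \<epsilon> then cnj (\<psi> y) / (y - x) else 0)"
    by (rule truncated_kernel_integrable[OF B _ cL1 e]) measurable
   have "(LINT y:{y. dist x y > \<epsilon>}|?M. frechet_derivative (fund_sol \<omega>) (at (x - y)) N * \<phi> y) =
    (\<integral>y. (- N / (4 * pi)) * (cut \<psi> x \<epsilon> y) +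
     (- cnj N / (4 * pi)) * cnj (if dist x y > \<epsilon> then cnj (\<psi> y) / (y - x) else 0) +
     (if dist x y > \<epsilon> then K y * \<psi> y else 0) \<partial>?M)"
    unfolding set_lebesgue_integral_def
   proof (rule Bochner_Integration.integral_cong[OF refl])
    fix y assume "y \<in> space ?M"
    then have y: "\<psi> y = \<phi> y" using \<psi>\<phi> by (simp add: space_surface_measure)
    show "indicator {y. dist x y > \<epsilon>} y *\<^sub>R (frechet_derivative (fund_sol \<omega>) (at (x - y)) N * \<phi> y) =
     (- N / (4 * pi)) * (cut \<psi> x \<epsilon> y) +
     (- cnj N / (4 * pi)) * cnj (if dist x y > \<epsilon> then cnj (\<psi> y) / (y - x) else 0) +
     (if dist x y > \<epsilon> then K y * \<psi> y else 0)"
    proof (cases "dist x y > \<epsilon>")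
     case True
     then have ne: "x - y \<noteq> 0" "y \<noteq> x" using e by auto
     define w where "w = x - y"
     have w0: "w \<noteq> 0" using ne by (simp add: w_def)
     have yx: "y - x = - w" by (simp add: w_def)
     have "complex_of_real (1 / (2 * pi * cmod w)) * of_real ((N \<bullet> w) / cmod w) = of_real ((N \<bullet> w) / (cmod w)\<^sup>2) / of_real (2 * pi)"
      by (simp add: power2_eq_square)
     also have "... = (N / w + cnj (N / w)) / (4 * pi)"
      unfolding inner_div_norm_square by simp
     finally have a: "complex_of_real (1 / (2 * pi * cmod w)) * of_real ((N \<bullet> w) / cmod w) = (N / w + cnj (N / w)) / (4 * pi)" .
     have "frechet_derivative (fund_sol \<omega>) (at w) N = (N / w + cnj (N / w)) / (4 * pi) + K y"
      using fd[OF w0, of N] ne by (simp only: distrib_right a) (simp add: K_def w_def)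
     then have "frechet_derivative (fund_sol \<omega>) (at w) N * \<psi> y = ((N / w + cnj (N / w)) / (4 * pi) + K y) * \<psi> y" by simp
     also have "... = (- N / (4 * pi)) * (\<psi> y / (- w)) + (- cnj N / (4 * pi)) * cnj (cnj (\<psi> y) / (- w)) + K y * \<psi> y"
      by (simp add: add_divide_distrib distrib_right distrib_left mult.commute)
     finally show ?thesis using True y by (simp only: yx w_def[symmetric] if_True mem_Collect_eq indicator_simps simp_thms scaleR_one)
    qed simp
   qed
   also have "... = (- N / (4 * pi)) * (\<integral>y. (cut \<psi> x \<epsilon> y) \<partial>?M) +
    (- cnj N / (4 * pi)) * (\<integral>y. cnj (if dist x y > \<epsilon> then cnj (\<psi> y) / (y - x) else 0) \<partial>?M) +
    (\<integral>y. (if dist x y > \<epsilon> then K y * \<psi> y else 0) \<partial>?M)"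
   proof -
    have j1: "integrable ?M (\<lambda>y. (- N / (4 * pi)) * (cut \<psi> x \<epsilon> y))"
     by (rule integrable_mult_right[OF i1])
    have j2: "integrable ?M (\<lambda>y. (- cnj N / (4 * pi)) * cnj (if dist x y > \<epsilon> then cnj (\<psi> y) / (y - x) else 0))"
     by (rule integrable_mult_right[OF integrable_cnj[OF i2]])
    show ?thesis
     unfolding Bochner_Integration.integral_add[OF Bochner_Integration.integrable_add[OF j1 j2] Kint]
      Bochner_Integration.integral_add[OF j1 j2] integral_mult_right_zero ..
   qed
   finally show ?thesis by (simp only: Bochner_Integration.integral_cnj)
  qed
  have "((\<lambda>\<epsilon>. (- N / (4 * pi)) * (\<integral>y. (cut \<psi> x \<epsilon> y) \<partial>?M) +
    (- cnj N / (4 * pi)) * cnj (\<integral>y. (if dist x y > \<epsilon> then cnj (\<psi> y) / (y - x) else 0) \<partial>?M) +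
    (\<integral>y. (if dist x y > \<epsilon> then K y * \<psi> y else 0) \<partial>?M)) \<longlongrightarrow>
    (- N / (4 * pi)) * l1 + (- cnj N / (4 * pi)) * cnj l2 + (\<integral>y. (if dist x y > 0 then K y * \<psi> y else 0) \<partial>?M)) (at_right 0)"
   by (intro tendsto_add tendsto_mult tendsto_const tendsto_cnj l1 l2 l3)
  moreover have "eventually (\<lambda>\<epsilon>. (- N / (4 * pi)) * (\<integral>y. (cut \<psi> x \<epsilon> y) \<partial>?M) +
    (- cnj N / (4 * pi)) * cnj (\<integral>y. (if dist x y > \<epsilon> then cnj (\<psi> y) / (y - x) else 0) \<partial>?M) +
    (\<integral>y. (if dist x y > \<epsilon> then K y * \<psi> y else 0) \<partial>?M) =
    (LINT y:{y. dist x y > \<epsilon>}|?M. frechet_derivative (fund_sol \<omega>) (at (x - y)) N * \<phi> y)) (at_right 0)"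
   by (rule eventually_at_rightI[OF split[symmetric] zero_less_one]) simp
  ultimately show ?case unfolding N_def[symmetric] by (intro exI, rule Lim_transform_eventually)
 qed
qed

section \<open>Rotation invariance of Lebesgue and Hausdorff measure\<close>

lemma lborel_complex_eq_distr: "distr (lborel :: (real^2) measure) borel (\<lambda>v. Complex (v $ 1) (v $ 2)) = lborel"
proof (rule lborel_eqI[symmetric])
 have meas [measurable]: "(\<lambda>v::real^2. Complex (v $ 1) (v $ 2)) \<in> borel_measurable borel"
  by (intro borel_measurable_continuous_onI) (simp add: Complex_eq continuous_intros)
 fix l u :: complex assume le: "\<And>b. b \<in> Basis ==> l \<bullet> b \<le> u \<bullet> b"
 have le': "Re l \<le> Re u" "Im l \<le> Im u" using le[of 1] le[of \<i>] by (auto simp: Basis_complex_def)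
 have B2: "(Basis :: (real^2) set) = {axis 1 1, axis 2 1}"
  by (auto simp: Basis_vec_def UNIV_2)
 have ne: "axis 1 1 \<noteq> (axis 2 1 :: real^2)" by (simp add: axis_eq_axis)
 have "emeasure (distr lborel borel (\<lambda>v::real^2. Complex (v $ 1) (v $ 2))) (box l u) =
   emeasure lborel ((\<lambda>v::real^2. Complex (v $ 1) (v $ 2)) -` box l u)"
  by (subst emeasure_distr) simp_all
 also have "(\<lambda>v::real^2. Complex (v $ 1) (v $ 2)) -` box l u = box (vector [Re l, Im l]) (vector [Re u, Im u])"
  by (auto simp: in_box_complex_iff mem_box_cart forall_2)
 also have "emeasure lborel ... = ennreal (\<Prod>b\<in>Basis. (u - l) \<bullet> b)"
  using le' ne by (subst emeasure_lborel_box) (auto simp: B2 Basis_complex_def inner_axis inner_axis' mult.commute)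
 finally show "emeasure (distr lborel borel (\<lambda>v::real^2. Complex (v $ 1) (v $ 2))) (box l u) = ennreal (\<Prod>b\<in>Basis. (u - l) \<bullet> b)" .
qed simp

text \<open>Orthogonal invariance of Lebesgue measure is transferred from \<open>real^2\<close>.\<close>
lemma distr_lborel_rotation:
 assumes c: "cmod c = 1"
 shows "distr lborel borel (\<lambda>z. c * z) = (lborel :: complex measure)"
proof -
 define \<phi> :: "real^2 => complex" where "\<phi> v = Complex (v $ 1) (v $ 2)" for v
 define T :: "complex => real^2 => real^2"
  where "T a v = vector [Re a * v $ 1 - Im a * v $ 2, Im a * v $ 1 + Re a * v $ 2]" for a v
 have \<phi>m [measurable]: "\<phi> \<in> borel_measurable borel" unfolding \<phi>_def
  by (intro borel_measurable_continuous_onI) (simp add: Complex_eq continuous_intros)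
 have lin: "linear (T a)" for a
  by (rule linearI) (simp_all add: T_def vec_eq_iff forall_2 algebra_simps)
 have Tm [measurable]: "T a \<in> borel_measurable borel" for a
  by (intro borel_measurable_continuous_onI linear_continuous_on) (simp add: lin linear_conv_bounded_linear[symmetric])
 have c2: "(Re c)\<^sup>2 + (Im c)\<^sup>2 = 1" using c by (simp add: cmod_def)
 have orth: "orthogonal_transformation (T (cnj c))"
  unfolding orthogonal_transformation
 proof (intro conjI lin allI)
  fix v :: "real^2"
  have "(norm (T (cnj c) v))\<^sup>2 = ((Re c)\<^sup>2 + (Im c)\<^sup>2) * (norm v)\<^sup>2"
   unfolding power2_norm_eq_inner inner_vec_def sum_2 T_def by (simp add: power2_eq_square algebra_simps)
  then show "norm (T (cnj c) v) = norm v" by (simp add: c2)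
 qed
 have inv1: "T c (T (cnj c) v) = v" and inv2: "T (cnj c) (T c v) = v" for v
 proof -
  have e: "Im c * (Im c * x) + Re c * (Re c * x) = x" for x
   using arg_cong[OF c2, of "\<lambda>k. k * x"] by (simp add: power2_eq_square algebra_simps)
  then show "T c (T (cnj c) v) = v" "T (cnj c) (T c v) = v"
   by (simp_all add: T_def vec_eq_iff forall_2 algebra_simps e)
 qed
 have vim: "T c -` S = T (cnj c) ` S" for S
  using inv1 inv2 by (auto simp: image_iff) metis
 have Tl: "distr lborel borel (T c) = lborel"
 proof (rule lborel_eqI[symmetric])
  fix l u :: "real^2" assume le: "\<And>b. b \<in> Basis ==> l \<bullet> b \<le> u \<bullet> b"
  have b: "box l u \<in> lmeasurable" by simp
  have img: "T (cnj c) ` box l u \<in> sets borel" unfolding vim[symmetric] using measurable_sets[OF Tm, of "box l u" c] by simp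
  have "emeasure (distr lborel borel (T c)) (box l u) = emeasure lborel (T (cnj c) ` box l u)"
   unfolding vim[symmetric] by (subst emeasure_distr) simp_all
  also have "... = emeasure lebesgue (T (cnj c) ` box l u)" using img by simp
  also have "... = ennreal (measure lebesgue (T (cnj c) ` box l u))"
   using measurable_orthogonal_image[OF orth b] by (simp only: emeasure_eq_measure2)
  also have "... = ennreal (measure lebesgue (box l u))" using measure_orthogonal_image[OF orth b] by simp
  also have "... = emeasure lborel (box l u)" using b by (simp add: emeasure_eq_measure2)
  also have "... = ennreal (\<Prod>b\<in>Basis. (u - l) \<bullet> b)" using le by (simp add: emeasure_lborel_box)
  finally show "emeasure (distr lborel borel (T c)) (box l u) = ennreal (\<Prod>b\<in>Basis. (u - l) \<bullet> b)" .
 qed simp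
 have "distr lborel borel (\<lambda>z. c * z) = distr (distr lborel borel \<phi>) borel (\<lambda>z. c * z)"
  using lborel_complex_eq_distr by (simp add: \<phi>_def[abs_def])
 also have "... = distr lborel borel ((\<lambda>z. c * z) \<circ> \<phi>)" by (rule distr_distr) simp_all
 also have "(\<lambda>z. c * z) \<circ> \<phi> = \<phi> \<circ> T c"
  by (auto simp: \<phi>_def T_def complex_eq_iff)
 also have "distr lborel borel (\<phi> \<circ> T c) = distr (distr lborel borel (T c)) borel \<phi>" by (rule distr_distr[symmetric]) simp_all
 also have "... = distr lborel borel \<phi>" by (simp only: Tl)
 also have "... = lborel" using lborel_complex_eq_distr by (simp add: \<phi>_def[abs_def])
 finally show ?thesis .
qed

lemma distr_lebesgue_rotation:
 assumes c: "cmod c = 1"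
 shows "(\<lambda>z. c * z) \<in> measurable lebesgue (lebesgue :: complex measure)"
  and "distr lebesgue lebesgue (\<lambda>z. c * z) = (lebesgue :: complex measure)"
proof -
 have m: "(\<lambda>z. c * z) \<in> measurable lebesgue (lborel :: complex measure)"
  by (rule measurable_completion) simp
 have "distr lebesgue lborel (\<lambda>z. c * z) = distr (lborel :: complex measure) lborel (\<lambda>z. c * z)"
  by (rule distr_completion) simp
 also have "... = distr lborel borel (\<lambda>z. c * z)" by (rule distr_cong) simp_all
 finally have d: "distr lebesgue lborel (\<lambda>z. c * z) = (lborel :: complex measure)"
  using distr_lborel_rotation[OF c] by simp
 show "(\<lambda>z. c * z) \<in> measurable lebesgue (lebesgue :: complex measure)"
  by (rule complete_measure.measurable_completion2[OF completion.complete_measure_axioms m]) (simp add: d)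
 show "distr lebesgue lebesgue (\<lambda>z. c * z) = (lebesgue :: complex measure)"
  using complete_measure.completion_distr_eq[OF completion.complete_measure_axioms m] by (simp add: d)
qed

lemma hausdorff1_pre_isometry_le:
 assumes "\<And>x y. dist (f x) (f y) = dist x y"
 shows "hausdorff1_pre \<delta> (f ` A) \<le> hausdorff1_pre \<delta> A"
 unfolding hausdorff1_pre_def
proof (rule INF_mono)
 have diam: "diameter (f ` S) = diameter S" for S
 proof (cases "S = {}")
  case False
  have "(\<lambda>(x,y). dist x y) ` (f ` S \<times> f ` S) = (\<lambda>(x,y). dist x y) ` (S \<times> S)"
   using assms by (force simp: image_iff)
  then show ?thesis using False by (simp add: diameter_def)
 qed simp
 have bd: "bounded (f ` S) \<longleftrightarrow> bounded S" for S by (simp add: bounded_two_points assms)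
 fix U :: "nat => 'a set" assume U: "U \<in> {U. A \<subseteq> (\<Union>i. U i) \<and> (\<forall>i. bounded (U i) \<and> diameter (U i) \<le> \<delta>)}"
 show "\<exists>V\<in>{V. f ` A \<subseteq> (\<Union>i. V i) \<and> (\<forall>i. bounded (V i) \<and> diameter (V i) \<le> \<delta>)}.
   (\<Sum>i. ennreal (diameter (V i))) \<le> (\<Sum>i. ennreal (diameter (U i)))"
 proof (rule bexI[of _ "\<lambda>i. f ` U i"])
  have "f ` A \<subseteq> f ` (\<Union>i. U i)" using U by (intro image_mono) simp
  then show "(\<lambda>i. f ` U i) \<in> {V. f ` A \<subseteq> (\<Union>i. V i) \<and> (\<forall>i. bounded (V i) \<and> diameter (V i) \<le> \<delta>)}"
   using U by (simp add: diam bd image_UN)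
 qed (simp add: diam)
qed

lemma hausdorff1_outer_rotation:
 fixes A :: "complex set"
 assumes c: "cmod c = 1"
 shows "hausdorff1_outer ((\<lambda>z. c * z) ` A) = hausdorff1_outer A"
proof -
 have iso: "dist (a * x) (a * y) = dist x y" if "cmod a = 1" for a x y
  using that by (simp add: dist_norm right_diff_distrib[symmetric] norm_mult)
 have cc: "cnj c * c = 1" using c by (metis complex_norm_square mult.commute of_real_1 one_power2)
 have "hausdorff1_pre \<delta> ((\<lambda>z. c * z) ` A) = hausdorff1_pre \<delta> A" for \<delta>
 proof (rule antisym)
  show "hausdorff1_pre \<delta> ((\<lambda>z. c * z) ` A) \<le> hausdorff1_pre \<delta> A"
   by (rule hausdorff1_pre_isometry_le[OF iso[OF c]])
  have "(\<lambda>z. cnj c * z) ` (\<lambda>z. c * z) ` A = A" by (simp add: image_image mult.assoc[symmetric] cc)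
  then show "hausdorff1_pre \<delta> A \<le> hausdorff1_pre \<delta> ((\<lambda>z. c * z) ` A)"
   using hausdorff1_pre_isometry_le[OF iso[of "cnj c"], of \<delta> "(\<lambda>z. c * z) ` A"] c by simp
 qed
 then show ?thesis by (simp add: hausdorff1_outer_def)
qed

lemma distr_hausdorff1_rotation:
 assumes c: "cmod c = 1"
 shows "distr hausdorff1 hausdorff1 (\<lambda>z. c * z) = (hausdorff1 :: complex measure)"
proof (rule measure_eqI)
 fix S assume "S \<in> sets (distr hausdorff1 hausdorff1 (\<lambda>z. c * z))"
 then have S: "S \<in> sets borel" by simp
 have cc: "c * cnj c = 1" "cnj c * c = 1" using c by (metis complex_norm_square mult.commute of_real_1 one_power2)+
 have vim: "(\<lambda>z. c * z) -` S = (\<lambda>z. cnj c * z) ` S"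
 proof -
  have "cnj c * (c * z) = z" "c * (cnj c * z) = z" for z by (simp_all add: mult.assoc[symmetric] cc)
  then show ?thesis by (intro set_eqI) (metis image_iff vimage_eq)
 qed
 have m: "(\<lambda>z. c * z) \<in> borel_measurable borel" by simp
 have S': "(\<lambda>z. cnj c * z) ` S \<in> sets borel" unfolding vim[symmetric] using measurable_sets[OF m S] by simp
 have "emeasure (distr hausdorff1 hausdorff1 (\<lambda>z. c * z)) S = emeasure hausdorff1 ((\<lambda>z. c * z) -` S)"
  using S m by (subst emeasure_distr) (simp_all add: measurable_cong_sets[OF sets_hausdorff1 sets_hausdorff1])
 also have "... = emeasure hausdorff1 ((\<lambda>z. cnj c * z) ` S)" by (simp only: vim)
 also have "... = emeasure hausdorff1 S"
  using S S' c sets.sigma_sets_eq[of "borel :: complex measure"]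
  by (simp add: hausdorff1_def emeasure_measure_of_conv hausdorff1_outer_rotation)
 finally show "emeasure (distr hausdorff1 hausdorff1 (\<lambda>z. c * z)) S = emeasure hausdorff1 S" .
qed simp

section \<open>Transport of integrals and normals under a rotation\<close>

text \<open>Both measures may live on subsets; the definitions of the boundary problem contain integrals
  of functions that are not known to be measurable, so the transport rules below are stated for arbitrary
  functions.\<close>
locale rotation =
 fixes c :: complex and M N :: "complex measure"
 assumes unit: "cmod c = 1"
  and measurable_rotation: "(\<lambda>z. c * z) \<in> measurable M N"
  and measurable_rotation_back: "(\<lambda>z. cnj c * z) \<in> measurable N M"
  and distr_rotation: "distr M N (\<lambda>z. c * z) = N"
begin

lemma cancel: "c * (cnj c * z) = z" "cnj c * (c * z) = z"
 using unit by (simp_all add: mult.assoc[symmetric] mult.commute[of "cnj c"] complex_norm_square[symmetric])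

lemma rotation_back: "rotation (cnj c) N M"
proof
 have "distr N M (\<lambda>z. cnj c * z) = distr (distr M N (\<lambda>z. c * z)) M (\<lambda>z. cnj c * z)" by (simp only: distr_rotation)
 also have "... = distr M M ((\<lambda>z. cnj c * z) \<circ> (\<lambda>z. c * z))"
  by (rule distr_distr[OF measurable_rotation_back measurable_rotation])
 also have "... = M" by (simp add: o_def cancel distr_id2)
 finally show "distr N M (\<lambda>z. cnj c * z) = M" .
qed (use unit measurable_rotation measurable_rotation_back in simp_all)

lemma AE_iff: "(AE x in N. P x) \<longleftrightarrow> (AE x in M. P (c * x))"
proof
 assume "AE x in N. P x"
 then have "AE x in distr M N (\<lambda>z. c * z). P x" by (simp only: distr_rotation)
 then show "AE x in M. P (c * x)" by (rule AE_distrD[OF measurable_rotation])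
next
 interpret r: rotation "cnj c" N M by (rule rotation_back)
 assume "AE x in M. P (c * x)"
 then have "AE x in distr N M (\<lambda>z. cnj c * z). P (c * x)" by (simp only: r.distr_rotation)
 then have "AE x in N. P (c * (cnj c * x))" by (rule AE_distrD[OF r.measurable_rotation])
 then show "AE x in N. P x" by (simp add: cancel)
qed

lemma measurable_iff: "(\<lambda>x. f (c * x)) \<in> measurable M K \<longleftrightarrow> f \<in> measurable N K"
proof
 assume "(\<lambda>x. f (c * x)) \<in> measurable M K"
 from measurable_compose[OF measurable_rotation_back this] show "f \<in> measurable N K" by (simp add: cancel)
qed (rule measurable_compose[OF measurable_rotation])

text \<open>Simple functions below \<open>f\<close> are transported, which settles functions that need not
  be measurable.\<close>
lemma nn_integral_le: "(\<integral>\<^sup>+x. f x \<partial>N) \<le> (\<integral>\<^sup>+x. f (c * x) \<partial>M)"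
 unfolding nn_integral_def[of N]
proof (rule SUP_least)
 fix g assume g: "g \<in> {g. simple_function N g \<and> g \<le> f}"
 then have "integral\<^sup>S N g = (\<integral>\<^sup>+x. g x \<partial>distr M N (\<lambda>z. c * z))"
  by (simp add: nn_integral_eq_simple_integral distr_rotation)
 also have "... = (\<integral>\<^sup>+x. g (c * x) \<partial>M)"
  using g by (intro nn_integral_distr[OF measurable_rotation]) (simp add: distr_rotation borel_measurable_simple_function)
 also have "... \<le> (\<integral>\<^sup>+x. f (c * x) \<partial>M)" using g by (intro nn_integral_mono) (auto simp: le_fun_def)
 finally show "integral\<^sup>S N g \<le> (\<integral>\<^sup>+x. f (c * x) \<partial>M)" .
qed

lemma nn_integral_rotation: "(\<integral>\<^sup>+x. f (c * x) \<partial>M) = (\<integral>\<^sup>+x. f x \<partial>N)"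
 using nn_integral_le[of f] rotation.nn_integral_le[OF rotation_back, of "\<lambda>x. f (c * x)"]
 by (simp add: cancel antisym)

lemma
 fixes f :: "complex => 'b :: {banach, second_countable_topology}"
 shows integrable_rotation: "integrable M (\<lambda>x. f (c * x)) \<longleftrightarrow> integrable N f"
  and integral_rotation: "(\<integral>x. f (c * x) \<partial>M) = (\<integral>x. f x \<partial>N)"
proof -
 have "integrable M (\<lambda>x. f (c * x)) \<longleftrightarrow> integrable N f" (is ?A)
  and "(\<integral>x. f (c * x) \<partial>M) = (\<integral>x. f x \<partial>N)" (is ?B)
 proof -
  show 1: ?A
   using integrable_distr_eq[OF measurable_rotation, of f] measurable_iff[of f borel]
   by (metis borel_measurable_integrable distr_rotation)
  show ?B
  proof (cases "f \<in> borel_measurable N")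
   case True
   then show ?thesis using integral_distr[OF measurable_rotation, of f] by (simp add: distr_rotation)
  next
   case False
   then have "\<not> integrable N f" by auto
   then show ?thesis using 1 by (simp add: not_integrable_integral_eq)
  qed
 qed
 then show "integrable M (\<lambda>x. f (c * x)) \<longleftrightarrow> integrable N f" "(\<integral>x. f (c * x) \<partial>M) = (\<integral>x. f x \<partial>N)" by auto
qed

lemma in_L2_rotation: "in_L2 M (\<lambda>x. f (c * x)) \<longleftrightarrow> in_L2 N f"
 unfolding in_L2_def using measurable_iff[of f borel] integrable_rotation[of "\<lambda>x. (cmod (f x))\<^sup>2"] by simp

lemma L2_tendsto_rotation: "L2_tendsto M (\<lambda>k x. f k (c * x)) (\<lambda>x. g (c * x)) \<longleftrightarrow> L2_tendsto N f g"
 unfolding L2_tendsto_def using nn_integral_rotation[of "\<lambda>x. ennreal ((cmod (f _ x - g x))\<^sup>2)"] by simp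

end

lemma unit_mult_cnj: "cmod c = 1 ==> c * (cnj c * z) = z" "cmod c = 1 ==> cnj c * (c * z) = z"
 by (simp_all add: mult.assoc[symmetric] mult.commute[of "cnj c"] complex_norm_square[symmetric])

lemma rotation_image_mem: "cmod c = 1 ==> y \<in> (\<lambda>z. c * z) ` S \<longleftrightarrow> cnj c * y \<in> S"
 using unit_mult_cnj by (metis image_iff)

lemma rotation_homeomorphism:
 assumes c: "cmod c = 1"
 shows "closure ((\<lambda>z. c * z) ` S) = (\<lambda>z. c * z) ` closure S"
  and "interior ((\<lambda>z. c * z) ` S) = (\<lambda>z. c * z) ` interior S"
  and "frontier ((\<lambda>z. c * z) ` S) = (\<lambda>z. c * z) ` frontier S"
proof -
 have lin: "linear (\<lambda>z. c * z)" by (rule linearI) (auto simp: algebra_simps)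
 have inj: "inj (\<lambda>z. c * z)" using c by (auto intro!: injI)
 show 1: "closure ((\<lambda>z. c * z) ` S) = (\<lambda>z. c * z) ` closure S"
  by (rule closure_injective_linear_image[OF lin inj, symmetric])
 show 2: "interior ((\<lambda>z. c * z) ` S) = (\<lambda>z. c * z) ` interior S"
  by (rule interior_injective_linear_image[OF lin inj])
 show "frontier ((\<lambda>z. c * z) ` S) = (\<lambda>z. c * z) ` frontier S"
  unfolding frontier_def 1 2 by (rule image_set_diff[OF inj, symmetric])
qed

lemma rotation_restrict_space:
 assumes M: "rotation c M M" and sp: "space M = UNIV" and S: "S \<in> sets M"
 shows "rotation c (restrict_space M S) (restrict_space M ((\<lambda>z. c * z) ` S))"
proof -
 interpret rotation c M M by (rule M)
 interpret b: rotation "cnj c" M M by (rule rotation_back)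
 have vim: "(\<lambda>z. cnj c * z) -` A = (\<lambda>z. c * z) ` A" for A
  by (auto simp: rotation_image_mem[OF unit] cancel)
 have cS: "(\<lambda>z. c * z) ` S \<in> sets M"
  using measurable_sets[OF b.measurable_rotation S] sp by (simp add: vim)
 have f: "(\<lambda>z. c * z) \<in> measurable (restrict_space M S) (restrict_space M ((\<lambda>z. c * z) ` S))"
  by (intro measurable_restrict_space3 measurable_rotation) auto
 show ?thesis
 proof
  show "(\<lambda>z. cnj c * z) \<in> measurable (restrict_space M ((\<lambda>z. c * z) ` S)) (restrict_space M S)"
   by (intro measurable_restrict_space3 b.measurable_rotation) (auto simp: cancel)
  show "distr (restrict_space M S) (restrict_space M ((\<lambda>z. c * z) ` S)) (\<lambda>z. c * z) = restrict_space M ((\<lambda>z. c * z) ` S)"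
  proof (rule measure_eqI)
   fix A assume "A \<in> sets (distr (restrict_space M S) (restrict_space M ((\<lambda>z. c * z) ` S)) (\<lambda>z. c * z))"
   then have A': "A \<in> sets (restrict_space M ((\<lambda>z. c * z) ` S))" by simp
   then have A: "A \<in> sets M" "A \<subseteq> (\<lambda>z. c * z) ` S" using cS by (auto simp: sets_restrict_space_iff)
   have sub: "(\<lambda>z. c * z) -` A \<subseteq> S"
   proof
    fix x assume "x \<in> (\<lambda>z. c * z) -` A"
    then have "c * x \<in> (\<lambda>z. c * z) ` S" using A(2) by blast
    then show "x \<in> S" by (simp only: rotation_image_mem[OF unit] cancel)
   qed
   have "emeasure (distr (restrict_space M S) (restrict_space M ((\<lambda>z. c * z) ` S)) (\<lambda>z. c * z)) A =
     emeasure (restrict_space M S) ((\<lambda>z. c * z) -` A)"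
    using sub sp by (subst emeasure_distr[OF f A']) (simp add: space_restrict_space Int_absorb2)
   also have "... = emeasure M ((\<lambda>z. c * z) -` A)"
    using sub S sp by (intro emeasure_restrict_space) auto
   also have "... = emeasure (distr M M (\<lambda>z. c * z)) A"
    using A(1) sp by (subst emeasure_distr[OF measurable_rotation]) auto
   also have "... = emeasure (restrict_space M ((\<lambda>z. c * z) ` S)) A"
    using A cS sp by (subst emeasure_restrict_space) (auto simp: distr_rotation)
   finally show "emeasure (distr (restrict_space M S) (restrict_space M ((\<lambda>z. c * z) ` S)) (\<lambda>z. c * z)) A =
    emeasure (restrict_space M ((\<lambda>z. c * z) ` S)) A" .
  qed simp
 qed (use unit f in simp_all)
qed

lemma rotation_surface_measure:
 assumes c: "cmod c = 1"
 shows "rotation c (surface_measure B) (surface_measure ((\<lambda>z. c * z) ` B))"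
proof -
 have m: "(\<lambda>z. a * z) \<in> measurable hausdorff1 hausdorff1" for a :: complex
  by (simp add: measurable_cong_sets[OF sets_hausdorff1 sets_hausdorff1])
 have "rotation c hausdorff1 hausdorff1" by standard (use c m distr_hausdorff1_rotation[OF c] in auto)
 then show ?thesis
  unfolding surface_measure_def rotation_homeomorphism(3)[OF c]
  by (rule rotation_restrict_space) auto
qed

lemma rotation_lebesgue_on:
 assumes c: "cmod c = 1" and B: "B \<in> sets lebesgue"
 shows "rotation c (lebesgue_on B) (lebesgue_on ((\<lambda>z. c * z) ` B))"
proof -
 have "rotation c lebesgue lebesgue"
  by standard (use c distr_lebesgue_rotation[of c] distr_lebesgue_rotation[of "cnj c"] in auto)
 then show ?thesis using B by (intro rotation_restrict_space) auto
qed

text \<open>Between two candidates there is a direction that points into \<open>B\<close> for one and out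
  of \<open>B\<close> for the other. Uniqueness is what makes the definite description in the normal
  transportable.\<close>
lemma outward_normal_unique:
 assumes "is_outward_normal B x n\<^sub>1" "is_outward_normal B x n\<^sub>2"
 shows "n\<^sub>1 = n\<^sub>2"
proof (rule ccontr)
 assume ne: "n\<^sub>1 \<noteq> n\<^sub>2"
 define v where "v = n\<^sub>2 - n\<^sub>1"
 have v0: "norm v > 0" using ne by (simp add: v_def)
 have n: "n\<^sub>1 \<bullet> n\<^sub>1 = 1" "n\<^sub>2 \<bullet> n\<^sub>2 = 1" using assms by (simp_all add: is_outward_normal_def norm_eq_1)
 have vv: "(norm v)\<^sup>2 = 2 - 2 * (n\<^sub>1 \<bullet> n\<^sub>2)"
  unfolding power2_norm_eq_inner v_def using n by (simp add: inner_diff inner_commute)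
 have i: "v \<bullet> n\<^sub>1 = - ((norm v)\<^sup>2 / 2)" "v \<bullet> n\<^sub>2 = (norm v)\<^sup>2 / 2"
  using n vv by (simp_all add: v_def inner_diff inner_commute diff_divide_distrib)
 have e: "norm v / 4 > 0" using v0 by simp
 obtain \<delta>\<^sub>1 where d1: "\<delta>\<^sub>1 > 0" "\<And>y. dist y x < \<delta>\<^sub>1 ==> (y - x) \<bullet> n\<^sub>1 < - (norm v / 4) * dist y x ==> y \<in> B"
  using assms(1) e unfolding is_outward_normal_def by meson
 obtain \<delta>\<^sub>2 where d2: "\<delta>\<^sub>2 > 0" "\<And>y. dist y x < \<delta>\<^sub>2 ==> (y - x) \<bullet> n\<^sub>2 > norm v / 4 * dist y x ==> y \<notin> B"
  using assms(2) e unfolding is_outward_normal_def by meson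
 define t where "t = min \<delta>\<^sub>1 \<delta>\<^sub>2 / (2 * norm v)"
 have t0: "t > 0" using d1(1) d2(1) v0 by (simp add: t_def)
 define y where "y = x + t *\<^sub>R v"
 have dyx: "dist y x = t * norm v" using t0 by (simp add: y_def dist_norm)
 have "t * norm v < min \<delta>\<^sub>1 \<delta>\<^sub>2" using d1(1) d2(1) v0 by (simp add: t_def) linarith
 moreover have "t * (norm v)\<^sup>2 > 0" using t0 v0 by simp
 ultimately have "y \<in> B" "y \<notin> B"
  using d1(2)[of y] d2(2)[of y] by (auto simp: dyx) (auto simp: y_def i power2_eq_square)
 then show False by simp
qed

lemma is_outward_normal_rotate:
 assumes c: "cmod c = 1" and n: "is_outward_normal B x n"
 shows "is_outward_normal ((\<lambda>z. c * z) ` B) (c * x) (c * n)"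
 unfolding is_outward_normal_def
proof (intro conjI allI impI)
 show "norm (c * n) = 1" using c n by (simp add: norm_mult is_outward_normal_def)
 fix \<epsilon> :: real assume "\<epsilon> > 0"
 then obtain \<delta> where d: "\<delta> > 0" "\<And>y. dist y x < \<delta> ==>
    ((y - x) \<bullet> n < - \<epsilon> * dist y x \<longrightarrow> y \<in> B) \<and> ((y - x) \<bullet> n > \<epsilon> * dist y x \<longrightarrow> y \<notin> B)"
  using n unfolding is_outward_normal_def by meson
 show "\<exists>\<delta>>0. \<forall>y. dist y (c * x) < \<delta> \<longrightarrow>
    ((y - c * x) \<bullet> (c * n) < - \<epsilon> * dist y (c * x) \<longrightarrow> y \<in> (\<lambda>z. c * z) ` B) \<and>
    ((y - c * x) \<bullet> (c * n) > \<epsilon> * dist y (c * x) \<longrightarrow> y \<notin> (\<lambda>z. c * z) ` B)"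
 proof (intro exI[of _ \<delta>] conjI d(1) allI impI)
  fix y assume y: "dist y (c * x) < \<delta>"
  define y' where "y' = cnj c * y"
  have yy: "y = c * y'" using unit_mult_cnj(1)[OF c] by (simp add: y'_def)
  have ds: "dist y (c * x) = dist y' x"
   using c by (simp add: yy dist_norm right_diff_distrib[symmetric] norm_mult)
  have "(c * v) \<bullet> (c * n) = v \<bullet> n" for v
  proof -
   have "(c * v) \<bullet> (c * n) = (c \<bullet> c) * (v \<bullet> n)" by (simp add: inner_complex_def algebra_simps)
   then show ?thesis using c by (simp add: norm_eq_1)
  qed
  then have ip: "(y - c * x) \<bullet> (c * n) = (y' - x) \<bullet> n" by (simp add: yy right_diff_distrib[symmetric])
  have mem: "y \<in> (\<lambda>z. c * z) ` B \<longleftrightarrow> y' \<in> B" by (simp add: rotation_image_mem[OF c] y'_def)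
  show "y \<in> (\<lambda>z. c * z) ` B" if "(y - c * x) \<bullet> (c * n) < - \<epsilon> * dist y (c * x)"
   using d(2)[of y'] y that unfolding ip ds mem by blast
  show "y \<notin> (\<lambda>z. c * z) ` B" if "(y - c * x) \<bullet> (c * n) > \<epsilon> * dist y (c * x)"
   using d(2)[of y'] y that unfolding ip ds mem by blast
 qed
qed

lemma outward_normal_rotate:
 assumes c: "cmod c = 1"
 shows "outward_normal ((\<lambda>z. c * z) ` B) (c * x) = c * outward_normal B x"
proof (cases "\<exists>n. is_outward_normal B x n")
 case True
 then obtain n where n: "is_outward_normal B x n" by blast
 have "outward_normal B x = n"
  using n outward_normal_unique by (auto simp: outward_normal_def intro!: the_equality)
 moreover have "outward_normal ((\<lambda>z. c * z) ` B) (c * x) = c * n"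
  using is_outward_normal_rotate[OF c n] outward_normal_unique by (auto simp: outward_normal_def intro!: the_equality)
 ultimately show ?thesis by simp
next
 case False
 have "\<not> is_outward_normal ((\<lambda>z. c * z) ` B) (c * x) n" for n
 proof
  assume "is_outward_normal ((\<lambda>z. c * z) ` B) (c * x) n"
  from is_outward_normal_rotate[OF _ this, of "cnj c"] have "is_outward_normal B x (cnj c * n)"
   using c by (simp add: image_image unit_mult_cnj)
  then show False using False by blast
 qed
 then show ?thesis using False by (simp add: outward_normal_def)
qed

section \<open>Transport of the boundary value problem and of the layer potentials\<close>

lemma foldr_dir_deriv_differentiable:
 assumes "smooth \<eta>"
 shows "foldr dir_deriv ds \<eta> differentiable (at x)"
 using assms unfolding smooth_def differentiable_on_def by simp

lemma smooth_differentiable: "smooth \<eta> ==> \<eta> differentiable (at x)"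
 using foldr_dir_deriv_differentiable[of \<eta> "[]"] by simp

lemma smooth_continuous: "smooth \<eta> ==> continuous_on UNIV \<eta>"
 by (intro continuous_at_imp_continuous_on ballI differentiable_imp_continuous_within smooth_differentiable)

lemma smooth_dir_deriv_continuous: "smooth \<eta> ==> continuous_on UNIV (dir_deriv d \<eta>)"
 using foldr_dir_deriv_differentiable[of \<eta> "[d]"]
 by (intro continuous_at_imp_continuous_on ballI differentiable_imp_continuous_within) simp

lemma frechet_derivative_rotate:
 fixes f :: "complex => complex"
 assumes "f differentiable (at (c * x))"
 shows "frechet_derivative (\<lambda>y. f (c * y)) (at x) h = frechet_derivative f (at (c * x)) (c * h)"
proof -
 have "(f has_derivative frechet_derivative f (at (c * x))) (at (c * x))"
  using assms by (simp add: frechet_derivative_works)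
 from has_derivative_compose[OF bounded_linear_imp_has_derivative[OF bounded_linear_mult_right[of c]] this]
 have "((\<lambda>y. f (c * y)) has_derivative (\<lambda>h. frechet_derivative f (at (c * x)) (c * h))) (at x)" .
 from frechet_derivative_at[OF this] show ?thesis by metis
qed

lemma dir_deriv_rotate:
 "f differentiable (at (c * x)) ==> dir_deriv d (\<lambda>y. f (c * y)) x = dir_deriv (c * d) f (c * x)"
 by (simp add: dir_deriv_def frechet_derivative_rotate)

lemma dir_deriv_combination:
 assumes "f differentiable (at x)"
 shows "dir_deriv e f x = of_real (Re e) * dir_deriv 1 f x + of_real (Im e) * dir_deriv \<i> f x"
proof -
 have lin: "linear (frechet_derivative f (at x))" using assms by (rule linear_frechet_derivative)
 have "e = Re e *\<^sub>R 1 + Im e *\<^sub>R \<i>" by (simp add: complex_eq_iff)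
 then have "frechet_derivative f (at x) e = frechet_derivative f (at x) (Re e *\<^sub>R 1 + Im e *\<^sub>R \<i>)" by simp
 also have "... = Re e *\<^sub>R frechet_derivative f (at x) 1 + Im e *\<^sub>R frechet_derivative f (at x) \<i>"
  using lin by (simp add: linear_add linear_scale)
 finally show ?thesis by (simp add: dir_deriv_def scaleR_conv_of_real)
qed

lemma foldr_dir_deriv_rotate:
 assumes "smooth \<eta>"
 shows "foldr dir_deriv ds (\<lambda>x. \<eta> (c * x)) = (\<lambda>x. foldr dir_deriv (map (\<lambda>d. c * d) ds) \<eta> (c * x))"
proof (induction ds)
 case (Cons d ds)
 show ?case
  using foldr_dir_deriv_differentiable[OF assms] by (simp add: Cons.IH dir_deriv_rotate fun_eq_iff)
qed simp

lemma differentiable_rotate: "f differentiable (at (c * x)) ==> (\<lambda>x. f (c * x)) differentiable (at x)"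
 for f :: "complex => complex"
 by (rule differentiable_compose[of f "\<lambda>x. c * x"]) (auto intro: bounded_linear_imp_differentiable bounded_linear_mult_right)

lemma smooth_rotate: "smooth \<eta> ==> smooth (\<lambda>x. \<eta> (c * x))"
 unfolding smooth_def differentiable_on_def
 by (auto simp: foldr_dir_deriv_rotate smooth_def differentiable_on_def intro!: differentiable_rotate)

lemma foldr_dir_deriv_scale:
 assumes "smooth \<eta>"
 shows "foldr dir_deriv ds (\<lambda>x. a * \<eta> x) = (\<lambda>x. a * foldr dir_deriv ds \<eta> x)"
proof (induction ds)
 case (Cons d ds)
 have "dir_deriv d (\<lambda>x. a * foldr dir_deriv ds \<eta> x) x = a * dir_deriv d (foldr dir_deriv ds \<eta>) x" for x
 proof -
  have "(foldr dir_deriv ds \<eta> has_derivative frechet_derivative (foldr dir_deriv ds \<eta>) (at x)) (at x)"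
   using foldr_dir_deriv_differentiable[OF assms, of ds x] by (simp add: frechet_derivative_works)
  then have "((\<lambda>x. a * foldr dir_deriv ds \<eta> x) has_derivative (\<lambda>h. a * frechet_derivative (foldr dir_deriv ds \<eta>) (at x) h)) (at x)"
   by (rule has_derivative_mult_right)
  from frechet_derivative_at[OF this] show ?thesis unfolding dir_deriv_def by metis
 qed
 then show ?case by (simp add: Cons.IH fun_eq_iff)
qed simp

lemma smooth_scale: "smooth \<eta> ==> smooth (\<lambda>x. a * \<eta> x)"
 unfolding smooth_def differentiable_on_def
 by (auto simp: foldr_dir_deriv_scale smooth_def differentiable_on_def intro!: differentiable_mult)

lemma test_function_rotate:
 assumes c: "cmod c = 1" and t: "test_function ((\<lambda>z. c * z) ` B) \<eta>"
 shows "test_function B (\<lambda>x. \<eta> (c * x))"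
proof -
 have c': "cmod (cnj c) = 1" using c by simp
 have "{x. \<eta> (c * x) \<noteq> 0} = (\<lambda>z. cnj c * z) ` {x. \<eta> x \<noteq> 0}"
  using rotation_image_mem[OF c', of _ "{x. \<eta> x \<noteq> 0}"] by auto
 then have cl: "closure {x. \<eta> (c * x) \<noteq> 0} = (\<lambda>z. cnj c * z) ` closure {x. \<eta> x \<noteq> 0}"
  using rotation_homeomorphism(1)[OF c'] by simp
 have "(\<lambda>z. cnj c * z) ` closure {x. \<eta> x \<noteq> 0} \<subseteq> B"
 proof (rule image_subsetI)
  fix z assume "z \<in> closure {x. \<eta> x \<noteq> 0}"
  then have "z \<in> (\<lambda>z. c * z) ` B" using t unfolding test_function_def by blast
  then show "cnj c * z \<in> B" by (simp only: rotation_image_mem[OF c])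
 qed
 moreover have "compact ((\<lambda>z. cnj c * z) ` closure {x. \<eta> x \<noteq> 0})"
  using t by (intro compact_continuous_image continuous_intros) (simp add: test_function_def)
 ultimately show ?thesis using t by (simp add: test_function_def smooth_rotate cl)
qed

lemma integrable_L2_times_continuous:
 assumes B: "bounded B" "B \<in> sets lebesgue" and u: "in_L2 (lebesgue_on B) u" and g: "continuous_on UNIV g"
 shows "integrable (lebesgue_on B) (\<lambda>x. u x * g x :: complex)"
proof -
 have fin: "finite_measure (lebesgue_on B)"
  using bounded_set_imp_lmeasurable[OF B] by (intro finite_measure_lebesgue_on)
 have u1: "integrable (lebesgue_on B) u"
  using u by (intro integrable_of_square[OF fin]) (auto simp: in_L2_def)
 have "compact (closure B)" using B by simp
 then have "bounded (g ` closure B)"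
  by (intro compact_imp_bounded compact_continuous_image continuous_on_subset[OF g]) auto
 then obtain C where C: "\<And>x. x \<in> B ==> cmod (g x) \<le> C" using closure_subset by (fastforce simp: bounded_iff)
 have gm: "g \<in> borel_measurable (lebesgue_on B)"
  using borel_measurable_continuous_onI[OF g] by (intro measurable_restrict_space1 measurable_completion) simp
 show ?thesis
 proof (rule Bochner_Integration.integrable_bound)
  show "integrable (lebesgue_on B) (\<lambda>x. C * cmod (u x))" using u1 by simp
  show "(\<lambda>x. u x * g x) \<in> borel_measurable (lebesgue_on B)" using gm u by (auto simp: in_L2_def)
  have "cmod (u x * g x) \<le> \<bar>C * cmod (u x)\<bar>" if "x \<in> B" for x
   using mult_left_mono[OF C[OF that] norm_ge_zero[of "u x"]] by (simp add: norm_mult mult.commute)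
  then show "AE x in lebesgue_on B. norm (u x * g x) \<le> norm (C * cmod (u x))"
   by (intro AE_I2) (simp add: space_restrict_space)
 qed
qed

lemma fund_sol_differentiable:
 assumes "\<omega> > 0" "w \<noteq> 0"
 shows "fund_sol \<omega> differentiable (at w)"
proof -
 obtain \<rho> :: "real => complex" where "\<And>w. w \<noteq> 0 ==> (fund_sol \<omega> has_derivative
   (\<lambda>v. (of_real (1 / (2 * pi * cmod w)) + \<rho> (cmod w)) * of_real ((v \<bullet> w) / cmod w))) (at w)"
  by (rule fund_sol_has_derivative[OF assms(1)]) blast
 from differentiableI[OF this[OF assms(2)]] show ?thesis .
qed

locale domain_rotation =
 fixes c :: complex and B :: "complex set"
 assumes unit: "cmod c = 1" and open_domain: "open B" and bounded_domain: "bounded B"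
begin

abbreviation "rB \<equiv> (\<lambda>z. c * z) ` B"

lemma sets_domain: "B \<in> sets lebesgue" using open_domain by simp

lemma sets_rdomain: "rB \<in> sets lebesgue"
proof -
 have "open rB" using rotation_homeomorphism(2)[OF unit, of B] open_domain by (metis interior_eq)
 then show ?thesis by simp
qed

lemma bounded_rdomain: "bounded rB"
 using bounded_domain by (intro bounded_linear_image) (auto intro: bounded_linear_mult_right)

lemma opposite: "domain_rotation (cnj c) rB"
proof
 show "open rB" using rotation_homeomorphism(2)[OF unit, of B] open_domain by (metis interior_eq)
qed (use unit bounded_rdomain in auto)

lemma image_back: "(\<lambda>z. cnj c * z) ` rB = B"
 by (simp add: image_image unit_mult_cnj[OF unit])

sublocale vol: rotation c "lebesgue_on B" "lebesgue_on rB"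
 by (rule rotation_lebesgue_on[OF unit sets_domain])

sublocale surf: rotation c "surface_measure B" "surface_measure rB"
 by (rule rotation_surface_measure[OF unit])

text \<open>The weak derivative in direction \<open>d\<close> of \<open>x \<mapsto> u (c x)\<close> by the
  chain rule.\<close>
definition grad :: "complex => (complex => complex) => (complex => complex) => complex => complex" where
 "grad d u1 u2 x = of_real (Re (c * d)) * u1 (c * x) + of_real (Im (c * d)) * u2 (c * x)"

lemma in_L2_grad:
 assumes "in_L2 (lebesgue_on rB) u1" "in_L2 (lebesgue_on rB) u2"
 shows "in_L2 (lebesgue_on B) (grad d u1 u2)"
proof -
 have 1: "in_L2 (lebesgue_on B) (\<lambda>x. u1 (c * x))" "in_L2 (lebesgue_on B) (\<lambda>x. u2 (c * x))"
  using assms by (simp_all add: vol.in_L2_rotation)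
 then have [measurable]: "(\<lambda>x. u1 (c * x)) \<in> borel_measurable (lebesgue_on B)" "(\<lambda>x. u2 (c * x)) \<in> borel_measurable (lebesgue_on B)"
  and i: "integrable (lebesgue_on B) (\<lambda>x. (cmod (u1 (c * x)))\<^sup>2)" "integrable (lebesgue_on B) (\<lambda>x. (cmod (u2 (c * x)))\<^sup>2)"
  by (simp_all add: in_L2_def)
 have gm: "grad d u1 u2 \<in> borel_measurable (lebesgue_on B)" unfolding grad_def by measurable
 have le: "(cmod (grad d u1 u2 x))\<^sup>2 \<le> 2 * (cmod d)\<^sup>2 * ((cmod (u1 (c * x)))\<^sup>2 + (cmod (u2 (c * x)))\<^sup>2)" for x
 proof -
  have cd: "\<bar>Re (c * d)\<bar> \<le> cmod d" "\<bar>Im (c * d)\<bar> \<le> cmod d"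
   using abs_Re_le_cmod[of "c * d"] abs_Im_le_cmod[of "c * d"] unit by (simp_all add: norm_mult)
  have "cmod (grad d u1 u2 x) \<le> \<bar>Re (c * d)\<bar> * cmod (u1 (c * x)) + \<bar>Im (c * d)\<bar> * cmod (u2 (c * x))"
  proof -
   have "cmod (of_real p * a + of_real q * b) \<le> \<bar>p\<bar> * cmod a + \<bar>q\<bar> * cmod b" for p q a b
    using norm_triangle_ineq[of "of_real p * a" "of_real q * b"] by (simp add: norm_mult)
   then show ?thesis unfolding grad_def .
  qed
  also have "... \<le> cmod d * cmod (u1 (c * x)) + cmod d * cmod (u2 (c * x))"
   using cd by (intro add_mono mult_right_mono) auto
  finally have "cmod (grad d u1 u2 x) \<le> cmod d * (cmod (u1 (c * x)) + cmod (u2 (c * x)))" by (simp add: distrib_left)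
  then have "(cmod (grad d u1 u2 x))\<^sup>2 \<le> (cmod d * (cmod (u1 (c * x)) + cmod (u2 (c * x))))\<^sup>2" by (rule power_mono) simp
  also have "... = (cmod d)\<^sup>2 * (cmod (u1 (c * x)) + cmod (u2 (c * x)))\<^sup>2" by (rule power_mult_distrib)
  also have "... \<le> (cmod d)\<^sup>2 * (2 * ((cmod (u1 (c * x)))\<^sup>2 + (cmod (u2 (c * x)))\<^sup>2))"
  proof (rule mult_left_mono)
   have "0 \<le> (cmod (u1 (c * x)) - cmod (u2 (c * x)))\<^sup>2" by simp
   then show "(cmod (u1 (c * x)) + cmod (u2 (c * x)))\<^sup>2 \<le> 2 * ((cmod (u1 (c * x)))\<^sup>2 + (cmod (u2 (c * x)))\<^sup>2)"
    by (simp add: power2_eq_square algebra_simps)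
  qed simp
  finally show ?thesis by (simp only: mult.assoc mult.left_commute)
 qed
 have "integrable (lebesgue_on B) (\<lambda>x. (cmod (grad d u1 u2 x))\<^sup>2)"
 proof (rule Bochner_Integration.integrable_bound)
  show "integrable (lebesgue_on B) (\<lambda>x. 2 * (cmod d)\<^sup>2 * ((cmod (u1 (c * x)))\<^sup>2 + (cmod (u2 (c * x)))\<^sup>2))" using i by simp
  show "AE x in lebesgue_on B. norm ((cmod (grad d u1 u2 x))\<^sup>2) \<le> norm (2 * (cmod d)\<^sup>2 * ((cmod (u1 (c * x)))\<^sup>2 + (cmod (u2 (c * x)))\<^sup>2))"
   using le by (intro AE_I2) (simp add: abs_of_nonneg)
 qed (use gm in measurable)
 then show ?thesis using gm by (simp add: in_L2_def)
qed

lemma weak_deriv_rotate: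
 assumes H: "in_H1 rB u u1 u2"
 shows "weak_deriv B d (\<lambda>x. u (c * x)) (grad d u1 u2)"
 unfolding weak_deriv_def
proof (intro allI impI)
 fix \<eta> assume t: "test_function B \<eta>"
 interpret b: domain_rotation "cnj c" rB by (rule opposite)
 define \<eta>' where "\<eta>' y = \<eta> (cnj c * y)" for y
 have t': "test_function rB \<eta>'" unfolding \<eta>'_def using test_function_rotate[OF b.unit, of rB \<eta>] t by (simp add: image_back)
 then have s': "smooth \<eta>'" by (simp add: test_function_def)
 have \<eta>: "\<eta> = (\<lambda>x. \<eta>' (c * x))" by (simp add: \<eta>'_def unit_mult_cnj[OF unit])
 have dd: "dir_deriv d \<eta> x = of_real (Re (c * d)) * dir_deriv 1 \<eta>' (c * x) + of_real (Im (c * d)) * dir_deriv \<i> \<eta>' (c * x)" for x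
  unfolding \<eta> using smooth_differentiable[OF s'] by (simp add: dir_deriv_rotate dir_deriv_combination[of _ _ "c * d"])
 have L2: "in_L2 (lebesgue_on rB) u" "in_L2 (lebesgue_on rB) u1" "in_L2 (lebesgue_on rB) u2"
  and w: "weak_deriv rB 1 u u1" "weak_deriv rB \<i> u u2" using H by (simp_all add: in_H1_def)
 note int = integrable_L2_times_continuous[OF bounded_rdomain sets_rdomain]
 have i: "integrable (lebesgue_on rB) (\<lambda>y. u y * dir_deriv e \<eta>' y)" for e
  by (rule int[OF L2(1) smooth_dir_deriv_continuous[OF s']])
 have j: "integrable (lebesgue_on rB) (\<lambda>y. u1 y * \<eta>' y)" "integrable (lebesgue_on rB) (\<lambda>y. u2 y * \<eta>' y)"
  by (rule int[OF L2(2) smooth_continuous[OF s']], rule int[OF L2(3) smooth_continuous[OF s']])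
 have "(\<integral>x. u (c * x) * dir_deriv d \<eta> x \<partial>lebesgue_on B) =
   (\<integral>x. (\<lambda>y. of_real (Re (c * d)) * (u y * dir_deriv 1 \<eta>' y) + of_real (Im (c * d)) * (u y * dir_deriv \<i> \<eta>' y)) (c * x) \<partial>lebesgue_on B)"
  by (simp add: dd distrib_left mult_ac)
 also have "... = (\<integral>y. of_real (Re (c * d)) * (u y * dir_deriv 1 \<eta>' y) + of_real (Im (c * d)) * (u y * dir_deriv \<i> \<eta>' y) \<partial>lebesgue_on rB)"
  by (rule vol.integral_rotation)
 also have "... = of_real (Re (c * d)) * (\<integral>y. u y * dir_deriv 1 \<eta>' y \<partial>lebesgue_on rB) + of_real (Im (c * d)) * (\<integral>y. u y * dir_deriv \<i> \<eta>' y \<partial>lebesgue_on rB)"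
  using i by (subst Bochner_Integration.integral_add) simp_all
 also have "... = - (of_real (Re (c * d)) * (\<integral>y. u1 y * \<eta>' y \<partial>lebesgue_on rB) + of_real (Im (c * d)) * (\<integral>y. u2 y * \<eta>' y \<partial>lebesgue_on rB))"
  using w t' by (simp add: weak_deriv_def)
 also have "... = - (\<integral>y. of_real (Re (c * d)) * (u1 y * \<eta>' y) + of_real (Im (c * d)) * (u2 y * \<eta>' y) \<partial>lebesgue_on rB)"
  using j by (subst Bochner_Integration.integral_add) simp_all
 also have "... = - (\<integral>x. (\<lambda>y. of_real (Re (c * d)) * (u1 y * \<eta>' y) + of_real (Im (c * d)) * (u2 y * \<eta>' y)) (c * x) \<partial>lebesgue_on B)"
  by (rule arg_cong[where f = uminus], rule vol.integral_rotation[symmetric])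
 also have "... = - (\<integral>x. grad d u1 u2 x * \<eta> x \<partial>lebesgue_on B)"
  by (simp add: grad_def \<eta> algebra_simps)
 finally show "(\<integral>x. u (c * x) * dir_deriv d \<eta> x \<partial>lebesgue_on B) = - (\<integral>x. grad d u1 u2 x * \<eta> x \<partial>lebesgue_on B)" .
qed

lemma in_H1_rotate:
 assumes H: "in_H1 rB u u1 u2"
 shows "in_H1 B (\<lambda>x. u (c * x)) (grad 1 u1 u2) (grad \<i> u1 u2)"
 using H weak_deriv_rotate[OF H] in_L2_grad[of u1 u2] by (simp add: in_H1_def vol.in_L2_rotation)

lemma L2_tendsto_grad:
 assumes s: "\<And>k. smooth (\<eta> k)" and H: "in_H1 rB u u1 u2" and t: "H1_tendsto rB \<eta> u u1 u2" and d: "cmod d = 1"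
 shows "L2_tendsto (lebesgue_on B) (\<lambda>k. dir_deriv d (\<lambda>x. \<eta> k (c * x))) (grad d u1 u2)"
proof -
 let ?f = "\<lambda>k x. ennreal ((cmod (dir_deriv 1 (\<eta> k) x - u1 x))\<^sup>2)"
 let ?g = "\<lambda>k x. ennreal ((cmod (dir_deriv \<i> (\<eta> k) x - u2 x))\<^sup>2)"
 have lim: "(\<lambda>k. (\<integral>\<^sup>+x. ?f k x \<partial>lebesgue_on rB) + (\<integral>\<^sup>+x. ?g k x \<partial>lebesgue_on rB)) \<longlonglongrightarrow> 0 + 0"
  using t unfolding H1_tendsto_def L2_tendsto_def by (intro tendsto_add) auto
 have le: "(\<integral>\<^sup>+x. ennreal ((cmod (dir_deriv d (\<lambda>x. \<eta> k (c * x)) x - grad d u1 u2 x))\<^sup>2) \<partial>lebesgue_on B) \<le>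
   (\<integral>\<^sup>+x. ?f k x \<partial>lebesgue_on rB) + (\<integral>\<^sup>+x. ?g k x \<partial>lebesgue_on rB)" for k
 proof -
  have dm: "dir_deriv e (\<eta> k) \<in> borel_measurable (lebesgue_on rB)" for e
   using borel_measurable_continuous_onI[OF smooth_dir_deriv_continuous[OF s]]
   by (intro measurable_restrict_space1 measurable_completion) simp
  have um: "u1 \<in> borel_measurable (lebesgue_on rB)" "u2 \<in> borel_measurable (lebesgue_on rB)"
   using H by (simp_all add: in_H1_def in_L2_def)
  have pt: "(cmod (dir_deriv d (\<lambda>x. \<eta> k (c * x)) x - grad d u1 u2 x))\<^sup>2 \<le>
    (cmod (dir_deriv 1 (\<eta> k) (c * x) - u1 (c * x)))\<^sup>2 + (cmod (dir_deriv \<i> (\<eta> k) (c * x) - u2 (c * x)))\<^sup>2" for x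
  proof -
   define a b where "a = dir_deriv 1 (\<eta> k) (c * x) - u1 (c * x)" and "b = dir_deriv \<i> (\<eta> k) (c * x) - u2 (c * x)"
   define p q where "p = Re (c * d)" and "q = Im (c * d)"
   have pq: "p\<^sup>2 + q\<^sup>2 = 1" using cmod_power2[of "c * d"] unit d unfolding p_def q_def by (simp only: norm_mult mult_1 one_power2)
   have "dir_deriv d (\<lambda>x. \<eta> k (c * x)) x - grad d u1 u2 x = of_real p * a + of_real q * b"
   proof -
    note sd = smooth_differentiable[OF s[of k], of "c * x"]
    have "dir_deriv d (\<lambda>x. \<eta> k (c * x)) x = of_real p * dir_deriv 1 (\<eta> k) (c * x) + of_real q * dir_deriv \<i> (\<eta> k) (c * x)"
     unfolding p_def q_def by (simp only: dir_deriv_rotate[OF sd] dir_deriv_combination[OF sd, of "c * d"])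
    moreover have "grad d u1 u2 x = of_real p * u1 (c * x) + of_real q * u2 (c * x)" unfolding grad_def p_def q_def ..
    ultimately show ?thesis by (simp add: a_def b_def right_diff_distrib)
   qed
   moreover have "(cmod (of_real p * a + of_real q * b))\<^sup>2 + (cmod (of_real q * a - of_real p * b))\<^sup>2 = (p\<^sup>2 + q\<^sup>2) * ((cmod a)\<^sup>2 + (cmod b)\<^sup>2)"
    unfolding cmod_power2 by (simp add: power2_eq_square algebra_simps)
   ultimately show ?thesis unfolding a_def[symmetric] b_def[symmetric] pq by (metis add.commute le_add_same_cancel2 mult_1 zero_le_power2)
  qed
  have "(\<integral>\<^sup>+x. ennreal ((cmod (dir_deriv d (\<lambda>x. \<eta> k (c * x)) x - grad d u1 u2 x))\<^sup>2) \<partial>lebesgue_on B) \<le>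
    (\<integral>\<^sup>+x. (\<lambda>y. ?f k y + ?g k y) (c * x) \<partial>lebesgue_on B)"
   by (intro nn_integral_mono) (simp add: ennreal_plus[symmetric] ennreal_leI pt del: ennreal_plus)
  also have "... = (\<integral>\<^sup>+y. ?f k y + ?g k y \<partial>lebesgue_on rB)" by (rule vol.nn_integral_rotation)
  also have "... = (\<integral>\<^sup>+x. ?f k x \<partial>lebesgue_on rB) + (\<integral>\<^sup>+x. ?g k x \<partial>lebesgue_on rB)"
   using dm um by (intro nn_integral_add) auto
  finally show ?thesis .
 qed
 show ?thesis unfolding L2_tendsto_def
  by (rule tendsto_sandwich[OF _ _ tendsto_const lim[unfolded add_0_right]]) (use le in auto)
qed

lemma has_trace_rotate:
 assumes "has_trace rB v h"
 shows "has_trace B (\<lambda>x. v (c * x)) (\<lambda>x. h (c * x))"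
proof -
 obtain v1 v2 \<eta> where v: "in_L2 (surface_measure rB) h" "in_H1 rB v v1 v2" "\<And>k. smooth (\<eta> k)" "H1_tendsto rB \<eta> v v1 v2"
   "L2_tendsto (surface_measure rB) \<eta> h" using assms unfolding has_trace_def by blast
 have "H1_tendsto B (\<lambda>k x. \<eta> k (c * x)) (\<lambda>x. v (c * x)) (grad 1 v1 v2) (grad \<i> v1 v2)"
  using v(4) L2_tendsto_grad[OF v(3,2,4)] vol.L2_tendsto_rotation[of \<eta> v] by (simp add: H1_tendsto_def)
 moreover have "in_L2 (surface_measure B) (\<lambda>x. h (c * x))" using v(1) by (simp only: surf.in_L2_rotation)
 moreover have "L2_tendsto (surface_measure B) (\<lambda>k x. \<eta> k (c * x)) (\<lambda>x. h (c * x))"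
  using v(5) by (simp only: surf.L2_tendsto_rotation)
 moreover have "\<forall>k. smooth (\<lambda>x. \<eta> k (c * x))" using v(3) by (intro allI smooth_rotate)
 ultimately show ?thesis unfolding has_trace_def using in_H1_rotate[OF v(2)]
  by (intro conjI exI[of _ "grad 1 v1 v2"] exI[of _ "grad \<i> v1 v2"] exI[of _ "\<lambda>k x. \<eta> k (c * x)"])
qed

text \<open>Test functions on \<open>B\<close> are rotated back to the other domain; the two gradients
  turn by the same angle, so their product is unchanged.\<close>
lemma neumann_solution_rotate:
 assumes "neumann_solution \<omega> rB \<sigma> \<mu> g w"
 shows "neumann_solution \<omega> B (\<lambda>x. \<sigma> (c * x)) (\<lambda>x. \<mu> (c * x)) (\<lambda>x. g (c * x)) (\<lambda>x. w (c * x))"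
proof -
 interpret b: domain_rotation "cnj c" rB by (rule opposite)
 obtain w1 w2 where w: "in_H1 rB w w1 w2" and
  eq: "\<And>v v1 v2 h. in_H1 rB v v1 v2 ==> has_trace rB v h ==>
     (\<integral>x. of_real (1 / \<sigma> x) * (w1 x * v1 x + w2 x * v2 x) - of_real (\<omega>\<^sup>2 * \<mu> x) * w x * v x \<partial>lebesgue_on rB) =
     (\<integral>y. g y * h y \<partial>surface_measure rB)"
  using assms unfolding neumann_solution_def by blast
 show ?thesis unfolding neumann_solution_def
 proof (intro exI conjI allI impI)
  show "in_H1 B (\<lambda>x. w (c * x)) (grad 1 w1 w2) (grad \<i> w1 w2)" by (rule in_H1_rotate[OF w])
  fix v v1 v2 h assume vh: "in_H1 B v v1 v2 \<and> has_trace B v h"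
  define V1 V2 where "V1 = b.grad 1 v1 v2" and "V2 = b.grad \<i> v1 v2"
  have "in_H1 rB (\<lambda>x. v (cnj c * x)) V1 V2" "has_trace rB (\<lambda>x. v (cnj c * x)) (\<lambda>x. h (cnj c * x))"
   using b.in_H1_rotate[of v v1 v2] b.has_trace_rotate[of v h] vh by (simp_all add: image_back V1_def V2_def)
  note e = eq[OF this]
  let ?F = "\<lambda>y. of_real (1 / \<sigma> y) * (w1 y * V1 y + w2 y * V2 y) - of_real (\<omega>\<^sup>2 * \<mu> y) * w y * v (cnj c * y)"
  have pt: "grad 1 w1 w2 x * v1 x + grad \<i> w1 w2 x * v2 x = w1 (c * x) * V1 (c * x) + w2 (c * x) * V2 (c * x)" for x
   unfolding grad_def b.grad_def V1_def V2_def unit_mult_cnj(2)[OF unit] by (simp add: algebra_simps)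
  have "(\<integral>x. of_real (1 / \<sigma> (c * x)) * (grad 1 w1 w2 x * v1 x + grad \<i> w1 w2 x * v2 x)
    - of_real (\<omega>\<^sup>2 * \<mu> (c * x)) * w (c * x) * v x \<partial>lebesgue_on B) = (\<integral>x. ?F (c * x) \<partial>lebesgue_on B)"
   by (simp only: pt unit_mult_cnj[OF unit])
  also have "... = (\<integral>y. ?F y \<partial>lebesgue_on rB)" by (rule vol.integral_rotation)
  also have "... = (\<integral>y. g y * h (cnj c * y) \<partial>surface_measure rB)" by (rule e)
  also have "... = (\<integral>x. g (c * x) * h (cnj c * (c * x)) \<partial>surface_measure B)" by (rule surf.integral_rotation[symmetric])
  finally show "(\<integral>x. of_real (1 / \<sigma> (c * x)) * (grad 1 w1 w2 x * v1 x + grad \<i> w1 w2 x * v2 x)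
    - of_real (\<omega>\<^sup>2 * \<mu> (c * x)) * w (c * x) * v x \<partial>lebesgue_on B) = (\<integral>x. g (c * x) * h x \<partial>surface_measure B)"
   by (simp only: unit_mult_cnj[OF unit])
 qed
qed

lemma NtD_graph_rotate:
 "NtD_graph \<omega> rB \<sigma> \<mu> g h ==>
  NtD_graph \<omega> B (\<lambda>x. \<sigma> (c * x)) (\<lambda>x. \<mu> (c * x)) (\<lambda>x. g (c * x)) (\<lambda>x. h (c * x))"
 unfolding NtD_graph_def using neumann_solution_rotate has_trace_rotate by blast

lemma single_layer_rotate: "single_layer \<omega> rB \<phi> (c * x) = single_layer \<omega> B (\<lambda>y. \<phi> (c * y)) x"
proof -
 have "fund_sol \<omega> (c * x - c * y) = fund_sol \<omega> (x - y)" for y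
  using unit by (simp add: fund_sol_def right_diff_distrib[symmetric] norm_mult)
 then show ?thesis
  unfolding single_layer_def
  by (subst surf.integral_rotation[symmetric]) simp
qed

text \<open>The truncated integrals agree for every positive truncation, so both principal values are
  limits of the same function.\<close>
lemma K_star_rotate:
 assumes om: "\<omega> > 0"
 shows "K_star \<omega> rB \<phi> (c * x) = K_star \<omega> B (\<lambda>y. \<phi> (c * y)) x"
proof -
 have fd: "frechet_derivative (fund_sol \<omega>) (at (c * w)) (c * h) = frechet_derivative (fund_sol \<omega>) (at w) h" if "w \<noteq> 0" for w h
 proof -
  have "c * w \<noteq> 0" using that unit by auto
  then have "fund_sol \<omega> differentiable (at (c * w))" by (rule fund_sol_differentiable[OF om])
  from frechet_derivative_rotate[OF this, of h]
  have "frechet_derivative (\<lambda>w. fund_sol \<omega> (c * w)) (at w) h = frechet_derivative (fund_sol \<omega>) (at (c * w)) (c * h)" .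
  moreover have "(\<lambda>w. fund_sol \<omega> (c * w)) = fund_sol \<omega>" using unit by (simp add: fun_eq_iff fund_sol_def norm_mult)
  ultimately show ?thesis by simp
 qed
 let ?N = "outward_normal B x"
 have eq: "(LINT y:{y. dist (c * x) y > \<epsilon>}|surface_measure rB.
    frechet_derivative (fund_sol \<omega>) (at (c * x - y)) (outward_normal rB (c * x)) * \<phi> y) =
   (LINT y:{y. dist x y > \<epsilon>}|surface_measure B. frechet_derivative (fund_sol \<omega>) (at (x - y)) ?N * \<phi> (c * y))"
  if e: "\<epsilon> > 0" for \<epsilon>
 proof -
  have "indicator {y. dist (c * x) y > \<epsilon>} (c * y) *\<^sub>R (frechet_derivative (fund_sol \<omega>) (at (c * x - c * y)) (c * ?N) * \<phi> (c * y)) =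
    indicator {y. dist x y > \<epsilon>} y *\<^sub>R (frechet_derivative (fund_sol \<omega>) (at (x - y)) ?N * \<phi> (c * y))" for y
  proof -
   have d: "dist (c * x) (c * y) = dist x y"
    using unit by (simp add: dist_norm right_diff_distrib[symmetric] norm_mult)
   show ?thesis
   proof (cases "dist x y > \<epsilon>")
    case True
    then have "x - y \<noteq> 0" using e by auto
    then show ?thesis using True fd[of "x - y" ?N] by (simp add: d right_diff_distrib)
   qed (simp add: d)
  qed
  then show ?thesis
   unfolding set_lebesgue_integral_def outward_normal_rotate[OF unit]
   by (subst surf.integral_rotation[symmetric]) simp
 qed
 have ev: "eventually (\<lambda>\<epsilon>. (LINT y:{y. dist (c * x) y > \<epsilon>}|surface_measure rB.
    frechet_derivative (fund_sol \<omega>) (at (c * x - y)) (outward_normal rB (c * x)) * \<phi> y) =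
   (LINT y:{y. dist x y > \<epsilon>}|surface_measure B. frechet_derivative (fund_sol \<omega>) (at (x - y)) ?N * \<phi> (c * y))) (at_right 0)"
  by (rule eventually_at_rightI[OF eq zero_less_one]) simp
 show ?thesis unfolding K_star_def t2_space_class.Lim_def tendsto_cong[OF ev] ..
qed

lemma A_equation_rotate:
 assumes om: "\<omega> > 0" and A: "A_equation \<omega> rB \<sigma> \<mu> (\<phi>, \<psi>) (f, g)"
 shows "A_equation \<omega> B (\<lambda>x. \<sigma> (c * x)) (\<lambda>x. \<mu> (c * x)) (\<lambda>x. \<phi> (c * x), \<lambda>x. \<psi> (c * x)) (\<lambda>x. f (c * x), \<lambda>x. g (c * x))"
proof -
 obtain h where h: "NtD_graph \<omega> rB \<sigma> \<mu> \<psi> h" "AE x in surface_measure rB. - single_layer \<omega> rB \<phi> x + h x = f x"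
  and L: "in_L2 (surface_measure rB) \<phi>" "in_L2 (surface_measure rB) \<psi>"
  and k: "AE x in surface_measure rB. - (1 / 2 * \<phi> x + K_star \<omega> rB \<phi> x) + \<psi> x = g x"
  using A unfolding A_equation_def by auto
 have "AE x in surface_measure B. - single_layer \<omega> B (\<lambda>x. \<phi> (c * x)) x + h (c * x) = f (c * x)"
  using h(2) unfolding surf.AE_iff single_layer_rotate .
 moreover have "AE x in surface_measure B. - (1 / 2 * \<phi> (c * x) + K_star \<omega> B (\<lambda>x. \<phi> (c * x)) x) + \<psi> (c * x) = g (c * x)"
  using k unfolding surf.AE_iff K_star_rotate[OF om] .
 ultimately show ?thesis
  using L NtD_graph_rotate[OF h(1)] unfolding A_equation_def prod.case surf.in_L2_rotation by blast
qed

end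

section \<open>Multiplication by a unimodular constant, and the scattering coefficients\<close>

lemma in_L2_scale: "in_L2 M f ==> in_L2 M (\<lambda>x. a * f x)"
 by (auto simp: in_L2_def norm_mult power_mult_distrib)

lemma weak_deriv_scale: "weak_deriv B d u v ==> weak_deriv B d (\<lambda>x. a * u x) (\<lambda>x. a * v x)"
 by (simp add: weak_deriv_def mult.assoc)

lemma in_H1_scale: "in_H1 B u u1 u2 ==> in_H1 B (\<lambda>x. a * u x) (\<lambda>x. a * u1 x) (\<lambda>x. a * u2 x)"
 by (simp add: in_H1_def in_L2_scale weak_deriv_scale)

lemma L2_tendsto_scale:
 assumes "cmod a = 1" "L2_tendsto M f g"
 shows "L2_tendsto M (\<lambda>k x. a * f k x) (\<lambda>x. a * g x)"
 using assms by (simp add: L2_tendsto_def right_diff_distrib[symmetric] norm_mult)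

lemma H1_tendsto_scale:
 assumes a: "cmod a = 1" and s: "\<And>k. smooth (\<eta> k)" and t: "H1_tendsto B \<eta> u u1 u2"
 shows "H1_tendsto B (\<lambda>k x. a * \<eta> k x) (\<lambda>x. a * u x) (\<lambda>x. a * u1 x) (\<lambda>x. a * u2 x)"
proof -
 have "dir_deriv d (\<lambda>x. a * \<eta> k x) = (\<lambda>x. a * dir_deriv d (\<eta> k) x)" for d k
  using foldr_dir_deriv_scale[OF s[of k], of "[d]"] by simp
 moreover have "L2_tendsto (lebesgue_on B) \<eta> u" "L2_tendsto (lebesgue_on B) (\<lambda>k. dir_deriv 1 (\<eta> k)) u1"
   "L2_tendsto (lebesgue_on B) (\<lambda>k. dir_deriv \<i> (\<eta> k)) u2" using t by (auto simp: H1_tendsto_def)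
 note this[THEN L2_tendsto_scale[OF a]]
 ultimately show ?thesis by (simp only: H1_tendsto_def simp_thms)
qed

lemma has_trace_scale:
 assumes a: "cmod a = 1" and "has_trace B u h"
 shows "has_trace B (\<lambda>x. a * u x) (\<lambda>x. a * h x)"
proof -
 obtain u1 u2 \<eta> where u: "in_L2 (surface_measure B) h" "in_H1 B u u1 u2" "\<And>k. smooth (\<eta> k)" "H1_tendsto B \<eta> u u1 u2"
   "L2_tendsto (surface_measure B) \<eta> h" using assms(2) unfolding has_trace_def by blast
 show ?thesis unfolding has_trace_def
  by (intro conjI exI[of _ "\<lambda>x. a * u1 x"] exI[of _ "\<lambda>x. a * u2 x"] exI[of _ "\<lambda>k x. a * \<eta> k x"] allI
    in_L2_scale in_H1_scale smooth_scale H1_tendsto_scale L2_tendsto_scale a u)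
qed

lemma neumann_solution_scale:
 assumes "neumann_solution \<omega> B \<sigma> \<mu> g w"
 shows "neumann_solution \<omega> B \<sigma> \<mu> (\<lambda>x. a * g x) (\<lambda>x. a * w x)"
proof -
 obtain w1 w2 where w: "in_H1 B w w1 w2" and
  eq: "\<And>v v1 v2 h. in_H1 B v v1 v2 ==> has_trace B v h ==>
     (\<integral>x. of_real (1 / \<sigma> x) * (w1 x * v1 x + w2 x * v2 x) - of_real (\<omega>\<^sup>2 * \<mu> x) * w x * v x \<partial>lebesgue_on B) =
     (\<integral>y. g y * h y \<partial>surface_measure B)"
  using assms unfolding neumann_solution_def by blast
 show ?thesis unfolding neumann_solution_def
 proof (intro exI conjI allI impI)
  show "in_H1 B (\<lambda>x. a * w x) (\<lambda>x. a * w1 x) (\<lambda>x. a * w2 x)" by (rule in_H1_scale[OF w])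
  fix v v1 v2 h assume vh: "in_H1 B v v1 v2 \<and> has_trace B v h"
  have pt: "of_real (1 / \<sigma> x) * (a * w1 x * v1 x + a * w2 x * v2 x) - of_real (\<omega>\<^sup>2 * \<mu> x) * (a * w x) * v x =
    a * (of_real (1 / \<sigma> x) * (w1 x * v1 x + w2 x * v2 x) - of_real (\<omega>\<^sup>2 * \<mu> x) * w x * v x)" for x
   by (simp add: algebra_simps)
  have "(\<integral>x. of_real (1 / \<sigma> x) * (a * w1 x * v1 x + a * w2 x * v2 x) - of_real (\<omega>\<^sup>2 * \<mu> x) * (a * w x) * v x \<partial>lebesgue_on B) =
    a * (\<integral>y. g y * h y \<partial>surface_measure B)"
   unfolding pt integral_mult_right_zero eq[OF vh[THEN conjunct1] vh[THEN conjunct2]] ..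
  then show "(\<integral>x. of_real (1 / \<sigma> x) * (a * w1 x * v1 x + a * w2 x * v2 x) - of_real (\<omega>\<^sup>2 * \<mu> x) * (a * w x) * v x \<partial>lebesgue_on B) =
    (\<integral>y. a * g y * h y \<partial>surface_measure B)"
   by (simp only: mult.assoc integral_mult_right_zero)
 qed
qed

lemma NtD_graph_scale:
 "cmod a = 1 ==> NtD_graph \<omega> B \<sigma> \<mu> g h ==> NtD_graph \<omega> B \<sigma> \<mu> (\<lambda>x. a * g x) (\<lambda>x. a * h x)"
 unfolding NtD_graph_def using neumann_solution_scale has_trace_scale by blast

lemma single_layer_scale: "single_layer \<omega> B (\<lambda>y. a * \<phi> y) x = a * single_layer \<omega> B \<phi> x"
 unfolding single_layer_def mult.left_commute[of _ a] by (rule integral_mult_right_zero)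

text \<open>The one place where the existence of the principal value enters.\<close>
lemma K_star_scale:
 assumes "\<omega> > 0" "bounded_lipschitz_domain B" "in_L2 (surface_measure B) \<phi>"
 shows "AE x in surface_measure B. K_star \<omega> B (\<lambda>y. a * \<phi> y) x = a * K_star \<omega> B \<phi> x"
 using K_star_limit_exists[OF assms]
proof eventually_elim
 case (elim x)
 then obtain l where l: "((\<lambda>\<epsilon>. LINT y:{y. dist x y > \<epsilon>}|surface_measure B.
  frechet_derivative (fund_sol \<omega>) (at (x - y)) (outward_normal B x) * \<phi> y) \<longlongrightarrow> l) (at_right 0)" by blast
 have "(LINT y:{y. dist x y > \<epsilon>}|surface_measure B. frechet_derivative (fund_sol \<omega>) (at (x - y)) (outward_normal B x) * (a * \<phi> y)) =
   a * (LINT y:{y. dist x y > \<epsilon>}|surface_measure B. frechet_derivative (fund_sol \<omega>) (at (x - y)) (outward_normal B x) * \<phi> y)" for \<epsilon>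
  unfolding mult.left_commute[of _ a] by (rule set_integral_mult_right)
 moreover have "((\<lambda>\<epsilon>. a * (LINT y:{y. dist x y > \<epsilon>}|surface_measure B.
  frechet_derivative (fund_sol \<omega>) (at (x - y)) (outward_normal B x) * \<phi> y)) \<longlongrightarrow> a * l) (at_right 0)"
  by (intro tendsto_mult tendsto_const l)
 ultimately have "K_star \<omega> B (\<lambda>y. a * \<phi> y) x = a * l"
  unfolding K_star_def by (intro tendsto_Lim) simp_all
 moreover have "K_star \<omega> B \<phi> x = l" unfolding K_star_def by (intro tendsto_Lim l) simp
 ultimately show ?case by simp
qed

lemma A_equation_scale:
 assumes om: "\<omega> > 0" and B: "bounded_lipschitz_domain B" and a: "cmod a = 1"
  and A: "A_equation \<omega> B \<sigma> \<mu> (\<phi>, \<psi>) (f, g)"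
 shows "A_equation \<omega> B \<sigma> \<mu> (\<lambda>x. a * \<phi> x, \<lambda>x. a * \<psi> x) (\<lambda>x. a * f x, \<lambda>x. a * g x)"
proof -
 obtain h where h: "NtD_graph \<omega> B \<sigma> \<mu> \<psi> h" "AE x in surface_measure B. - single_layer \<omega> B \<phi> x + h x = f x"
  and L: "in_L2 (surface_measure B) \<phi>" "in_L2 (surface_measure B) \<psi>"
  and k: "AE x in surface_measure B. - (1 / 2 * \<phi> x + K_star \<omega> B \<phi> x) + \<psi> x = g x"
  using A unfolding A_equation_def by auto
 have "AE x in surface_measure B. - single_layer \<omega> B (\<lambda>y. a * \<phi> y) x + a * h x = a * f x"
  using h(2)
 proof eventually_elim
  case (elim x)
  show ?case unfolding elim[symmetric] single_layer_scale by (simp add: algebra_simps)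
 qed
 moreover have "AE x in surface_measure B. - (1 / 2 * (a * \<phi> x) + K_star \<omega> B (\<lambda>y. a * \<phi> y) x) + a * \<psi> x = a * g x"
  using k K_star_scale[OF om B L(1), of a]
 proof eventually_elim
  case (elim x)
  show ?case unfolding elim(1)[symmetric] elim(2) by (simp add: algebra_simps)
 qed
 ultimately show ?thesis
  using in_L2_scale[OF L(1), of a] in_L2_scale[OF L(2), of a] NtD_graph_scale[OF a h(1)]
  unfolding A_equation_def prod.case by blast
qed

lemma A_equation_cong:
 assumes "A_equation \<omega> B \<sigma> \<mu> p (f, g)" "AE x in surface_measure B. f x = f' x" "AE x in surface_measure B. g x = g' x"
 shows "A_equation \<omega> B \<sigma> \<mu> p (f', g')"
proof -
 obtain \<phi> \<psi> where p: "p = (\<phi>, \<psi>)" by (cases p)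
 obtain h where h: "NtD_graph \<omega> B \<sigma> \<mu> \<psi> h" "AE x in surface_measure B. - single_layer \<omega> B \<phi> x + h x = f x"
  and L: "in_L2 (surface_measure B) \<phi>" "in_L2 (surface_measure B) \<psi>"
  and k: "AE x in surface_measure B. - (1 / 2 * \<phi> x + K_star \<omega> B \<phi> x) + \<psi> x = g x"
  using assms(1) unfolding p A_equation_def by auto
 have "AE x in surface_measure B. - single_layer \<omega> B \<phi> x + h x = f' x"
  using h(2) assms(2) by eventually_elim (simp only:)
 moreover have "AE x in surface_measure B. - (1 / 2 * \<phi> x + K_star \<omega> B \<phi> x) + \<psi> x = g' x"
  using k assms(3) by eventually_elim (simp only:)
 ultimately show ?thesis using L h(1) unfolding p A_equation_def prod.case by blast
qed

lemma normal_deriv_cyl_wave_rotate: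
 assumes om: "\<omega> > 0" and c: "cmod c = 1" and x: "x \<noteq> 0"
 shows "normal_deriv ((\<lambda>z. c * z) ` B) (cyl_wave \<omega> m) (c * x) = c powi m * normal_deriv B (cyl_wave \<omega> m) x"
proof -
 let ?n = "outward_normal B x"
 have cx: "c * x \<noteq> 0" using c x by auto
 have "frechet_derivative (\<lambda>y. cyl_wave \<omega> m (c * y)) (at x) ?n = frechet_derivative (cyl_wave \<omega> m) (at (c * x)) (c * ?n)"
  by (rule frechet_derivative_rotate[OF cyl_wave_differentiable[OF om cx]])
 moreover have "((\<lambda>y. cyl_wave \<omega> m (c * y)) has_derivative (\<lambda>h. c powi m * frechet_derivative (cyl_wave \<omega> m) (at x) h)) (at x)"
 proof (rule has_derivative_transform_within_open[of _ _ _ _ "- {0}"])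
  have "(cyl_wave \<omega> m has_derivative frechet_derivative (cyl_wave \<omega> m) (at x)) (at x)"
   using cyl_wave_differentiable[OF om x] by (simp add: frechet_derivative_works)
  then show "((\<lambda>y. c powi m * cyl_wave \<omega> m y) has_derivative (\<lambda>h. c powi m * frechet_derivative (cyl_wave \<omega> m) (at x) h)) (at x)"
   by (rule has_derivative_mult_right)
 qed (use x in \<open>auto simp: cyl_wave_rotate[OF c]\<close>)
 ultimately show ?thesis
  unfolding normal_deriv_def outward_normal_rotate[OF c] using frechet_derivative_at by metis
qed

lemma scattering_solution_rotate:
 assumes om: "\<omega> > 0" and c: "cmod c = 1" and B: "open B" "bounded B" "0 \<in> B"
  and p: "scattering_solution \<omega> ((\<lambda>z. c * z) ` B) \<sigma> \<mu> m (\<phi>, \<psi>)"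
 shows "A_equation \<omega> B (\<lambda>x. \<sigma> (c * x)) (\<lambda>x. \<mu> (c * x)) (\<lambda>x. \<phi> (c * x), \<lambda>x. \<psi> (c * x))
  (\<lambda>x. c powi m * cyl_wave \<omega> m x, \<lambda>x. c powi m * normal_deriv B (cyl_wave \<omega> m) x)"
proof -
 interpret domain_rotation c B by standard (use c B in auto)
 have nz: "AE x in surface_measure B. x \<noteq> 0"
  using B by (intro AE_I2) (auto simp: space_surface_measure frontier_def interior_open)
 show ?thesis
 proof (rule A_equation_cong[OF A_equation_rotate[OF om p[unfolded scattering_solution_def]]])
  show "AE x in surface_measure B. cyl_wave \<omega> m (c * x) = c powi m * cyl_wave \<omega> m x"
   using nz by eventually_elim (rule cyl_wave_rotate[OF c])
  show "AE x in surface_measure B. normal_deriv rB (cyl_wave \<omega> m) (c * x) = c powi m * normal_deriv B (cyl_wave \<omega> m) x"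
   using nz by eventually_elim (rule normal_deriv_cyl_wave_rotate[OF om c])
 qed
qed

lemma cyl_wave_borel_measurable:
 assumes "\<omega> > 0"
 shows "cyl_wave \<omega> m \<in> borel_measurable borel"
proof -
 have "(\<lambda>x. if x \<in> {0} then cyl_wave \<omega> m 0 else cyl_wave \<omega> m x) \<in> borel_measurable borel"
  by (intro borel_measurable_continuous_on_if continuous_on_const continuous_at_imp_continuous_on ballI
    differentiable_imp_continuous_within cyl_wave_differentiable assms) auto
 then show ?thesis by (rule measurable_cong[THEN iffD1, rotated]) auto
qed

lemma A_equation_unscale:
 assumes "\<omega> > 0" "bounded_lipschitz_domain B" "cmod a = 1"
  "A_equation \<omega> B \<sigma> \<mu> (\<phi>, \<psi>) (\<lambda>x. a * f x, \<lambda>x. a * g x)"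
 shows "A_equation \<omega> B \<sigma> \<mu> (\<lambda>x. cnj a * \<phi> x, \<lambda>x. cnj a * \<psi> x) (f, g)"
 using A_equation_scale[OF assms(1,2) _ assms(4), of "cnj a"] assms(3) by (simp add: unit_mult_cnj)

lemma scattering_solution_unique:
 assumes "scattering_uniquely_solvable \<omega> B \<sigma> \<mu> m"
  and "scattering_solution \<omega> B \<sigma> \<mu> m p" "scattering_solution \<omega> B \<sigma> \<mu> m q"
 shows "AE x in surface_measure B. fst p x = fst q x \<and> snd p x = snd q x"
 using assms unfolding scattering_uniquely_solvable_def by (elim conjE allE impE) auto

text \<open>Solutions are moved in both directions, so that unique solvability is equivalent for the two
  domains; when it fails both coefficients are zero by convention.\<close>
lemma scattering_coeff_rotate:
 assumes om: "\<omega> > 0" and B: "bounded_lipschitz_domain B" "0 \<in> B" and c: "cmod c = 1"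
 shows "scattering_coeff \<omega> ((\<lambda>z. c * z) ` B) (\<lambda>x. \<sigma> (cnj c * x)) (\<lambda>x. \<mu> (cnj c * x)) n m =
  c powi (m - n) * scattering_coeff \<omega> B \<sigma> \<mu> n m"
proof -
 have oB: "open B" "bounded B" using B by (auto simp: bounded_lipschitz_domain_def)
 interpret domain_rotation c B by standard (use c oB in auto)
 interpret b: domain_rotation "cnj c" rB by (rule opposite)
 define a where "a = c powi m"
 have a: "cmod a = 1" using c by (simp add: a_def norm_power_int)
 have ca: "cnj a = cnj c powi m" by (simp add: a_def)
 let ?s' = "\<lambda>x. \<sigma> (cnj c * x)" and ?m' = "\<lambda>x. \<mu> (cnj c * x)"
 have fwd: "scattering_solution \<omega> B \<sigma> \<mu> m (\<lambda>x. cnj a * fst p (c * x), \<lambda>x. cnj a * snd p (c * x))"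
  if p: "scattering_solution \<omega> rB ?s' ?m' m p" for p
 proof -
  have "A_equation \<omega> B \<sigma> \<mu> (\<lambda>x. fst p (c * x), \<lambda>x. snd p (c * x))
    (\<lambda>x. a * cyl_wave \<omega> m x, \<lambda>x. a * normal_deriv B (cyl_wave \<omega> m) x)"
   using scattering_solution_rotate[OF om c oB B(2), of ?s' ?m' m "fst p" "snd p"] p
   by (simp only: a_def unit_mult_cnj[OF c] prod.collapse)
  from A_equation_unscale[OF om B(1) a this] show ?thesis by (simp only: scattering_solution_def)
 qed
 have bwd: "scattering_solution \<omega> rB ?s' ?m' m (\<lambda>y. a * fst p (cnj c * y), \<lambda>y. a * snd p (cnj c * y))"
  if p: "scattering_solution \<omega> B \<sigma> \<mu> m p" for p
 proof -
  have "A_equation \<omega> B \<sigma> \<mu> (\<lambda>x. a * fst p x, \<lambda>x. a * snd p x) (\<lambda>x. a * cyl_wave \<omega> m x, \<lambda>x. a * normal_deriv B (cyl_wave \<omega> m) x)"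
   using A_equation_scale[OF om B(1) a, of \<sigma> \<mu> "fst p" "snd p"] p by (simp only: scattering_solution_def prod.collapse)
  then have "A_equation \<omega> ((\<lambda>z. cnj c * z) ` rB) \<sigma> \<mu> (\<lambda>x. a * fst p x, \<lambda>x. a * snd p x)
    (\<lambda>x. a * cyl_wave \<omega> m x, \<lambda>x. a * normal_deriv B (cyl_wave \<omega> m) x)" by (simp only: image_back)
  from b.A_equation_rotate[OF om this]
  have A: "A_equation \<omega> rB ?s' ?m' (\<lambda>x. a * fst p (cnj c * x), \<lambda>x. a * snd p (cnj c * x))
    (\<lambda>x. a * cyl_wave \<omega> m (cnj c * x), \<lambda>x. a * normal_deriv B (cyl_wave \<omega> m) (cnj c * x))" .
  have "0 \<in> rB" using B(2) by (force simp: image_iff)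
  then have nz: "AE x in surface_measure rB. x \<noteq> 0"
   using b.open_domain by (intro AE_I2) (auto simp: space_surface_measure frontier_def interior_open)
  show ?thesis unfolding scattering_solution_def
  proof (rule A_equation_cong[OF A])
   show "AE x in surface_measure rB. a * cyl_wave \<omega> m (cnj c * x) = cyl_wave \<omega> m x"
    using nz by eventually_elim (simp only: cyl_wave_rotate[OF b.unit] ca[symmetric] unit_mult_cnj[OF a] not_False_eq_True)
   show "AE x in surface_measure rB. a * normal_deriv B (cyl_wave \<omega> m) (cnj c * x) = normal_deriv rB (cyl_wave \<omega> m) x"
    using nz
   proof eventually_elim
    case (elim x)
    from normal_deriv_cyl_wave_rotate[OF om b.unit this, of rB m]
    show ?case by (simp only: image_back ca[symmetric] unit_mult_cnj[OF a])
   qed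
  qed
 qed
 have ex: "(\<exists>p. scattering_solution \<omega> rB ?s' ?m' m p) \<longleftrightarrow> (\<exists>p. scattering_solution \<omega> B \<sigma> \<mu> m p)"
  using fwd bwd by blast
 have a0: "a \<noteq> 0" "cnj a \<noteq> 0" using a by auto
 have us: "scattering_uniquely_solvable \<omega> rB ?s' ?m' m \<longleftrightarrow> scattering_uniquely_solvable \<omega> B \<sigma> \<mu> m"
 proof
  assume U: "scattering_uniquely_solvable \<omega> rB ?s' ?m' m"
  show "scattering_uniquely_solvable \<omega> B \<sigma> \<mu> m"
   unfolding scattering_uniquely_solvable_def
  proof (intro conjI allI impI)
   fix p q assume pq: "scattering_solution \<omega> B \<sigma> \<mu> m p \<and> scattering_solution \<omega> B \<sigma> \<mu> m q"
   have "AE y in surface_measure rB. a * fst p (cnj c * y) = a * fst q (cnj c * y) \<and> a * snd p (cnj c * y) = a * snd q (cnj c * y)"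
    using scattering_solution_unique[OF U bwd[OF conjunct1[OF pq]] bwd[OF conjunct2[OF pq]]] by (simp only: fst_conv snd_conv)
   then have "AE x in surface_measure B. a * fst p x = a * fst q x \<and> a * snd p x = a * snd q x"
    unfolding surf.AE_iff unit_mult_cnj[OF c] .
   then show "AE x in surface_measure B. fst p x = fst q x \<and> snd p x = snd q x"
    by eventually_elim (use a0 in simp)
  qed (use U[unfolded scattering_uniquely_solvable_def, THEN conjunct1] in \<open>simp only: ex\<close>)
 next
  assume U: "scattering_uniquely_solvable \<omega> B \<sigma> \<mu> m"
  show "scattering_uniquely_solvable \<omega> rB ?s' ?m' m"
   unfolding scattering_uniquely_solvable_def
  proof (intro conjI allI impI)
   fix p q assume pq: "scattering_solution \<omega> rB ?s' ?m' m p \<and> scattering_solution \<omega> rB ?s' ?m' m q"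
   have "AE x in surface_measure B. cnj a * fst p (c * x) = cnj a * fst q (c * x) \<and> cnj a * snd p (c * x) = cnj a * snd q (c * x)"
    using scattering_solution_unique[OF U fwd[OF conjunct1[OF pq]] fwd[OF conjunct2[OF pq]]] by (simp only: fst_conv snd_conv)
   then show "AE x in surface_measure rB. fst p x = fst q x \<and> snd p x = snd q x"
    unfolding surf.AE_iff by eventually_elim (use a0 in simp)
  qed (use U[unfolded scattering_uniquely_solvable_def, THEN conjunct1] in \<open>simp only: ex\<close>)
 qed
 show ?thesis
 proof (cases "scattering_uniquely_solvable \<omega> B \<sigma> \<mu> m")
  case True
  define q where "q = (SOME p. scattering_solution \<omega> B \<sigma> \<mu> m p)"
  define p where "p = (SOME p. scattering_solution \<omega> rB ?s' ?m' m p)"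
  have exq: "\<exists>p. scattering_solution \<omega> B \<sigma> \<mu> m p"
   using True unfolding scattering_uniquely_solvable_def by (rule conjunct1)
  have q: "scattering_solution \<omega> B \<sigma> \<mu> m q" unfolding q_def by (rule someI_ex[OF exq])
  have p: "scattering_solution \<omega> rB ?s' ?m' m p" unfolding p_def by (rule someI_ex[OF exq[folded ex]])
  have pq: "AE x in surface_measure B. cnj a * fst p (c * x) = fst q x"
   using scattering_solution_unique[OF True fwd[OF p] q] unfolding fst_conv by eventually_elim (rule conjunct1)
  have Lq: "in_L2 (surface_measure B) (fst q)"
   using q by (cases q) (simp add: scattering_solution_def A_equation_def)
  have Lp: "in_L2 (surface_measure rB) (fst p)"
   using p by (cases p) (simp add: scattering_solution_def A_equation_def)
  then have Lp': "in_L2 (surface_measure B) (\<lambda>x. fst p (c * x))" by (simp only: surf.in_L2_rotation)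
  have cm: "cyl_wave \<omega> n \<in> borel_measurable (surface_measure B')" for B'
   by (rule measurable_surface_measure[OF cyl_wave_borel_measurable[OF om]])
  have pm: "(\<lambda>x. fst p (c * x)) \<in> borel_measurable (surface_measure B)" "fst q \<in> borel_measurable (surface_measure B)"
   using Lp' Lq by (simp_all add: in_L2_def)
  have cm': "(\<lambda>x. cyl_wave \<omega> n (c * x)) \<in> borel_measurable (surface_measure B)"
   using cm[of rB] by (simp only: surf.measurable_iff)
  have nz: "AE x in surface_measure B. x \<noteq> 0"
   using oB B(2) by (intro AE_I2) (auto simp: space_surface_measure frontier_def interior_open)
  have "(\<integral>y. cnj (cyl_wave \<omega> n y) * fst p y \<partial>surface_measure rB) = (\<integral>x. cnj (cyl_wave \<omega> n (c * x)) * fst p (c * x) \<partial>surface_measure B)"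
   by (rule surf.integral_rotation[symmetric])
  also have "... = (\<integral>x. c powi (m - n) * (cnj (cyl_wave \<omega> n x) * fst q x) \<partial>surface_measure B)"
  proof (rule integral_cong_AE)
   have c0: "c \<noteq> 0" using c by auto
   have cn: "cnj (c powi n) * a = c powi (m - n)"
   proof -
    have "cnj c = inverse c" using c unit_mult_cnj[OF c, of 1] by (simp add: inverse_unique)
    then show ?thesis using c0 by (simp add: a_def power_int_diff power_int_inverse divide_inverse mult.commute)
   qed
   show "AE x in surface_measure B. cnj (cyl_wave \<omega> n (c * x)) * fst p (c * x) = c powi (m - n) * (cnj (cyl_wave \<omega> n x) * fst q x)"
    using pq nz
   proof eventually_elim
    case (elim x)
    have "fst p (c * x) = a * fst q x" unfolding elim(1)[symmetric] unit_mult_cnj[OF a] ..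
    then show ?case unfolding cyl_wave_rotate[OF c elim(2)] cn[symmetric] by simp
   qed
  qed (use pm cm cm' in measurable)
  also have "... = c powi (m - n) * (\<integral>x. cnj (cyl_wave \<omega> n x) * fst q x \<partial>surface_measure B)"
   by (rule integral_mult_right_zero)
  finally show ?thesis using True us by (simp add: scattering_coeff_def p_def q_def)
 next
  case False
  then show ?thesis using us by (simp add: scattering_coeff_def)
 qed
qed

theorem proposition4p4:
  fixes \<omega> \<theta> c\<^sub>1 c\<^sub>2 c\<^sub>3 c\<^sub>4 :: real
    and B :: "complex set"
    and \<sigma> \<mu> :: "complex \<Rightarrow> real"
    and n m :: int
  assumes "\<omega> > 0"
    and "\<And>x. \<sigma> x > 0" and "\<And>x. \<mu> x > 0"
    and "(\<lambda>x. 1 / \<sigma> x) \<in> borel_measurable lebesgue" and "\<mu> \<in> borel_measurable lebesgue"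
    and "c\<^sub>1 > 0" and "\<And>x. c\<^sub>1 \<le> 1 / \<sigma> x \<and> 1 / \<sigma> x \<le> c\<^sub>2"
    and "c\<^sub>3 > 0" and "\<And>x. c\<^sub>3 \<le> \<mu> x \<and> \<mu> x \<le> c\<^sub>4"
    and "compact (closure {x. 1 / \<sigma> x - 1 \<noteq> 0})" and "compact (closure {x. \<mu> x - 1 \<noteq> 0})"
    and "bounded_lipschitz_domain B" and "0 \<in> B"
    and "closure {x. 1 / \<sigma> x - 1 \<noteq> 0} \<subseteq> B" and "closure {x. \<mu> x - 1 \<noteq> 0} \<subseteq> B"
    and "\<not> neumann_eigenvalue B \<sigma> \<mu> (\<omega>\<^sup>2)"
    and "\<not> dirichlet_eigenvalue B (\<omega>\<^sup>2)"
  shows "scattering_coeff \<omega> ((\<lambda>x. exp (\<i> * of_real \<theta>) * x) ` B)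
           (\<lambda>x. \<sigma> (exp (- \<i> * of_real \<theta>) * x)) (\<lambda>x. \<mu> (exp (- \<i> * of_real \<theta>) * x)) n m
         = exp (\<i> * of_int (m - n) * of_real \<theta>) * scattering_coeff \<omega> B \<sigma> \<mu> n m"
proof -
  define c where "c = cis \<theta>"
  have c: "cmod c = 1" by (simp add: c_def)
  have e1: "exp (\<i> * of_real \<theta>) = c" by (simp add: c_def cis_conv_exp)
  have "exp (- \<i> * of_real \<theta>) = cis (- \<theta>)" by (simp add: cis_conv_exp)
  then have e2: "exp (- \<i> * of_real \<theta>) = cnj c" by (simp only: c_def cis_cnj)
  have "exp (\<i> * of_int (m - n) * of_real \<theta>) = exp (of_int (m - n) * (\<i> * of_real \<theta>))" by (simp only: mult_ac)
  also have "\<dots> = c powi (m - n)" by (simp only: exp_power_int[symmetric] e1)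
  finally have e3: "exp (\<i> * of_int (m - n) * of_real \<theta>) = c powi (m - n)" .
  show ?thesis unfolding e1 e2 e3 by (rule scattering_coeff_rotate[OF assms(1,12,13) c])
qed

end
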